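(* Let $\mathbf{A}$ be a polycategory. Then $\Sigma\Pi_{\mathbf{A}}$ is a polycategory whose objects are the formulas of the logic $\Sigma\Pi_{\mathbf{A}}$ and whose morphisms $\Gamma\to\Delta$ are the $\sim$-equivalence classes of derivations of the sequent $\Gamma\vdash\Delta$ (with composition given by the cut rule and identities by the identity derivations).
   Context: Polycategory (always symmetric): a class of objects; for finite lists of objects $\Gamma,\Delta$ a set $\mathbf{P}(\Gamma;\Delta)$ of polymorphisms; identities $1_x\in\mathbf{P}(x;x)$; cut operations $\mathbf{P}(\Gamma;\Delta_1,x,\Delta_2)\times\mathbf{P}(\Gamma_1,x,\Gamma_2;\Delta)\to\mathbf{P}(\Gamma_1,\Gamma,\Gamma_2;\Delta_1,\Delta,\Delta_2)$ whenever ($\Gamma_1$ or $\Delta_1$ is empty) and ($\Gamma_2$ or $\Delta_2$ is empty); and an action of permutations on domain and codomain lists. Cut is unital and associative, satisfies the interchange law (cutting a map with two others along two different codomain objects, or dually two domain objects, is independent of the order), and is compatible with the permutation actions. Using the symmetric action, domains and codomains are treated as unordered families labelled by distinct channel names, and $f;_\gamma g$ denotes the cut on channel $\gamma$ (the only channel name shared by $f$ and $g$, after renaming). Logic and terms. Formulas of $\Sigma\Pi_{\mathbf{A}}$ are the objects of $\mathbf{A}$ (atoms) and, for every finite (possibly empty) set $I$ and formulas $X_i$ ($i\in I$), the sum $\sum_{i\in I}a_i{:}X_i$ and the product $\prod_{i\in I}a_i{:}X_i$ (the $a_i$ are distinct names of the components). A sequent $\Gamma\vdash\Delta$ consists of two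 finite unordered families of formulas, every occurrence being labelled by a distinct channel name. Derivations (terms) are formed as follows. - Axioms: every polymorphism $f:\Gamma\to\Delta$ of $\mathbf{A}$ between atoms; in particular $1_A$ derives $\alpha{:}A\vdash\beta{:}A$. - Cotuple: from $f_i$ deriving $\Gamma,\alpha{:}X_i\vdash\Delta$ ($i\in I$), $\alpha\{a_i\mapsto f_i\}_{i\in I}$ derives $\Gamma,\alpha{:}\sum_i a_i{:}X_i\vdash\Delta$. - Tuple: from $f_i$ deriving $\Gamma\vdash\alpha{:}X_i,\Delta$ ($i\in I$), $\alpha(a_i\mapsto f_i)_{i\in I}$ derives $\Gamma\vdash\alpha{:}\prod_i a_i{:}X_i,\Delta$. - Projection: from $f$ deriving $\Gamma,\alpha{:}X_k\vdash\Delta$, $\overleftarrow{\alpha}[a_k](f)$ derives $\Gamma,\alpha{:}\prod_i a_i{:}X_i\vdash\Delta$. - Injection: from $f$ deriving $\Gamma\vdash\alpha{:}X_k,\Delta$, $\overrightarrow{\alpha}[a_k](f)$ derives $\Gamma\vdash\alpha{:}\sum_i a_i{:}X_i,\Delta$. - Cut: from $f$ deriving $\Gamma\vdash\Delta,\gamma{:}Z$ and $g$ deriving $\gamma{:}Z,\Gamma'\vdash\Delta'$, $f;_\gamma g$ derives $\Gamma,\Gamma'\vdash\Delta,\Delta'$. Identity derivations $\iota_X$ of $\alpha{:}X\vdash\beta{:}X$: $1_A$ for atoms; $\alpha\{a_i\mapsto\overrightarrow{\beta}[a_i](\iota_{X_i})\}_i$ for $X=\sum_i a_i{:}X_i$;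 $\beta(a_i\mapsto\overleftarrow{\alpha}[a_i](\iota_{X_i}))_i$ for $X=\prod_i a_i{:}X_i$. The relation $\sim$ is the equivalence relation on derivations of a sequent generated (in any context) by identifying a cut between two axioms with the axiom given by composition in $\mathbf{A}$, and by the following (different Greek letters denote distinct channels; (1),(2) up to renaming of the channel; index sets of cotuples/tuples may be empty): (1) $f;_\gamma 1\Rightarrow f$; (2) $1;_\gamma f\Rightarrow f$; (3) $\alpha\{a_i\mapsto f_i\}_i;_\gamma g\Rightarrow\alpha\{a_i\mapsto f_i;_\gamma g\}_i$; (4) $f;_\gamma\beta(b_i\mapsto g_i)_i\Rightarrow\beta(b_i\mapsto f;_\gamma g_i)_i$; (5) $\overrightarrow{\alpha}[a_k](f);_\gamma g\Rightarrow\overrightarrow{\alpha}[a_k](f;_\gamma g)$; (6) $f;_\gamma\overleftarrow{\beta}[b_k](g)\Rightarrow\overleftarrow{\beta}[b_k](f;_\gamma g)$; (7) $\overleftarrow{\alpha}[a_k](f);_\gamma g\Rightarrow\overleftarrow{\alpha}[a_k](f;_\gamma g)$; (8) $f;_\gamma\overrightarrow{\beta}[b_k](g)\Rightarrow\overrightarrow{\beta}[b_k](f;_\gamma g)$; (9) $\alpha(a_i\mapsto f_i)_i;_\gamma g\Rightarrow\alpha(a_i\mapsto f_i;_\gamma g)_i$; (10) $f;_\gamma\beta\{b_i\mapsto g_i\}_i\Rightarrow\beta\{b_i\mapsto f;_\gamma g_i\}_i$; (11) $\overrightarrow{\gamma}[a_k](f);_\gamma\gamma\{a_i\mapsto g_i\}_i\Rightarrow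 f;_\gamma g_k$; (12) $\gamma(a_i\mapsto f_i)_i;_\gamma\overleftarrow{\gamma}[a_k](g)\Rightarrow f_k;_\gamma g$; (13) $\alpha\{a_i\mapsto\beta\{b_j\mapsto f_{ij}\}_j\}_i\leftrightarrow\beta\{b_j\mapsto\alpha\{a_i\mapsto f_{ij}\}_i\}_j$; (14) $\alpha(a_i\mapsto\beta(b_j\mapsto f_{ij})_j)_i\leftrightarrow\beta(b_j\mapsto\alpha(a_i\mapsto f_{ij})_i)_j$; (15) $\alpha\{a_i\mapsto\overrightarrow{\beta}[b_k](f_i)\}_i\leftrightarrow\overrightarrow{\beta}[b_k](\alpha\{a_i\mapsto f_i\}_i)$; (16) $\overleftarrow{\alpha}[a_k](\beta(b_i\mapsto g_i)_i)\leftrightarrow\beta(b_i\mapsto\overleftarrow{\alpha}[a_k](g_i))_i$; (17) $\alpha\{a_i\mapsto\overleftarrow{\beta}[b_k](f_i)\}_i\leftrightarrow\overleftarrow{\beta}[b_k](\alpha\{a_i\mapsto f_i\}_i)$; (18) $\overrightarrow{\alpha}[a_k](\beta(b_i\mapsto g_i)_i)\leftrightarrow\beta(b_i\mapsto\overrightarrow{\alpha}[a_k](g_i))_i$; (19) $\alpha\{a_i\mapsto\beta(b_j\mapsto f_{ij})_j\}_i\leftrightarrow\beta(b_j\mapsto\alpha\{a_i\mapsto f_{ij}\}_i)_j$; (20) $\overrightarrow{\alpha}[a_k](\overrightarrow{\beta}[b_l](f))\leftrightarrow\overrightarrow{\beta}[b_l](\overrightarrow{\alpha}[a_k](f))$;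 (21) $\overleftarrow{\alpha}[a_k](\overleftarrow{\beta}[b_l](f))\leftrightarrow\overleftarrow{\beta}[b_l](\overleftarrow{\alpha}[a_k](f))$; (22) $\overrightarrow{\alpha}[a_k](\overleftarrow{\beta}[b_l](f))\leftrightarrow\overleftarrow{\beta}[b_l](\overrightarrow{\alpha}[a_k](f))$. *)

theory Defs
  imports "HOL-Library.Finite_Map" "HOL-Combinatorics.Permutations"
begin

section \<open>Symmetric polycategories\<close>

text \<open>
  The polymorphism sets and all operations are indexed by lists of objects, so the sets
  \<^term>\<open>Hom P \<Gamma> \<Delta>\<close> for different \<open>\<Gamma>\<close>, \<open>\<Delta>\<close> need not be disjoint.
  \<open>cut P \<Gamma> \<Delta>1 x \<Delta>2 \<Gamma>1 \<Gamma>2 \<Delta> f g\<close> is the cut at \<open>x\<close> of \<open>f\<close> in \<open>P(\<Gamma>; \<Delta>1,x,\<Delta>2)\<close> with \<open>g\<close> in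
  \<open>P(\<Gamma>1,x,\<Gamma>2; \<Delta>)\<close>.  \<open>act P \<Gamma> \<Delta> \<sigma> \<tau> f\<close> permutes the domain and the codomain of \<open>f\<close> in
  \<open>P(\<Gamma>; \<Delta>)\<close>, following the convention of \<^const>\<open>permute_list\<close>: position \<open>i\<close> of the new
  domain is position \<open>\<sigma> i\<close> of the old one.
\<close>

record ('o, 'm) polycat =
  Ob :: "'o set"
  Hom :: "'o list \<Rightarrow> 'o list \<Rightarrow> 'm set"
  Idn :: "'o \<Rightarrow> 'm"
  cut :: "'o list \<Rightarrow> 'o list \<Rightarrow> 'o \<Rightarrow> 'o list \<Rightarrow> 'o list \<Rightarrow> 'o list \<Rightarrow> 'o list \<Rightarrow> 'm \<Rightarrow> 'm \<Rightarrow> 'm"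
  act :: "'o list \<Rightarrow> 'o list \<Rightarrow> (nat \<Rightarrow> nat) \<Rightarrow> (nat \<Rightarrow> nat) \<Rightarrow> 'm \<Rightarrow> 'm"

definition planar :: "'o list \<Rightarrow> 'o list \<Rightarrow> 'o list \<Rightarrow> 'o list \<Rightarrow> bool" where
  "planar \<Gamma>1 \<Gamma>2 \<Delta>1 \<Delta>2 \<longleftrightarrow> (\<Gamma>1 = [] \<or> \<Delta>1 = []) \<and> (\<Gamma>2 = [] \<or> \<Delta>2 = [])"

text \<open>
  In a composite list \<open>xs1 @ ys @ xs2\<close> obtained by substituting \<open>ys\<close> for \<open>x\<close> in
  \<open>xs1 @ x # xs2\<close>, where \<open>xs1\<close> has length \<open>i\<close> and \<open>ys\<close> has length \<open>n\<close>, the entry at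
  position \<open>p\<close> comes from a position of \<open>xs1 @ x # xs2\<close> (tagged \<^const>\<open>Inl\<close>) or of \<open>ys\<close>
  (tagged \<^const>\<open>Inr\<close>).
\<close>

definition slot :: "nat \<Rightarrow> nat \<Rightarrow> nat \<Rightarrow> nat + nat" where
  "slot i n p = (if p < i then Inl p else if p < i + n then Inr (p - i) else Inl (p - n + 1))"

text \<open>
  In the two interchange laws the conditions that the four cuts involved are permitted
  force the empty contexts that are left out here.  In \<open>cut_act\<close>, the permutations
  \<open>\<pi>\<close> and \<open>\<rho>\<close> are the ones induced on the composite domain and codomain.
\<close>

locale polycategory =
  fixes P :: "('o, 'm) polycat"
  assumes Hom_Ob: "f \<in> Hom P \<Gamma> \<Delta> \<Longrightarrow> set \<Gamma> \<union> set \<Delta> \<subseteq> Ob P"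
    and Idn_Hom: "x \<in> Ob P \<Longrightarrow> Idn P x \<in> Hom P [x] [x]"
    and cut_Hom: "\<lbrakk>f \<in> Hom P \<Gamma> (\<Delta>1 @ x # \<Delta>2); g \<in> Hom P (\<Gamma>1 @ x # \<Gamma>2) \<Delta>; planar \<Gamma>1 \<Gamma>2 \<Delta>1 \<Delta>2\<rbrakk>
      \<Longrightarrow> cut P \<Gamma> \<Delta>1 x \<Delta>2 \<Gamma>1 \<Gamma>2 \<Delta> f g \<in> Hom P (\<Gamma>1 @ \<Gamma> @ \<Gamma>2) (\<Delta>1 @ \<Delta> @ \<Delta>2)"
    and act_Hom: "\<lbrakk>f \<in> Hom P \<Gamma> \<Delta>; \<sigma> permutes {..<length \<Gamma>}; \<tau> permutes {..<length \<Delta>}\<rbrakk>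
      \<Longrightarrow> act P \<Gamma> \<Delta> \<sigma> \<tau> f \<in> Hom P (permute_list \<sigma> \<Gamma>) (permute_list \<tau> \<Delta>)"
    and cut_Idn_right: "f \<in> Hom P \<Gamma> (\<Delta>1 @ x # \<Delta>2)
      \<Longrightarrow> cut P \<Gamma> \<Delta>1 x \<Delta>2 [] [] [x] f (Idn P x) = f"
    and cut_Idn_left: "g \<in> Hom P (\<Gamma>1 @ x # \<Gamma>2) \<Delta>
      \<Longrightarrow> cut P [x] [] x [] \<Gamma>1 \<Gamma>2 \<Delta> (Idn P x) g = g"
    and cut_assoc: "\<lbrakk>f \<in> Hom P \<Gamma> (\<Delta>1 @ x # \<Delta>2); g \<in> Hom P (\<Gamma>1 @ x # \<Gamma>2) (\<Theta>1 @ y # \<Theta>2);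
        h \<in> Hom P (\<Lambda>1 @ y # \<Lambda>2) \<Xi>;
        planar \<Gamma>1 \<Gamma>2 \<Delta>1 \<Delta>2; planar \<Lambda>1 \<Lambda>2 (\<Delta>1 @ \<Theta>1) (\<Theta>2 @ \<Delta>2);
        planar \<Lambda>1 \<Lambda>2 \<Theta>1 \<Theta>2; planar (\<Lambda>1 @ \<Gamma>1) (\<Gamma>2 @ \<Lambda>2) \<Delta>1 \<Delta>2\<rbrakk>
      \<Longrightarrow> cut P (\<Gamma>1 @ \<Gamma> @ \<Gamma>2) (\<Delta>1 @ \<Theta>1) y (\<Theta>2 @ \<Delta>2) \<Lambda>1 \<Lambda>2 \<Xi>
            (cut P \<Gamma> \<Delta>1 x \<Delta>2 \<Gamma>1 \<Gamma>2 (\<Theta>1 @ y # \<Theta>2) f g) h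
        = cut P \<Gamma> \<Delta>1 x \<Delta>2 (\<Lambda>1 @ \<Gamma>1) (\<Gamma>2 @ \<Lambda>2) (\<Theta>1 @ \<Xi> @ \<Theta>2)
            f (cut P (\<Gamma>1 @ x # \<Gamma>2) \<Theta>1 y \<Theta>2 \<Lambda>1 \<Lambda>2 \<Xi> g h)"
    and cut_interchange_codomain: "\<lbrakk>f \<in> Hom P \<Gamma> (\<Delta>1 @ x # \<Delta>2 @ y # \<Delta>3);
        g \<in> Hom P (\<Gamma>1 @ [x]) \<Theta>; h \<in> Hom P (y # \<Lambda>2) \<Xi>; \<Gamma>1 = [] \<or> \<Delta>1 = []; \<Lambda>2 = [] \<or> \<Delta>3 = []\<rbrakk>
      \<Longrightarrow> cut P (\<Gamma>1 @ \<Gamma>) (\<Delta>1 @ \<Theta> @ \<Delta>2) y \<Delta>3 [] \<Lambda>2 \<Xi>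
            (cut P \<Gamma> \<Delta>1 x (\<Delta>2 @ y # \<Delta>3) \<Gamma>1 [] \<Theta> f g) h
        = cut P (\<Gamma> @ \<Lambda>2) \<Delta>1 x (\<Delta>2 @ \<Xi> @ \<Delta>3) \<Gamma>1 [] \<Theta>
            (cut P \<Gamma> (\<Delta>1 @ x # \<Delta>2) y \<Delta>3 [] \<Lambda>2 \<Xi> f h) g"
    and cut_interchange_domain: "\<lbrakk>f \<in> Hom P \<Gamma> (\<Delta>1 @ [x]); g \<in> Hom P \<Lambda> (y # \<Theta>2);
        h \<in> Hom P (\<Gamma>1 @ x # \<Gamma>2 @ y # \<Gamma>3) \<Xi>; \<Gamma>1 = [] \<or> \<Delta>1 = []; \<Gamma>3 = [] \<or> \<Theta>2 = []\<rbrakk>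
      \<Longrightarrow> cut P \<Lambda> [] y \<Theta>2 (\<Gamma>1 @ \<Gamma> @ \<Gamma>2) \<Gamma>3 (\<Delta>1 @ \<Xi>)
            g (cut P \<Gamma> \<Delta>1 x [] \<Gamma>1 (\<Gamma>2 @ y # \<Gamma>3) \<Xi> f h)
        = cut P \<Gamma> \<Delta>1 x [] \<Gamma>1 (\<Gamma>2 @ \<Lambda> @ \<Gamma>3) (\<Xi> @ \<Theta>2)
            f (cut P \<Lambda> [] y \<Theta>2 (\<Gamma>1 @ x # \<Gamma>2) \<Gamma>3 \<Xi> g h)"
    and act_id: "f \<in> Hom P \<Gamma> \<Delta> \<Longrightarrow> act P \<Gamma> \<Delta> id id f = f"
    and act_act: "\<lbrakk>f \<in> Hom P \<Gamma> \<Delta>;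
        \<sigma> permutes {..<length \<Gamma>}; \<sigma>' permutes {..<length \<Gamma>};
        \<tau> permutes {..<length \<Delta>}; \<tau>' permutes {..<length \<Delta>}\<rbrakk>
      \<Longrightarrow> act P (permute_list \<sigma> \<Gamma>) (permute_list \<tau> \<Delta>) \<sigma>' \<tau>' (act P \<Gamma> \<Delta> \<sigma> \<tau> f)
        = act P \<Gamma> \<Delta> (\<sigma> \<circ> \<sigma>') (\<tau> \<circ> \<tau>') f"
    and cut_act: "\<lbrakk>f \<in> Hom P \<Gamma> (\<Delta>1 @ x # \<Delta>2); g \<in> Hom P (\<Gamma>1 @ x # \<Gamma>2) \<Delta>; planar \<Gamma>1 \<Gamma>2 \<Delta>1 \<Delta>2;
        \<sigma> permutes {..<length \<Gamma>}; \<tau> permutes {..<length (\<Delta>1 @ x # \<Delta>2)};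
        \<sigma>' permutes {..<length (\<Gamma>1 @ x # \<Gamma>2)}; \<tau>' permutes {..<length \<Delta>};
        permute_list \<tau> (\<Delta>1 @ x # \<Delta>2) = \<Delta>1' @ x # \<Delta>2'; \<tau> (length \<Delta>1') = length \<Delta>1;
        permute_list \<sigma>' (\<Gamma>1 @ x # \<Gamma>2) = \<Gamma>1' @ x # \<Gamma>2'; \<sigma>' (length \<Gamma>1') = length \<Gamma>1;
        planar \<Gamma>1' \<Gamma>2' \<Delta>1' \<Delta>2';
        \<pi> permutes {..<length (\<Gamma>1 @ \<Gamma> @ \<Gamma>2)};
        \<forall>p < length (\<Gamma>1 @ \<Gamma> @ \<Gamma>2). slot (length \<Gamma>1) (length \<Gamma>) (\<pi> p)
          = map_sum \<sigma>' \<sigma> (slot (length \<Gamma>1') (length \<Gamma>) p);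
        \<rho> permutes {..<length (\<Delta>1 @ \<Delta> @ \<Delta>2)};
        \<forall>p < length (\<Delta>1 @ \<Delta> @ \<Delta>2). slot (length \<Delta>1) (length \<Delta>) (\<rho> p)
          = map_sum \<tau> \<tau>' (slot (length \<Delta>1') (length \<Delta>) p)\<rbrakk>
      \<Longrightarrow> cut P (permute_list \<sigma> \<Gamma>) \<Delta>1' x \<Delta>2' \<Gamma>1' \<Gamma>2' (permute_list \<tau>' \<Delta>)
            (act P \<Gamma> (\<Delta>1 @ x # \<Delta>2) \<sigma> \<tau> f) (act P (\<Gamma>1 @ x # \<Gamma>2) \<Delta> \<sigma>' \<tau>' g)
        = act P (\<Gamma>1 @ \<Gamma> @ \<Gamma>2) (\<Delta>1 @ \<Delta> @ \<Delta>2) \<pi> \<rho> (cut P \<Gamma> \<Delta>1 x \<Delta>2 \<Gamma>1 \<Gamma>2 \<Delta> f g)"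


section \<open>Formulas and sequents\<close>

text \<open>Component names are natural numbers; the index set of a sum or product is its finite
  set of component names.\<close>

type_synonym name = nat

datatype 'o form =
    Atom 'o
  | SumF "(name, 'o form) fmap"
  | ProdF "(name, 'o form) fmap"

text \<open>The finite family indexed by \<open>I\<close> whose member at \<open>i\<close> is \<open>f i\<close>.\<close>

context
  includes fset.lifting and fmap.lifting
begin

lift_definition fam :: "'i fset \<Rightarrow> ('i \<Rightarrow> 'a) \<Rightarrow> ('i, 'a) fmap"
  is "\<lambda>I f i. if i \<in> I then Some (f i) else None"
  by (simp add: dom_def)

lemma fmlookup_fam [simp]: "fmlookup (fam I f) i = (if i |\<in>| I then Some (f i) else None)"
  by transfer simp

end

definition formulas :: "('o, 'm) polycat \<Rightarrow> 'o form set" where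
  "formulas A = {X. set_form X \<subseteq> Ob A}"

text \<open>The constructors provide names for the positions of a list-shaped sequent, and
  infinitely many further names \<open>Aux k\<close>; in a general sequent any name can label any formula.\<close>

datatype chan = In nat | Out nat | Aux nat

type_synonym 'o ctx = "(chan, 'o form) fmap"

definition label :: "chan list \<Rightarrow> 'o form list \<Rightarrow> 'o ctx" where
  "label cs Xs = fmap_of_list (zip cs Xs)"

definition sequent :: "('o, 'm) polycat \<Rightarrow> 'o ctx \<Rightarrow> 'o ctx \<Rightarrow> bool" where
  "sequent A \<Gamma> \<Delta> \<longleftrightarrow> fmdom \<Gamma> |\<inter>| fmdom \<Delta> = {||} \<and> fmran' \<Gamma> \<union> fmran' \<Delta> \<subseteq> formulas A"


section \<open>Derivations\<close>

text \<open>
  \<open>Ax As Bs f cs ds\<close> is a polymorphism \<open>f : As \<rightarrow> Bs\<close> with channels \<open>cs\<close> on its domain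
  and \<open>ds\<close> on its codomain.  A cut \<open>Cut \<gamma> Z L f g\<close> records the cut formula \<open>Z\<close> and the
  set \<open>L\<close> of the channels other than \<open>\<gamma>\<close> of its left premise \<open>f\<close>.  Without these, a
  term could stand for several derivations of the same sequent, because the channels and formulas
  of a sequent need not occur in the term when there are nullary tuples or cotuples.
\<close>

datatype ('c, 'o, 'm) deriv =
    Ax "'o list" "'o list" 'm "'c list" "'c list"
  | Cotuple 'c "(name, ('c, 'o, 'm) deriv) fmap"
  | Tuple 'c "(name, ('c, 'o, 'm) deriv) fmap"
  | Proj 'c name "('c, 'o, 'm) deriv"
  | Inj 'c name "('c, 'o, 'm) deriv"
  | Cut 'c "'o form" "'c fset" "('c, 'o, 'm) deriv" "('c, 'o, 'm) deriv"

type_synonym ('o, 'm) der = "(chan, 'o, 'm) deriv"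

text \<open>Renaming acts on all channels, including those bound by cuts, and is meant for injective
  functions only.\<close>

definition rename :: "(chan \<Rightarrow> chan) \<Rightarrow> ('o, 'm) der \<Rightarrow> ('o, 'm) der" where
  "rename \<rho> = map_deriv \<rho> id id"

inductive derives :: "('o, 'm) polycat \<Rightarrow> 'o ctx \<Rightarrow> 'o ctx \<Rightarrow> ('o, 'm) der \<Rightarrow> bool"
  for A :: "('o, 'm) polycat" where
  ax: "\<lbrakk>f \<in> Hom A As Bs; length cs = length As; length ds = length Bs; distinct (cs @ ds)\<rbrakk>
    \<Longrightarrow> derives A (label cs (map Atom As)) (label ds (map Atom Bs)) (Ax As Bs f cs ds)"
| cotuple: "\<lbrakk>\<alpha> |\<notin>| fmdom \<Gamma>; sequent A (fmupd \<alpha> (SumF (fam I X)) \<Gamma>) \<Delta>;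
      \<And>i. i |\<in>| I \<Longrightarrow> derives A (fmupd \<alpha> (X i) \<Gamma>) \<Delta> (f i)\<rbrakk>
    \<Longrightarrow> derives A (fmupd \<alpha> (SumF (fam I X)) \<Gamma>) \<Delta> (Cotuple \<alpha> (fam I f))"
| tuple: "\<lbrakk>\<alpha> |\<notin>| fmdom \<Delta>; sequent A \<Gamma> (fmupd \<alpha> (ProdF (fam I X)) \<Delta>);
      \<And>i. i |\<in>| I \<Longrightarrow> derives A \<Gamma> (fmupd \<alpha> (X i) \<Delta>) (f i)\<rbrakk>
    \<Longrightarrow> derives A \<Gamma> (fmupd \<alpha> (ProdF (fam I X)) \<Delta>) (Tuple \<alpha> (fam I f))"
| proj: "\<lbrakk>\<alpha> |\<notin>| fmdom \<Gamma>; sequent A (fmupd \<alpha> (ProdF (fam I X)) \<Gamma>) \<Delta>; k |\<in>| I;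
      derives A (fmupd \<alpha> (X k) \<Gamma>) \<Delta> f\<rbrakk>
    \<Longrightarrow> derives A (fmupd \<alpha> (ProdF (fam I X)) \<Gamma>) \<Delta> (Proj \<alpha> k f)"
| inj: "\<lbrakk>\<alpha> |\<notin>| fmdom \<Delta>; sequent A \<Gamma> (fmupd \<alpha> (SumF (fam I X)) \<Delta>); k |\<in>| I;
      derives A \<Gamma> (fmupd \<alpha> (X k) \<Delta>) f\<rbrakk>
    \<Longrightarrow> derives A \<Gamma> (fmupd \<alpha> (SumF (fam I X)) \<Delta>) (Inj \<alpha> k f)"
| cut: "\<lbrakk>derives A \<Gamma> (fmupd \<gamma> Z \<Delta>) f; derives A (fmupd \<gamma> Z \<Gamma>') \<Delta>' g;
      (fmdom \<Gamma> |\<union>| fmdom \<Delta>) |\<inter>| (fmdom \<Gamma>' |\<union>| fmdom \<Delta>') = {||};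
      \<gamma> |\<notin>| fmdom \<Gamma> |\<union>| fmdom \<Delta> |\<union>| fmdom \<Gamma>' |\<union>| fmdom \<Delta>'\<rbrakk>
    \<Longrightarrow> derives A (\<Gamma> ++\<^sub>f \<Gamma>') (\<Delta> ++\<^sub>f \<Delta>') (Cut \<gamma> Z (fmdom \<Gamma> |\<union>| fmdom \<Delta>) f g)"

primrec iota :: "('o, 'm) polycat \<Rightarrow> 'o form \<Rightarrow> chan \<Rightarrow> chan \<Rightarrow> ('o, 'm) der" where
  "iota A (Atom x) = (\<lambda>\<alpha> \<beta>. Ax [x] [x] (Idn A x) [\<alpha>] [\<beta>])"
| "iota A (SumF F) = (\<lambda>\<alpha> \<beta>. Cotuple \<alpha> (fmmap_keys (\<lambda>a d. Inj \<beta> a (d \<alpha> \<beta>)) (fmmap (iota A) F)))"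
| "iota A (ProdF F) = (\<lambda>\<alpha> \<beta>. Tuple \<beta> (fmmap_keys (\<lambda>a d. Proj \<alpha> a (d \<alpha> \<beta>)) (fmmap (iota A) F)))"


section \<open>Equivalence of derivations\<close>

text \<open>
  The generating identifications.  The first two express that terms are taken up to renaming of the
  channel bound by a cut, and that an axiom is a polymorphism between unordered families labelled by
  channels, so that it does not depend on how these families are listed.  The rules are applied to
  pairs of derivations of the same sequent only (see \<open>sim\<close> below).
\<close>

inductive rewr :: "('o, 'm) polycat \<Rightarrow> ('o, 'm) der \<Rightarrow> ('o, 'm) der \<Rightarrow> bool"
  for A :: "('o, 'm) polycat" where
  alpha: "rewr A (Cut \<gamma> Z L f g)
    (Cut \<delta> Z L (rename (transpose \<gamma> \<delta>) f) (rename (transpose \<gamma> \<delta>) g))"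
| ax_perm: "\<lbrakk>\<sigma> permutes {..<length As}; \<tau> permutes {..<length Bs}\<rbrakk>
    \<Longrightarrow> rewr A (Ax As Bs f cs ds)
      (Ax (permute_list \<sigma> As) (permute_list \<tau> Bs) (act A As Bs \<sigma> \<tau> f)
        (permute_list \<sigma> cs) (permute_list \<tau> ds))"
| ax_cut: "\<lbrakk>planar \<Gamma>1 \<Gamma>2 \<Delta>1 \<Delta>2; length ds1 = length \<Delta>1; length ds2 = length \<Delta>2;
      length cs1 = length \<Gamma>1; length cs2 = length \<Gamma>2\<rbrakk>
    \<Longrightarrow> rewr A
      (Cut \<gamma> (Atom x) L (Ax \<Gamma> (\<Delta>1 @ x # \<Delta>2) f cs (ds1 @ \<gamma> # ds2))
        (Ax (\<Gamma>1 @ x # \<Gamma>2) \<Delta> g (cs1 @ \<gamma> # cs2) ds))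
      (Ax (\<Gamma>1 @ \<Gamma> @ \<Gamma>2) (\<Delta>1 @ \<Delta> @ \<Delta>2) (polycat.cut A \<Gamma> \<Delta>1 x \<Delta>2 \<Gamma>1 \<Gamma>2 \<Delta> f g)
        (cs1 @ cs @ cs2) (ds1 @ ds @ ds2))"
| r1: "rewr A (Cut \<gamma> (Atom x) L f (Ax [x] [x] (Idn A x) [\<gamma>] [\<beta>])) (rename (transpose \<gamma> \<beta>) f)"
| r2: "rewr A (Cut \<gamma> (Atom x) L (Ax [x] [x] (Idn A x) [\<alpha>] [\<gamma>]) f) (rename (transpose \<gamma> \<alpha>) f)"
| r3: "\<alpha> \<noteq> \<gamma> \<Longrightarrow> rewr A (Cut \<gamma> Z L (Cotuple \<alpha> (fam I f)) g)
    (Cotuple \<alpha> (fam I (\<lambda>i. Cut \<gamma> Z L (f i) g)))"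
| r4: "\<beta> \<noteq> \<gamma> \<Longrightarrow> rewr A (Cut \<gamma> Z L f (Tuple \<beta> (fam I g)))
    (Tuple \<beta> (fam I (\<lambda>i. Cut \<gamma> Z L f (g i))))"
| r5: "\<alpha> \<noteq> \<gamma> \<Longrightarrow> rewr A (Cut \<gamma> Z L (Inj \<alpha> k f) g) (Inj \<alpha> k (Cut \<gamma> Z L f g))"
| r6: "\<beta> \<noteq> \<gamma> \<Longrightarrow> rewr A (Cut \<gamma> Z L f (Proj \<beta> k g)) (Proj \<beta> k (Cut \<gamma> Z L f g))"
| r7: "\<alpha> \<noteq> \<gamma> \<Longrightarrow> rewr A (Cut \<gamma> Z L (Proj \<alpha> k f) g) (Proj \<alpha> k (Cut \<gamma> Z L f g))"
| r8: "\<beta> \<noteq> \<gamma> \<Longrightarrow> rewr A (Cut \<gamma> Z L f (Inj \<beta> k g)) (Inj \<beta> k (Cut \<gamma> Z L f g))"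
| r9: "\<alpha> \<noteq> \<gamma> \<Longrightarrow> rewr A (Cut \<gamma> Z L (Tuple \<alpha> (fam I f)) g)
    (Tuple \<alpha> (fam I (\<lambda>i. Cut \<gamma> Z L (f i) g)))"
| r10: "\<beta> \<noteq> \<gamma> \<Longrightarrow> rewr A (Cut \<gamma> Z L f (Cotuple \<beta> (fam I g)))
    (Cotuple \<beta> (fam I (\<lambda>i. Cut \<gamma> Z L f (g i))))"
| r11: "k |\<in>| I \<Longrightarrow> rewr A (Cut \<gamma> (SumF (fam I X)) L (Inj \<gamma> k f) (Cotuple \<gamma> (fam I g)))
    (Cut \<gamma> (X k) L f (g k))"
| r12: "k |\<in>| I \<Longrightarrow> rewr A (Cut \<gamma> (ProdF (fam I X)) L (Tuple \<gamma> (fam I f)) (Proj \<gamma> k g))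
    (Cut \<gamma> (X k) L (f k) g)"
| r13: "\<alpha> \<noteq> \<beta> \<Longrightarrow> rewr A (Cotuple \<alpha> (fam I (\<lambda>i. Cotuple \<beta> (fam J (\<lambda>j. f i j)))))
    (Cotuple \<beta> (fam J (\<lambda>j. Cotuple \<alpha> (fam I (\<lambda>i. f i j)))))"
| r14: "\<alpha> \<noteq> \<beta> \<Longrightarrow> rewr A (Tuple \<alpha> (fam I (\<lambda>i. Tuple \<beta> (fam J (\<lambda>j. f i j)))))
    (Tuple \<beta> (fam J (\<lambda>j. Tuple \<alpha> (fam I (\<lambda>i. f i j)))))"
| r15: "\<alpha> \<noteq> \<beta> \<Longrightarrow> rewr A (Cotuple \<alpha> (fam I (\<lambda>i. Inj \<beta> k (f i)))) (Inj \<beta> k (Cotuple \<alpha> (fam I f)))"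
| r16: "\<alpha> \<noteq> \<beta> \<Longrightarrow> rewr A (Proj \<alpha> k (Tuple \<beta> (fam I g))) (Tuple \<beta> (fam I (\<lambda>i. Proj \<alpha> k (g i))))"
| r17: "\<alpha> \<noteq> \<beta> \<Longrightarrow> rewr A (Cotuple \<alpha> (fam I (\<lambda>i. Proj \<beta> k (f i)))) (Proj \<beta> k (Cotuple \<alpha> (fam I f)))"
| r18: "\<alpha> \<noteq> \<beta> \<Longrightarrow> rewr A (Inj \<alpha> k (Tuple \<beta> (fam I g))) (Tuple \<beta> (fam I (\<lambda>i. Inj \<alpha> k (g i))))"
| r19: "\<alpha> \<noteq> \<beta> \<Longrightarrow> rewr A (Cotuple \<alpha> (fam I (\<lambda>i. Tuple \<beta> (fam J (\<lambda>j. f i j)))))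
    (Tuple \<beta> (fam J (\<lambda>j. Cotuple \<alpha> (fam I (\<lambda>i. f i j)))))"
| r20: "\<alpha> \<noteq> \<beta> \<Longrightarrow> rewr A (Inj \<alpha> k (Inj \<beta> l f)) (Inj \<beta> l (Inj \<alpha> k f))"
| r21: "\<alpha> \<noteq> \<beta> \<Longrightarrow> rewr A (Proj \<alpha> k (Proj \<beta> l f)) (Proj \<beta> l (Proj \<alpha> k f))"
| r22: "\<alpha> \<noteq> \<beta> \<Longrightarrow> rewr A (Inj \<alpha> k (Proj \<beta> l f)) (Proj \<beta> l (Inj \<alpha> k f))"

inductive sim :: "('o, 'm) polycat \<Rightarrow> 'o ctx \<Rightarrow> 'o ctx \<Rightarrow> ('o, 'm) der \<Rightarrow> ('o, 'm) der \<Rightarrow> bool"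
  for A :: "('o, 'm) polycat" where
  rule: "\<lbrakk>derives A \<Gamma> \<Delta> s; derives A \<Gamma> \<Delta> t; rewr A s t\<rbrakk> \<Longrightarrow> sim A \<Gamma> \<Delta> s t"
| refl: "derives A \<Gamma> \<Delta> t \<Longrightarrow> sim A \<Gamma> \<Delta> t t"
| sym: "sim A \<Gamma> \<Delta> s t \<Longrightarrow> sim A \<Gamma> \<Delta> t s"
| trans: "\<lbrakk>sim A \<Gamma> \<Delta> s t; sim A \<Gamma> \<Delta> t u\<rbrakk> \<Longrightarrow> sim A \<Gamma> \<Delta> s u"
| cotuple: "\<lbrakk>\<alpha> |\<notin>| fmdom \<Gamma>; sequent A (fmupd \<alpha> (SumF (fam I X)) \<Gamma>) \<Delta>;
      \<And>i. i |\<in>| I \<Longrightarrow> sim A (fmupd \<alpha> (X i) \<Gamma>) \<Delta> (f i) (g i)\<rbrakk>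
    \<Longrightarrow> sim A (fmupd \<alpha> (SumF (fam I X)) \<Gamma>) \<Delta> (Cotuple \<alpha> (fam I f)) (Cotuple \<alpha> (fam I g))"
| tuple: "\<lbrakk>\<alpha> |\<notin>| fmdom \<Delta>; sequent A \<Gamma> (fmupd \<alpha> (ProdF (fam I X)) \<Delta>);
      \<And>i. i |\<in>| I \<Longrightarrow> sim A \<Gamma> (fmupd \<alpha> (X i) \<Delta>) (f i) (g i)\<rbrakk>
    \<Longrightarrow> sim A \<Gamma> (fmupd \<alpha> (ProdF (fam I X)) \<Delta>) (Tuple \<alpha> (fam I f)) (Tuple \<alpha> (fam I g))"
| proj: "\<lbrakk>\<alpha> |\<notin>| fmdom \<Gamma>; sequent A (fmupd \<alpha> (ProdF (fam I X)) \<Gamma>) \<Delta>; k |\<in>| I;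
      sim A (fmupd \<alpha> (X k) \<Gamma>) \<Delta> f g\<rbrakk>
    \<Longrightarrow> sim A (fmupd \<alpha> (ProdF (fam I X)) \<Gamma>) \<Delta> (Proj \<alpha> k f) (Proj \<alpha> k g)"
| inj: "\<lbrakk>\<alpha> |\<notin>| fmdom \<Delta>; sequent A \<Gamma> (fmupd \<alpha> (SumF (fam I X)) \<Delta>); k |\<in>| I;
      sim A \<Gamma> (fmupd \<alpha> (X k) \<Delta>) f g\<rbrakk>
    \<Longrightarrow> sim A \<Gamma> (fmupd \<alpha> (SumF (fam I X)) \<Delta>) (Inj \<alpha> k f) (Inj \<alpha> k g)"
| cut: "\<lbrakk>sim A \<Gamma> (fmupd \<gamma> Z \<Delta>) f f'; sim A (fmupd \<gamma> Z \<Gamma>') \<Delta>' g g';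
      (fmdom \<Gamma> |\<union>| fmdom \<Delta>) |\<inter>| (fmdom \<Gamma>' |\<union>| fmdom \<Delta>') = {||};
      \<gamma> |\<notin>| fmdom \<Gamma> |\<union>| fmdom \<Delta> |\<union>| fmdom \<Gamma>' |\<union>| fmdom \<Delta>'\<rbrakk>
    \<Longrightarrow> sim A (\<Gamma> ++\<^sub>f \<Gamma>') (\<Delta> ++\<^sub>f \<Delta>') (Cut \<gamma> Z (fmdom \<Gamma> |\<union>| fmdom \<Delta>) f g)
          (Cut \<gamma> Z (fmdom \<Gamma> |\<union>| fmdom \<Delta>) f' g')"


section \<open>The polycategory of formulas and derivations\<close>

text \<open>The lists \<open>\<Gamma>\<close>, \<open>\<Delta>\<close> of formulas are read as the sequent in which position \<open>i\<close> of the
  domain has channel \<open>In i\<close> and position \<open>j\<close> of the codomain has channel \<open>Out j\<close>.\<close>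

definition dom_ctx :: "'o form list \<Rightarrow> 'o ctx" where
  "dom_ctx \<Gamma> = label (map In [0..<length \<Gamma>]) \<Gamma>"

definition cod_ctx :: "'o form list \<Rightarrow> 'o ctx" where
  "cod_ctx \<Delta> = label (map Out [0..<length \<Delta>]) \<Delta>"

definition derivations :: "('o, 'm) polycat \<Rightarrow> 'o form list \<Rightarrow> 'o form list \<Rightarrow> ('o, 'm) der set" where
  "derivations A \<Gamma> \<Delta> = {t. derives A (dom_ctx \<Gamma>) (cod_ctx \<Delta>) t}"

definition sim_rel :: "('o, 'm) polycat \<Rightarrow> 'o form list \<Rightarrow> 'o form list
    \<Rightarrow> (('o, 'm) der \<times> ('o, 'm) der) set" where
  "sim_rel A \<Gamma> \<Delta> = {(s, t). sim A (dom_ctx \<Gamma>) (cod_ctx \<Delta>) s t}"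

text \<open>
  For \<open>f\<close> deriving \<open>\<Gamma> \<turnstile> \<Delta>1, x, \<Delta>2\<close> and \<open>g\<close> deriving \<open>\<Gamma>1, x, \<Gamma>2 \<turnstile> \<Delta>\<close>, the following
  renamings give both occurrences of \<open>x\<close> the channel \<open>Aux 0\<close>, and every other formula the
  channel of its position in \<open>\<Gamma>1, \<Gamma>, \<Gamma>2 \<turnstile> \<Delta>1, \<Delta>, \<Delta>2\<close>.  The arguments \<open>n1\<close>, \<open>n\<close>, \<open>d1\<close>,
  \<open>d\<close> are the lengths of \<open>\<Gamma>1\<close>, \<open>\<Gamma>\<close>, \<open>\<Delta>1\<close>, \<open>\<Delta>\<close>.
\<close>

fun left_chan :: "nat \<Rightarrow> nat \<Rightarrow> nat \<Rightarrow> chan \<Rightarrow> chan" where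
  "left_chan n1 d1 d (In i) = In (n1 + i)"
| "left_chan n1 d1 d (Out j) = (if j < d1 then Out j else if j = d1 then Aux 0 else Out (j - 1 + d))"
| "left_chan n1 d1 d (Aux k) = Aux (Suc k)"

fun right_chan :: "nat \<Rightarrow> nat \<Rightarrow> nat \<Rightarrow> chan \<Rightarrow> chan" where
  "right_chan n1 n d1 (In i) = (if i < n1 then In i else if i = n1 then Aux 0 else In (i - 1 + n))"
| "right_chan n1 n d1 (Out j) = Out (d1 + j)"
| "right_chan n1 n d1 (Aux k) = Aux (Suc k)"

definition cut_deriv :: "'o form list \<Rightarrow> 'o form list \<Rightarrow> 'o form \<Rightarrow> 'o form list \<Rightarrow> 'o form list
    \<Rightarrow> 'o form list \<Rightarrow> 'o form list \<Rightarrow> ('o, 'm) der \<Rightarrow> ('o, 'm) der \<Rightarrow> ('o, 'm) der" where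
  "cut_deriv \<Gamma> \<Delta>1 x \<Delta>2 \<Gamma>1 \<Gamma>2 \<Delta> f g =
    (let \<rho> = left_chan (length \<Gamma>1) (length \<Delta>1) (length \<Delta>);
         L = (\<rho> |`| (fmdom (dom_ctx \<Gamma>) |\<union>| fmdom (cod_ctx (\<Delta>1 @ x # \<Delta>2)))) |-| {|Aux 0|}
     in Cut (Aux 0) x L (rename \<rho> f)
          (rename (right_chan (length \<Gamma>1) (length \<Gamma>) (length \<Delta>1)) g))"

fun perm_chan :: "(nat \<Rightarrow> nat) \<Rightarrow> (nat \<Rightarrow> nat) \<Rightarrow> chan \<Rightarrow> chan" where
  "perm_chan \<sigma> \<tau> (In i) = In (inv \<sigma> i)"
| "perm_chan \<sigma> \<tau> (Out j) = Out (inv \<tau> j)"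
| "perm_chan \<sigma> \<tau> (Aux k) = Aux k"

definition SigmaPi :: "('o, 'm) polycat \<Rightarrow> ('o form, ('o, 'm) der set) polycat" where
  "SigmaPi A = \<lparr>
     Ob = formulas A,
     Hom = (\<lambda>\<Gamma> \<Delta>. derivations A \<Gamma> \<Delta> // sim_rel A \<Gamma> \<Delta>),
     Idn = (\<lambda>X. sim_rel A [X] [X] `` {iota A X (In 0) (Out 0)}),
     cut = (\<lambda>\<Gamma> \<Delta>1 x \<Delta>2 \<Gamma>1 \<Gamma>2 \<Delta> F G. \<Union>f\<in>F. \<Union>g\<in>G.
       sim_rel A (\<Gamma>1 @ \<Gamma> @ \<Gamma>2) (\<Delta>1 @ \<Delta> @ \<Delta>2) `` {cut_deriv \<Gamma> \<Delta>1 x \<Delta>2 \<Gamma>1 \<Gamma>2 \<Delta> f g}),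
     act = (\<lambda>\<Gamma> \<Delta> \<sigma> \<tau> F. \<Union>f\<in>F.
       sim_rel A (permute_list \<sigma> \<Gamma>) (permute_list \<tau> \<Delta>) `` {rename (perm_chan \<sigma> \<tau>) f}) \<rparr>"

end

(*
  Cut elimination holds for derivations over A: every cut of two cut-free derivations can be pushed
  towards the axioms, where it is composed in A, and the sum of the sizes decreases.  Hence every
  derivation is equivalent to a cut-free one, and every law of a polycategory only has to be verified
  for cuts of cut-free derivations.  There it follows by induction on the sizes: a rule whose
  principal channel is not cut is pushed out of both sides of the equation, a pair of matching rules
  on a cut channel is cancelled on both sides, and for axioms the law is that of A.  With formulas
  carrying the sign of their side, associativity and the two interchange laws become one statement
  about a cut of f with g and of g with h, and the eight commutation rules become one as well.
*)
theory Submission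
  imports Defs
begin

subsection \<open>Families and renamings\<close>

text \<open>The obstacle is the bookkeeping of channels. Both sides of a polycategory law arise by
  renaming the premises to positions of a composite sequent, and the composite renamings on the two
  sides agree, up to the names of the cut channels, only on the channels of the premises. As
  \<open>rename\<close> also moves channels bound by cuts, the resulting terms differ inside the
  premises, and \<open>alpha\<close> changes a single cut at a time. A cut-free term contains no
  bound channels, so cut elimination, combined with stability of \<open>sim\<close> under injective
  renaming, closes this gap; it is thus needed for the law of permutations as well as for the cut
  laws. Size alone is a sufficient measure because the rules are additive: a commuted rule copies
  the other premise into its branches, but every branch is a smaller cut of its own, and a matching
  pair leaves a single cut. Composition in A is subject to planarity, so axioms are first permuted
  until their cut channels stand at the ends of the lists. The rules \<open>r1\<close> and
  \<open>r2\<close> concern atoms only; neutrality of the other identity derivations is an induction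
  of its own.\<close>

lemma fam_fmdom: "fam (fmdom F) (\<lambda>i. the (fmlookup F i)) = F"
  by (rule fmap_ext) (auto simp: fmlookup_dom_iff)

lemma fam_cong: "(\<And>i. i |\<in>| I \<Longrightarrow> f i = g i) \<Longrightarrow> fam I f = fam I g"
  by (rule fmap_ext) auto

lemma fam_eq_iff: "fam I f = fam J g \<longleftrightarrow> I = J \<and> (\<forall>i. i |\<in>| I \<longrightarrow> f i = g i)"
proof
  assume eq: "fam I f = fam J g"
  have look: "fmlookup (fam I f) i = fmlookup (fam J g) i" for i
    using eq by simp
  show "I = J \<and> (\<forall>i. i |\<in>| I \<longrightarrow> f i = g i)"
  proof (intro conjI allI impI fset_eqI)
    fix i show "i |\<in>| I \<longleftrightarrow> i |\<in>| J" using look[of i] by (auto split: if_splits)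
  next
    fix i assume "i |\<in>| I" then show "f i = g i" using look[of i] by (auto split: if_splits)
  qed
qed (auto intro: fam_cong)

lemma fmmap_fam: "fmmap h (fam I f) = fam I (\<lambda>i. h (f i))"
  by (rule fmap_ext) auto

lemma fmmap_keys_fam: "fmmap_keys h (fam I f) = fam I (\<lambda>i. h i (f i))"
  by (rule fmap_ext) auto

lemma fmran'_fam: "fmran' (fam I f) = f ` fset I"
  by (auto simp: fmlookup_ran'_iff split: if_splits)

section \<open>Transport of labelled families along injective renamings of channels\<close>

context
  includes fset.lifting and fmap.lifting
begin

text \<open>Read backwards through \<open>inv \<rho>\<close>, which keeps the domain finite for
  every function \<open>\<rho>\<close>; for an injective \<open>\<rho>\<close> it is the family in
  which each channel is replaced by its image.\<close>

lift_definition relabel :: "('c \<Rightarrow> 'd) \<Rightarrow> ('c, 'v) fmap \<Rightarrow> ('d, 'v) fmap"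
  is "\<lambda>\<rho> m k. if k \<in> range \<rho> then m (inv \<rho> k) else None"
proof -
  fix \<rho> :: "'c \<Rightarrow> 'd" and m :: "'c \<Rightarrow> 'v option" assume "finite (dom m)"
  moreover have "dom (\<lambda>k. if k \<in> range \<rho> then m (inv \<rho> k) else None) \<subseteq> \<rho> ` dom m"
    by (auto simp: f_inv_into_f split: if_splits intro!: rev_image_eqI)
  ultimately show "finite (dom (\<lambda>k. if k \<in> range \<rho> then m (inv \<rho> k) else None))"
    using finite_subset by blast
qed

lemma fmlookup_relabel: "fmlookup (relabel \<rho> S) k = (if k \<in> range \<rho> then fmlookup S (inv \<rho> k) else None)"
  by transfer simp

end

lemma fmlookup_relabel_app [simp]: "inj \<rho> \<Longrightarrow> fmlookup (relabel \<rho> S) (\<rho> c) = fmlookup S c"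
  by (simp add: fmlookup_relabel)

lemma fmlookup_relabel_Some:
  "inj \<rho> \<Longrightarrow> fmlookup (relabel \<rho> S) k = Some v \<longleftrightarrow> (\<exists>c. k = \<rho> c \<and> fmlookup S c = Some v)"
  by (auto simp: fmlookup_relabel f_inv_into_f)

text \<open>Extensionality on defined values only, to match the lookup rules for joins and
  renamings, which are stated in the form \<open>= Some v\<close>.\<close>

lemma fmap_eqI: "(\<And>k v. fmlookup S k = Some v \<longleftrightarrow> fmlookup T k = Some v) \<Longrightarrow> S = T"
  by (rule fmap_ext) (metis not_Some_eq)

lemma relabel_eqI:
  assumes "inj \<rho>" "\<And>c. fmlookup T (\<rho> c) = fmlookup S c" "\<And>k. k \<notin> range \<rho> \<Longrightarrow> fmlookup T k = None"
  shows "relabel \<rho> S = T"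
proof (rule fmap_ext)
  fix k show "fmlookup (relabel \<rho> S) k = fmlookup T k"
    using assms by (cases "k \<in> range \<rho>") (auto simp: fmlookup_relabel)
qed

lemma relabel_fmupd: "inj \<rho> \<Longrightarrow> relabel \<rho> (fmupd c v S) = fmupd (\<rho> c) v (relabel \<rho> S)"
  by (rule relabel_eqI) (auto simp: inj_eq fmlookup_relabel)

lemma relabel_fmdrop: "inj \<rho> \<Longrightarrow> relabel \<rho> (fmdrop c S) = fmdrop (\<rho> c) (relabel \<rho> S)"
  by (rule relabel_eqI) (auto simp: inj_eq fmlookup_relabel)

lemma relabel_add: "inj \<rho> \<Longrightarrow> relabel \<rho> (S ++\<^sub>f T) = relabel \<rho> S ++\<^sub>f relabel \<rho> T"
  by (rule relabel_eqI) (auto simp: fmlookup_dom_iff fmlookup_relabel)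

lemma fmdom_relabel: "inj \<rho> \<Longrightarrow> fmdom (relabel \<rho> S) = \<rho> |`| fmdom S"
  by (rule fset_eqI) (auto simp: fmlookup_dom_iff fmlookup_relabel_Some image_iff, metis)

lemma fmran'_relabel: "inj \<rho> \<Longrightarrow> fmran' (relabel \<rho> S) = fmran' S"
  by (auto simp: fmlookup_ran'_iff fmlookup_relabel_Some)

lemma relabel_comp: "inj \<rho> \<Longrightarrow> inj \<sigma> \<Longrightarrow> relabel (\<rho> \<circ> \<sigma>) S = relabel \<rho> (relabel \<sigma> S)"
  by (rule fmap_eqI) (auto simp: fmlookup_relabel_Some inj_compose)

lemma relabel_id: "relabel id S = S"
  by (rule fmap_eqI) (auto simp: fmlookup_relabel_Some)

text \<open>Agreement is asked on the domain only: composite renamings of positions usually agree on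
  the channels of a sequent and nowhere else.\<close>

lemma relabel_cong:
  assumes "inj \<rho>" "inj \<sigma>" "\<And>c. c |\<in>| fmdom S \<Longrightarrow> \<rho> c = \<sigma> c"
  shows "relabel \<rho> S = relabel \<sigma> S"
  by (rule fmap_eqI) (use assms in \<open>auto simp: fmlookup_relabel_Some fmdomI\<close>, metis fmdomI)

lemma fimage_minus_single: "inj \<rho> \<Longrightarrow> \<rho> |`| (K |-| {|c|}) = (\<rho> |`| K) |-| {|\<rho> c|}"
  by (rule fset_eqI) (auto simp: inj_eq)

lemma fmlookup_label:
  assumes "distinct cs" "length cs = length Xs"
  shows "fmlookup (label cs Xs) c = Some X \<longleftrightarrow> (\<exists>i<length Xs. c = cs ! i \<and> X = Xs ! i)"
  using assms unfolding label_def
  by (auto simp: fmlookup_of_list in_set_zip map_of_eq_Some_iff)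

lemma fmdom_label [simp]: "length cs = length Xs \<Longrightarrow> fmdom (label cs Xs) = fset_of_list cs"
  by (simp add: label_def)

lemma relabel_label:
  assumes "inj \<rho>" "distinct cs" "length cs = length Xs"
  shows "relabel \<rho> (label cs Xs) = label (map \<rho> cs) Xs"
proof -
  have "distinct (map \<rho> cs)" using assms by (simp add: distinct_map inj_on_def inj_def)
  then show ?thesis
    by (intro fmap_eqI) (use assms in \<open>auto simp: fmlookup_relabel_Some fmlookup_label\<close>)
qed

section \<open>Renaming of derivations and its compatibility with equivalence\<close>

lemma rename_simps [simp]:
  "rename \<rho> (Ax As Bs f cs ds) = Ax As Bs f (map \<rho> cs) (map \<rho> ds)"
  "rename \<rho> (Cotuple \<alpha> (fam I F)) = Cotuple (\<rho> \<alpha>) (fam I (\<lambda>i. rename \<rho> (F i)))"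
  "rename \<rho> (Tuple \<alpha> (fam I F)) = Tuple (\<rho> \<alpha>) (fam I (\<lambda>i. rename \<rho> (F i)))"
  "rename \<rho> (Proj \<alpha> k t) = Proj (\<rho> \<alpha>) k (rename \<rho> t)"
  "rename \<rho> (Inj \<alpha> k t) = Inj (\<rho> \<alpha>) k (rename \<rho> t)"
  "rename \<rho> (Cut \<gamma> Z L t u) = Cut (\<rho> \<gamma>) Z (\<rho> |`| L) (rename \<rho> t) (rename \<rho> u)"
  by (simp_all add: rename_def fmmap_fam list.map_id form.map_id)

lemma rename_comp: "rename \<rho> (rename \<sigma> t) = rename (\<rho> \<circ> \<sigma>) t"
  by (simp add: rename_def deriv.map_comp)

lemma rename_id: "rename id t = t"
  by (simp add: rename_def deriv.map_id)

text \<open>Conjugating a swap by an injection gives the swap of the images. It makes the rules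
  \<open>alpha\<close>, \<open>r1\<close> and \<open>r2\<close>, whose right sides contain a
  renaming, stable under \<open>rename\<close>.\<close>

lemma rename_transpose: "inj \<rho> \<Longrightarrow>
    rename \<rho> (rename (transpose \<gamma> \<delta>) t) = rename (transpose (\<rho> \<gamma>) (\<rho> \<delta>)) (rename \<rho> t)"
proof -
  assume "inj \<rho>"
  then have "\<rho> \<circ> transpose \<gamma> \<delta> = transpose (\<rho> \<gamma>) (\<rho> \<delta>) \<circ> \<rho>"
    by (auto simp: fun_eq_iff transpose_def inj_eq)
  then show ?thesis by (simp add: rename_comp)
qed

lemma sequent_relabel: "inj \<rho> \<Longrightarrow> sequent A (relabel \<rho> \<Gamma>) (relabel \<rho> \<Delta>) = sequent A \<Gamma> \<Delta>"
proof -
  assume \<rho>: "inj \<rho>"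
  have "\<rho> |`| fmdom \<Gamma> |\<inter>| \<rho> |`| fmdom \<Delta> = {||} \<longleftrightarrow> fmdom \<Gamma> |\<inter>| fmdom \<Delta> = {||}"
    using \<rho> by (auto simp: fset_eq_iff image_iff inj_eq)
  then show ?thesis using \<rho> by (simp add: sequent_def fmdom_relabel fmran'_relabel)
qed

text \<open>No freshness condition arises: the channels bound by cuts are moved along with the free
  ones, and injectivity preserves every disjointness and non-membership condition of the
  rules.\<close>

lemma derives_rename:
  assumes "derives A \<Gamma> \<Delta> t" "inj \<rho>"
  shows "derives A (relabel \<rho> \<Gamma>) (relabel \<rho> \<Delta>) (rename \<rho> t)"
  using assms(1)
proof induction
  case (ax f As Bs cs ds)
  have "distinct (map \<rho> cs @ map \<rho> ds)"
    using ax assms(2) by (auto simp: distinct_map inj_on_def inj_def)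
  then show ?case
    using ax assms(2) by (auto simp: relabel_label intro!: derives.ax)
next
  case (cotuple \<alpha> \<Gamma> I X \<Delta> f)
  have "derives A (fmupd (\<rho> \<alpha>) (SumF (fam I X)) (relabel \<rho> \<Gamma>)) (relabel \<rho> \<Delta>) (Cotuple (\<rho> \<alpha>) (fam I (\<lambda>i. rename \<rho> (f i))))"
    using cotuple assms(2) sequent_relabel[OF assms(2), of A "fmupd \<alpha> (SumF (fam I X)) \<Gamma>" \<Delta>]
    by (intro derives.cotuple) (auto simp: relabel_fmupd fmdom_relabel inj_eq)
  then show ?case using assms(2) by (simp add: relabel_fmupd)
next
  case (tuple \<alpha> \<Delta> \<Gamma> I X f)
  have "derives A (relabel \<rho> \<Gamma>) (fmupd (\<rho> \<alpha>) (ProdF (fam I X)) (relabel \<rho> \<Delta>)) (Tuple (\<rho> \<alpha>) (fam I (\<lambda>i. rename \<rho> (f i))))"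
    using tuple assms(2) sequent_relabel[OF assms(2), of A \<Gamma> "fmupd \<alpha> (ProdF (fam I X)) \<Delta>"]
    by (intro derives.tuple) (auto simp: relabel_fmupd fmdom_relabel inj_eq)
  then show ?case using assms(2) by (simp add: relabel_fmupd)
next
  case (proj \<alpha> \<Gamma> I X \<Delta> k f)
  have "derives A (fmupd (\<rho> \<alpha>) (ProdF (fam I X)) (relabel \<rho> \<Gamma>)) (relabel \<rho> \<Delta>) (Proj (\<rho> \<alpha>) k (rename \<rho> f))"
    using proj assms(2) sequent_relabel[OF assms(2), of A "fmupd \<alpha> (ProdF (fam I X)) \<Gamma>" \<Delta>]
    by (intro derives.proj) (auto simp: relabel_fmupd fmdom_relabel inj_eq)
  then show ?case using assms(2) by (simp add: relabel_fmupd)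
next
  case (inj \<alpha> \<Delta> \<Gamma> I X k f)
  have "derives A (relabel \<rho> \<Gamma>) (fmupd (\<rho> \<alpha>) (SumF (fam I X)) (relabel \<rho> \<Delta>)) (Inj (\<rho> \<alpha>) k (rename \<rho> f))"
    using inj assms(2) sequent_relabel[OF assms(2), of A \<Gamma> "fmupd \<alpha> (SumF (fam I X)) \<Delta>"]
    by (intro derives.inj) (auto simp: relabel_fmupd fmdom_relabel inj_eq)
  then show ?case using assms(2) by (simp add: relabel_fmupd)
next
  case (cut \<Gamma> \<gamma> Z \<Delta> f \<Gamma>' \<Delta>' g)
  have "derives A (relabel \<rho> \<Gamma> ++\<^sub>f relabel \<rho> \<Gamma>') (relabel \<rho> \<Delta> ++\<^sub>f relabel \<rho> \<Delta>')
     (Cut (\<rho> \<gamma>) Z (fmdom (relabel \<rho> \<Gamma>) |\<union>| fmdom (relabel \<rho> \<Delta>)) (rename \<rho> f) (rename \<rho> g))"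
    using cut assms(2) by (intro derives.cut) (auto simp: relabel_fmupd fmdom_relabel inj_eq fset_eq_iff image_iff)
  then show ?case using assms(2) by (simp add: relabel_add fmdom_relabel fimage_funion)
qed

lemma sim_derives: "sim A \<Gamma> \<Delta> s t \<Longrightarrow> derives A \<Gamma> \<Delta> s \<and> derives A \<Gamma> \<Delta> t"
proof (induction rule: sim.induct)
  case cotuple then show ?case by (blast intro!: derives.cotuple)
next
  case tuple then show ?case by (blast intro!: derives.tuple)
next
  case proj then show ?case by (blast intro!: derives.proj)
next
  case inj then show ?case by (blast intro!: derives.inj)
next
  case cut then show ?case by (blast intro: derives.cut)
qed auto

lemma derives_Ax_length:
  assumes "derives A \<Gamma> \<Delta> (Ax As Bs f cs ds)"
  shows "length cs = length As" "length ds = length Bs"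
  using assms by (auto elim: derives.cases)

text \<open>Derivability of \<open>s\<close> supplies the lengths of the channel lists of an axiom,
  which \<open>ax_perm\<close> does not record and on which the commutation of
  \<open>permute_list\<close> with \<open>map \<rho>\<close> depends.\<close>

lemma rewr_rename:
  assumes "rewr A s t" "derives A \<Gamma> \<Delta> s" "inj \<rho>"
  shows "rewr A (rename \<rho> s) (rename \<rho> t)"
  using assms(1,2)
proof induction
  case (alpha \<gamma> Z L f g \<delta>)
  show ?case using rewr.alpha assms(3) by (simp add: rename_transpose)
next
  case (ax_perm \<sigma> As \<tau> Bs f cs ds)
  have "length cs = length As" "length ds = length Bs"
    using derives_Ax_length[OF ax_perm(3)] by simp_all
  then show ?case using ax_perm rewr.ax_perm[of \<sigma> As \<tau> Bs A f "map \<rho> cs" "map \<rho> ds"]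
    by (simp add: permute_list_map)
next
  case (ax_cut \<Gamma>1 \<Gamma>2 \<Delta>1 \<Delta>2 ds1 ds2 cs1 cs2 \<gamma> x L \<Gamma> f cs \<Delta> g ds)
  then show ?case by (simp add: rewr.ax_cut)
next
  case r1 then show ?case using assms(3) by (simp add: rename_transpose rewr.r1)
next
  case r2 then show ?case using assms(3) by (simp add: rename_transpose rewr.r2)
next
  case (r11 k I \<gamma> X L f g)
  then show ?case using rewr.r11[of k I A "\<rho> \<gamma>" X "\<rho> |`| L" "rename \<rho> f" "\<lambda>i. rename \<rho> (g i)"] by simp
next
  case (r12 k I \<gamma> X L f g)
  then show ?case using rewr.r12[of k I A "\<rho> \<gamma>" X "\<rho> |`| L" "\<lambda>i. rename \<rho> (f i)" "rename \<rho> g"] by simp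
next
  case r3 then show ?case using assms(3) by (simp, intro rewr.r3) (simp add: inj_eq)
next
  case r4 then show ?case using assms(3) by (simp, intro rewr.r4) (simp add: inj_eq)
next
  case r5 then show ?case using assms(3) by (simp, intro rewr.r5) (simp add: inj_eq)
next
  case r6 then show ?case using assms(3) by (simp, intro rewr.r6) (simp add: inj_eq)
next
  case r7 then show ?case using assms(3) by (simp, intro rewr.r7) (simp add: inj_eq)
next
  case r8 then show ?case using assms(3) by (simp, intro rewr.r8) (simp add: inj_eq)
next
  case r9 then show ?case using assms(3) by (simp, intro rewr.r9) (simp add: inj_eq)
next
  case r10 then show ?case using assms(3) by (simp, intro rewr.r10) (simp add: inj_eq)
next
  case r13 then show ?case using assms(3) by (simp, intro rewr.r13) (simp add: inj_eq)
next
  case r14 then show ?case using assms(3) by (simp, intro rewr.r14) (simp add: inj_eq)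
next
  case r15 then show ?case using assms(3) by (simp, intro rewr.r15) (simp add: inj_eq)
next
  case r16 then show ?case using assms(3) by (simp, intro rewr.r16) (simp add: inj_eq)
next
  case r17 then show ?case using assms(3) by (simp, intro rewr.r17) (simp add: inj_eq)
next
  case r18 then show ?case using assms(3) by (simp, intro rewr.r18) (simp add: inj_eq)
next
  case r19 then show ?case using assms(3) by (simp, intro rewr.r19) (simp add: inj_eq)
next
  case r20 then show ?case using assms(3) by (simp, intro rewr.r20) (simp add: inj_eq)
next
  case r21 then show ?case using assms(3) by (simp, intro rewr.r21) (simp add: inj_eq)
next
  case r22 then show ?case using assms(3) by (simp, intro rewr.r22) (simp add: inj_eq)
qed

lemma sim_rename:
  assumes "sim A \<Gamma> \<Delta> s t" "inj \<rho>"
  shows "sim A (relabel \<rho> \<Gamma>) (relabel \<rho> \<Delta>) (rename \<rho> s) (rename \<rho> t)"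
  using assms(1)
proof induction
  case (rule \<Gamma> \<Delta> s t)
  then show ?case using derives_rename rewr_rename assms(2) by (metis sim.rule)
next
  case (refl \<Gamma> \<Delta> t)
  then show ?case using derives_rename assms(2) by (metis sim.refl)
next
  case (sym \<Gamma> \<Delta> s t)
  then show ?case by (metis sim.sym)
next
  case (trans \<Gamma> \<Delta> s t u)
  then show ?case by (metis sim.trans)
next
  case (cotuple \<alpha> \<Gamma> I X \<Delta> f g)
  have "sim A (fmupd (\<rho> \<alpha>) (SumF (fam I X)) (relabel \<rho> \<Gamma>)) (relabel \<rho> \<Delta>)
     (Cotuple (\<rho> \<alpha>) (fam I (\<lambda>i. rename \<rho> (f i)))) (Cotuple (\<rho> \<alpha>) (fam I (\<lambda>i. rename \<rho> (g i))))"
    using cotuple assms(2) sequent_relabel[OF assms(2), of A "fmupd \<alpha> (SumF (fam I X)) \<Gamma>" \<Delta>]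
    by (intro sim.cotuple) (auto simp: relabel_fmupd fmdom_relabel inj_eq)
  then show ?case using assms(2) by (simp add: relabel_fmupd)
next
  case (tuple \<alpha> \<Delta> \<Gamma> I X f g)
  have "sim A (relabel \<rho> \<Gamma>) (fmupd (\<rho> \<alpha>) (ProdF (fam I X)) (relabel \<rho> \<Delta>))
     (Tuple (\<rho> \<alpha>) (fam I (\<lambda>i. rename \<rho> (f i)))) (Tuple (\<rho> \<alpha>) (fam I (\<lambda>i. rename \<rho> (g i))))"
    using tuple assms(2) sequent_relabel[OF assms(2), of A \<Gamma> "fmupd \<alpha> (ProdF (fam I X)) \<Delta>"]
    by (intro sim.tuple) (auto simp: relabel_fmupd fmdom_relabel inj_eq)
  then show ?case using assms(2) by (simp add: relabel_fmupd)
next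
  case (proj \<alpha> \<Gamma> I X \<Delta> k f g)
  have "sim A (fmupd (\<rho> \<alpha>) (ProdF (fam I X)) (relabel \<rho> \<Gamma>)) (relabel \<rho> \<Delta>)
     (Proj (\<rho> \<alpha>) k (rename \<rho> f)) (Proj (\<rho> \<alpha>) k (rename \<rho> g))"
    using proj assms(2) sequent_relabel[OF assms(2), of A "fmupd \<alpha> (ProdF (fam I X)) \<Gamma>" \<Delta>]
    by (intro sim.proj) (auto simp: relabel_fmupd fmdom_relabel inj_eq)
  then show ?case using assms(2) by (simp add: relabel_fmupd)
next
  case (inj \<alpha> \<Delta> \<Gamma> I X k f g)
  have "sim A (relabel \<rho> \<Gamma>) (fmupd (\<rho> \<alpha>) (SumF (fam I X)) (relabel \<rho> \<Delta>))
     (Inj (\<rho> \<alpha>) k (rename \<rho> f)) (Inj (\<rho> \<alpha>) k (rename \<rho> g))"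
    using inj assms(2) sequent_relabel[OF assms(2), of A \<Gamma> "fmupd \<alpha> (SumF (fam I X)) \<Delta>"]
    by (intro sim.inj) (auto simp: relabel_fmupd fmdom_relabel inj_eq)
  then show ?case using assms(2) by (simp add: relabel_fmupd)
next
  case (cut \<Gamma> \<gamma> Z \<Delta> f f' \<Gamma>' \<Delta>' g g')
  have "sim A (relabel \<rho> \<Gamma> ++\<^sub>f relabel \<rho> \<Gamma>') (relabel \<rho> \<Delta> ++\<^sub>f relabel \<rho> \<Delta>')
     (Cut (\<rho> \<gamma>) Z (fmdom (relabel \<rho> \<Gamma>) |\<union>| fmdom (relabel \<rho> \<Delta>)) (rename \<rho> f) (rename \<rho> g))
     (Cut (\<rho> \<gamma>) Z (fmdom (relabel \<rho> \<Gamma>) |\<union>| fmdom (relabel \<rho> \<Delta>)) (rename \<rho> f') (rename \<rho> g'))"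
    using cut assms(2) by (intro sim.cut) (auto simp: relabel_fmupd fmdom_relabel inj_eq fset_eq_iff image_iff)
  then show ?case using assms(2) by (simp add: relabel_add fmdom_relabel fimage_funion)
qed

subsection \<open>Signed contexts\<close>

text \<open>A sequent is encoded as one context in which every formula carries the side on which it
  occurs: \<^const>\<open>False\<close> for the domain, \<^const>\<open>True\<close> for the codomain.  The duality between
  the left and the right rules then is the negation of the sign.\<close>

type_synonym 'o sctx = "(chan, bool \<times> 'o form) fmap"

definition prj :: "bool \<Rightarrow> 'o sctx \<Rightarrow> 'o ctx" where
  "prj s S = fmmap snd (fmfilter (\<lambda>c. fst (the (fmlookup S c)) = s) S)"

definition signed :: "'o ctx \<Rightarrow> 'o ctx \<Rightarrow> 'o sctx" where
  "signed \<Gamma> \<Delta> = fmmap (Pair False) \<Gamma> ++\<^sub>f fmmap (Pair True) \<Delta>"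

definition Der :: "('o, 'm) polycat \<Rightarrow> 'o sctx \<Rightarrow> ('o, 'm) der \<Rightarrow> bool" where
  "Der A S t \<longleftrightarrow> derives A (prj False S) (prj True S) t"

definition Sim :: "('o, 'm) polycat \<Rightarrow> 'o sctx \<Rightarrow> ('o, 'm) der \<Rightarrow> ('o, 'm) der \<Rightarrow> bool" where
  "Sim A S t u \<longleftrightarrow> sim A (prj False S) (prj True S) t u"

lemma fmlookup_prj: "fmlookup (prj s S) c = Some X \<longleftrightarrow> fmlookup S c = Some (s, X)"
  by (auto simp: prj_def)

lemma fmdom_prj: "fmdom (prj False S) |\<union>| fmdom (prj True S) = fmdom S"
  by (rule fset_eqI) (auto simp: fmlookup_dom_iff fmlookup_prj)

text \<open>Isolates \<open>c\<close> as an update of a context without \<open>c\<close>, the form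
  in which the rules of \<open>derives\<close> present a principal or a cut formula.\<close>

lemma prj_eq: "fmlookup S c = Some (s, X) \<Longrightarrow> prj s S = fmupd c X (fmdrop c (prj s S))"
  by (rule fmap_eqI) (auto simp: fmlookup_prj)

lemma prj_fmupd: "prj s (fmupd c (s, X) S) = fmupd c X (fmdrop c (prj s S))"
  by (rule fmap_eqI) (auto simp: fmlookup_prj)

lemma prj_fmupd_other:
  "fmlookup S c = Some (s, Y) \<Longrightarrow> s' \<noteq> s \<Longrightarrow> prj s' (fmupd c (s, X) S) = prj s' S"
  by (rule fmap_eqI) (auto simp: fmlookup_prj)

lemma prj_signed:
  assumes "fmdom \<Gamma> |\<inter>| fmdom \<Delta> = {||}"
  shows "prj False (signed \<Gamma> \<Delta>) = \<Gamma>" "prj True (signed \<Gamma> \<Delta>) = \<Delta>"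
proof -
  have no: "fmlookup \<Gamma> c = Some X \<Longrightarrow> fmlookup \<Delta> c = None" for c X
    using assms by (metis finterI fmdomI fempty_iff fmdom_notD)
  show "prj False (signed \<Gamma> \<Delta>) = \<Gamma>" "prj True (signed \<Gamma> \<Delta>) = \<Delta>"
    by (rule fmap_eqI; use no in \<open>force simp: fmlookup_prj signed_def fmlookup_dom_iff split: if_splits\<close>)+
qed

lemma fmlookup_signed:
  assumes "fmdom \<Gamma> |\<inter>| fmdom \<Delta> = {||}"
  shows "fmlookup (signed \<Gamma> \<Delta>) c = Some (s, X) \<longleftrightarrow> fmlookup (if s then \<Delta> else \<Gamma>) c = Some X"
  using fmlookup_prj[of s "signed \<Gamma> \<Delta>" c X] prj_signed[OF assms] by (cases s) auto

lemma prj_relabel: "inj \<rho> \<Longrightarrow> prj s (relabel \<rho> S) = relabel \<rho> (prj s S)"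
  by (rule fmap_eqI) (auto simp: fmlookup_prj fmlookup_relabel_Some)

lemma Der_rename: "Der A S t \<Longrightarrow> inj \<rho> \<Longrightarrow> Der A (relabel \<rho> S) (rename \<rho> t)"
  by (simp add: Der_def prj_relabel derives_rename)

lemma Sim_rename: "Sim A S t u \<Longrightarrow> inj \<rho> \<Longrightarrow> Sim A (relabel \<rho> S) (rename \<rho> t) (rename \<rho> u)"
  by (simp add: Sim_def prj_relabel sim_rename)

lemma Sim_refl: "Der A S t \<Longrightarrow> Sim A S t t"
  and Sim_sym: "Sim A S t u \<Longrightarrow> Sim A S u t"
  and Sim_trans [trans]: "Sim A S t u \<Longrightarrow> Sim A S u v \<Longrightarrow> Sim A S t v"
  and Sim_rule: "Der A S t \<Longrightarrow> Der A S u \<Longrightarrow> rewr A t u \<Longrightarrow> Sim A S t u"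
  unfolding Der_def Sim_def by (rule sim.refl, assumption) (rule sim.sym, assumption, rule sim.trans, assumption+, rule sim.rule, assumption+)

lemma Sim_Der: "Sim A S t u \<Longrightarrow> Der A S t \<and> Der A S u"
  by (simp add: Der_def Sim_def sim_derives)

definition wfs :: "('o, 'm) polycat \<Rightarrow> 'o sctx \<Rightarrow> bool" where
  "wfs A S \<longleftrightarrow> (\<forall>c s X. fmlookup S c = Some (s, X) \<longrightarrow> X \<in> formulas A)"

text \<open>Disjointness of the two sides is automatic, since a channel of a signed context carries
  exactly one sign; only the condition on the formulas is left.\<close>

lemma sequent_prj: "sequent A (prj False S) (prj True S) \<longleftrightarrow> wfs A S"
proof
  assume *: "sequent A (prj False S) (prj True S)"
  show "wfs A S" unfolding wfs_def
  proof (intro allI impI)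
    fix c s X assume "fmlookup S c = Some (s, X)"
    then have "X \<in> fmran' (prj s S)" by (auto simp: fmlookup_ran'_iff fmlookup_prj)
    then show "X \<in> formulas A" using * by (cases s) (auto simp: sequent_def)
  qed
next
  assume "wfs A S"
  then show "sequent A (prj False S) (prj True S)"
    by (auto simp: sequent_def wfs_def fmlookup_ran'_iff fmlookup_prj fset_eq_iff fmlookup_dom_iff)
qed

lemma wfs_signed: "sequent A \<Gamma> \<Delta> \<Longrightarrow> wfs A (signed \<Gamma> \<Delta>)"
  using sequent_prj[of A "signed \<Gamma> \<Delta>"] by (simp add: prj_signed sequent_def)

subsection \<open>Cuts and logical rules on signed contexts\<close>

text \<open>\<open>\<gamma>\<close> lies in both contexts and is removed after the union. As
  \<open>++\<^sub>f\<close> is biased to the right, the union is symmetric off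
  \<open>\<gamma>\<close> only for contexts that overlap nowhere else; hence the hypothesis
  \<open>cuttable\<close> in \<open>fmlookup_join\<close> and \<open>join_flip\<close>.\<close>

definition join :: "chan \<Rightarrow> 'o sctx \<Rightarrow> 'o sctx \<Rightarrow> 'o sctx" where
  "join \<gamma> S T = fmdrop \<gamma> (S ++\<^sub>f T)"

definition cuttable :: "bool \<Rightarrow> chan \<Rightarrow> 'o form \<Rightarrow> 'o sctx \<Rightarrow> 'o sctx \<Rightarrow> bool" where
  "cuttable s \<gamma> Z S T \<longleftrightarrow> fmlookup S \<gamma> = Some (s, Z) \<and> fmlookup T \<gamma> = Some (\<not> s, Z)
     \<and> fmdom S |\<inter>| fmdom T = {|\<gamma>|}"

text \<open>The cut of \<open>f\<close> and \<open>g\<close> on \<open>\<gamma>\<close>, where \<open>s\<close> is the side of \<open>\<gamma>\<close> in \<open>f\<close>; \<open>K\<close> and \<open>K'\<close> are the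
  sets of channels of \<open>f\<close> and \<open>g\<close>.\<close>

definition gcut :: "bool \<Rightarrow> chan \<Rightarrow> 'o form \<Rightarrow> chan fset \<Rightarrow> chan fset
    \<Rightarrow> ('o, 'm) der \<Rightarrow> ('o, 'm) der \<Rightarrow> ('o, 'm) der" where
  "gcut s \<gamma> Z K K' f g =
     (if s then Cut \<gamma> Z (K |-| {|\<gamma>|}) f g else Cut \<gamma> Z (K' |-| {|\<gamma>|}) g f)"

lemma gcut_flip: "gcut s \<gamma> Z K K' f g = gcut (\<not> s) \<gamma> Z K' K g f"
  by (simp add: gcut_def)

lemma cuttable_flip: "cuttable s \<gamma> Z S T \<Longrightarrow> cuttable (\<not> s) \<gamma> Z T S"
  by (auto simp: cuttable_def)

lemma cuttable_disj:
  "cuttable s \<gamma> Z S T \<Longrightarrow> c \<noteq> \<gamma> \<Longrightarrow> fmlookup S c = Some v \<Longrightarrow> fmlookup T c = None"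
  unfolding cuttable_def by (metis finterI finsertE fempty_iff fmdomI fmdom_notD)

lemma fmlookup_join:
  assumes "cuttable s \<gamma> Z S T"
  shows "fmlookup (join \<gamma> S T) c = Some v \<longleftrightarrow> c \<noteq> \<gamma> \<and> (fmlookup S c = Some v \<or> fmlookup T c = Some v)"
  using cuttable_disj[OF assms, of c "the (fmlookup S c)"]
  by (cases "fmlookup S c"; cases "fmlookup T c"; cases "c = \<gamma>") (simp_all add: join_def fmlookup_dom_iff)

lemma join_flip: "cuttable s \<gamma> Z S T \<Longrightarrow> join \<gamma> S T = join \<gamma> T S"
  by (rule fmap_eqI) (auto simp: fmlookup_join cuttable_flip fmlookup_join[OF cuttable_flip])

lemma fmdom_join: "fmdom (join \<gamma> S T) = (fmdom S |\<union>| fmdom T) |-| {|\<gamma>|}"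
  by (simp add: join_def) blast

lemma wfs_join: "cuttable s \<gamma> Z S T \<Longrightarrow> wfs A S \<Longrightarrow> wfs A T \<Longrightarrow> wfs A (join \<gamma> S T)"
  unfolding wfs_def by (metis fmlookup_join)

text \<open>The passage from the conclusion to a premise of a rule at \<open>\<alpha>\<close>: only
  the formula at \<open>\<alpha>\<close> changes, so the contexts remain cuttable and the change
  carries over to the join.\<close>

lemma cuttable_fmupd:
  assumes "cuttable s \<gamma> Z S T" "fmlookup S \<alpha> = Some w" "\<alpha> \<noteq> \<gamma>"
  shows "cuttable s \<gamma> Z (fmupd \<alpha> v S) T"
    "join \<gamma> (fmupd \<alpha> v S) T = fmupd \<alpha> v (join \<gamma> S T)"
proof -
  have "fmdom (fmupd \<alpha> v S) = fmdom S" using assms(2) fmdomI by fastforce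
  then show 1: "cuttable s \<gamma> Z (fmupd \<alpha> v S) T"
    using assms by (auto simp: cuttable_def)
  have "fmlookup T \<alpha> = None" using cuttable_disj assms by metis
  then show "join \<gamma> (fmupd \<alpha> v S) T = fmupd \<alpha> v (join \<gamma> S T)"
    by (intro fmap_eqI) (use assms in \<open>auto simp: fmlookup_join[OF assms(1)] fmlookup_join[OF 1]\<close>)
qed

text \<open>The premises of a matching pair of rules keep the channel \<open>\<gamma>\<close>, now
  with a component, and the join drops \<open>\<gamma>\<close> together with its formula. So the
  reduced cut derives the same sequent.\<close>

lemma cuttable_principal:
  assumes "cuttable s \<gamma> Z S T"
  shows "cuttable s \<gamma> X (fmupd \<gamma> (s, X) S) (fmupd \<gamma> (\<not> s, X) T)"
    "join \<gamma> (fmupd \<gamma> (s, X) S) (fmupd \<gamma> (\<not> s, X) T) = join \<gamma> S T"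
proof -
  have "fmdom (fmupd \<gamma> (s, X) S) = fmdom S" "fmdom (fmupd \<gamma> (\<not> s, X) T) = fmdom T"
    using assms unfolding cuttable_def by (auto intro: fmdomI)
  then show "cuttable s \<gamma> X (fmupd \<gamma> (s, X) S) (fmupd \<gamma> (\<not> s, X) T)"
    using assms by (auto simp: cuttable_def)
  show "join \<gamma> (fmupd \<gamma> (s, X) S) (fmupd \<gamma> (\<not> s, X) T) = join \<gamma> S T"
    by (rule fmap_ext) (auto simp: join_def)
qed

text \<open>A rule and its premises have the same channels. The channel sets stored in a cut
  therefore stay the same when a rule moves through it, and the terms match the two sides of
  \<open>rewr\<close> literally.\<close>

lemma fmdom_fmupd_idle: "fmlookup S \<alpha> = Some w \<Longrightarrow> fmdom (fmupd \<alpha> v S) = fmdom S"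
  using fmdomI by fastforce

lemma relabel_join: "inj \<rho> \<Longrightarrow> relabel \<rho> (join \<gamma> S T) = join (\<rho> \<gamma>) (relabel \<rho> S) (relabel \<rho> T)"
  by (simp add: join_def relabel_fmdrop relabel_add del: fmdrop_add_distrib)

lemma cuttable_relabel: "inj \<rho> \<Longrightarrow> cuttable s \<gamma> Z S T \<Longrightarrow> cuttable s (\<rho> \<gamma>) Z (relabel \<rho> S) (relabel \<rho> T)"
  by (auto simp: cuttable_def fmdom_relabel fset_eq_iff image_iff inj_eq)

lemma rename_gcut: "inj \<rho> \<Longrightarrow> rename \<rho> (gcut s \<gamma> Z K K' f g) =
    gcut s (\<rho> \<gamma>) Z (\<rho> |`| K) (\<rho> |`| K') (rename \<rho> f) (rename \<rho> g)"
  by (simp add: gcut_def fimage_minus_single)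

text \<open>Splits two cuttable contexts into the four unsigned contexts of the rule
  \<open>cut\<close>, for the orientation with \<open>\<gamma>\<close> in the codomain of the left
  premise.\<close>

lemma cut_contexts:
  assumes "cuttable True \<gamma> Z S T"
  defines "\<Gamma> \<equiv> prj False S" and "\<Delta> \<equiv> fmdrop \<gamma> (prj True S)"
    and "\<Gamma>' \<equiv> fmdrop \<gamma> (prj False T)" and "\<Delta>' \<equiv> prj True T"
  shows "prj True S = fmupd \<gamma> Z \<Delta>" "prj False T = fmupd \<gamma> Z \<Gamma>'"
    "(fmdom \<Gamma> |\<union>| fmdom \<Delta>) |\<inter>| (fmdom \<Gamma>' |\<union>| fmdom \<Delta>') = {||}"
    "\<gamma> |\<notin>| fmdom \<Gamma> |\<union>| fmdom \<Delta> |\<union>| fmdom \<Gamma>' |\<union>| fmdom \<Delta>'"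
    "\<Gamma> ++\<^sub>f \<Gamma>' = prj False (join \<gamma> S T)" "\<Delta> ++\<^sub>f \<Delta>' = prj True (join \<gamma> S T)"
    "fmdom \<Gamma> |\<union>| fmdom \<Delta> = fmdom S |-| {|\<gamma>|}"
proof -
  have S: "fmlookup S \<gamma> = Some (True, Z)" and T: "fmlookup T \<gamma> = Some (False, Z)"
    using assms(1) by (auto simp: cuttable_def)
  note disj = cuttable_disj[OF assms(1)]
  show "prj True S = fmupd \<gamma> Z \<Delta>" "prj False T = fmupd \<gamma> Z \<Gamma>'"
    unfolding \<Delta>_def \<Gamma>'_def using S T by (simp_all flip: prj_eq)
  show "(fmdom \<Gamma> |\<union>| fmdom \<Delta>) |\<inter>| (fmdom \<Gamma>' |\<union>| fmdom \<Delta>') = {||}"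
    unfolding \<Gamma>_def \<Delta>_def \<Gamma>'_def \<Delta>'_def using S T disj
    by (force simp: fset_eq_iff fmlookup_dom_iff fmlookup_prj)
  show "\<gamma> |\<notin>| fmdom \<Gamma> |\<union>| fmdom \<Delta> |\<union>| fmdom \<Gamma>' |\<union>| fmdom \<Delta>'"
    unfolding \<Gamma>_def \<Delta>_def \<Gamma>'_def \<Delta>'_def using S T
    by (auto simp: fmlookup_dom_iff fmlookup_prj)
  show "\<Gamma> ++\<^sub>f \<Gamma>' = prj False (join \<gamma> S T)"
    unfolding \<Gamma>_def \<Gamma>'_def
    apply (rule fmap_eqI) using S T disj
    by (force simp: fmlookup_dom_iff fmlookup_prj fmlookup_join[OF assms(1)] split: if_splits)
  show "\<Delta> ++\<^sub>f \<Delta>' = prj True (join \<gamma> S T)"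
    unfolding \<Delta>_def \<Delta>'_def
    apply (rule fmap_eqI) using S T disj
    by (force simp: fmlookup_dom_iff fmlookup_prj fmlookup_join[OF assms(1)] split: if_splits)
  show "fmdom \<Gamma> |\<union>| fmdom \<Delta> = fmdom S |-| {|\<gamma>|}"
    unfolding \<Gamma>_def \<Delta>_def using S
    by (auto simp: fset_eq_iff fmlookup_dom_iff fmlookup_prj)
qed

text \<open>Only the orientation with \<open>\<gamma>\<close> in the codomain of the first
  derivation is checked against \<open>derives.cut\<close>; exchanging the premises gives the other
  one.\<close>

lemma Der_gcut:
  assumes "cuttable s \<gamma> Z S T" "Der A S f" "Der A T g"
  shows "Der A (join \<gamma> S T) (gcut s \<gamma> Z (fmdom S) (fmdom T) f g)"
proof -
  have *: "Der A (join \<gamma> S T) (gcut True \<gamma> Z (fmdom S) (fmdom T) f g)"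
    if "cuttable True \<gamma> Z S T" "Der A S f" "Der A T g" for S T f g
    using derives.cut[of A "prj False S" \<gamma> Z "fmdrop \<gamma> (prj True S)" f "fmdrop \<gamma> (prj False T)"
        "prj True T" g] cut_contexts[OF that(1)] that(2,3)
    unfolding Der_def gcut_def by simp
  show ?thesis
  proof (cases s)
    case True then show ?thesis using * assms by simp
  next
    case False
    then show ?thesis
      using *[of T S g f] assms cuttable_flip[OF assms(1)] join_flip[OF assms(1)]
      by (simp add: gcut_def)
  qed
qed

lemma Sim_gcut:
  assumes "cuttable s \<gamma> Z S T" "Sim A S f f'" "Sim A T g g'"
  shows "Sim A (join \<gamma> S T) (gcut s \<gamma> Z (fmdom S) (fmdom T) f g) (gcut s \<gamma> Z (fmdom S) (fmdom T) f' g')"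
proof -
  have *: "Sim A (join \<gamma> S T) (gcut True \<gamma> Z (fmdom S) (fmdom T) f g) (gcut True \<gamma> Z (fmdom S) (fmdom T) f' g')"
    if "cuttable True \<gamma> Z S T" "Sim A S f f'" "Sim A T g g'" for S T f g f' g'
    using sim.cut[of A "prj False S" \<gamma> Z "fmdrop \<gamma> (prj True S)" f f' "fmdrop \<gamma> (prj False T)"
        "prj True T" g g'] cut_contexts[OF that(1)] that(2,3)
    unfolding Sim_def gcut_def by simp
  show ?thesis
  proof (cases s)
    case True then show ?thesis using * assms by simp
  next
    case False
    then show ?thesis
      using *[of T S g g' f f'] assms cuttable_flip[OF assms(1)] join_flip[OF assms(1)]
      by (simp add: gcut_def)
  qed
qed

text \<open>A logical rule of \<open>\<Sigma>\<Pi>\<close> with principal channel \<open>\<alpha>\<close> on side \<open>s\<close>: the (co)tupling over \<open>I\<close> if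
  \<open>\<kappa> = None\<close>, the projection or injection at \<open>k\<close> if \<open>\<kappa> = Some k\<close>.\<close>

definition node :: "bool \<Rightarrow> chan \<Rightarrow> name option \<Rightarrow> name fset \<Rightarrow> (name \<Rightarrow> ('o, 'm) der) \<Rightarrow> ('o, 'm) der" where
  "node s \<alpha> \<kappa> I f = (case \<kappa> of
     None \<Rightarrow> if s then Tuple \<alpha> (fam I f) else Cotuple \<alpha> (fam I f)
   | Some k \<Rightarrow> if s then Inj \<alpha> k (f k) else Proj \<alpha> k (f k))"

text \<open>Tuples on the right and projections on the left act on products, the other two rules on
  sums, so the connective records whether side and kind of rule agree. An equation
  \<open>principal s \<kappa> F = principal (\<not> s) \<kappa>' F\<close> then says that exactly
  one of the two rules is a (co)tupling, which is the situation of \<open>r11\<close> and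
  \<open>r12\<close>.\<close>

definition principal :: "bool \<Rightarrow> name option \<Rightarrow> (name, 'o form) fmap \<Rightarrow> 'o form" where
  "principal s \<kappa> F = (if s \<longleftrightarrow> \<kappa> = None then ProdF F else SumF F)"

text \<open>Indexes the premises. \<open>branches \<kappa> I |\<subseteq>| I\<close> is trivial for
  (co)tuplings and becomes the side condition \<open>k |\<in>| I\<close> for projections and
  injections, so one hypothesis serves all four rules.\<close>

definition branches :: "name option \<Rightarrow> name fset \<Rightarrow> name fset" where
  "branches \<kappa> I = (case \<kappa> of None \<Rightarrow> I | Some k \<Rightarrow> {|k|})"

lemma principal_simps [simp]:
  "principal s \<kappa> F \<noteq> Atom x" "Atom x \<noteq> principal s \<kappa> F"
  "principal s \<kappa> F = principal s' \<kappa>' F' \<longleftrightarrow> F = F' \<and> ((s \<longleftrightarrow> \<kappa> = None) \<longleftrightarrow> (s' \<longleftrightarrow> \<kappa>' = None))"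
  by (auto simp: principal_def)

lemma branches_simps [simp]: "branches None I = I" "branches (Some k) I = {|k|}"
  by (auto simp: branches_def)

lemma node_cong: "(\<And>i. i |\<in>| branches \<kappa> I \<Longrightarrow> f i = g i) \<Longrightarrow> node s \<alpha> \<kappa> I f = node s \<alpha> \<kappa> I g"
  by (cases \<kappa>) (auto simp: node_def fam_eq_iff)

lemma rename_node: "rename \<rho> (node s \<alpha> \<kappa> I f) = node s (\<rho> \<alpha>) \<kappa> I (\<lambda>i. rename \<rho> (f i))"
  by (cases \<kappa>) (auto simp: node_def)

lemma size_node: "i |\<in>| branches \<kappa> I \<Longrightarrow> size (f i) < size (node s \<alpha> \<kappa> I f)"
proof (cases \<kappa>)
  case None
  assume "i |\<in>| branches \<kappa> I"
  then have *: "(i, f i) |\<in>| fset_of_fmap (fam I f)" using None by simp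
  have "size (f i) \<le> (\<Sum>x\<in>fset (fset_of_fmap (fam I f)). Suc (case x of (a, b) \<Rightarrow> size b))"
    using member_le_sum[OF *, of "\<lambda>x. Suc (case x of (a, b) \<Rightarrow> size b)"] by simp
  then show ?thesis using None by (simp add: node_def)
qed (auto simp: node_def)

text \<open>Each combination of \<open>s\<close> and \<open>\<kappa>\<close> is one logical rule of
  \<open>derives\<close>: \<open>prj_eq\<close> isolates \<open>\<alpha>\<close> on its side, and
  \<open>prj_fmupd_other\<close> says that the other side is untouched.\<close>

lemma Der_node:
  assumes S: "fmlookup S \<alpha> = Some (s, principal s \<kappa> (fam I X))" and wf: "wfs A S"
    and sub: "branches \<kappa> I |\<subseteq>| I"
    and prem: "\<And>i. i |\<in>| branches \<kappa> I \<Longrightarrow> Der A (fmupd \<alpha> (s, X i) S) (f i)"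
  shows "Der A S (node s \<alpha> \<kappa> I f)"
proof -
  note eq = prj_eq[OF S] and wf' = wf[folded sequent_prj]
  show ?thesis
  proof (cases s)
    case True
    have pr: "derives A (prj False S) (fmupd \<alpha> (X i) (fmdrop \<alpha> (prj True S))) (f i)"
      if "i |\<in>| branches \<kappa> I" for i
      using prem[OF that] prj_fmupd_other[OF S, of False "X i"] True by (simp add: Der_def prj_fmupd)
    show ?thesis
    proof (cases \<kappa>)
      case None
      have "derives A (prj False S) (fmupd \<alpha> (ProdF (fam I X)) (fmdrop \<alpha> (prj True S))) (Tuple \<alpha> (fam I f))"
        using eq wf' pr True None by (intro derives.tuple) (auto simp: principal_def)
      then show ?thesis using eq True None by (simp add: Der_def node_def principal_def)
    next
      case (Some k)
      have "derives A (prj False S) (fmupd \<alpha> (SumF (fam I X)) (fmdrop \<alpha> (prj True S))) (Inj \<alpha> k (f k))"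
        using eq wf' pr True Some sub by (intro derives.inj) (auto simp: principal_def)
      then show ?thesis using eq True Some by (simp add: Der_def node_def principal_def)
    qed
  next
    case False
    have pr: "derives A (fmupd \<alpha> (X i) (fmdrop \<alpha> (prj False S))) (prj True S) (f i)"
      if "i |\<in>| branches \<kappa> I" for i
      using prem[OF that] prj_fmupd_other[OF S, of True "X i"] False by (simp add: Der_def prj_fmupd)
    show ?thesis
    proof (cases \<kappa>)
      case None
      have "derives A (fmupd \<alpha> (SumF (fam I X)) (fmdrop \<alpha> (prj False S))) (prj True S) (Cotuple \<alpha> (fam I f))"
        using eq wf' pr False None by (intro derives.cotuple) (auto simp: principal_def)
      then show ?thesis using eq False None by (simp add: Der_def node_def principal_def)
    next
      case (Some k)
      have "derives A (fmupd \<alpha> (ProdF (fam I X)) (fmdrop \<alpha> (prj False S))) (prj True S) (Proj \<alpha> k (f k))"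
        using eq wf' pr False Some sub by (intro derives.proj) (auto simp: principal_def)
      then show ?thesis using eq False Some by (simp add: Der_def node_def principal_def)
    qed
  qed
qed

lemma Sim_node:
  assumes S: "fmlookup S \<alpha> = Some (s, principal s \<kappa> (fam I X))" and wf: "wfs A S"
    and sub: "branches \<kappa> I |\<subseteq>| I"
    and prem: "\<And>i. i |\<in>| branches \<kappa> I \<Longrightarrow> Sim A (fmupd \<alpha> (s, X i) S) (f i) (g i)"
  shows "Sim A S (node s \<alpha> \<kappa> I f) (node s \<alpha> \<kappa> I g)"
proof -
  note eq = prj_eq[OF S] and wf' = wf[folded sequent_prj]
  show ?thesis
  proof (cases s)
    case True
    have pr: "sim A (prj False S) (fmupd \<alpha> (X i) (fmdrop \<alpha> (prj True S))) (f i) (g i)"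
      if "i |\<in>| branches \<kappa> I" for i
      using prem[OF that] prj_fmupd_other[OF S, of False "X i"] True by (simp add: Sim_def prj_fmupd)
    show ?thesis
    proof (cases \<kappa>)
      case None
      have "sim A (prj False S) (fmupd \<alpha> (ProdF (fam I X)) (fmdrop \<alpha> (prj True S)))
          (Tuple \<alpha> (fam I f)) (Tuple \<alpha> (fam I g))"
        using eq wf' pr True None by (intro sim.tuple) (auto simp: principal_def)
      then show ?thesis using eq True None by (simp add: Sim_def node_def principal_def)
    next
      case (Some k)
      have "sim A (prj False S) (fmupd \<alpha> (SumF (fam I X)) (fmdrop \<alpha> (prj True S)))
          (Inj \<alpha> k (f k)) (Inj \<alpha> k (g k))"
        using eq wf' pr True Some sub by (intro sim.inj) (auto simp: principal_def)
      then show ?thesis using eq True Some by (simp add: Sim_def node_def principal_def)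
    qed
  next
    case False
    have pr: "sim A (fmupd \<alpha> (X i) (fmdrop \<alpha> (prj False S))) (prj True S) (f i) (g i)"
      if "i |\<in>| branches \<kappa> I" for i
      using prem[OF that] prj_fmupd_other[OF S, of True "X i"] False by (simp add: Sim_def prj_fmupd)
    show ?thesis
    proof (cases \<kappa>)
      case None
      have "sim A (fmupd \<alpha> (SumF (fam I X)) (fmdrop \<alpha> (prj False S))) (prj True S)
          (Cotuple \<alpha> (fam I f)) (Cotuple \<alpha> (fam I g))"
        using eq wf' pr False None by (intro sim.cotuple) (auto simp: principal_def)
      then show ?thesis using eq False None by (simp add: Sim_def node_def principal_def)
    next
      case (Some k)
      have "sim A (fmupd \<alpha> (ProdF (fam I X)) (fmdrop \<alpha> (prj False S))) (prj True S)
          (Proj \<alpha> k (f k)) (Proj \<alpha> k (g k))"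
        using eq wf' pr False Some sub by (intro sim.proj) (auto simp: principal_def)
      then show ?thesis using eq False Some by (simp add: Sim_def node_def principal_def)
    qed
  qed
qed

lemma rewr_push:
  assumes "\<alpha> \<noteq> \<gamma>"
  shows "rewr A (gcut s \<gamma> Z K K' (node s' \<alpha> \<kappa> I f) g) (node s' \<alpha> \<kappa> I (\<lambda>i. gcut s \<gamma> Z K K' (f i) g))"
  using assms by (cases \<kappa>; cases s; cases s') (simp_all add: gcut_def node_def rewr.r3 rewr.r4 rewr.r5 rewr.r6
    rewr.r7 rewr.r8 rewr.r9 rewr.r10)

lemma rewr_principal:
  assumes "k |\<in>| I"
  shows "rewr A (gcut s \<gamma> (principal s (Some k) (fam I X)) K K' (node s \<gamma> (Some k) J f) (node (\<not> s) \<gamma> None I g))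
     (gcut s \<gamma> (X k) K K' (f k) (g k))"
  using assms rewr.r11[of k I A] rewr.r12[of k I A] by (cases s) (simp_all add: gcut_def node_def principal_def)

text \<open>A generating step of \<open>sim\<close> needs derivations of the same sequent at both
  ends. What has to be shown is that the pushed form derives the join, whose update at
  \<open>\<alpha>\<close> is the join of the updated context.\<close>

lemma Sim_push:
  assumes cut: "cuttable s \<gamma> Z S T"
    and S: "fmlookup S \<alpha> = Some (s', principal s' \<kappa> (fam I X))" and wf: "wfs A S" "wfs A T"
    and sub: "branches \<kappa> I |\<subseteq>| I" and "\<alpha> \<noteq> \<gamma>"
    and prem: "\<And>i. i |\<in>| branches \<kappa> I \<Longrightarrow> Der A (fmupd \<alpha> (s', X i) S) (f i)"
    and g: "Der A T g"
  shows "Sim A (join \<gamma> S T) (gcut s \<gamma> Z (fmdom S) (fmdom T) (node s' \<alpha> \<kappa> I f) g)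
     (node s' \<alpha> \<kappa> I (\<lambda>i. gcut s \<gamma> Z (fmdom S) (fmdom T) (f i) g))"
proof (rule Sim_rule)
  show "Der A (join \<gamma> S T) (gcut s \<gamma> Z (fmdom S) (fmdom T) (node s' \<alpha> \<kappa> I f) g)"
    by (intro Der_gcut Der_node) (use assms in auto)
  show "Der A (join \<gamma> S T) (node s' \<alpha> \<kappa> I (\<lambda>i. gcut s \<gamma> Z (fmdom S) (fmdom T) (f i) g))"
  proof (rule Der_node)
    show "fmlookup (join \<gamma> S T) \<alpha> = Some (s', principal s' \<kappa> (fam I X))"
      using fmlookup_join[OF cut] S \<open>\<alpha> \<noteq> \<gamma>\<close> by simp
    fix i assume "i |\<in>| branches \<kappa> I"
    then show "Der A (fmupd \<alpha> (s', X i) (join \<gamma> S T)) (gcut s \<gamma> Z (fmdom S) (fmdom T) (f i) g)"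
      using Der_gcut[OF cuttable_fmupd(1)[OF cut S \<open>\<alpha> \<noteq> \<gamma>\<close>] prem g]
      unfolding fmdom_fmupd_idle[OF S] cuttable_fmupd(2)[OF cut S \<open>\<alpha> \<noteq> \<gamma>\<close>] by blast
  qed (use wfs_join[OF cut wf] sub in auto)
qed (rule rewr_push, fact)

lemma Sim_principal:
  assumes cut: "cuttable s \<gamma> (principal s (Some k) (fam I X)) S T"
    and wf: "wfs A S" "wfs A T" and k: "k |\<in>| I"
    and f: "Der A (fmupd \<gamma> (s, X k) S) (f k)"
    and g: "\<And>i. i |\<in>| I \<Longrightarrow> Der A (fmupd \<gamma> (\<not> s, X i) T) (g i)"
  shows "Sim A (join \<gamma> S T)
     (gcut s \<gamma> (principal s (Some k) (fam I X)) (fmdom S) (fmdom T)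
        (node s \<gamma> (Some k) J f) (node (\<not> s) \<gamma> None I g))
     (gcut s \<gamma> (X k) (fmdom S) (fmdom T) (f k) (g k))"
proof (rule Sim_rule)
  have S: "fmlookup S \<gamma> = Some (s, principal s (Some k) (fam I X))"
    and T: "fmlookup T \<gamma> = Some (\<not> s, principal (\<not> s) None (fam I X))"
    using cut by (auto simp: cuttable_def principal_def)
  show "Der A (join \<gamma> S T) (gcut s \<gamma> (principal s (Some k) (fam I X)) (fmdom S) (fmdom T)
        (node s \<gamma> (Some k) J f) (node (\<not> s) \<gamma> None I g))"
  proof (intro Der_gcut cut)
    \<comment> \<open>The index set does not enter the term of a projection or injection, so the
      derivation found for \<open>I\<close> is the one written with \<open>J\<close>.\<close>
    have "Der A S (node s \<gamma> (Some k) I f)"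
      by (rule Der_node[OF S]) (use wf k f in auto)
    then show "Der A S (node s \<gamma> (Some k) J f)" by (simp add: node_def)
    show "Der A T (node (\<not> s) \<gamma> None I g)"
      by (rule Der_node[OF T]) (use wf g in auto)
  qed
  show "Der A (join \<gamma> S T) (gcut s \<gamma> (X k) (fmdom S) (fmdom T) (f k) (g k))"
    using Der_gcut[OF cuttable_principal(1)[OF cut] f g[OF k]]
    unfolding fmdom_fmupd_idle[OF S] fmdom_fmupd_idle[OF T] cuttable_principal(2)[OF cut] .
qed (rule rewr_principal, fact)

subsection \<open>Cut-free derivations\<close>

text \<open>Channels move together with their formulas, so the labelled family is unchanged.\<close>

lemma label_permute:
  assumes "distinct cs" "length cs = length Xs" "\<sigma> permutes {..<length Xs}"
  shows "label (permute_list \<sigma> cs) (permute_list \<sigma> Xs) = label cs Xs"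
proof (rule fmap_eqI)
  fix c X
  have d: "distinct (permute_list \<sigma> cs)" using assms by simp
  have "fmlookup (label (permute_list \<sigma> cs) (permute_list \<sigma> Xs)) c = Some X
    \<longleftrightarrow> (\<exists>i<length Xs. c = cs ! \<sigma> i \<and> X = Xs ! \<sigma> i)"
    using d assms by (auto simp: fmlookup_label permute_list_nth)
  also have "\<dots> \<longleftrightarrow> (\<exists>i<length Xs. c = cs ! i \<and> X = Xs ! i)"
  proof
    assume "\<exists>i<length Xs. c = cs ! \<sigma> i \<and> X = Xs ! \<sigma> i"
    then show "\<exists>i<length Xs. c = cs ! i \<and> X = Xs ! i"
      using permutes_in_image[OF assms(3)] by auto
  next
    assume "\<exists>i<length Xs. c = cs ! i \<and> X = Xs ! i"
    then obtain i where i: "i < length Xs" "c = cs ! i" "X = Xs ! i" by blast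
    have "inv \<sigma> i < length Xs" "\<sigma> (inv \<sigma> i) = i"
      using permutes_in_image[OF permutes_inv[OF assms(3)]] i permutes_inverses[OF assms(3)] by auto
    then show "\<exists>i<length Xs. c = cs ! \<sigma> i \<and> X = Xs ! \<sigma> i" using i by metis
  qed
  finally show "fmlookup (label (permute_list \<sigma> cs) (permute_list \<sigma> Xs)) c = Some X
    \<longleftrightarrow> fmlookup (label cs Xs) c = Some X"
    using assms by (simp add: fmlookup_label)
qed

definition axs :: "'o list \<Rightarrow> 'o list \<Rightarrow> chan list \<Rightarrow> chan list \<Rightarrow> 'o sctx" where
  "axs As Bs cs ds = signed (label cs (map Atom As)) (label ds (map Atom Bs))"

definition axiom :: "('o, 'm) polycat \<Rightarrow> 'o list \<Rightarrow> 'o list \<Rightarrow> 'm \<Rightarrow> chan list \<Rightarrow> chan list \<Rightarrow> bool" where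
  "axiom A As Bs f cs ds \<longleftrightarrow> f \<in> Hom A As Bs \<and> length cs = length As \<and> length ds = length Bs
     \<and> distinct (cs @ ds)"

text \<open>The sequent is an index because a term with nullary (co)tuples does not determine it. In
  \<open>cf_ax\<close> the context is tied by an equation, so that the rule also applies to a
  \<open>join\<close> that is only provably of the form \<open>axs\<close>.\<close>

inductive cut_free :: "('o, 'm) polycat \<Rightarrow> 'o sctx \<Rightarrow> ('o, 'm) der \<Rightarrow> bool"
  for A :: "('o, 'm) polycat" where
  cf_ax: "\<lbrakk>axiom A As Bs f cs ds; S = axs As Bs cs ds\<rbrakk> \<Longrightarrow> cut_free A S (Ax As Bs f cs ds)"
| cf_node: "\<lbrakk>fmlookup S \<alpha> = Some (s, principal s \<kappa> (fam I X)); wfs A S; branches \<kappa> I |\<subseteq>| I;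
      \<And>i. i |\<in>| branches \<kappa> I \<Longrightarrow> cut_free A (fmupd \<alpha> (s, X i) S) (f i)\<rbrakk>
    \<Longrightarrow> cut_free A S (node s \<alpha> \<kappa> I f)"

lemma label_disj:
  assumes "distinct (cs @ ds)" "length cs = length Xs" "length ds = length Ys"
  shows "fmdom (label cs Xs) |\<inter>| fmdom (label ds Ys) = {||}"
  using assms by (auto simp: fset_eq_iff fset_of_list_elem)

lemma fmlookup_axs:
  assumes "axiom A As Bs f cs ds"
  shows "fmlookup (axs As Bs cs ds) c = Some (s, X) \<longleftrightarrow>
    (\<exists>x. X = Atom x \<and> (c, x) \<in> set (zip (if s then ds else cs) (if s then Bs else As)))"
proof -
  have d: "distinct cs" "distinct ds" using assms by (auto simp: axiom_def)
  have "fmdom (label cs (map Atom As)) |\<inter>| fmdom (label ds (map Atom Bs)) = {||}"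
    by (rule label_disj) (use assms in \<open>auto simp: axiom_def\<close>)
  from fmlookup_signed[OF this] show ?thesis
    using assms d unfolding axs_def by (auto simp: axiom_def fmlookup_label in_set_zip)
qed

lemma fmdom_axs: "axiom A As Bs f cs ds \<Longrightarrow> fmdom (axs As Bs cs ds) = fset_of_list (cs @ ds)"
  by (simp add: axiom_def axs_def signed_def)

lemma prj_axs:
  assumes "axiom A As Bs f cs ds"
  shows "prj False (axs As Bs cs ds) = label cs (map Atom As)"
    "prj True (axs As Bs cs ds) = label ds (map Atom Bs)"
  using prj_signed[OF label_disj, of cs ds "map Atom As" "map Atom Bs"] assms
  by (simp_all add: axiom_def axs_def)

lemma Der_ax: "axiom A As Bs f cs ds \<Longrightarrow> Der A (axs As Bs cs ds) (Ax As Bs f cs ds)"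
  unfolding Der_def by (simp add: prj_axs) (auto simp: axiom_def intro: derives.ax)

lemma axs_atom: "axiom A As Bs f cs ds \<Longrightarrow> fmlookup (axs As Bs cs ds) c = Some (s, X) \<Longrightarrow> \<exists>x. X = Atom x"
  by (auto simp: fmlookup_axs split: if_splits)

lemma axs_side:
  assumes "axiom A As Bs f cs ds" "fmlookup (axs As Bs cs ds) c = Some (s, X)"
  shows "s \<longleftrightarrow> c \<in> set ds" "\<not> s \<longleftrightarrow> c \<in> set cs"
  using assms(2) assms(1) unfolding fmlookup_axs[OF assms(1)]
  by (auto simp: axiom_def dest: set_zip_leftD split: if_splits)

lemma cut_free_Der: "cut_free A S t \<Longrightarrow> Der A S t"
  by (induction rule: cut_free.induct) (auto intro: Der_ax Der_node)

text \<open>No cut binds a channel here, and the premises of a node have the channels of its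
  conclusion, so a renaming acts through its values on \<open>S\<close> alone. For terms with cuts
  this can fail, and it is recovered up to \<open>Sim\<close> by cut elimination.\<close>

lemma cut_free_rename:
  assumes "cut_free A S t" "\<And>c. c |\<in>| fmdom S \<Longrightarrow> \<rho> c = \<sigma> c"
  shows "rename \<rho> t = rename \<sigma> t"
  using assms
proof induction
  case (cf_ax As Bs f cs ds S)
  then show ?case by (simp add: fmdom_axs fset_of_list_elem)
next
  case (cf_node S \<alpha> s \<kappa> I X f)
  have "rename \<rho> (f i) = rename \<sigma> (f i)" if "i |\<in>| branches \<kappa> I" for i
    using cf_node(5)[OF that] cf_node(6) fmdom_fmupd_idle[OF cf_node(1)] by metis
  then show ?case
    using cf_node(6)[of \<alpha>] fmdomI[OF cf_node(1)] by (simp add: rename_node) (rule node_cong)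
qed

context polycategory
begin

lemma wfs_axs:
  assumes "axiom P As Bs f cs ds" shows "wfs P (axs As Bs cs ds)"
  unfolding wfs_def
proof (intro allI impI)
  fix c s X assume *: "fmlookup (axs As Bs cs ds) c = Some (s, X)"
  have "set As \<union> set Bs \<subseteq> Ob P" using assms Hom_Ob unfolding axiom_def by blast
  then show "X \<in> formulas P"
    using * by (auto simp: fmlookup_axs[OF assms] formulas_def dest: set_zip_rightD split: if_splits)
qed

lemma cut_free_wfs: "cut_free P S t \<Longrightarrow> wfs P S"
  by (erule cut_free.cases) (auto simp: wfs_axs)

lemma derives_sequent: "derives P \<Gamma> \<Delta> t \<Longrightarrow> sequent P \<Gamma> \<Delta>"
proof (induction rule: derives.induct)
  case (ax f As Bs cs ds)
  then have *: "axiom P As Bs f cs ds" by (simp add: axiom_def)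
  show ?case using sequent_prj[of P "axs As Bs cs ds"] wfs_axs[OF *] by (simp add: prj_axs[OF *])
next
  case (cut \<Gamma> \<gamma> Z \<Delta> f \<Gamma>' \<Delta>' g)
  have *: "X \<in> formulas P" if "fmlookup \<Gamma> c = Some X \<or> fmlookup \<Delta> c = Some X
      \<or> fmlookup \<Gamma>' c = Some X \<or> fmlookup \<Delta>' c = Some X" for c X
  proof -
    \<comment> \<open>By freshness of \<open>\<gamma>\<close>, a formula of the conclusion survives
      the update at \<open>\<gamma>\<close> and so occurs in one of the premises.\<close>
    have "c \<noteq> \<gamma>" using that cut.hyps fmdomI by fastforce
    then have "X \<in> fmran' \<Gamma> \<or> X \<in> fmran' (fmupd \<gamma> Z \<Delta>) \<or> X \<in> fmran' (fmupd \<gamma> Z \<Gamma>') \<or> X \<in> fmran' \<Delta>'"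
      using that unfolding fmlookup_ran'_iff by auto
    then show ?thesis using cut.IH unfolding sequent_def by blast
  qed
  have "fmran' (\<Gamma> ++\<^sub>f \<Gamma>') \<union> fmran' (\<Delta> ++\<^sub>f \<Delta>') \<subseteq> formulas P"
    using * by (auto simp: fmlookup_ran'_iff subset_iff split: if_splits)
  moreover have "fmdom (\<Gamma> ++\<^sub>f \<Gamma>') |\<inter>| fmdom (\<Delta> ++\<^sub>f \<Delta>') = {||}"
    using cut unfolding sequent_def by (auto simp: fset_eq_iff)
  ultimately show ?case by (simp add: sequent_def)
qed auto

lemma Der_wfs: "Der P S t \<Longrightarrow> wfs P S"
  using derives_sequent sequent_prj unfolding Der_def by blast

text \<open>Lists with the same elements differ by a permutation, and \<open>ax_perm\<close>
  transports the polymorphism along it without changing the labelled sequent. This brings cut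
  channels to the ends of their lists, where planarity holds.\<close>

lemma ax_reorder:
  assumes ax: "axiom P As Bs f cs ds" and "mset cs' = mset cs" "mset ds' = mset ds"
  obtains As' Bs' f' where "axiom P As' Bs' f' cs' ds'" "axs As' Bs' cs' ds' = axs As Bs cs ds"
    "Sim P (axs As Bs cs ds) (Ax As Bs f cs ds) (Ax As' Bs' f' cs' ds')"
proof -
  obtain \<sigma> where \<sigma>: "\<sigma> permutes {..<length cs}" "permute_list \<sigma> cs = cs'"
    using mset_eq_permutation assms(2) by metis
  obtain \<tau> where \<tau>: "\<tau> permutes {..<length ds}" "permute_list \<tau> ds = ds'"
    using mset_eq_permutation assms(3) by metis
  let ?As = "permute_list \<sigma> As" and ?Bs = "permute_list \<tau> Bs" and ?f = "act P As Bs \<sigma> \<tau> f"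
  have 1: "axiom P ?As ?Bs ?f cs' ds'"
    using ax \<sigma> \<tau> assms(2,3) act_Hom[of f As Bs \<sigma> \<tau>] unfolding axiom_def
    by (auto simp flip: set_mset_mset)
  have 2: "axs ?As ?Bs cs' ds' = axs As Bs cs ds"
    using ax \<sigma> \<tau> label_permute[of cs "map Atom As" \<sigma>] label_permute[of ds "map Atom Bs" \<tau>]
    unfolding axs_def axiom_def by (simp add: permute_list_map)
  have "rewr P (Ax As Bs f cs ds) (Ax ?As ?Bs ?f cs' ds')"
    using rewr.ax_perm[of \<sigma> As \<tau> Bs P f cs ds] ax \<sigma> \<tau> by (simp add: axiom_def)
  then show ?thesis
    using that[OF 1 2] Der_ax[OF ax] Der_ax[OF 1] Sim_rule unfolding 2 by blast
qed

text \<open>Substituting the channel lists in the same way as the object lists makes the context of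
  the polymorphism composed in \<open>P\<close> equal to the join, so \<open>rewr.ax_cut\<close>
  becomes an instance of \<open>Sim\<close>.\<close>

lemma ax_cut:
  assumes f: "axiom P \<Gamma> (\<Delta>1 @ x # \<Delta>2) f cs (ds1 @ \<gamma> # ds2)"
    and g: "axiom P (\<Gamma>1 @ x # \<Gamma>2) \<Delta> g (cs1 @ \<gamma> # cs2) ds"
    and len: "length ds1 = length \<Delta>1" "length ds2 = length \<Delta>2" "length cs1 = length \<Gamma>1" "length cs2 = length \<Gamma>2"
    and planar: "planar \<Gamma>1 \<Gamma>2 \<Delta>1 \<Delta>2"
    and S: "S = axs \<Gamma> (\<Delta>1 @ x # \<Delta>2) cs (ds1 @ \<gamma> # ds2)" and T: "T = axs (\<Gamma>1 @ x # \<Gamma>2) \<Delta> (cs1 @ \<gamma> # cs2) ds"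
    and cut: "cuttable True \<gamma> (Atom x) S T"
  defines "h \<equiv> polycat.cut P \<Gamma> \<Delta>1 x \<Delta>2 \<Gamma>1 \<Gamma>2 \<Delta> f g"
  shows "axiom P (\<Gamma>1 @ \<Gamma> @ \<Gamma>2) (\<Delta>1 @ \<Delta> @ \<Delta>2) h (cs1 @ cs @ cs2) (ds1 @ ds @ ds2)"
    "axs (\<Gamma>1 @ \<Gamma> @ \<Gamma>2) (\<Delta>1 @ \<Delta> @ \<Delta>2) (cs1 @ cs @ cs2) (ds1 @ ds @ ds2) = join \<gamma> S T"
    "Sim P (join \<gamma> S T)
      (gcut True \<gamma> (Atom x) (fmdom S) (fmdom T) (Ax \<Gamma> (\<Delta>1 @ x # \<Delta>2) f cs (ds1 @ \<gamma> # ds2))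
        (Ax (\<Gamma>1 @ x # \<Gamma>2) \<Delta> g (cs1 @ \<gamma> # cs2) ds))
      (Ax (\<Gamma>1 @ \<Gamma> @ \<Gamma>2) (\<Delta>1 @ \<Delta> @ \<Delta>2) h (cs1 @ cs @ cs2) (ds1 @ ds @ ds2))"
proof -
  have doms: "fset_of_list (cs @ ds1 @ \<gamma> # ds2) |\<inter>| fset_of_list ((cs1 @ \<gamma> # cs2) @ ds) = {|\<gamma>|}"
    using cut fmdom_axs[OF f] fmdom_axs[OF g] unfolding cuttable_def S T by simp
  have disj: "set (cs @ ds1 @ ds2) \<inter> set (cs1 @ cs2 @ ds) = {}"
  proof -
    have "c = \<gamma>" if "c \<in> set (cs @ ds1 @ ds2)" "c \<in> set (cs1 @ cs2 @ ds)" for c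
      using arg_cong[OF doms, of "\<lambda>F. c |\<in>| F"] that by (auto simp: fset_of_list_elem)
    then show ?thesis using f g unfolding axiom_def by auto
  qed
  show ax: "axiom P (\<Gamma>1 @ \<Gamma> @ \<Gamma>2) (\<Delta>1 @ \<Delta> @ \<Delta>2) h (cs1 @ cs @ cs2) (ds1 @ ds @ ds2)"
    unfolding axiom_def h_def using f g len planar disj cut_Hom by (auto simp: axiom_def)
  show eq: "axs (\<Gamma>1 @ \<Gamma> @ \<Gamma>2) (\<Delta>1 @ \<Delta> @ \<Delta>2) (cs1 @ cs @ cs2) (ds1 @ ds @ ds2) = join \<gamma> S T"
  proof (rule fmap_eqI)
    fix c :: chan and v :: "bool \<times> 'o form"
    obtain s X where v: "v = (s, X)" by (cases v)
    have "\<gamma> \<notin> set (cs @ ds1 @ ds2 @ cs1 @ cs2 @ ds)" using f g by (auto simp: axiom_def)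
    \<comment> \<open>\<open>\<gamma>\<close> labels only the two cut positions, so no other
      position is lost when the join forgets \<open>\<gamma>\<close>.\<close>
    then have *: "(\<gamma>, y) \<notin> set (zip ds1 \<Delta>1)" "(\<gamma>, y) \<notin> set (zip ds2 \<Delta>2)" "(\<gamma>, y) \<notin> set (zip cs \<Gamma>)"
        "(\<gamma>, y) \<notin> set (zip cs1 \<Gamma>1)" "(\<gamma>, y) \<notin> set (zip cs2 \<Gamma>2)" "(\<gamma>, y) \<notin> set (zip ds \<Delta>)" for y
      by (auto dest: set_zip_leftD)
    have "fmlookup (join \<gamma> S T) c = Some v \<longleftrightarrow> c \<noteq> \<gamma> \<and> (fmlookup S c = Some (s, X) \<or> fmlookup T c = Some (s, X))"
      using fmlookup_join[OF cut] v by simp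
    also have "\<dots> \<longleftrightarrow> fmlookup (axs (\<Gamma>1 @ \<Gamma> @ \<Gamma>2) (\<Delta>1 @ \<Delta> @ \<Delta>2) (cs1 @ cs @ cs2) (ds1 @ ds @ ds2)) c = Some (s, X)"
      unfolding S T fmlookup_axs[OF f] fmlookup_axs[OF g] fmlookup_axs[OF ax]
      using len f g * by (cases s) (auto simp: axiom_def)
    finally show "fmlookup (axs (\<Gamma>1 @ \<Gamma> @ \<Gamma>2) (\<Delta>1 @ \<Delta> @ \<Delta>2) (cs1 @ cs @ cs2) (ds1 @ ds @ ds2)) c = Some v
        \<longleftrightarrow> fmlookup (join \<gamma> S T) c = Some v" using v by simp
  qed
  show "Sim P (join \<gamma> S T)
      (gcut True \<gamma> (Atom x) (fmdom S) (fmdom T) (Ax \<Gamma> (\<Delta>1 @ x # \<Delta>2) f cs (ds1 @ \<gamma> # ds2))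
        (Ax (\<Gamma>1 @ x # \<Gamma>2) \<Delta> g (cs1 @ \<gamma> # cs2) ds))
      (Ax (\<Gamma>1 @ \<Gamma> @ \<Gamma>2) (\<Delta>1 @ \<Delta> @ \<Delta>2) h (cs1 @ cs @ cs2) (ds1 @ ds @ ds2))"
  proof (rule Sim_rule)
    show "Der P (join \<gamma> S T)
      (gcut True \<gamma> (Atom x) (fmdom S) (fmdom T) (Ax \<Gamma> (\<Delta>1 @ x # \<Delta>2) f cs (ds1 @ \<gamma> # ds2))
        (Ax (\<Gamma>1 @ x # \<Gamma>2) \<Delta> g (cs1 @ \<gamma> # cs2) ds))"
      using Der_gcut[OF cut] Der_ax[OF f] Der_ax[OF g] S T by blast
    show "Der P (join \<gamma> S T) (Ax (\<Gamma>1 @ \<Gamma> @ \<Gamma>2) (\<Delta>1 @ \<Delta> @ \<Delta>2) h (cs1 @ cs @ cs2) (ds1 @ ds @ ds2))"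
      using Der_ax[OF ax] eq by simp
  qed (use rewr.ax_cut[OF planar len] in \<open>simp add: gcut_def h_def\<close>)
qed

end

subsection \<open>Cut elimination\<close>

context polycategory
begin

text \<open>Chooses cut-free equivalents for all branches simultaneously and applies the congruence
  of \<open>Sim\<close> for the rule.\<close>

lemma cut_free_node:
  assumes S: "fmlookup S \<alpha> = Some (s, principal s \<kappa> (fam I X))" and wf: "wfs P S"
    and sub: "branches \<kappa> I |\<subseteq>| I"
    and ex: "\<And>i. i |\<in>| branches \<kappa> I \<Longrightarrow>
      \<exists>u. cut_free P (fmupd \<alpha> (s, X i) S) u \<and> Sim P (fmupd \<alpha> (s, X i) S) (f i) u"
  shows "\<exists>u. cut_free P S u \<and> Sim P S (node s \<alpha> \<kappa> I f) u"
proof -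
  obtain u where u: "\<And>i. i |\<in>| branches \<kappa> I \<Longrightarrow> cut_free P (fmupd \<alpha> (s, X i) S) (u i)"
      "\<And>i. i |\<in>| branches \<kappa> I \<Longrightarrow> Sim P (fmupd \<alpha> (s, X i) S) (f i) (u i)"
    using ex by metis
  show ?thesis using cf_node[OF S wf sub u(1)] Sim_node[OF S wf sub u(2)] by blast
qed

lemma push_cut_free:
  assumes cut: "cuttable s \<gamma> Z S T"
    and S: "fmlookup S \<alpha> = Some (s', principal s' \<kappa> (fam I X))" and wf: "wfs P S" "wfs P T"
    and sub: "branches \<kappa> I |\<subseteq>| I" and ne: "\<alpha> \<noteq> \<gamma>"
    and prem: "\<And>i. i |\<in>| branches \<kappa> I \<Longrightarrow> Der P (fmupd \<alpha> (s', X i) S) (f i)"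
    and g: "Der P T g"
    and IH: "\<And>i. i |\<in>| branches \<kappa> I \<Longrightarrow> \<exists>u. cut_free P (join \<gamma> (fmupd \<alpha> (s', X i) S) T) u
      \<and> Sim P (join \<gamma> (fmupd \<alpha> (s', X i) S) T)
          (gcut s \<gamma> Z (fmdom (fmupd \<alpha> (s', X i) S)) (fmdom T) (f i) g) u"
  shows "\<exists>u. cut_free P (join \<gamma> S T) u
    \<and> Sim P (join \<gamma> S T) (gcut s \<gamma> Z (fmdom S) (fmdom T) (node s' \<alpha> \<kappa> I f) g) u"
proof -
  note upd = cuttable_fmupd(2)[OF cut S ne]
  have j: "fmlookup (join \<gamma> S T) \<alpha> = Some (s', principal s' \<kappa> (fam I X))"
    using fmlookup_join[OF cut] S ne by simp
  have "\<exists>u. cut_free P (join \<gamma> S T) u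
      \<and> Sim P (join \<gamma> S T) (node s' \<alpha> \<kappa> I (\<lambda>i. gcut s \<gamma> Z (fmdom S) (fmdom T) (f i) g)) u"
    using IH unfolding fmdom_fmupd_idle[OF S] upd by (rule cut_free_node[OF j wfs_join[OF cut wf] sub])
  then show ?thesis
    using Sim_push[OF cut S wf sub ne prem g] Sim_trans by blast
qed

text \<open>\<open>Sim_principal\<close> has the projection or injection in its first argument. If
  it is in the second one, the cut is read in the opposite orientation; \<open>k\<close> is the
  chosen index in both cases.\<close>

lemma Sim_principal_cases:
  assumes cut: "cuttable s \<gamma> (principal s \<kappa> (fam I X)) S T" and dual: "(\<kappa> = None) \<noteq> (\<kappa>' = None)"
    and wf: "wfs P S" "wfs P T" and k: "k |\<in>| I" "k |\<in>| branches \<kappa> I" "k |\<in>| branches \<kappa>' I"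
    and f: "\<And>i. i |\<in>| branches \<kappa> I \<Longrightarrow> Der P (fmupd \<gamma> (s, X i) S) (f i)"
    and g: "\<And>i. i |\<in>| branches \<kappa>' I \<Longrightarrow> Der P (fmupd \<gamma> (\<not> s, X i) T) (g i)"
  shows "Sim P (join \<gamma> S T)
     (gcut s \<gamma> (principal s \<kappa> (fam I X)) (fmdom S) (fmdom T) (node s \<gamma> \<kappa> I f) (node (\<not> s) \<gamma> \<kappa>' I g))
     (gcut s \<gamma> (X k) (fmdom S) (fmdom T) (f k) (g k))"
proof (cases \<kappa>)
  case None
  then have \<kappa>': "\<kappa>' = Some k" using dual k by auto
  have pr: "principal s \<kappa> (fam I X) = principal (\<not> s) (Some k) (fam I X)"
    using None by simp
  have cut': "cuttable (\<not> s) \<gamma> (principal (\<not> s) (Some k) (fam I X)) T S"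
    using cuttable_flip[OF cut] unfolding pr .
  have "Sim P (join \<gamma> T S)
     (gcut (\<not> s) \<gamma> (principal s \<kappa> (fam I X)) (fmdom T) (fmdom S) (node (\<not> s) \<gamma> (Some k) I g) (node (\<not> \<not> s) \<gamma> None I f))
     (gcut (\<not> s) \<gamma> (X k) (fmdom T) (fmdom S) (g k) (f k))"
    unfolding pr by (rule Sim_principal[OF cut']) (use wf k f g None \<kappa>' in auto)
  then show ?thesis
    using None \<kappa>' join_flip[OF cut] by (cases s) (simp_all add: gcut_def)
next
  case (Some l)
  then have "l = k" "\<kappa>' = None" using dual k by auto
  then show ?thesis using Sim_principal[of s \<gamma> k I X S T P f g I] cut wf k f g Some by simp
qed

text \<open>Contexts, cut formula and side are generalized: a premise changes the context, a
  matching pair replaces the cut formula by a component, and a rule of \<open>g\<close> is treated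
  with the cut flipped. Rules away from \<open>\<gamma>\<close> are pushed out first, so a matching
  pair is met only when both terms end with a rule at \<open>\<gamma>\<close>.\<close>

lemma cut_cut_free:
  assumes "cut_free P S f" "cut_free P T g" "cuttable s \<gamma> Z S T"
  shows "\<exists>u. cut_free P (join \<gamma> S T) u \<and> Sim P (join \<gamma> S T) (gcut s \<gamma> Z (fmdom S) (fmdom T) f g) u"
  using assms
proof (induction "size f + size g" arbitrary: s \<gamma> Z S T f g rule: less_induct)
  case less
  note cut = less.prems(3)
  have wf: "wfs P S" "wfs P T" and Der: "Der P S f" "Der P T g"
    using less.prems cut_free_wfs cut_free_Der by auto
  from less.prems(1) consider (ax) As Bs a cs ds where "f = Ax As Bs a cs ds" "axiom P As Bs a cs ds" "S = axs As Bs cs ds"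
    | (node) \<alpha> s' \<kappa> I X f' where "f = node s' \<alpha> \<kappa> I f'" "fmlookup S \<alpha> = Some (s', principal s' \<kappa> (fam I X))"
        "branches \<kappa> I |\<subseteq>| I" "\<And>i. i |\<in>| branches \<kappa> I \<Longrightarrow> cut_free P (fmupd \<alpha> (s', X i) S) (f' i)"
    by cases metis+
  note f_cases = this
  from less.prems(2) consider (ax) As Bs a cs ds where "g = Ax As Bs a cs ds" "axiom P As Bs a cs ds" "T = axs As Bs cs ds"
    | (node) \<alpha> s' \<kappa> I X f' where "g = node s' \<alpha> \<kappa> I f'" "fmlookup T \<alpha> = Some (s', principal s' \<kappa> (fam I X))"
        "branches \<kappa> I |\<subseteq>| I" "\<And>i. i |\<in>| branches \<kappa> I \<Longrightarrow> cut_free P (fmupd \<alpha> (s', X i) T) (f' i)"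
    by cases metis+
  note g_cases = this
  have left: ?case if f: "f = node s' \<alpha> \<kappa> I f'" and S: "fmlookup S \<alpha> = Some (s', principal s' \<kappa> (fam I X))"
      and sub: "branches \<kappa> I |\<subseteq>| I" and prem: "\<And>i. i |\<in>| branches \<kappa> I \<Longrightarrow> cut_free P (fmupd \<alpha> (s', X i) S) (f' i)"
      and ne: "\<alpha> \<noteq> \<gamma>" for s' \<alpha> \<kappa> I X f'
    unfolding f
  proof (rule push_cut_free[OF cut S wf sub ne _ Der(2)])
    fix i assume i: "i |\<in>| branches \<kappa> I"
    show "Der P (fmupd \<alpha> (s', X i) S) (f' i)" using prem[OF i] cut_free_Der by blast
    show "\<exists>u. cut_free P (join \<gamma> (fmupd \<alpha> (s', X i) S) T) u
      \<and> Sim P (join \<gamma> (fmupd \<alpha> (s', X i) S) T)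
          (gcut s \<gamma> Z (fmdom (fmupd \<alpha> (s', X i) S)) (fmdom T) (f' i) g) u"
      by (rule less.hyps) (use size_node[OF i] f prem[OF i] less.prems(2) cuttable_fmupd(1)[OF cut S ne] in auto)
  qed
  \<comment> \<open>The mirror image of \<open>left\<close>, with the cut read from the side of
    \<open>g\<close>.\<close>
  have right: ?case if g: "g = node s' \<alpha> \<kappa> I f'" and S: "fmlookup T \<alpha> = Some (s', principal s' \<kappa> (fam I X))"
      and sub: "branches \<kappa> I |\<subseteq>| I" and prem: "\<And>i. i |\<in>| branches \<kappa> I \<Longrightarrow> cut_free P (fmupd \<alpha> (s', X i) T) (f' i)"
      and ne: "\<alpha> \<noteq> \<gamma>" for s' \<alpha> \<kappa> I X f'
    unfolding g gcut_flip[of s] join_flip[OF cut]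
  proof (rule push_cut_free[OF cuttable_flip[OF cut] S wf(2,1) sub ne _ Der(1)])
    fix i assume i: "i |\<in>| branches \<kappa> I"
    show "Der P (fmupd \<alpha> (s', X i) T) (f' i)" using prem[OF i] cut_free_Der by blast
    show "\<exists>u. cut_free P (join \<gamma> (fmupd \<alpha> (s', X i) T) S) u
      \<and> Sim P (join \<gamma> (fmupd \<alpha> (s', X i) T) S)
          (gcut (\<not> s) \<gamma> Z (fmdom (fmupd \<alpha> (s', X i) T)) (fmdom S) (f' i) f) u"
      by (rule less.hyps) (use size_node[OF i] g prem[OF i] less.prems(1)
          cuttable_fmupd(1)[OF cuttable_flip[OF cut] S ne] in auto)
  qed
  have S\<gamma>: "fmlookup S \<gamma> = Some (s, Z)" and T\<gamma>: "fmlookup T \<gamma> = Some (\<not> s, Z)"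
    using cut by (auto simp: cuttable_def)
  from f_cases show ?case
  proof cases
    case f: ax
    obtain x where x: "Z = Atom x" using axs_atom[OF f(2)] S\<gamma> f(3) by blast
    from g_cases show ?thesis
    proof cases
      case g: ax
      have *: "\<exists>u. cut_free P (join \<gamma> S T) u \<and> Sim P (join \<gamma> S T) (gcut True \<gamma> Z (fmdom S) (fmdom T) f g) u"
        if cut: "cuttable True \<gamma> Z S T" and f: "f = Ax As Bs a cs ds" "axiom P As Bs a cs ds" "S = axs As Bs cs ds"
          and g: "g = Ax As' Bs' b cs' ds'" "axiom P As' Bs' b cs' ds'" "T = axs As' Bs' cs' ds'"
        for S T f g As Bs a cs ds As' Bs' b cs' ds'
      proof -
        have "\<gamma> \<in> set ds" "\<gamma> \<in> set cs'"
          using axs_side(1)[OF f(2), of \<gamma> True Z] axs_side(2)[OF g(2), of \<gamma> False Z] f(3) g(3) cut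
          by (auto simp: cuttable_def)
        \<comment> \<open>With \<open>\<gamma>\<close> last in the codomain of \<open>f\<close> and
          first in the domain of \<open>g\<close>, nothing follows it in the one list and nothing
          precedes it in the other, which satisfies planarity.\<close>
        then have "mset (remove1 \<gamma> ds @ [\<gamma>]) = mset ds" "mset ([\<gamma>] @ remove1 \<gamma> cs') = mset cs'"
          by auto
        obtain As1 Bs1 f1 where f1: "axiom P As1 Bs1 f1 cs (remove1 \<gamma> ds @ [\<gamma>])" "axs As1 Bs1 cs (remove1 \<gamma> ds @ [\<gamma>]) = S"
            "Sim P S f (Ax As1 Bs1 f1 cs (remove1 \<gamma> ds @ [\<gamma>]))"
          using ax_reorder[OF f(2) HOL.refl \<open>mset (remove1 \<gamma> ds @ [\<gamma>]) = mset ds\<close>] f by metis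
        obtain As2 Bs2 g2 where g2: "axiom P As2 Bs2 g2 ([\<gamma>] @ remove1 \<gamma> cs') ds'" "axs As2 Bs2 ([\<gamma>] @ remove1 \<gamma> cs') ds' = T"
            "Sim P T g (Ax As2 Bs2 g2 ([\<gamma>] @ remove1 \<gamma> cs') ds')"
          using ax_reorder[OF g(2) \<open>mset ([\<gamma>] @ remove1 \<gamma> cs') = mset cs'\<close> HOL.refl] g by metis
        obtain B x where B: "Bs1 = B @ [x]" using f1(1) by (cases Bs1 rule: rev_cases) (auto simp: axiom_def)
        obtain C y where C: "As2 = y # C" using g2(1) by (cases As2) (auto simp: axiom_def)
        have len: "length (remove1 \<gamma> ds) = length B" "length (remove1 \<gamma> cs') = length C"
          using f1(1) g2(1) unfolding B C axiom_def by auto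
        have Zx: "Z = Atom x"
          using cut fmlookup_axs[OF f1(1), of \<gamma> True Z] f1(1) unfolding f1(2) cuttable_def
          by (auto simp: axiom_def B len dest: set_zip_leftD)
        have Zy: "Z = Atom y"
          using cut fmlookup_axs[OF g2(1), of \<gamma> False Z] g2(1) unfolding g2(2) cuttable_def
          by (auto simp: axiom_def C len dest: set_zip_leftD)
        have xy: "y = x" using Zx Zy by simp
        note ac = ax_cut[of As1 B x "[]" f1 cs "remove1 \<gamma> ds" \<gamma> "[]" "[]" C Bs2 g2 "[]" "remove1 \<gamma> cs'" ds' S T]
        have hyps: "axiom P As1 (B @ [x]) f1 cs (remove1 \<gamma> ds @ [\<gamma>])" "axiom P (x # C) Bs2 g2 (\<gamma> # remove1 \<gamma> cs') ds'"
           "S = axs As1 (B @ [x]) cs (remove1 \<gamma> ds @ [\<gamma>])" "T = axs (x # C) Bs2 (\<gamma> # remove1 \<gamma> cs') ds'"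
          using f1 g2 B C xy by auto
        let ?u = "Ax (As1 @ C) (B @ Bs2) (polycat.cut P As1 B x [] [] C Bs2 f1 g2) (cs @ remove1 \<gamma> cs') (remove1 \<gamma> ds @ ds')"
        have "cut_free P (join \<gamma> S T) ?u"
          using ac(1,2) hyps len cut Zx by (intro cf_ax) (auto simp: planar_def)
        moreover have "Sim P (join \<gamma> S T) (gcut True \<gamma> Z (fmdom S) (fmdom T)
            (Ax As1 (B @ [x]) f1 cs (remove1 \<gamma> ds @ [\<gamma>])) (Ax (x # C) Bs2 g2 (\<gamma> # remove1 \<gamma> cs') ds')) ?u"
          using ac(3) hyps len cut Zx by (auto simp: planar_def)
        moreover have "Sim P (join \<gamma> S T) (gcut True \<gamma> Z (fmdom S) (fmdom T) f g)
            (gcut True \<gamma> Z (fmdom S) (fmdom T)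
            (Ax As1 (B @ [x]) f1 cs (remove1 \<gamma> ds @ [\<gamma>])) (Ax (x # C) Bs2 g2 (\<gamma> # remove1 \<gamma> cs') ds'))"
          using Sim_gcut[OF cut f1(3) g2(3)] B C xy by simp
        ultimately show ?thesis using Sim_trans by blast
      qed
      show ?thesis
      proof (cases s)
        case True
        then have s: "s = True" by simp
        show ?thesis using *[OF _ f g] cut unfolding s by blast
      next
        case False
        then have s: "s = False" by simp
        have "cuttable True \<gamma> Z T S" using cuttable_flip[OF cut] unfolding s by simp
        from *[OF this g f] show ?thesis
          unfolding join_flip[OF cut] gcut_flip[of s] unfolding s by (simp only: not_False_eq_True)
      qed
    next
      case (node \<alpha> s' \<kappa> I X g')
      \<comment> \<open>The cut formula is an atom because \<open>f\<close> is an axiom, whereas a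
        principal formula is compound.\<close>
      then have "\<alpha> \<noteq> \<gamma>" using T\<gamma> x by auto
      then show ?thesis using right[OF node] by blast
    qed
  next
    case f: (node \<alpha> s' \<kappa> I X f')
    show ?thesis
    proof (cases "\<alpha> = \<gamma>")
      case False
      then show ?thesis using left[OF f] by blast
    next
      case True
      then have Z: "Z = principal s \<kappa> (fam I X)" and s': "s' = s" using f S\<gamma> by auto
      from g_cases show ?thesis
      proof cases
        case ax
        then show ?thesis using axs_atom[OF ax(2)] T\<gamma> Z by fastforce
      next
        case g: (node \<beta> t \<kappa>' J Y g')
        show ?thesis
        proof (cases "\<beta> = \<gamma>")
          case False
          then show ?thesis using right[OF g] by blast
        next
          case \<beta>: True
          then have t: "t = (\<not> s)" and eq: "fam J Y = fam I X" and dual: "(\<kappa> = None) \<noteq> (\<kappa>' = None)"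
            using g(2) T\<gamma> Z by auto
          have J: "J = I" and Y: "\<And>i. i |\<in>| I \<Longrightarrow> Y i = X i" using eq by (auto simp: fam_eq_iff)
          \<comment> \<open>Exactly one of the two rules is a projection or injection;
            \<open>k\<close> is its index, and the opposite (co)tupling has a branch for it.\<close>
          obtain k where k: "k |\<in>| I" "k |\<in>| branches \<kappa> I" "k |\<in>| branches \<kappa>' I"
            using dual f(3) g(3) J by (cases \<kappa>; cases \<kappa>') auto
          have fp: "cut_free P (fmupd \<gamma> (s, X i) S) (f' i)" if "i |\<in>| branches \<kappa> I" for i
            using f(4)[OF that] True s' by simp
          have gp: "cut_free P (fmupd \<gamma> (\<not> s, X i) T) (g' i)" if "i |\<in>| branches \<kappa>' I" for i
          proof -
            have b: "i |\<in>| branches \<kappa>' J" "i |\<in>| I" using that g(3) unfolding J by auto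
            from g(4)[OF b(1)] show ?thesis unfolding \<beta> t Y[OF b(2)] .
          qed
          have "size (f' k) < size f" "size (g' k) < size g"
            unfolding f(1) g(1) J by (rule size_node[OF k(2)], rule size_node[OF k(3)])
          then have small: "size (f' k) + size (g' k) < size f + size g" by (rule add_strict_mono)
          have "Sim P (join \<gamma> S T)
             (gcut s \<gamma> Z (fmdom S) (fmdom T) (node s \<gamma> \<kappa> I f') (node (\<not> s) \<gamma> \<kappa>' I g'))
             (gcut s \<gamma> (X k) (fmdom S) (fmdom T) (f' k) (g' k))"
            unfolding Z
            by (rule Sim_principal_cases[OF cut[unfolded Z] dual wf k cut_free_Der[OF fp] cut_free_Der[OF gp]])
          moreover have "\<exists>u. cut_free P (join \<gamma> (fmupd \<gamma> (s, X k) S) (fmupd \<gamma> (\<not> s, X k) T)) u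
            \<and> Sim P (join \<gamma> (fmupd \<gamma> (s, X k) S) (fmupd \<gamma> (\<not> s, X k) T))
              (gcut s \<gamma> (X k) (fmdom (fmupd \<gamma> (s, X k) S)) (fmdom (fmupd \<gamma> (\<not> s, X k) T)) (f' k) (g' k)) u"
            by (rule less.hyps[OF small fp[OF k(2)] gp[OF k(3)] cuttable_principal(1)[OF cut]])
          ultimately show ?thesis
            unfolding cuttable_principal(2)[OF cut] fmdom_fmupd_idle[OF S\<gamma>] fmdom_fmupd_idle[OF T\<gamma>]
              f(1) g(1) True \<beta> s' t J using Sim_trans by blast
        qed
      qed
    qed
  qed
qed

lemma signed_fmupd:
  assumes "\<alpha> |\<notin>| fmdom \<Gamma> |\<union>| fmdom \<Delta>" "fmdom \<Gamma> |\<inter>| fmdom \<Delta> = {||}"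
  shows "signed (fmupd \<alpha> X \<Gamma>) \<Delta> = fmupd \<alpha> (False, X) (signed \<Gamma> \<Delta>)"
    "signed \<Gamma> (fmupd \<alpha> X \<Delta>) = fmupd \<alpha> (True, X) (signed \<Gamma> \<Delta>)"
  using assms(1) by (auto intro!: fmap_ext simp: signed_def)

text \<open>The logical rules keep the cut-free forms of their premises. A cut is eliminated once
  its premises have been made cut-free, so topmost cuts disappear first.\<close>

lemma cut_elimination_derives:
  "derives P \<Gamma> \<Delta> t \<Longrightarrow> \<exists>u. cut_free P (signed \<Gamma> \<Delta>) u \<and> Sim P (signed \<Gamma> \<Delta>) t u"
proof (induction rule: derives.induct)
  case (ax f As Bs cs ds)
  then have "axiom P As Bs f cs ds" by (simp add: axiom_def)
  from cf_ax[OF this HOL.refl] Sim_refl[OF Der_ax[OF this]] show ?case unfolding axs_def by blast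
next
  case (cotuple \<alpha> \<Gamma> I X \<Delta> f)
  let ?S = "signed (fmupd \<alpha> (SumF (fam I X)) \<Gamma>) \<Delta>"
  have d: "\<alpha> |\<notin>| fmdom \<Gamma> |\<union>| fmdom \<Delta>" "fmdom \<Gamma> |\<inter>| fmdom \<Delta> = {||}"
    using cotuple.hyps(1,2) by (auto simp: sequent_def)
  note upd = signed_fmupd[OF d]
  have S: "fmlookup ?S \<alpha> = Some (False, principal False None (fam I X))"
    unfolding upd by (simp add: principal_def)
  have IH: "\<exists>u. cut_free P (fmupd \<alpha> (False, X i) ?S) u \<and> Sim P (fmupd \<alpha> (False, X i) ?S) (f i) u"
    if "i |\<in>| branches None I" for i
    using cotuple.IH that unfolding upd by simp
  have "\<exists>u. cut_free P ?S u \<and> Sim P ?S (node False \<alpha> None I f) u"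
    by (rule cut_free_node[OF S wfs_signed[OF cotuple.hyps(2)] _ IH]) (use cotuple.hyps in simp_all)
  then show ?case by (simp add: node_def)
next
  case (tuple \<alpha> \<Delta> \<Gamma> I X f)
  let ?S = "signed \<Gamma> (fmupd \<alpha> (ProdF (fam I X)) \<Delta>)"
  have d: "\<alpha> |\<notin>| fmdom \<Gamma> |\<union>| fmdom \<Delta>" "fmdom \<Gamma> |\<inter>| fmdom \<Delta> = {||}"
    using tuple.hyps(1,2) by (auto simp: sequent_def)
  note upd = signed_fmupd[OF d]
  have S: "fmlookup ?S \<alpha> = Some (True, principal True None (fam I X))"
    unfolding upd by (simp add: principal_def)
  have IH: "\<exists>u. cut_free P (fmupd \<alpha> (True, X i) ?S) u \<and> Sim P (fmupd \<alpha> (True, X i) ?S) (f i) u"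
    if "i |\<in>| branches None I" for i
    using tuple.IH that unfolding upd by simp
  have "\<exists>u. cut_free P ?S u \<and> Sim P ?S (node True \<alpha> None I f) u"
    by (rule cut_free_node[OF S wfs_signed[OF tuple.hyps(2)] _ IH]) (use tuple.hyps in simp_all)
  then show ?case by (simp add: node_def)
next
  case (proj \<alpha> \<Gamma> I X \<Delta> k f)
  let ?S = "signed (fmupd \<alpha> (ProdF (fam I X)) \<Gamma>) \<Delta>"
  have d: "\<alpha> |\<notin>| fmdom \<Gamma> |\<union>| fmdom \<Delta>" "fmdom \<Gamma> |\<inter>| fmdom \<Delta> = {||}"
    using proj.hyps(1,2) by (auto simp: sequent_def)
  note upd = signed_fmupd[OF d]
  have S: "fmlookup ?S \<alpha> = Some (False, principal False (Some k) (fam I X))"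
    unfolding upd by (simp add: principal_def)
  have IH: "\<exists>u. cut_free P (fmupd \<alpha> (False, X i) ?S) u \<and> Sim P (fmupd \<alpha> (False, X i) ?S) (f) u"
    if "i |\<in>| branches (Some k) I" for i
    using proj.IH that unfolding upd by simp
  \<comment> \<open>A rule with one premise is a \<open>node\<close> whose family of premises may be
    taken constant.\<close>
  have "\<exists>u. cut_free P ?S u \<and> Sim P ?S (node False \<alpha> (Some k) I (\<lambda>_. f)) u"
    by (rule cut_free_node[OF S wfs_signed[OF proj.hyps(2)] _ IH]) (use proj.hyps in simp_all)
  then show ?case by (simp add: node_def)
next
  case (inj \<alpha> \<Delta> \<Gamma> I X k f)
  let ?S = "signed \<Gamma> (fmupd \<alpha> (SumF (fam I X)) \<Delta>)"
  have d: "\<alpha> |\<notin>| fmdom \<Gamma> |\<union>| fmdom \<Delta>" "fmdom \<Gamma> |\<inter>| fmdom \<Delta> = {||}"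
    using inj.hyps(1,2) by (auto simp: sequent_def)
  note upd = signed_fmupd[OF d]
  have S: "fmlookup ?S \<alpha> = Some (True, principal True (Some k) (fam I X))"
    unfolding upd by (simp add: principal_def)
  have IH: "\<exists>u. cut_free P (fmupd \<alpha> (True, X i) ?S) u \<and> Sim P (fmupd \<alpha> (True, X i) ?S) (f) u"
    if "i |\<in>| branches (Some k) I" for i
    using inj.IH that unfolding upd by simp
  have "\<exists>u. cut_free P ?S u \<and> Sim P ?S (node True \<alpha> (Some k) I (\<lambda>_. f)) u"
    by (rule cut_free_node[OF S wfs_signed[OF inj.hyps(2)] _ IH]) (use inj.hyps in simp_all)
  then show ?case by (simp add: node_def)
next
  case (cut \<Gamma> \<gamma> Z \<Delta> f \<Gamma>' \<Delta>' g)
  let ?S = "signed \<Gamma> (fmupd \<gamma> Z \<Delta>)" and ?T = "signed (fmupd \<gamma> Z \<Gamma>') \<Delta>'"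
  have seq: "fmdom \<Gamma> |\<inter>| fmdom \<Delta> = {||}" "fmdom \<Gamma>' |\<inter>| fmdom \<Delta>' = {||}"
    using derives_sequent[OF cut.hyps(1)] derives_sequent[OF cut.hyps(2)] by (auto simp: sequent_def fset_eq_iff)
  have S: "?S = fmupd \<gamma> (True, Z) (signed \<Gamma> \<Delta>)" and T: "?T = fmupd \<gamma> (False, Z) (signed \<Gamma>' \<Delta>')"
    using seq cut.hyps by (auto intro: signed_fmupd)
  have ct: "cuttable True \<gamma> Z ?S ?T"
    unfolding cuttable_def S T using cut.hyps(3,4) by (auto simp: signed_def fset_eq_iff)
  have d: "c |\<notin>| fmdom \<Gamma>' \<and> c |\<notin>| fmdom \<Delta>'" if "c |\<in>| fmdom \<Gamma> \<or> c |\<in>| fmdom \<Delta>" for c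
    using that cut.hyps(3) by (auto simp: fset_eq_iff)
  have j: "join \<gamma> ?S ?T = signed (\<Gamma> ++\<^sub>f \<Gamma>') (\<Delta> ++\<^sub>f \<Delta>')"
    unfolding S T
  proof (rule fmap_ext)
    fix c
    show "fmlookup (join \<gamma> (fmupd \<gamma> (True, Z) (signed \<Gamma> \<Delta>)) (fmupd \<gamma> (False, Z) (signed \<Gamma>' \<Delta>'))) c
        = fmlookup (signed (\<Gamma> ++\<^sub>f \<Gamma>') (\<Delta> ++\<^sub>f \<Delta>')) c"
      using d[of c] cut.hyps(4) by (cases "c = \<gamma>") (auto simp: join_def signed_def dest: fmdom_notD)
  qed
  have K: "fmdom ?S |-| {|\<gamma>|} = fmdom \<Gamma> |\<union>| fmdom \<Delta>"
    unfolding S using cut.hyps(4) by (auto simp: signed_def fset_eq_iff)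
  obtain u v where u: "cut_free P ?S u" "Sim P ?S f u" and v: "cut_free P ?T v" "Sim P ?T g v"
    using cut.IH by blast
  obtain w where w: "cut_free P (join \<gamma> ?S ?T) w" "Sim P (join \<gamma> ?S ?T) (gcut True \<gamma> Z (fmdom ?S) (fmdom ?T) u v) w"
    using cut_cut_free[OF u(1) v(1) ct] by blast
  have "Sim P (join \<gamma> ?S ?T) (gcut True \<gamma> Z (fmdom ?S) (fmdom ?T) f g) w"
    using Sim_gcut[OF ct u(2) v(2)] w(2) by (rule Sim_trans)
  then have "Sim P (signed (\<Gamma> ++\<^sub>f \<Gamma>') (\<Delta> ++\<^sub>f \<Delta>')) (Cut \<gamma> Z (fmdom \<Gamma> |\<union>| fmdom \<Delta>) f g) w"
    unfolding j gcut_def K by (simp only: if_True)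
  then show ?case using w(1) unfolding j by blast
qed

lemma cut_elimination: "Der P S t \<Longrightarrow> \<exists>u. cut_free P S u \<and> Sim P S t u"
proof -
  assume "Der P S t"
  moreover have "signed (prj False S) (prj True S) = S"
  proof (rule fmap_eqI)
    fix c v
    have "fmdom (prj False S) |\<inter>| fmdom (prj True S) = {||}"
      by (auto simp: fset_eq_iff fmlookup_dom_iff fmlookup_prj)
    then show "fmlookup (signed (prj False S) (prj True S)) c = Some v \<longleftrightarrow> fmlookup S c = Some v"
      using fmlookup_signed[of "prj False S" "prj True S"] by (cases v) (simp add: fmlookup_prj)
  qed
  ultimately show ?thesis using cut_elimination_derives[of "prj False S" "prj True S" t] unfolding Der_def by metis
qed

text \<open>A cut-free derivation contains no channels other than those of its sequent.\<close>

lemma Sim_rename_cong: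
  assumes t: "Der P S t" and inj: "inj \<rho>" "inj \<sigma>" and eq: "\<And>c. c |\<in>| fmdom S \<Longrightarrow> \<rho> c = \<sigma> c"
  shows "Sim P (relabel \<rho> S) (rename \<rho> t) (rename \<sigma> t)"
proof -
  \<comment> \<open>The two renamings may treat the bound channels of \<open>t\<close> differently.
    The detour through \<open>u\<close>, on which they agree literally, removes the
    difference.\<close>
  obtain u where u: "cut_free P S u" "Sim P S t u" using cut_elimination[OF t] by blast
  have ren: "rename \<rho> u = rename \<sigma> u" using u(1) eq by (rule cut_free_rename)
  have ctx: "relabel \<rho> S = relabel \<sigma> S" using inj eq by (rule relabel_cong)
  have "Sim P (relabel \<rho> S) (rename \<rho> t) (rename \<sigma> u)"
    using Sim_rename[OF u(2) inj(1)] unfolding ren .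
  also have "Sim P (relabel \<rho> S) (rename \<sigma> u) (rename \<sigma> t)"
    using Sim_sym[OF Sim_rename[OF u(2) inj(2)]] unfolding ctx .
  finally show ?thesis .
qed

end

subsection \<open>Associativity and interchange\<close>

text \<open>For the middle derivation of an interchange law, which has both cut channels on the same
  side: one goes to the front and one to the back, so that its neighbours attach at opposite
  ends.\<close>

lemma mset_ends: "\<gamma> \<in> set cs \<Longrightarrow> \<delta> \<in> set cs \<Longrightarrow> \<gamma> \<noteq> \<delta>
    \<Longrightarrow> mset (\<gamma> # remove1 \<delta> (remove1 \<gamma> cs) @ [\<delta>]) = mset cs"
proof -
  assume *: "\<gamma> \<in> set cs" "\<delta> \<in> set cs" "\<gamma> \<noteq> \<delta>"
  then have \<delta>: "\<delta> \<in> set (remove1 \<gamma> cs)" by (simp add: in_set_remove1)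
  have e: "mset (x # remove1 x r) = mset r" if "x \<in> set r" for x and r :: "'a list"
    using that by simp
  have "mset (\<gamma> # remove1 \<delta> (remove1 \<gamma> cs) @ [\<delta>]) = add_mset \<gamma> (mset (\<delta> # remove1 \<delta> (remove1 \<gamma> cs)))"
    by simp
  also have "\<dots> = mset (\<gamma> # remove1 \<gamma> cs)" unfolding e[OF \<delta>] by simp
  also have "\<dots> = mset cs" by (rule e[OF *(1)])
  finally show ?thesis .
qed

lemma list_ends:
  assumes "length xs = length (a # ys @ [b])"
  obtains x zs y where "xs = x # zs @ [y]" "length zs = length ys"
proof -
  obtain x xs' where 1: "xs = x # xs'" using assms by (cases xs) auto
  obtain zs y where 2: "xs' = zs @ [y]" using assms 1 by (cases xs' rule: rev_cases) auto
  show ?thesis using that 1 2 assms by simp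
qed

text \<open>The middle context shares one channel with each neighbour and the neighbours share none,
  which allows the two cuts to be performed in either order.\<close>

definition chain :: "bool \<Rightarrow> chan \<Rightarrow> 'o form \<Rightarrow> bool \<Rightarrow> chan \<Rightarrow> 'o form \<Rightarrow> 'o sctx \<Rightarrow> 'o sctx \<Rightarrow> 'o sctx \<Rightarrow> bool" where
  "chain s \<gamma> Z s' \<delta> Z' S T U \<longleftrightarrow> cuttable s \<gamma> Z S T \<and> cuttable s' \<delta> Z' T U
     \<and> fmdom S |\<inter>| fmdom U = {||} \<and> \<gamma> \<noteq> \<delta>"

text \<open>Associativity is the case \<open>s = s'\<close>; the interchange laws for the codomain and for the domain are
  the cases \<open>s = False, s' = True\<close> and \<open>s = True, s' = False\<close>.\<close>

definition cut_law :: "('o, 'm) polycat \<Rightarrow> bool \<Rightarrow> chan \<Rightarrow> 'o form \<Rightarrow> bool \<Rightarrow> chan \<Rightarrow> 'o form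
    \<Rightarrow> 'o sctx \<Rightarrow> 'o sctx \<Rightarrow> 'o sctx \<Rightarrow> ('o, 'm) der \<Rightarrow> ('o, 'm) der \<Rightarrow> ('o, 'm) der \<Rightarrow> bool" where
  "cut_law A s \<gamma> Z s' \<delta> Z' S T U f g h \<longleftrightarrow> Sim A (join \<delta> (join \<gamma> S T) U)
     (gcut s' \<delta> Z' (fmdom (join \<gamma> S T)) (fmdom U) (gcut s \<gamma> Z (fmdom S) (fmdom T) f g) h)
     (gcut s \<gamma> Z (fmdom S) (fmdom (join \<delta> T U)) f (gcut s' \<delta> Z' (fmdom T) (fmdom U) g h))"

lemma disjoint_lookup: "fmdom S |\<inter>| fmdom U = {||} \<Longrightarrow> fmlookup S c = Some v \<Longrightarrow> fmlookup U c = None"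
  by (metis finterI fmdomI fempty_iff fmdom_notD)

lemma chain_outer:
  assumes "chain s \<gamma> Z s' \<delta> Z' S T U"
  shows "cuttable s \<gamma> Z S T" "cuttable s' \<delta> Z' T U"
    "cuttable s' \<delta> Z' (join \<gamma> S T) U" "cuttable s \<gamma> Z S (join \<delta> T U)"
    "join \<delta> (join \<gamma> S T) U = join \<gamma> S (join \<delta> T U)"
proof -
  show c: "cuttable s \<gamma> Z S T" "cuttable s' \<delta> Z' T U" using assms by (auto simp: chain_def)
  have ne: "\<gamma> \<noteq> \<delta>" and dj: "fmdom S |\<inter>| fmdom U = {||}" using assms by (auto simp: chain_def)
  have "\<gamma> |\<notin>| fmdom U" "\<delta> |\<notin>| fmdom S"
    using dj c fmdomI unfolding cuttable_def by (metis finterI fempty_iff)+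
  then show c': "cuttable s' \<delta> Z' (join \<gamma> S T) U" "cuttable s \<gamma> Z S (join \<delta> T U)"
    using c ne dj unfolding cuttable_def fmlookup_join[OF c(1)] fmlookup_join[OF c(2)] fmdom_join
    by (auto simp: fset_eq_iff)
  show "join \<delta> (join \<gamma> S T) U = join \<gamma> S (join \<delta> T U)"
    by (rule fmap_eqI) (auto simp: fmlookup_join[OF c'(1)] fmlookup_join[OF c'(2)] fmlookup_join[OF c(1)]
        fmlookup_join[OF c(2)] \<open>\<gamma> |\<notin>| fmdom U\<close> \<open>\<delta> |\<notin>| fmdom S\<close>
        fmdom_notD[OF \<open>\<gamma> |\<notin>| fmdom U\<close>] fmdom_notD[OF \<open>\<delta> |\<notin>| fmdom S\<close>])
qed

lemma chain_flip: "chain s \<gamma> Z s' \<delta> Z' S T U \<Longrightarrow> chain (\<not> s') \<delta> Z' (\<not> s) \<gamma> Z U T S"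
  unfolding chain_def by (auto dest: cuttable_flip)

text \<open>Reading the chain from the other end exchanges the two sides of the law and negates the
  signs. A last rule of \<open>h\<close> is thereby treated as a last rule of \<open>f\<close>, and
  associativity against the direction of composition as ordinary associativity.\<close>

lemma cut_law_flip:
  assumes ch: "chain s \<gamma> Z s' \<delta> Z' S T U" and law: "cut_law A (\<not> s') \<delta> Z' (\<not> s) \<gamma> Z U T S h g f"
  shows "cut_law A s \<gamma> Z s' \<delta> Z' S T U f g h"
proof -
  note ch' = chain_flip[OF ch]
  have j: "join \<delta> U T = join \<delta> T U" "join \<gamma> T S = join \<gamma> S T"
    using join_flip[OF chain_outer(1)[OF ch]] join_flip[OF chain_outer(2)[OF ch]] by simp_all
  have j2: "join \<gamma> (join \<delta> T U) S = join \<delta> (join \<gamma> S T) U"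
    using join_flip[OF chain_outer(4)[OF ch]] chain_outer(5)[OF ch] by simp
  have flip: "gcut (\<not> t) \<epsilon> X K K' a b = gcut t \<epsilon> X K' K b a" for t \<epsilon> X K K' and a b :: "('a, 'b) der"
    by (simp add: gcut_def)
  have "Sim A (join \<delta> (join \<gamma> S T) U)
     (gcut s \<gamma> Z (fmdom S) (fmdom (join \<delta> T U)) f (gcut s' \<delta> Z' (fmdom T) (fmdom U) g h))
     (gcut s' \<delta> Z' (fmdom (join \<gamma> S T)) (fmdom U) (gcut s \<gamma> Z (fmdom S) (fmdom T) f g) h)"
    using law unfolding cut_law_def j j2 flip .
  then show ?thesis unfolding cut_law_def by (rule Sim_sym)
qed

lemma cut_law_cong:
  assumes ch: "chain s \<gamma> Z s' \<delta> Z' S T U" and sim: "Sim A S f f'" "Sim A T g g'" "Sim A U h h'"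
    and law: "cut_law A s \<gamma> Z s' \<delta> Z' S T U f' g' h'"
  shows "cut_law A s \<gamma> Z s' \<delta> Z' S T U f g h"
proof -
  note c = chain_outer[OF ch]
  have 1: "Sim A (join \<delta> (join \<gamma> S T) U)
     (gcut s' \<delta> Z' (fmdom (join \<gamma> S T)) (fmdom U) (gcut s \<gamma> Z (fmdom S) (fmdom T) f g) h)
     (gcut s' \<delta> Z' (fmdom (join \<gamma> S T)) (fmdom U) (gcut s \<gamma> Z (fmdom S) (fmdom T) f' g') h')"
    by (intro Sim_gcut c sim)
  have 2: "Sim A (join \<gamma> S (join \<delta> T U))
     (gcut s \<gamma> Z (fmdom S) (fmdom (join \<delta> T U)) f (gcut s' \<delta> Z' (fmdom T) (fmdom U) g h))
     (gcut s \<gamma> Z (fmdom S) (fmdom (join \<delta> T U)) f' (gcut s' \<delta> Z' (fmdom T) (fmdom U) g' h'))"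
    by (intro Sim_gcut c sim)
  show ?thesis
    using Sim_trans[OF Sim_trans[OF 1 law[unfolded cut_law_def]] Sim_sym[OF 2[folded c(5)]]] unfolding cut_law_def .
qed

text \<open>The inner cuts are rewritten first, and it remains to compare the outer ones. Every case
  of the law supplies its own \<open>a\<close> and \<open>b\<close>.\<close>

lemma cut_law_congD:
  assumes ch: "chain s \<gamma> Z s' \<delta> Z' S T U" and D: "Der A S f" "Der A T g" "Der A U h"
    and l: "Sim A (join \<gamma> S T) (gcut s \<gamma> Z (fmdom S) (fmdom T) f g) a"
    and r: "Sim A (join \<delta> T U) (gcut s' \<delta> Z' (fmdom T) (fmdom U) g h) b"
    and eq: "Sim A (join \<delta> (join \<gamma> S T) U) (gcut s' \<delta> Z' (fmdom (join \<gamma> S T)) (fmdom U) a h)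
      (gcut s \<gamma> Z (fmdom S) (fmdom (join \<delta> T U)) f b)"
  shows "cut_law A s \<gamma> Z s' \<delta> Z' S T U f g h"
proof -
  note c = chain_outer[OF ch]
  have 1: "Sim A (join \<delta> (join \<gamma> S T) U)
     (gcut s' \<delta> Z' (fmdom (join \<gamma> S T)) (fmdom U) (gcut s \<gamma> Z (fmdom S) (fmdom T) f g) h)
     (gcut s' \<delta> Z' (fmdom (join \<gamma> S T)) (fmdom U) a h)"
    by (intro Sim_gcut c l Sim_refl D)
  have 2: "Sim A (join \<delta> (join \<gamma> S T) U)
     (gcut s \<gamma> Z (fmdom S) (fmdom (join \<delta> T U)) f (gcut s' \<delta> Z' (fmdom T) (fmdom U) g h))
     (gcut s \<gamma> Z (fmdom S) (fmdom (join \<delta> T U)) f b)"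
    unfolding c(5) by (intro Sim_gcut c r Sim_refl D)
  show ?thesis unfolding cut_law_def by (rule Sim_trans[OF Sim_trans[OF 1 eq] Sim_sym[OF 2]])
qed

lemma Sim_push_right:
  assumes cut: "cuttable s \<gamma> Z S T"
    and T: "fmlookup T \<alpha> = Some (s', principal s' \<kappa> (fam I X))" and wf: "wfs A S" "wfs A T"
    and sub: "branches \<kappa> I |\<subseteq>| I" and "\<alpha> \<noteq> \<gamma>"
    and prem: "\<And>i. i |\<in>| branches \<kappa> I \<Longrightarrow> Der A (fmupd \<alpha> (s', X i) T) (g i)"
    and f: "Der A S f"
  shows "Sim A (join \<gamma> S T) (gcut s \<gamma> Z (fmdom S) (fmdom T) f (node s' \<alpha> \<kappa> I g))
     (node s' \<alpha> \<kappa> I (\<lambda>i. gcut s \<gamma> Z (fmdom S) (fmdom T) f (g i)))"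
  unfolding join_flip[OF cut] gcut_flip[of s]
  by (rule Sim_push[OF cuttable_flip[OF cut] T wf(2,1) sub \<open>\<alpha> \<noteq> \<gamma>\<close> prem f])

lemma chain_fmupd:
  assumes ch: "chain s \<gamma> Z s' \<delta> Z' S T U" and S: "fmlookup S \<alpha> = Some w" and "\<alpha> \<noteq> \<gamma>"
  shows "chain s \<gamma> Z s' \<delta> Z' (fmupd \<alpha> v S) T U"
  using ch cuttable_fmupd(1)[OF chain_outer(1)[OF ch] S \<open>\<alpha> \<noteq> \<gamma>\<close>] fmdom_fmupd_idle[OF S]
  unfolding chain_def by simp

lemma chain_fmupd_middle:
  assumes ch: "chain s \<gamma> Z s' \<delta> Z' S T U" and T: "fmlookup T \<alpha> = Some w" and ne: "\<alpha> \<noteq> \<gamma>" "\<alpha> \<noteq> \<delta>"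
  shows "chain s \<gamma> Z s' \<delta> Z' S (fmupd \<alpha> v T) U"
  using ch cuttable_fmupd(1)[OF chain_outer(2)[OF ch] T ne(2)]
    cuttable_flip[OF cuttable_fmupd(1)[OF cuttable_flip[OF chain_outer(1)[OF ch]] T ne(1)]]
  unfolding chain_def by simp

text \<open>The rule leaves two nested cuts on the left side but only one on the right side, where
  \<open>f\<close> is a premise of the outer cut; afterwards the branches agree by the induction
  hypothesis.\<close>

lemma cut_law_node_left:
  assumes ch: "chain s \<gamma> Z s' \<delta> Z' S T U"
    and S: "fmlookup S \<alpha> = Some (t, principal t \<kappa> (fam I X))" and wf: "wfs A S" "wfs A T" "wfs A U"
    and sub: "branches \<kappa> I |\<subseteq>| I" and ne: "\<alpha> \<noteq> \<gamma>"
    and prem: "\<And>i. i |\<in>| branches \<kappa> I \<Longrightarrow> Der A (fmupd \<alpha> (t, X i) S) (f i)"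
    and D: "Der A T g" "Der A U h"
    and IH: "\<And>i. i |\<in>| branches \<kappa> I \<Longrightarrow> cut_law A s \<gamma> Z s' \<delta> Z' (fmupd \<alpha> (t, X i) S) T U (f i) g h"
  shows "cut_law A s \<gamma> Z s' \<delta> Z' S T U (node t \<alpha> \<kappa> I f) g h"
proof -
  note c = chain_outer[OF ch]
  let ?l = "\<lambda>i. gcut s \<gamma> Z (fmdom S) (fmdom T) (f i) g"
  \<comment> \<open>\<open>\<alpha>\<close> is a channel of \<open>S\<close>, and
    \<open>\<delta>\<close> is one of \<open>U\<close>, which is disjoint from
    \<open>S\<close>.\<close>
  have ne': "\<alpha> \<noteq> \<delta>"
  proof
    assume "\<alpha> = \<delta>"
    have "fmlookup U \<delta> = Some (\<not> s', Z')" using c(2) unfolding cuttable_def by (elim conjE)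
    moreover have "fmdom S |\<inter>| fmdom U = {||}" using ch unfolding chain_def by (elim conjE)
    ultimately show False using disjoint_lookup[OF _ S] \<open>\<alpha> = \<delta>\<close> by fastforce
  qed
  have jS: "fmlookup (join \<gamma> S T) \<alpha> = Some (t, principal t \<kappa> (fam I X))"
    using fmlookup_join[OF c(1)] S ne by simp
  have jjS: "fmlookup (join \<delta> (join \<gamma> S T) U) \<alpha> = Some (t, principal t \<kappa> (fam I X))"
    using fmlookup_join[OF c(3)] jS ne' by simp
  have w: "wfs A (join \<gamma> S T)" "wfs A (join \<delta> T U)" "wfs A (join \<delta> (join \<gamma> S T) U)"
    using wfs_join[OF c(1)] wfs_join[OF c(2)] wfs_join[OF c(3)] wf by blast+
  have u1: "join \<gamma> (fmupd \<alpha> v S) T = fmupd \<alpha> v (join \<gamma> S T)" for v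
    by (rule cuttable_fmupd(2)[OF c(1) S ne])
  have u2: "join \<delta> (fmupd \<alpha> v (join \<gamma> S T)) U = fmupd \<alpha> v (join \<delta> (join \<gamma> S T) U)" for v
    by (rule cuttable_fmupd(2)[OF c(3) jS ne'])
  have Dl: "Der A (fmupd \<alpha> (t, X i) (join \<gamma> S T)) (?l i)" if "i |\<in>| branches \<kappa> I" for i
    using Der_gcut[OF cuttable_fmupd(1)[OF c(1) S ne] prem[OF that] D(1)] unfolding u1 fmdom_fmupd_idle[OF S] .
  have Df: "Der A S (node t \<alpha> \<kappa> I f)" by (rule Der_node[OF S wf(1) sub prem])
  show ?thesis
  proof (rule cut_law_congD[OF ch Df D])
    show "Sim A (join \<gamma> S T) (gcut s \<gamma> Z (fmdom S) (fmdom T) (node t \<alpha> \<kappa> I f) g) (node t \<alpha> \<kappa> I ?l)"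
      by (rule Sim_push[OF c(1) S wf(1,2) sub ne prem D(1)])
    show "Sim A (join \<delta> T U) (gcut s' \<delta> Z' (fmdom T) (fmdom U) g h) (gcut s' \<delta> Z' (fmdom T) (fmdom U) g h)"
      by (intro Sim_refl Der_gcut c D)
    have "Sim A (join \<delta> (join \<gamma> S T) U) (gcut s' \<delta> Z' (fmdom (join \<gamma> S T)) (fmdom U) (node t \<alpha> \<kappa> I ?l) h)
        (node t \<alpha> \<kappa> I (\<lambda>i. gcut s' \<delta> Z' (fmdom (join \<gamma> S T)) (fmdom U) (?l i) h))"
      by (rule Sim_push[OF c(3) jS w(1) wf(3) sub ne' Dl D(2)])
    also have "Sim A (join \<delta> (join \<gamma> S T) U) \<dots>
        (node t \<alpha> \<kappa> I (\<lambda>i. gcut s \<gamma> Z (fmdom S) (fmdom (join \<delta> T U)) (f i) (gcut s' \<delta> Z' (fmdom T) (fmdom U) g h)))"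
      by (rule Sim_node[OF jjS w(3) sub])
        (use IH in \<open>simp only: cut_law_def u1 u2 fmdom_fmupd_idle[OF S] fmdom_fmupd_idle[OF jS]\<close>)
    also have "Sim A (join \<delta> (join \<gamma> S T) U) \<dots>
        (gcut s \<gamma> Z (fmdom S) (fmdom (join \<delta> T U)) (node t \<alpha> \<kappa> I f) (gcut s' \<delta> Z' (fmdom T) (fmdom U) g h))"
      unfolding c(5) by (rule Sim_sym, rule Sim_push[OF c(4) S wf(1) w(2) sub ne prem Der_gcut[OF c(2) D]])
    finally show "Sim A (join \<delta> (join \<gamma> S T) U)
        (gcut s' \<delta> Z' (fmdom (join \<gamma> S T)) (fmdom U) (node t \<alpha> \<kappa> I ?l) h)
        (gcut s \<gamma> Z (fmdom S) (fmdom (join \<delta> T U)) (node t \<alpha> \<kappa> I f) (gcut s' \<delta> Z' (fmdom T) (fmdom U) g h))" .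
  qed
qed

text \<open>The middle derivation lies inside the inner cut on both sides of the law, so its rule is
  pushed out twice on each.\<close>

lemma cut_law_node_middle:
  assumes ch: "chain s \<gamma> Z s' \<delta> Z' S T U"
    and T: "fmlookup T \<alpha> = Some (t, principal t \<kappa> (fam I X))" and wf: "wfs A S" "wfs A T" "wfs A U"
    and sub: "branches \<kappa> I |\<subseteq>| I" and ne: "\<alpha> \<noteq> \<gamma>" "\<alpha> \<noteq> \<delta>"
    and prem: "\<And>i. i |\<in>| branches \<kappa> I \<Longrightarrow> Der A (fmupd \<alpha> (t, X i) T) (g i)"
    and D: "Der A S f" "Der A U h"
    and IH: "\<And>i. i |\<in>| branches \<kappa> I \<Longrightarrow> cut_law A s \<gamma> Z s' \<delta> Z' S (fmupd \<alpha> (t, X i) T) U f (g i) h"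
  shows "cut_law A s \<gamma> Z s' \<delta> Z' S T U f (node t \<alpha> \<kappa> I g) h"
proof -
  note c = chain_outer[OF ch]
  let ?l = "\<lambda>i. gcut s \<gamma> Z (fmdom S) (fmdom T) f (g i)" and ?r = "\<lambda>i. gcut s' \<delta> Z' (fmdom T) (fmdom U) (g i) h"
  have jT: "fmlookup (join \<gamma> S T) \<alpha> = Some (t, principal t \<kappa> (fam I X))"
     "fmlookup (join \<delta> T U) \<alpha> = Some (t, principal t \<kappa> (fam I X))"
    using fmlookup_join[OF c(1)] fmlookup_join[OF c(2)] T ne by simp_all
  have jjT: "fmlookup (join \<delta> (join \<gamma> S T) U) \<alpha> = Some (t, principal t \<kappa> (fam I X))"
    using fmlookup_join[OF c(3)] jT ne by simp
  have w: "wfs A (join \<gamma> S T)" "wfs A (join \<delta> T U)" "wfs A (join \<delta> (join \<gamma> S T) U)"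
    using wfs_join[OF c(1)] wfs_join[OF c(2)] wfs_join[OF c(3)] wf by blast+
  note cl = cuttable_flip[OF c(1)]
  have ST: "cuttable s \<gamma> Z S (fmupd \<alpha> v T)" for v
    using cuttable_flip[OF cuttable_fmupd(1)[OF cl T ne(1)]] by simp
  have u1: "join \<gamma> S (fmupd \<alpha> v T) = fmupd \<alpha> v (join \<gamma> S T)" for v
    unfolding join_flip[OF ST] join_flip[OF c(1)] by (rule cuttable_fmupd(2)[OF cl T ne(1)])
  have u2: "join \<delta> (fmupd \<alpha> v T) U = fmupd \<alpha> v (join \<delta> T U)" for v
    by (rule cuttable_fmupd(2)[OF c(2) T ne(2)])
  have u3: "join \<delta> (fmupd \<alpha> v (join \<gamma> S T)) U = fmupd \<alpha> v (join \<delta> (join \<gamma> S T) U)" for v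
    by (rule cuttable_fmupd(2)[OF c(3) jT(1) ne(2)])
  have Dl: "Der A (fmupd \<alpha> (t, X i) (join \<gamma> S T)) (?l i)" if "i |\<in>| branches \<kappa> I" for i
    using Der_gcut[OF ST D(1) prem[OF that]] unfolding u1 fmdom_fmupd_idle[OF T] .
  have Dr: "Der A (fmupd \<alpha> (t, X i) (join \<delta> T U)) (?r i)" if "i |\<in>| branches \<kappa> I" for i
    using Der_gcut[OF cuttable_fmupd(1)[OF c(2) T ne(2)] prem[OF that] D(2)] unfolding u2 fmdom_fmupd_idle[OF T] .
  have Dg: "Der A T (node t \<alpha> \<kappa> I g)" by (rule Der_node[OF T wf(2) sub prem])
  show ?thesis
  proof (rule cut_law_congD[OF ch D(1) Dg D(2)])
    show "Sim A (join \<gamma> S T) (gcut s \<gamma> Z (fmdom S) (fmdom T) f (node t \<alpha> \<kappa> I g)) (node t \<alpha> \<kappa> I ?l)"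
      by (rule Sim_push_right[OF c(1) T wf(1,2) sub ne(1) prem D(1)])
    show "Sim A (join \<delta> T U) (gcut s' \<delta> Z' (fmdom T) (fmdom U) (node t \<alpha> \<kappa> I g) h) (node t \<alpha> \<kappa> I ?r)"
      by (rule Sim_push[OF c(2) T wf(2,3) sub ne(2) prem D(2)])
    have "Sim A (join \<delta> (join \<gamma> S T) U) (gcut s' \<delta> Z' (fmdom (join \<gamma> S T)) (fmdom U) (node t \<alpha> \<kappa> I ?l) h)
        (node t \<alpha> \<kappa> I (\<lambda>i. gcut s' \<delta> Z' (fmdom (join \<gamma> S T)) (fmdom U) (?l i) h))"
      by (rule Sim_push[OF c(3) jT(1) w(1) wf(3) sub ne(2) Dl D(2)])
    also have "Sim A (join \<delta> (join \<gamma> S T) U) \<dots>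
        (node t \<alpha> \<kappa> I (\<lambda>i. gcut s \<gamma> Z (fmdom S) (fmdom (join \<delta> T U)) f (?r i)))"
      by (rule Sim_node[OF jjT w(3) sub])
        (use IH in \<open>simp only: cut_law_def u1 u2 u3 fmdom_fmupd_idle[OF T] fmdom_fmupd_idle[OF jT(1)]
            fmdom_fmupd_idle[OF jT(2)]\<close>)
    also have "Sim A (join \<delta> (join \<gamma> S T) U) \<dots>
        (gcut s \<gamma> Z (fmdom S) (fmdom (join \<delta> T U)) f (node t \<alpha> \<kappa> I ?r))"
      unfolding c(5) by (rule Sim_sym, rule Sim_push_right[OF c(4) jT(2) wf(1) w(2) sub ne(1) Dr D(1)])
    finally show "Sim A (join \<delta> (join \<gamma> S T) U)
        (gcut s' \<delta> Z' (fmdom (join \<gamma> S T)) (fmdom U) (node t \<alpha> \<kappa> I ?l) h)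
        (gcut s \<gamma> Z (fmdom S) (fmdom (join \<delta> T U)) f (node t \<alpha> \<kappa> I ?r))" .
  qed
qed

text \<open>The sequent of an identity as the partner in a cut: the other derivation has
  \<open>\<gamma>\<close> on side \<open>s\<close>, so \<open>\<gamma>\<close> is on the opposite
  side here, and \<open>\<beta>\<close> takes over its role on side \<open>s\<close>.\<close>

definition idctx :: "bool \<Rightarrow> 'o form \<Rightarrow> chan \<Rightarrow> chan \<Rightarrow> 'o sctx" where
  "idctx s Z \<gamma> \<beta> = fmupd \<gamma> (\<not> s, Z) (fmupd \<beta> (s, Z) fmempty)"

text \<open>A compound formula is principal for a rule on either side, a (co)tupling or a choice
  according to the connective. So the side \<open>s\<close> can be prescribed in advance.\<close>

lemma form_cases:
  obtains (atom) x where "Z = Atom x" | (node) \<kappa> I X where "Z = principal s \<kappa> (fam I X)"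
proof (cases Z)
  case (Atom x) then show ?thesis using atom by blast
next
  case (SumF F)
  \<comment> \<open>\<open>principal\<close> only asks whether \<open>\<kappa>\<close> is
    \<open>None\<close>, so the index of the choice may stay \<open>undefined\<close>.\<close>
  then have "Z = principal s (if s then Some undefined else None) (fam (fmdom F) (\<lambda>i. the (fmlookup F i)))"
    by (simp add: principal_def fam_fmdom)
  then show ?thesis by (rule node)
next
  case (ProdF F)
  then have "Z = principal s (if s then None else Some undefined) (fam (fmdom F) (\<lambda>i. the (fmlookup F i)))"
    by (simp add: principal_def fam_fmdom)
  then show ?thesis by (rule node)
qed

lemma size_form_fam: "i |\<in>| I \<Longrightarrow> size (X i) < size (principal s \<kappa> (fam I X))"
proof -
  assume "i |\<in>| I"
  then have *: "(i, X i) |\<in>| fset_of_fmap (fam I X)" by simp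
  have "size (X i) \<le> (\<Sum>x\<in>fset (fset_of_fmap (fam I X)). Suc (case x of (a, b) \<Rightarrow> size b))"
    using member_le_sum[OF *, of "\<lambda>x. Suc (case x of (a, b) \<Rightarrow> size b)"] by simp
  then show ?thesis by (simp add: principal_def)
qed

lemma idctx_upd:
  "fmupd \<gamma> (\<not> s, Y) (fmupd \<beta> (s, Y) (idctx s Z \<gamma> \<beta>)) = idctx s Y \<gamma> \<beta>"
  "\<gamma> \<noteq> \<beta> \<Longrightarrow> fmupd \<beta> (s, Y) (fmupd \<gamma> (\<not> s, Y) (idctx s Z \<gamma> \<beta>)) = idctx s Y \<gamma> \<beta>"
  by (rule fmap_ext; auto simp: idctx_def)+

lemma idctx_simps:
  assumes "\<gamma> \<noteq> \<beta>"
  shows "fmlookup (idctx s Z \<gamma> \<beta>) \<gamma> = Some (\<not> s, Z)" "fmlookup (idctx s Z \<gamma> \<beta>) \<beta> = Some (s, Z)"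
    "fmdom (idctx s Z \<gamma> \<beta>) = {|\<gamma>, \<beta>|}"
  using assms by (simp_all add: idctx_def)

lemma wfs_fmupd: "wfs A S \<Longrightarrow> Y \<in> formulas A \<Longrightarrow> wfs A (fmupd \<alpha> (t, Y) S)"
  unfolding wfs_def by simp

context polycategory
begin

text \<open>On the left side the matching pair meets in the inner cut and reduces at once. On the
  right side the rule of the middle derivation is first pushed through the cut with
  \<open>h\<close>, and the pair then meets in the outer cut. Both sides become cuts at the
  component \<open>X k\<close>.\<close>

lemma cut_law_principal:
  assumes ch: "chain s \<gamma> (principal s \<kappa> (fam I X)) s' \<delta> Z' S T U" and dual: "(\<kappa> = None) \<noteq> (\<kappa>' = None)"
    and wf: "wfs P S" "wfs P T" "wfs P U" and sub: "branches \<kappa> I |\<subseteq>| I" "branches \<kappa>' I |\<subseteq>| I"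
    and k: "k |\<in>| I" "k |\<in>| branches \<kappa> I" "k |\<in>| branches \<kappa>' I"
    and f: "\<And>i. i |\<in>| branches \<kappa> I \<Longrightarrow> Der P (fmupd \<gamma> (s, X i) S) (f i)"
    and g: "\<And>i. i |\<in>| branches \<kappa>' I \<Longrightarrow> Der P (fmupd \<gamma> (\<not> s, X i) T) (g i)"
    and h: "Der P U h"
    and IH: "cut_law P s \<gamma> (X k) s' \<delta> Z' (fmupd \<gamma> (s, X k) S) (fmupd \<gamma> (\<not> s, X k) T) U (f k) (g k) h"
  shows "cut_law P s \<gamma> (principal s \<kappa> (fam I X)) s' \<delta> Z' S T U (node s \<gamma> \<kappa> I f) (node (\<not> s) \<gamma> \<kappa>' I g) h"
proof -
  let ?Z = "principal s \<kappa> (fam I X)"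
  note c = chain_outer[OF ch]
  have ne: "\<gamma> \<noteq> \<delta>" using ch unfolding chain_def by (elim conjE)
  have pr: "principal s \<kappa> (fam I X) = principal (\<not> s) \<kappa>' (fam I X)"
    using dual by (cases \<kappa>; cases \<kappa>') simp_all
  have S: "fmlookup S \<gamma> = Some (s, ?Z)" and T0: "fmlookup T \<gamma> = Some (\<not> s, ?Z)"
    using c(1) by (simp_all add: cuttable_def)
  have T: "fmlookup T \<gamma> = Some (\<not> s, principal (\<not> s) \<kappa>' (fam I X))" using T0 unfolding pr .
  have jT: "fmlookup (join \<delta> T U) \<gamma> = Some (\<not> s, principal (\<not> s) \<kappa>' (fam I X))"
    unfolding fmlookup_join[OF c(2)] using T ne by blast
  let ?r = "\<lambda>i. gcut s' \<delta> Z' (fmdom T) (fmdom U) (g i) h"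
  have u: "join \<delta> (fmupd \<gamma> v T) U = fmupd \<gamma> v (join \<delta> T U)" for v
    by (rule cuttable_fmupd(2)[OF c(2) T ne])
  have Dr: "Der P (fmupd \<gamma> (\<not> s, X i) (join \<delta> T U)) (?r i)" if "i |\<in>| branches \<kappa>' I" for i
    using Der_gcut[OF cuttable_fmupd(1)[OF c(2) T ne] g[OF that] h] unfolding u fmdom_fmupd_idle[OF T] .
  have Df: "Der P S (node s \<gamma> \<kappa> I f)" by (rule Der_node[OF S wf(1) sub(1) f])
  have Dg: "Der P T (node (\<not> s) \<gamma> \<kappa>' I g)" by (rule Der_node[OF T wf(2) sub(2) g])
  show ?thesis
  proof (rule cut_law_congD[OF ch Df Dg h])
    show "Sim P (join \<gamma> S T) (gcut s \<gamma> ?Z (fmdom S) (fmdom T) (node s \<gamma> \<kappa> I f) (node (\<not> s) \<gamma> \<kappa>' I g))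
        (gcut s \<gamma> (X k) (fmdom S) (fmdom T) (f k) (g k))"
      by (rule Sim_principal_cases[OF c(1) dual wf(1,2) k f g])
    show "Sim P (join \<delta> T U) (gcut s' \<delta> Z' (fmdom T) (fmdom U) (node (\<not> s) \<gamma> \<kappa>' I g) h) (node (\<not> s) \<gamma> \<kappa>' I ?r)"
      by (rule Sim_push[OF c(2) T wf(2,3) sub(2) ne g h])
    have "Sim P (join \<delta> (join \<gamma> S T) U)
        (gcut s' \<delta> Z' (fmdom (join \<gamma> S T)) (fmdom U) (gcut s \<gamma> (X k) (fmdom S) (fmdom T) (f k) (g k)) h)
        (gcut s \<gamma> (X k) (fmdom S) (fmdom (join \<delta> T U)) (f k) (?r k))"
      using IH unfolding cut_law_def u cuttable_principal(2)[OF c(1)]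
        fmdom_fmupd_idle[OF S] fmdom_fmupd_idle[OF T] fmdom_fmupd_idle[OF jT] .
    also have "Sim P (join \<delta> (join \<gamma> S T) U) \<dots>
        (gcut s \<gamma> ?Z (fmdom S) (fmdom (join \<delta> T U)) (node s \<gamma> \<kappa> I f) (node (\<not> s) \<gamma> \<kappa>' I ?r))"
      unfolding c(5) by (rule Sim_sym, rule Sim_principal_cases[OF c(4) dual wf(1) wfs_join[OF c(2) wf(2,3)] k f Dr])
    finally show "Sim P (join \<delta> (join \<gamma> S T) U)
        (gcut s' \<delta> Z' (fmdom (join \<gamma> S T)) (fmdom U) (gcut s \<gamma> (X k) (fmdom S) (fmdom T) (f k) (g k)) h)
        (gcut s \<gamma> ?Z (fmdom S) (fmdom (join \<delta> T U)) (node s \<gamma> \<kappa> I f) (node (\<not> s) \<gamma> \<kappa>' I ?r))" .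
  qed
qed

section \<open>The cut laws for axioms\<close>

lemma ax_cut_last_first:
  assumes f: "axiom P \<Gamma> (\<Delta> @ [x]) f cs (ds @ [\<gamma>])" and g: "axiom P (x # \<Gamma>') \<Delta>' g (\<gamma> # cs') ds'"
    and S: "S = axs \<Gamma> (\<Delta> @ [x]) cs (ds @ [\<gamma>])" and T: "T = axs (x # \<Gamma>') \<Delta>' (\<gamma> # cs') ds'"
    and cut: "cuttable True \<gamma> (Atom x) S T"
  shows "axiom P (\<Gamma> @ \<Gamma>') (\<Delta> @ \<Delta>') (polycat.cut P \<Gamma> \<Delta> x [] [] \<Gamma>' \<Delta>' f g) (cs @ cs') (ds @ ds')"
    "join \<gamma> S T = axs (\<Gamma> @ \<Gamma>') (\<Delta> @ \<Delta>') (cs @ cs') (ds @ ds')"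
    "Sim P (join \<gamma> S T)
      (gcut True \<gamma> (Atom x) (fmdom S) (fmdom T) (Ax \<Gamma> (\<Delta> @ [x]) f cs (ds @ [\<gamma>])) (Ax (x # \<Gamma>') \<Delta>' g (\<gamma> # cs') ds'))
      (Ax (\<Gamma> @ \<Gamma>') (\<Delta> @ \<Delta>') (polycat.cut P \<Gamma> \<Delta> x [] [] \<Gamma>' \<Delta>' f g) (cs @ cs') (ds @ ds'))"
proof -
  have len: "length ds = length \<Delta>" "length cs' = length \<Gamma>'" using f g by (simp_all add: axiom_def)
  note ac = ax_cut[of \<Gamma> \<Delta> x "[]" f cs ds \<gamma> "[]" "[]" \<Gamma>' \<Delta>' g "[]" cs' ds' S T,
      unfolded append_Nil append_Nil2, OF f g len(1) _ _ len(2) _ S T cut, unfolded planar_def]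
  show "axiom P (\<Gamma> @ \<Gamma>') (\<Delta> @ \<Delta>') (polycat.cut P \<Gamma> \<Delta> x [] [] \<Gamma>' \<Delta>' f g) (cs @ cs') (ds @ ds')"
    by (rule ac(1)) simp_all
  show "join \<gamma> S T = axs (\<Gamma> @ \<Gamma>') (\<Delta> @ \<Delta>') (cs @ cs') (ds @ ds')"
    by (rule ac(2)[symmetric]) simp_all
  show "Sim P (join \<gamma> S T)
      (gcut True \<gamma> (Atom x) (fmdom S) (fmdom T) (Ax \<Gamma> (\<Delta> @ [x]) f cs (ds @ [\<gamma>])) (Ax (x # \<Gamma>') \<Delta>' g (\<gamma> # cs') ds'))
      (Ax (\<Gamma> @ \<Gamma>') (\<Delta> @ \<Delta>') (polycat.cut P \<Gamma> \<Delta> x [] [] \<Gamma>' \<Delta>' f g) (cs @ cs') (ds @ ds'))"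
    by (rule ac(3)) simp_all
qed

text \<open>The mirror arrangement, planar because nothing precedes \<open>\<gamma>\<close> in the
  codomain and nothing follows it in the domain. The lists of the derivation with
  \<open>\<gamma>\<close> in its domain now come first in the composite.\<close>

lemma ax_cut_first_last:
  assumes f: "axiom P \<Gamma> (x # \<Delta>) f cs (\<gamma> # ds)" and g: "axiom P (\<Gamma>' @ [x]) \<Delta>' g (cs' @ [\<gamma>]) ds'"
    and S: "S = axs \<Gamma> (x # \<Delta>) cs (\<gamma> # ds)" and T: "T = axs (\<Gamma>' @ [x]) \<Delta>' (cs' @ [\<gamma>]) ds'"
    and cut: "cuttable True \<gamma> (Atom x) S T"
  shows "axiom P (\<Gamma>' @ \<Gamma>) (\<Delta>' @ \<Delta>) (polycat.cut P \<Gamma> [] x \<Delta> \<Gamma>' [] \<Delta>' f g) (cs' @ cs) (ds' @ ds)"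
    "join \<gamma> S T = axs (\<Gamma>' @ \<Gamma>) (\<Delta>' @ \<Delta>) (cs' @ cs) (ds' @ ds)"
    "Sim P (join \<gamma> S T)
      (gcut True \<gamma> (Atom x) (fmdom S) (fmdom T) (Ax \<Gamma> (x # \<Delta>) f cs (\<gamma> # ds)) (Ax (\<Gamma>' @ [x]) \<Delta>' g (cs' @ [\<gamma>]) ds'))
      (Ax (\<Gamma>' @ \<Gamma>) (\<Delta>' @ \<Delta>) (polycat.cut P \<Gamma> [] x \<Delta> \<Gamma>' [] \<Delta>' f g) (cs' @ cs) (ds' @ ds))"
proof -
  have len: "length ds = length \<Delta>" "length cs' = length \<Gamma>'" using f g by (simp_all add: axiom_def)
  note ac = ax_cut[of \<Gamma> "[]" x \<Delta> f cs "[]" \<gamma> ds \<Gamma>' "[]" \<Delta>' g cs' "[]" ds' S T,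
      unfolded append_Nil append_Nil2, OF f g _ len _ _ S T cut, unfolded planar_def]
  show "axiom P (\<Gamma>' @ \<Gamma>) (\<Delta>' @ \<Delta>) (polycat.cut P \<Gamma> [] x \<Delta> \<Gamma>' [] \<Delta>' f g) (cs' @ cs) (ds' @ ds)"
    by (rule ac(1)) simp_all
  show "join \<gamma> S T = axs (\<Gamma>' @ \<Gamma>) (\<Delta>' @ \<Delta>) (cs' @ cs) (ds' @ ds)"
    by (rule ac(2)[symmetric]) simp_all
  show "Sim P (join \<gamma> S T)
      (gcut True \<gamma> (Atom x) (fmdom S) (fmdom T) (Ax \<Gamma> (x # \<Delta>) f cs (\<gamma> # ds)) (Ax (\<Gamma>' @ [x]) \<Delta>' g (cs' @ [\<gamma>]) ds'))
      (Ax (\<Gamma>' @ \<Gamma>) (\<Delta>' @ \<Delta>) (polycat.cut P \<Gamma> [] x \<Delta> \<Gamma>' [] \<Delta>' f g) (cs' @ cs) (ds' @ ds))"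
    by (rule ac(3)) simp_all
qed

lemma Der_axs: "axiom P As Bs f cs ds \<Longrightarrow> S = axs As Bs cs ds \<Longrightarrow> Der P S (Ax As Bs f cs ds)"
  using Der_ax by simp

text \<open>With each cut channel last in one codomain and first in the next domain, the segments
  \<open>\<Delta>2\<close>, \<open>\<Gamma>1\<close>, \<open>\<Theta>2\<close> and
  \<open>\<Lambda>1\<close> of \<open>cut_assoc\<close> are empty, and both composites are
  concatenations in the same order.\<close>

lemma ax_associativity:
  assumes ch: "chain True \<gamma> (Atom x) True \<delta> (Atom y) S T U"
    and f: "axiom P \<Gamma> (\<Delta> @ [x]) f cs (ds @ [\<gamma>])"
    and g: "axiom P (x # \<Gamma>') (\<Delta>' @ [y]) g (\<gamma> # cs') (ds' @ [\<delta>])"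
    and h: "axiom P (y # \<Gamma>'') \<Delta>'' h (\<delta> # cs'') ds''"
    and S: "S = axs \<Gamma> (\<Delta> @ [x]) cs (ds @ [\<gamma>])" and T: "T = axs (x # \<Gamma>') (\<Delta>' @ [y]) (\<gamma> # cs') (ds' @ [\<delta>])"
    and U: "U = axs (y # \<Gamma>'') \<Delta>'' (\<delta> # cs'') ds''"
  shows "cut_law P True \<gamma> (Atom x) True \<delta> (Atom y) S T U (Ax \<Gamma> (\<Delta> @ [x]) f cs (ds @ [\<gamma>]))
    (Ax (x # \<Gamma>') (\<Delta>' @ [y]) g (\<gamma> # cs') (ds' @ [\<delta>])) (Ax (y # \<Gamma>'') \<Delta>'' h (\<delta> # cs'') ds'')"
proof -
  note c = chain_outer[OF ch]
  note fg = ax_cut_last_first[OF f g S T c(1)]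
  note fgh = ax_cut_last_first[OF fg(1)[folded append_assoc] h fg(2)[folded append_assoc] U c(3)]
  note gh = ax_cut_last_first[OF g h T U c(2)]
  note fgh' = ax_cut_last_first[OF f gh(1)[unfolded append_Cons] S gh(2)[unfolded append_Cons] c(4)]
  have eq: "polycat.cut P (\<Gamma> @ \<Gamma>') (\<Delta> @ \<Delta>') y [] [] \<Gamma>'' \<Delta>'' (polycat.cut P \<Gamma> \<Delta> x [] [] \<Gamma>' (\<Delta>' @ [y]) f g) h
      = polycat.cut P \<Gamma> \<Delta> x [] [] (\<Gamma>' @ \<Gamma>'') (\<Delta>' @ \<Delta>'') f (polycat.cut P (x # \<Gamma>') \<Delta>' y [] [] \<Gamma>'' \<Delta>'' g h)"
    using cut_assoc[of f \<Gamma> \<Delta> x "[]" g "[]" \<Gamma>' \<Delta>' y "[]" h "[]" \<Gamma>'' \<Delta>''] f g h by (simp add: axiom_def planar_def)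
  show ?thesis
  proof (rule cut_law_congD[OF ch Der_axs[OF f S] Der_axs[OF g T] Der_axs[OF h U] fg(3)[folded append_assoc]
        gh(3)[unfolded append_Cons]])
    show "Sim P (join \<delta> (join \<gamma> S T) U)
     (gcut True \<delta> (Atom y) (fmdom (join \<gamma> S T)) (fmdom U)
       (Ax (\<Gamma> @ \<Gamma>') ((\<Delta> @ \<Delta>') @ [y]) (polycat.cut P \<Gamma> \<Delta> x [] [] \<Gamma>' (\<Delta>' @ [y]) f g) (cs @ cs') ((ds @ ds') @ [\<delta>]))
       (Ax (y # \<Gamma>'') \<Delta>'' h (\<delta> # cs'') ds''))
     (gcut True \<gamma> (Atom x) (fmdom S) (fmdom (join \<delta> T U)) (Ax \<Gamma> (\<Delta> @ [x]) f cs (ds @ [\<gamma>]))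
       (Ax (x # \<Gamma>' @ \<Gamma>'') (\<Delta>' @ \<Delta>'') (polycat.cut P (x # \<Gamma>') \<Delta>' y [] [] \<Gamma>'' \<Delta>'' g h) (\<gamma> # cs' @ cs'') (ds' @ ds'')))"
      using Sim_trans[OF fgh(3)[unfolded eq append_assoc] Sim_sym[OF fgh'(3)[folded c(5)]]] unfolding append_assoc .
  qed
qed

text \<open>The middle axiom has \<open>\<gamma>\<close> first and \<open>\<delta>\<close> last in
  its codomain, so \<open>f\<close> is attached before and \<open>h\<close> after it, and
  \<open>cut_interchange_codomain\<close> applies with \<open>\<Delta>1\<close> and
  \<open>\<Delta>3\<close> empty. The cut at \<open>\<gamma>\<close> is oriented from
  \<open>g\<close> to \<open>f\<close>, hence the flips.\<close>

lemma ax_interchange_codomain: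
  assumes ch: "chain False \<gamma> (Atom x) True \<delta> (Atom y) S T U"
    and f: "axiom P (\<Gamma> @ [x]) \<Delta> f (cs @ [\<gamma>]) ds"
    and g: "axiom P \<Gamma>' (x # \<Delta>' @ [y]) g cs' (\<gamma> # ds' @ [\<delta>])"
    and h: "axiom P (y # \<Gamma>'') \<Delta>'' h (\<delta> # cs'') ds''"
    and S: "S = axs (\<Gamma> @ [x]) \<Delta> (cs @ [\<gamma>]) ds" and T: "T = axs \<Gamma>' (x # \<Delta>' @ [y]) cs' (\<gamma> # ds' @ [\<delta>])"
    and U: "U = axs (y # \<Gamma>'') \<Delta>'' (\<delta> # cs'') ds''"
  shows "cut_law P False \<gamma> (Atom x) True \<delta> (Atom y) S T U (Ax (\<Gamma> @ [x]) \<Delta> f (cs @ [\<gamma>]) ds)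
    (Ax \<Gamma>' (x # \<Delta>' @ [y]) g cs' (\<gamma> # ds' @ [\<delta>])) (Ax (y # \<Gamma>'') \<Delta>'' h (\<delta> # cs'') ds'')"
proof -
  note c = chain_outer[OF ch]
  have c1: "cuttable True \<gamma> (Atom x) T S" using cuttable_flip[OF c(1)] by simp
  have c4: "cuttable True \<gamma> (Atom x) (join \<delta> T U) S" using cuttable_flip[OF c(4)] by simp
  note fg = ax_cut_first_last[OF g f T S c1, folded append_assoc]
  have gf: "join \<gamma> S T = axs (\<Gamma> @ \<Gamma>') ((\<Delta> @ \<Delta>') @ [y]) (cs @ cs') ((ds @ ds') @ [\<delta>])"
    using fg(2) join_flip[OF c(1)] by simp
  note fgh = ax_cut_last_first[OF fg(1) h gf U c(3)]
  note gh = ax_cut_last_first[of \<Gamma>' "x # \<Delta>'" y g cs' "\<gamma> # ds'", unfolded append_Cons, OF g h T U c(2)]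
  note fgh' = ax_cut_first_last[OF gh(1) f gh(2) S c4]
  have eq: "polycat.cut P (\<Gamma> @ \<Gamma>') (\<Delta> @ \<Delta>') y [] [] \<Gamma>'' \<Delta>'' (polycat.cut P \<Gamma>' [] x (\<Delta>' @ [y]) \<Gamma> [] \<Delta> g f) h
      = polycat.cut P (\<Gamma>' @ \<Gamma>'') [] x (\<Delta>' @ \<Delta>'') \<Gamma> [] \<Delta> (polycat.cut P \<Gamma>' (x # \<Delta>') y [] [] \<Gamma>'' \<Delta>'' g h) f"
    using cut_interchange_codomain[of g \<Gamma>' "[]" x \<Delta>' y "[]" f \<Gamma> \<Delta> h \<Gamma>'' \<Delta>''] f g h by (simp add: axiom_def)
  have fl: "gcut False \<gamma> (Atom x) K K' a b = gcut True \<gamma> (Atom x) K' K b a" for K K' and a b :: "('o, 'm) der"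
    by (simp add: gcut_def)
  show ?thesis
  proof (rule cut_law_congD[OF ch Der_axs[OF f S] Der_axs[OF g T] Der_axs[OF h U] _ gh(3)])
    show "Sim P (join \<gamma> S T)
     (gcut False \<gamma> (Atom x) (fmdom S) (fmdom T) (Ax (\<Gamma> @ [x]) \<Delta> f (cs @ [\<gamma>]) ds) (Ax \<Gamma>' (x # \<Delta>' @ [y]) g cs' (\<gamma> # ds' @ [\<delta>])))
      (Ax (\<Gamma> @ \<Gamma>') ((\<Delta> @ \<Delta>') @ [y]) (polycat.cut P \<Gamma>' [] x (\<Delta>' @ [y]) \<Gamma> [] \<Delta> g f) (cs @ cs') ((ds @ ds') @ [\<delta>]))"
      unfolding fl join_flip[OF c(1)] by (rule fg(3))
    have r: "Sim P (join \<gamma> S (join \<delta> T U))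
     (gcut False \<gamma> (Atom x) (fmdom S) (fmdom (join \<delta> T U)) (Ax (\<Gamma> @ [x]) \<Delta> f (cs @ [\<gamma>]) ds)
       (Ax (\<Gamma>' @ \<Gamma>'') (x # \<Delta>' @ \<Delta>'') (polycat.cut P \<Gamma>' (x # \<Delta>') y [] [] \<Gamma>'' \<Delta>'' g h) (cs' @ cs'') (\<gamma> # ds' @ ds'')))
     (Ax (\<Gamma> @ \<Gamma>' @ \<Gamma>'') (\<Delta> @ \<Delta>' @ \<Delta>'')
       (polycat.cut P (\<Gamma>' @ \<Gamma>'') [] x (\<Delta>' @ \<Delta>'') \<Gamma> [] \<Delta> (polycat.cut P \<Gamma>' (x # \<Delta>') y [] [] \<Gamma>'' \<Delta>'' g h) f)
       (cs @ cs' @ cs'') (ds @ ds' @ ds''))"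
      unfolding fl join_flip[OF c(4)] by (rule fgh'(3))
    show "Sim P (join \<delta> (join \<gamma> S T) U)
     (gcut True \<delta> (Atom y) (fmdom (join \<gamma> S T)) (fmdom U)
      (Ax (\<Gamma> @ \<Gamma>') ((\<Delta> @ \<Delta>') @ [y]) (polycat.cut P \<Gamma>' [] x (\<Delta>' @ [y]) \<Gamma> [] \<Delta> g f) (cs @ cs') ((ds @ ds') @ [\<delta>]))
       (Ax (y # \<Gamma>'') \<Delta>'' h (\<delta> # cs'') ds''))
     (gcut False \<gamma> (Atom x) (fmdom S) (fmdom (join \<delta> T U)) (Ax (\<Gamma> @ [x]) \<Delta> f (cs @ [\<gamma>]) ds)
       (Ax (\<Gamma>' @ \<Gamma>'') (x # \<Delta>' @ \<Delta>'') (polycat.cut P \<Gamma>' (x # \<Delta>') y [] [] \<Gamma>'' \<Delta>'' g h) (cs' @ cs'') (\<gamma> # ds' @ ds'')))"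
      using Sim_trans[OF fgh(3)[unfolded eq append_assoc] Sim_sym[OF r[folded c(5)]]] unfolding append_assoc .
  qed
qed

text \<open>Dually, the middle axiom has both channels in its domain. It plays the part of
  \<open>h\<close> in \<open>cut_interchange_domain\<close>, while the last derivation of the chain
  plays the part of \<open>g\<close>.\<close>

lemma ax_interchange_domain:
  assumes ch: "chain True \<gamma> (Atom x) False \<delta> (Atom y) S T U"
    and f: "axiom P \<Gamma> (\<Delta> @ [x]) f cs (ds @ [\<gamma>])"
    and g: "axiom P (x # \<Gamma>' @ [y]) \<Delta>' g (\<gamma> # cs' @ [\<delta>]) ds'"
    and h: "axiom P \<Gamma>'' (y # \<Delta>'') h cs'' (\<delta> # ds'')"
    and S: "S = axs \<Gamma> (\<Delta> @ [x]) cs (ds @ [\<gamma>])" and T: "T = axs (x # \<Gamma>' @ [y]) \<Delta>' (\<gamma> # cs' @ [\<delta>]) ds'"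
    and U: "U = axs \<Gamma>'' (y # \<Delta>'') cs'' (\<delta> # ds'')"
  shows "cut_law P True \<gamma> (Atom x) False \<delta> (Atom y) S T U (Ax \<Gamma> (\<Delta> @ [x]) f cs (ds @ [\<gamma>]))
    (Ax (x # \<Gamma>' @ [y]) \<Delta>' g (\<gamma> # cs' @ [\<delta>]) ds') (Ax \<Gamma>'' (y # \<Delta>'') h cs'' (\<delta> # ds''))"
proof -
  note c = chain_outer[OF ch]
  have c2: "cuttable True \<delta> (Atom y) U T" using cuttable_flip[OF c(2)] by simp
  have c3: "cuttable True \<delta> (Atom y) U (join \<gamma> S T)" using cuttable_flip[OF c(3)] by simp
  note fg = ax_cut_last_first[OF f g S T c(1), folded append_assoc]
  note fgh = ax_cut_first_last[OF h fg(1) U fg(2) c3]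
  note gh = ax_cut_first_last[of _ y _ h _ \<delta> _ "x # \<Gamma>'" _ g "\<gamma> # cs'", unfolded append_Cons, OF h g U T c2]
  have hg: "join \<delta> T U = axs (x # \<Gamma>' @ \<Gamma>'') (\<Delta>' @ \<Delta>'') (\<gamma> # cs' @ cs'') (ds' @ ds'')"
    using gh(2) join_flip[OF c(2)] by simp
  note fgh' = ax_cut_last_first[OF f gh(1) S hg c(4)]
  have eq: "polycat.cut P \<Gamma>'' [] y \<Delta>'' (\<Gamma> @ \<Gamma>') [] (\<Delta> @ \<Delta>') h (polycat.cut P \<Gamma> \<Delta> x [] [] (\<Gamma>' @ [y]) \<Delta>' f g)
      = polycat.cut P \<Gamma> \<Delta> x [] [] (\<Gamma>' @ \<Gamma>'') (\<Delta>' @ \<Delta>'') f (polycat.cut P \<Gamma>'' [] y \<Delta>'' (x # \<Gamma>') [] \<Delta>' h g)"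
    using cut_interchange_domain[of f \<Gamma> \<Delta> x h \<Gamma>'' y \<Delta>'' g "[]" \<Gamma>' "[]" \<Delta>'] f g h by (simp add: axiom_def)
  have fl: "gcut False \<delta> (Atom y) K K' a b = gcut True \<delta> (Atom y) K' K b a" for K K' and a b :: "('o, 'm) der"
    by (simp add: gcut_def)
  show ?thesis
  proof (rule cut_law_congD[OF ch Der_axs[OF f S] Der_axs[OF g T] Der_axs[OF h U] fg(3)])
    show "Sim P (join \<delta> T U)
     (gcut False \<delta> (Atom y) (fmdom T) (fmdom U) (Ax (x # \<Gamma>' @ [y]) \<Delta>' g (\<gamma> # cs' @ [\<delta>]) ds') (Ax \<Gamma>'' (y # \<Delta>'') h cs'' (\<delta> # ds'')))
      (Ax (x # \<Gamma>' @ \<Gamma>'') (\<Delta>' @ \<Delta>'') (polycat.cut P \<Gamma>'' [] y \<Delta>'' (x # \<Gamma>') [] \<Delta>' h g) (\<gamma> # cs' @ cs'') (ds' @ ds''))"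
      unfolding fl join_flip[OF c(2)] by (rule gh(3))
    have l: "Sim P (join \<delta> (join \<gamma> S T) U)
     (gcut False \<delta> (Atom y) (fmdom (join \<gamma> S T)) (fmdom U)
       (Ax ((\<Gamma> @ \<Gamma>') @ [y]) (\<Delta> @ \<Delta>') (polycat.cut P \<Gamma> \<Delta> x [] [] (\<Gamma>' @ [y]) \<Delta>' f g) ((cs @ cs') @ [\<delta>]) (ds @ ds'))
       (Ax \<Gamma>'' (y # \<Delta>'') h cs'' (\<delta> # ds'')))
     (Ax ((\<Gamma> @ \<Gamma>') @ \<Gamma>'') ((\<Delta> @ \<Delta>') @ \<Delta>'')
       (polycat.cut P \<Gamma>'' [] y \<Delta>'' (\<Gamma> @ \<Gamma>') [] (\<Delta> @ \<Delta>') h (polycat.cut P \<Gamma> \<Delta> x [] [] (\<Gamma>' @ [y]) \<Delta>' f g))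
       ((cs @ cs') @ cs'') ((ds @ ds') @ ds''))"
      unfolding fl join_flip[OF c(3)] by (rule fgh(3))
    show "Sim P (join \<delta> (join \<gamma> S T) U)
     (gcut False \<delta> (Atom y) (fmdom (join \<gamma> S T)) (fmdom U)
       (Ax ((\<Gamma> @ \<Gamma>') @ [y]) (\<Delta> @ \<Delta>') (polycat.cut P \<Gamma> \<Delta> x [] [] (\<Gamma>' @ [y]) \<Delta>' f g) ((cs @ cs') @ [\<delta>]) (ds @ ds'))
       (Ax \<Gamma>'' (y # \<Delta>'') h cs'' (\<delta> # ds'')))
     (gcut True \<gamma> (Atom x) (fmdom S) (fmdom (join \<delta> T U)) (Ax \<Gamma> (\<Delta> @ [x]) f cs (ds @ [\<gamma>]))
       (Ax (x # \<Gamma>' @ \<Gamma>'') (\<Delta>' @ \<Delta>'') (polycat.cut P \<Gamma>'' [] y \<Delta>'' (x # \<Gamma>') [] \<Delta>' h g) (\<gamma> # cs' @ cs'') (ds' @ ds'')))"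
      using Sim_trans[OF l[unfolded eq append_assoc] Sim_sym[OF fgh'(3)[folded c(5)]]] unfolding append_assoc .
  qed
qed

lemma axs_lookup_dom:
  assumes "axiom P (A1 @ x # A2) Bs f (c1 @ \<gamma> # c2) ds" "length c1 = length A1"
  shows "fmlookup (axs (A1 @ x # A2) Bs (c1 @ \<gamma> # c2) ds) \<gamma> = Some (False, Atom x)"
  unfolding fmlookup_axs[OF assms(1)] using assms(2) by simp

lemma axs_lookup_cod:
  assumes "axiom P As (B1 @ x # B2) f cs (d1 @ \<gamma> # d2)" "length d1 = length B1"
  shows "fmlookup (axs As (B1 @ x # B2) cs (d1 @ \<gamma> # d2)) \<gamma> = Some (True, Atom x)"
  unfolding fmlookup_axs[OF assms(1)] using assms(2) by simp

lemma ax_arrange: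
  assumes "axiom P As Bs f cs ds" "S = axs As Bs cs ds" "mset cs' = mset cs" "mset ds' = mset ds"
  obtains As' Bs' f' where "axiom P As' Bs' f' cs' ds'" "S = axs As' Bs' cs' ds'"
    "Sim P S (Ax As Bs f cs ds) (Ax As' Bs' f' cs' ds')"
  using ax_reorder[OF assms(1,3,4)] assms(2) by metis

text \<open>Here and in the next three lemmas an axiom is put into the shape required for a cut at
  one channel. The rearrangement returns unknown object lists, so the object at the channel is
  identified through the signed context.\<close>

lemma ax_dom_first:
  assumes ax: "axiom P As Bs f cs ds" and S: "S = axs As Bs cs ds" and look: "fmlookup S \<gamma> = Some (False, Z)"
  obtains x \<Gamma> \<Delta> g cs' ds' where "Z = Atom x" "axiom P (x # \<Gamma>) \<Delta> g (\<gamma> # cs') ds'"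
    "S = axs (x # \<Gamma>) \<Delta> (\<gamma> # cs') ds'" "Sim P S (Ax As Bs f cs ds) (Ax (x # \<Gamma>) \<Delta> g (\<gamma> # cs') ds')"
proof -
  have "\<gamma> \<in> set cs" using axs_side(2)[OF ax, of \<gamma> False Z] look S by simp
  then obtain As' Bs' f' where *: "axiom P As' Bs' f' (\<gamma> # remove1 \<gamma> cs) ds" "S = axs As' Bs' (\<gamma> # remove1 \<gamma> cs) ds"
      "Sim P S (Ax As Bs f cs ds) (Ax As' Bs' f' (\<gamma> # remove1 \<gamma> cs) ds)"
    using ax_arrange[OF ax S _ HOL.refl, of "\<gamma> # remove1 \<gamma> cs"] by auto
  obtain x \<Gamma> where A: "As' = x # \<Gamma>" using *(1) by (cases As') (auto simp: axiom_def)
  have "Z = Atom x"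
    using look axs_lookup_dom[of "[]" x \<Gamma> Bs' f' "[]" \<gamma> "remove1 \<gamma> cs" ds] * A by simp
  then show ?thesis using that * A by blast
qed

lemma ax_dom_last:
  assumes ax: "axiom P As Bs f cs ds" and S: "S = axs As Bs cs ds" and look: "fmlookup S \<gamma> = Some (False, Z)"
  obtains x \<Gamma> \<Delta> g cs' ds' where "Z = Atom x" "axiom P (\<Gamma> @ [x]) \<Delta> g (cs' @ [\<gamma>]) ds'"
    "S = axs (\<Gamma> @ [x]) \<Delta> (cs' @ [\<gamma>]) ds'" "Sim P S (Ax As Bs f cs ds) (Ax (\<Gamma> @ [x]) \<Delta> g (cs' @ [\<gamma>]) ds')"
proof -
  have "\<gamma> \<in> set cs" using axs_side(2)[OF ax, of \<gamma> False Z] look S by simp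
  then obtain As' Bs' f' where *: "axiom P As' Bs' f' (remove1 \<gamma> cs @ [\<gamma>]) ds" "S = axs As' Bs' (remove1 \<gamma> cs @ [\<gamma>]) ds"
      "Sim P S (Ax As Bs f cs ds) (Ax As' Bs' f' (remove1 \<gamma> cs @ [\<gamma>]) ds)"
    using ax_arrange[OF ax S _ HOL.refl, of "remove1 \<gamma> cs @ [\<gamma>]"] by auto
  obtain x \<Gamma> where A: "As' = \<Gamma> @ [x]" using *(1) by (cases As' rule: rev_cases) (auto simp: axiom_def)
  have "length (remove1 \<gamma> cs) = length \<Gamma>" using *(1) unfolding A axiom_def length_append by simp
  then have "Z = Atom x"
    using look axs_lookup_dom[of \<Gamma> x "[]" Bs' f' "remove1 \<gamma> cs" \<gamma> "[]" ds] * A by simp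
  then show ?thesis using that * A by blast
qed

lemma ax_cod_first:
  assumes ax: "axiom P As Bs f cs ds" and S: "S = axs As Bs cs ds" and look: "fmlookup S \<gamma> = Some (True, Z)"
  obtains x \<Gamma> \<Delta> g cs' ds' where "Z = Atom x" "axiom P \<Gamma> (x # \<Delta>) g cs' (\<gamma> # ds')"
    "S = axs \<Gamma> (x # \<Delta>) cs' (\<gamma> # ds')" "Sim P S (Ax As Bs f cs ds) (Ax \<Gamma> (x # \<Delta>) g cs' (\<gamma> # ds'))"
proof -
  have "\<gamma> \<in> set ds" using axs_side(1)[OF ax, of \<gamma> True Z] look S by simp
  then obtain As' Bs' f' where *: "axiom P As' Bs' f' cs (\<gamma> # remove1 \<gamma> ds)" "S = axs As' Bs' cs (\<gamma> # remove1 \<gamma> ds)"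
      "Sim P S (Ax As Bs f cs ds) (Ax As' Bs' f' cs (\<gamma> # remove1 \<gamma> ds))"
    using ax_arrange[OF ax S HOL.refl, of "\<gamma> # remove1 \<gamma> ds"] by auto
  obtain x \<Delta> where B: "Bs' = x # \<Delta>" using *(1) by (cases Bs') (auto simp: axiom_def)
  have "Z = Atom x"
    using look axs_lookup_cod[of As' "[]" x \<Delta> f' cs "[]" \<gamma> "remove1 \<gamma> ds"] * B by simp
  then show ?thesis using that * B by blast
qed

lemma ax_cod_last:
  assumes ax: "axiom P As Bs f cs ds" and S: "S = axs As Bs cs ds" and look: "fmlookup S \<gamma> = Some (True, Z)"
  obtains x \<Gamma> \<Delta> g cs' ds' where "Z = Atom x" "axiom P \<Gamma> (\<Delta> @ [x]) g cs' (ds' @ [\<gamma>])"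
    "S = axs \<Gamma> (\<Delta> @ [x]) cs' (ds' @ [\<gamma>])" "Sim P S (Ax As Bs f cs ds) (Ax \<Gamma> (\<Delta> @ [x]) g cs' (ds' @ [\<gamma>]))"
proof -
  have "\<gamma> \<in> set ds" using axs_side(1)[OF ax, of \<gamma> True Z] look S by simp
  then obtain As' Bs' f' where *: "axiom P As' Bs' f' cs (remove1 \<gamma> ds @ [\<gamma>])" "S = axs As' Bs' cs (remove1 \<gamma> ds @ [\<gamma>])"
      "Sim P S (Ax As Bs f cs ds) (Ax As' Bs' f' cs (remove1 \<gamma> ds @ [\<gamma>]))"
    using ax_arrange[OF ax S HOL.refl, of "remove1 \<gamma> ds @ [\<gamma>]"] by auto
  obtain x \<Delta> where B: "Bs' = \<Delta> @ [x]" using *(1) by (cases Bs' rule: rev_cases) (auto simp: axiom_def)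
  have "length (remove1 \<gamma> ds) = length \<Delta>" using *(1) unfolding B axiom_def length_append by simp
  then have "Z = Atom x"
    using look axs_lookup_cod[of As' \<Delta> x "[]" f' cs "remove1 \<gamma> ds" \<gamma> "[]"] * B by simp
  then show ?thesis using that * B by blast
qed

text \<open>For the middle axiom of an associativity law. Domain and codomain are arranged one after
  the other; as the second rearrangement returns new object lists, the object at
  \<open>\<gamma>\<close> is recovered from the context once more.\<close>

lemma ax_dom_first_cod_last:
  assumes ax: "axiom P As Bs f cs ds" and S: "S = axs As Bs cs ds"
    and look: "fmlookup S \<gamma> = Some (False, Z)" "fmlookup S \<delta> = Some (True, Z')"
  obtains x y \<Gamma> \<Delta> g cs' ds' where "Z = Atom x" "Z' = Atom y" "axiom P (x # \<Gamma>) (\<Delta> @ [y]) g (\<gamma> # cs') (ds' @ [\<delta>])"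
    "S = axs (x # \<Gamma>) (\<Delta> @ [y]) (\<gamma> # cs') (ds' @ [\<delta>])"
    "Sim P S (Ax As Bs f cs ds) (Ax (x # \<Gamma>) (\<Delta> @ [y]) g (\<gamma> # cs') (ds' @ [\<delta>]))"
proof -
  obtain x \<Gamma> \<Delta> g cs' ds' where 1: "Z = Atom x" "axiom P (x # \<Gamma>) \<Delta> g (\<gamma> # cs') ds'"
    "S = axs (x # \<Gamma>) \<Delta> (\<gamma> # cs') ds'" "Sim P S (Ax As Bs f cs ds) (Ax (x # \<Gamma>) \<Delta> g (\<gamma> # cs') ds')"
    by (rule ax_dom_first[OF ax S look(1)])
  have "\<delta> \<in> set ds'" using axs_side(1)[OF 1(2), of \<delta> True Z'] look 1(3) by simp
  then obtain As' Bs' f' where *: "axiom P As' Bs' f' (\<gamma> # cs') (remove1 \<delta> ds' @ [\<delta>])"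
      "S = axs As' Bs' (\<gamma> # cs') (remove1 \<delta> ds' @ [\<delta>])"
      "Sim P S (Ax (x # \<Gamma>) \<Delta> g (\<gamma> # cs') ds') (Ax As' Bs' f' (\<gamma> # cs') (remove1 \<delta> ds' @ [\<delta>]))"
    using ax_arrange[OF 1(2,3) HOL.refl, of "remove1 \<delta> ds' @ [\<delta>]"] by auto
  obtain x' \<Gamma>' where A: "As' = x' # \<Gamma>'" using *(1) by (cases As') (auto simp: axiom_def)
  obtain y \<Delta>' where B: "Bs' = \<Delta>' @ [y]" using *(1) by (cases Bs' rule: rev_cases) (auto simp: axiom_def)
  have len: "length (remove1 \<delta> ds') = length \<Delta>'" using *(1) unfolding B axiom_def length_append by simp
  have "Z = Atom x'"
    using look(1) axs_lookup_dom[of "[]" x' \<Gamma>' Bs' f' "[]" \<gamma> cs' "remove1 \<delta> ds' @ [\<delta>]"] * A by simp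
  moreover have "Z' = Atom y"
    using look(2) axs_lookup_cod[of As' \<Delta>' y "[]" f' "\<gamma> # cs'" "remove1 \<delta> ds'" \<delta> "[]"] * B len by simp
  ultimately show ?thesis using that * A B Sim_trans[OF 1(4) *(3)] by blast
qed

lemma ax_cod_ends:
  assumes ax: "axiom P As Bs f cs ds" and S: "S = axs As Bs cs ds" and ne: "\<gamma> \<noteq> \<delta>"
    and look: "fmlookup S \<gamma> = Some (True, Z)" "fmlookup S \<delta> = Some (True, Z')"
  obtains x y \<Gamma> \<Delta> g cs' ds' where "Z = Atom x" "Z' = Atom y" "axiom P \<Gamma> (x # \<Delta> @ [y]) g cs' (\<gamma> # ds' @ [\<delta>])"
    "S = axs \<Gamma> (x # \<Delta> @ [y]) cs' (\<gamma> # ds' @ [\<delta>])"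
    "Sim P S (Ax As Bs f cs ds) (Ax \<Gamma> (x # \<Delta> @ [y]) g cs' (\<gamma> # ds' @ [\<delta>]))"
proof -
  let ?ds = "remove1 \<delta> (remove1 \<gamma> ds)"
  have "\<gamma> \<in> set ds" "\<delta> \<in> set ds"
    using axs_side(1)[OF ax, of \<gamma> True Z] axs_side(1)[OF ax, of \<delta> True Z'] look S by simp_all
  then obtain As' Bs' f' where *: "axiom P As' Bs' f' cs (\<gamma> # ?ds @ [\<delta>])" "S = axs As' Bs' cs (\<gamma> # ?ds @ [\<delta>])"
      "Sim P S (Ax As Bs f cs ds) (Ax As' Bs' f' cs (\<gamma> # ?ds @ [\<delta>]))"
    using ax_arrange[OF ax S HOL.refl mset_ends[OF _ _ ne]] by metis
  have "length Bs' = length (\<gamma> # ?ds @ [\<delta>])" using *(1) unfolding axiom_def by (elim conjE) (rule HOL.sym)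
  then obtain x \<Delta> y where B: "Bs' = x # \<Delta> @ [y]" "length \<Delta> = length ?ds" by (rule list_ends)
  have "Z = Atom x"
    using look(1) axs_lookup_cod[of As' "[]" x "\<Delta> @ [y]" f' cs "[]" \<gamma> "?ds @ [\<delta>]"] * B by simp
  moreover have "Z' = Atom y"
    using look(2) axs_lookup_cod[of As' "x # \<Delta>" y "[]" f' cs "\<gamma> # ?ds" \<delta> "[]"] * B by simp
  ultimately show ?thesis using that * B(1) by blast
qed

lemma ax_dom_ends:
  assumes ax: "axiom P As Bs f cs ds" and S: "S = axs As Bs cs ds" and ne: "\<gamma> \<noteq> \<delta>"
    and look: "fmlookup S \<gamma> = Some (False, Z)" "fmlookup S \<delta> = Some (False, Z')"
  obtains x y \<Gamma> \<Delta> g cs' ds' where "Z = Atom x" "Z' = Atom y" "axiom P (x # \<Gamma> @ [y]) \<Delta> g (\<gamma> # cs' @ [\<delta>]) ds'"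
    "S = axs (x # \<Gamma> @ [y]) \<Delta> (\<gamma> # cs' @ [\<delta>]) ds'"
    "Sim P S (Ax As Bs f cs ds) (Ax (x # \<Gamma> @ [y]) \<Delta> g (\<gamma> # cs' @ [\<delta>]) ds')"
proof -
  let ?cs = "remove1 \<delta> (remove1 \<gamma> cs)"
  have "\<gamma> \<in> set cs" "\<delta> \<in> set cs"
    using axs_side(2)[OF ax, of \<gamma> False Z] axs_side(2)[OF ax, of \<delta> False Z'] look S by simp_all
  then obtain As' Bs' f' where *: "axiom P As' Bs' f' (\<gamma> # ?cs @ [\<delta>]) ds" "S = axs As' Bs' (\<gamma> # ?cs @ [\<delta>]) ds"
      "Sim P S (Ax As Bs f cs ds) (Ax As' Bs' f' (\<gamma> # ?cs @ [\<delta>]) ds)"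
    using ax_arrange[OF ax S mset_ends[OF _ _ ne] HOL.refl] by metis
  have "length As' = length (\<gamma> # ?cs @ [\<delta>])" using *(1) unfolding axiom_def by (elim conjE) (rule HOL.sym)
  then obtain x \<Gamma> y where A: "As' = x # \<Gamma> @ [y]" "length \<Gamma> = length ?cs" by (rule list_ends)
  have "Z = Atom x"
    using look(1) axs_lookup_dom[of "[]" x "\<Gamma> @ [y]" Bs' f' "[]" \<gamma> "?cs @ [\<delta>]" ds] * A by simp
  moreover have "Z' = Atom y"
    using look(2) axs_lookup_dom[of "x # \<Gamma>" y "[]" Bs' f' "\<gamma> # ?cs" \<delta> "[]" ds] * A by simp
  ultimately show ?thesis using that * A(1) by blast
qed

text \<open>By \<open>cut_law_cong\<close> each axiom may be replaced by a rearranged one with its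
  cut channels in the positions that the law in question expects. The case of two signs
  \<open>False\<close> is that of two signs \<open>True\<close> read backwards.\<close>

lemma cut_law_axioms:
  assumes ch: "chain s \<gamma> Z s' \<delta> Z' S T U"
    and f: "axiom P As Bs f cs ds" "S = axs As Bs cs ds"
    and g: "axiom P As' Bs' g cs' ds'" "T = axs As' Bs' cs' ds'"
    and h: "axiom P As'' Bs'' h cs'' ds''" "U = axs As'' Bs'' cs'' ds''"
  shows "cut_law P s \<gamma> Z s' \<delta> Z' S T U (Ax As Bs f cs ds) (Ax As' Bs' g cs' ds') (Ax As'' Bs'' h cs'' ds'')"
proof -
  have assoc: "cut_law P True \<gamma> Z True \<delta> Z' S T U (Ax As Bs f cs ds) (Ax As' Bs' g cs' ds') (Ax As'' Bs'' h cs'' ds'')"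
    if ch: "chain True \<gamma> Z True \<delta> Z' S T U"
      and f: "axiom P As Bs f cs ds" "S = axs As Bs cs ds"
      and g: "axiom P As' Bs' g cs' ds'" "T = axs As' Bs' cs' ds'"
      and h: "axiom P As'' Bs'' h cs'' ds''" "U = axs As'' Bs'' cs'' ds''"
    for \<gamma> Z \<delta> Z' S T U As Bs f cs ds As' Bs' g cs' ds' As'' Bs'' h cs'' ds''
  proof -
    have l: "fmlookup S \<gamma> = Some (True, Z)" "fmlookup T \<gamma> = Some (False, Z)"
       "fmlookup T \<delta> = Some (True, Z')" "fmlookup U \<delta> = Some (False, Z')"
      using chain_outer(1,2)[OF ch] by (simp_all add: cuttable_def)
    show ?thesis
    proof (rule ax_cod_last[OF f l(1)], goal_cases)
      case f: (1 x1 \<Gamma>1 \<Delta>1 f1 cs1 ds1)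
      show ?case
      proof (rule ax_dom_first_cod_last[OF g l(2,3)], goal_cases)
        case g: (1 x2 y2 \<Gamma>2 \<Delta>2 f2 cs2 ds2)
        show ?case
        proof (rule ax_dom_first[OF h l(4)], goal_cases)
          case h: (1 y3 \<Gamma>3 \<Delta>3 f3 cs3 ds3)
          have "x2 = x1" "y3 = y2" using f(1) g(1,2) h(1) by simp_all
          show ?case
            by (rule cut_law_cong[OF ch f(4) g(5) h(4)], unfold f(1) g(2) \<open>x2 = x1\<close> \<open>y3 = y2\<close>, rule ax_associativity)
              (use ch f g h \<open>x2 = x1\<close> \<open>y3 = y2\<close> in simp_all)
        qed
      qed
    qed
  qed
  have l: "fmlookup S \<gamma> = Some (s, Z)" "fmlookup T \<gamma> = Some (\<not> s, Z)"
     "fmlookup T \<delta> = Some (s', Z')" "fmlookup U \<delta> = Some (\<not> s', Z')"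
    using chain_outer(1,2)[OF ch] by (simp_all add: cuttable_def)
  have ne: "\<gamma> \<noteq> \<delta>" using ch unfolding chain_def by (elim conjE)
  consider "s = True" "s' = True" | "s = False" "s' = False" | "s = False" "s' = True" | "s = True" "s' = False"
    by (cases s; cases s') blast+
  then show ?thesis
  proof cases
    case 1
    show ?thesis unfolding 1 by (rule assoc[OF ch[unfolded 1] f g h])
  next
    case 2
    have ch': "chain True \<delta> Z' True \<gamma> Z U T S" using chain_flip[OF ch] 2 by simp
    show ?thesis by (rule cut_law_flip[OF ch]) (use assoc[OF ch' h g f] 2 in simp)
  next
    case 3
    have ch': "chain False \<gamma> Z True \<delta> Z' S T U" using ch 3 by simp
    have l: "fmlookup S \<gamma> = Some (False, Z)" "fmlookup T \<gamma> = Some (True, Z)"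
      "fmlookup T \<delta> = Some (True, Z')" "fmlookup U \<delta> = Some (False, Z')" using l 3 by simp_all
    show ?thesis unfolding 3
    proof (rule ax_dom_last[OF f l(1)], goal_cases)
      case f: (1 x1 \<Gamma>1 \<Delta>1 f1 cs1 ds1)
      show ?case
      proof (rule ax_cod_ends[OF g ne l(2,3)], goal_cases)
        case g: (1 x2 y2 \<Gamma>2 \<Delta>2 f2 cs2 ds2)
        show ?case
        proof (rule ax_dom_first[OF h l(4)], goal_cases)
          case h: (1 y3 \<Gamma>3 \<Delta>3 f3 cs3 ds3)
          have "x2 = x1" "y3 = y2" using f(1) g(1,2) h(1) by simp_all
          show ?case
            by (rule cut_law_cong[OF ch' f(4) g(5) h(4)], unfold f(1) g(2) \<open>x2 = x1\<close> \<open>y3 = y2\<close>, rule ax_interchange_codomain)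
              (use ch' f g h \<open>x2 = x1\<close> \<open>y3 = y2\<close> in simp_all)
        qed
      qed
    qed
  next
    case 4
    have ch': "chain True \<gamma> Z False \<delta> Z' S T U" using ch 4 by simp
    have l: "fmlookup S \<gamma> = Some (True, Z)" "fmlookup T \<gamma> = Some (False, Z)"
      "fmlookup T \<delta> = Some (False, Z')" "fmlookup U \<delta> = Some (True, Z')" using l 4 by simp_all
    show ?thesis unfolding 4
    proof (rule ax_cod_last[OF f l(1)], goal_cases)
      case f: (1 x1 \<Gamma>1 \<Delta>1 f1 cs1 ds1)
      show ?case
      proof (rule ax_dom_ends[OF g ne l(2,3)], goal_cases)
        case g: (1 x2 y2 \<Gamma>2 \<Delta>2 f2 cs2 ds2)
        show ?case
        proof (rule ax_cod_first[OF h l(4)], goal_cases)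
          case h: (1 y3 \<Gamma>3 \<Delta>3 f3 cs3 ds3)
          have "x2 = x1" "y3 = y2" using f(1) g(1,2) h(1) by simp_all
          show ?case
            by (rule cut_law_cong[OF ch' f(4) g(5) h(4)], unfold f(1) g(2) \<open>x2 = x1\<close> \<open>y3 = y2\<close>, rule ax_interchange_domain)
              (use ch' f g h \<open>x2 = x1\<close> \<open>y3 = y2\<close> in simp_all)
        qed
      qed
    qed
  qed
qed

section \<open>The cut laws for cut-free and for arbitrary derivations\<close>

lemma chain_principal:
  assumes ch: "chain s \<gamma> Z s' \<delta> Z' S T U"
  shows "chain s \<gamma> X s' \<delta> Z' (fmupd \<gamma> (s, X) S) (fmupd \<gamma> (\<not> s, X) T) U"
proof -
  have ne: "\<gamma> \<noteq> \<delta>" using ch unfolding chain_def by (elim conjE)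
  have dj: "fmdom S |\<inter>| fmdom U = {||}" using ch unfolding chain_def by (elim conjE)
  have S: "fmlookup S \<gamma> = Some (s, Z)" and T: "fmlookup T \<gamma> = Some (\<not> s, Z)"
    using chain_outer(1)[OF ch] by (simp_all add: cuttable_def)
  show ?thesis
    unfolding chain_def fmdom_fmupd_idle[OF S]
    by (intro conjI cuttable_principal(1)[OF chain_outer(1)[OF ch]] cuttable_fmupd(1)[OF chain_outer(2)[OF ch] T ne] dj ne)
qed

text \<open>\<open>IH\<close> leaves contexts, sign and cut formula at \<open>\<gamma>\<close> open:
  the reduced law is about a component, over contexts updated at \<open>\<gamma>\<close>, and the
  lemma is also applied to the flipped chain.\<close>

lemma cut_law_principal_cut_free:
  assumes ch: "chain s \<gamma> Z s' \<delta> Z' S T U" and wf: "wfs P S" "wfs P T" "wfs P U"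
    and f: "fmlookup S \<gamma> = Some (t, principal t \<kappa> (fam I X))" "branches \<kappa> I |\<subseteq>| I"
      "\<And>i. i |\<in>| branches \<kappa> I \<Longrightarrow> cut_free P (fmupd \<gamma> (t, X i) S) (f i)"
    and g: "fmlookup T \<gamma> = Some (t', principal t' \<kappa>' (fam J Y))" "branches \<kappa>' J |\<subseteq>| J"
      "\<And>i. i |\<in>| branches \<kappa>' J \<Longrightarrow> cut_free P (fmupd \<gamma> (t', Y i) T) (g i)"
    and h: "cut_free P U h"
    and IH: "\<And>k S' T' s Z. k |\<in>| branches \<kappa> I \<Longrightarrow> k |\<in>| branches \<kappa>' J
      \<Longrightarrow> cut_free P S' (f k) \<Longrightarrow> cut_free P T' (g k) \<Longrightarrow> chain s \<gamma> Z s' \<delta> Z' S' T' U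
      \<Longrightarrow> cut_law P s \<gamma> Z s' \<delta> Z' S' T' U (f k) (g k) h"
  shows "cut_law P s \<gamma> Z s' \<delta> Z' S T U (node t \<gamma> \<kappa> I f) (node t' \<gamma> \<kappa>' J g) h"
proof -
  have l: "fmlookup S \<gamma> = Some (s, Z)" "fmlookup T \<gamma> = Some (\<not> s, Z)"
    using chain_outer(1)[OF ch] by (simp_all add: cuttable_def)
  have t: "t = s" "t' = (\<not> s)" and Z: "Z = principal s \<kappa> (fam I X)" and Z': "Z = principal (\<not> s) \<kappa>' (fam J Y)"
    using f(1)[unfolded l(1)] g(1)[unfolded l(2)] by simp_all
  have eq: "fam J Y = fam I X" and dual: "(\<kappa> = None) \<noteq> (\<kappa>' = None)"
    using Z' unfolding Z principal_simps by auto
  have J: "J = I" and Y: "\<And>i. i |\<in>| I \<Longrightarrow> Y i = X i" using eq by (auto simp: fam_eq_iff)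
  obtain k where k: "k |\<in>| I" "k |\<in>| branches \<kappa> I" "k |\<in>| branches \<kappa>' I"
    using dual f(2) g(2) J by (cases \<kappa>; cases \<kappa>') auto
  have fp: "cut_free P (fmupd \<gamma> (s, X i) S) (f i)" if "i |\<in>| branches \<kappa> I" for i
    using f(3)[OF that] unfolding t .
  have gp: "cut_free P (fmupd \<gamma> (\<not> s, X i) T) (g i)" if "i |\<in>| branches \<kappa>' I" for i
  proof -
    have b: "i |\<in>| branches \<kappa>' J" "i |\<in>| I" using that g(2) unfolding J by auto
    from g(3)[OF b(1)] show ?thesis unfolding t Y[OF b(2)] .
  qed
  show ?thesis
    unfolding t J Z
  proof (rule cut_law_principal[OF ch[unfolded Z] dual wf f(2) g(2)[unfolded J] k])
    show "Der P (fmupd \<gamma> (s, X i) S) (f i)" if "i |\<in>| branches \<kappa> I" for i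
      by (rule cut_free_Der[OF fp[OF that]])
    show "Der P (fmupd \<gamma> (\<not> s, X i) T) (g i)" if "i |\<in>| branches \<kappa>' I" for i
      by (rule cut_free_Der[OF gp[OF that]])
    show "Der P U h" by (rule cut_free_Der[OF h])
    show "cut_law P s \<gamma> (X k) s' \<delta> Z' (fmupd \<gamma> (s, X k) S) (fmupd \<gamma> (\<not> s, X k) T) U (f k) (g k) h"
      by (rule IH[OF k(2) k(3)[folded J] fp[OF k(2)] gp[OF k(3)] chain_principal[OF ch]])
  qed
qed

lemma cut_free_nodeE:
  assumes "cut_free P S t"
  obtains (ax) As Bs f cs ds where "t = Ax As Bs f cs ds" "axiom P As Bs f cs ds" "S = axs As Bs cs ds"
  | (node) \<alpha> s \<kappa> I X f where "t = node s \<alpha> \<kappa> I f" "fmlookup S \<alpha> = Some (s, principal s \<kappa> (fam I X))"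
      "branches \<kappa> I |\<subseteq>| I" "\<And>i. i |\<in>| branches \<kappa> I \<Longrightarrow> cut_free P (fmupd \<alpha> (s, X i) S) (f i)"
  using assms by cases blast+

text \<open>The last rule of the middle derivation \<open>g\<close> decides. At neither cut channel,
  it is pushed out. At \<open>\<gamma>\<close>, the cut formula is compound, so \<open>f\<close>
  also ends with a rule, which either matches or is pushed out; \<open>\<delta>\<close> is
  symmetric. If \<open>g\<close> is an axiom, both cut formulas are atoms, and a last rule of
  \<open>f\<close> or \<open>h\<close> is never at a cut channel.\<close>

lemma cut_law_cut_free:
  assumes "cut_free P S f" "cut_free P T g" "cut_free P U h" "chain s \<gamma> Z s' \<delta> Z' S T U"
  shows "cut_law P s \<gamma> Z s' \<delta> Z' S T U f g h"
  using assms
proof (induction "size f + size g + size h" arbitrary: s \<gamma> Z s' \<delta> Z' S T U f g h rule: less_induct)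
  case less
  note ch = less.prems(4) and c = chain_outer(1,2)[OF less.prems(4)]
  have wf: "wfs P S" "wfs P T" "wfs P U" and D: "Der P S f" "Der P T g" "Der P U h"
    using less.prems(1-3) cut_free_wfs cut_free_Der by blast+
  have ne: "\<gamma> \<noteq> \<delta>" using ch unfolding chain_def by (elim conjE)
  have l: "fmlookup S \<gamma> = Some (s, Z)" "fmlookup T \<gamma> = Some (\<not> s, Z)"
     "fmlookup T \<delta> = Some (s', Z')" "fmlookup U \<delta> = Some (\<not> s', Z')"
    using c by (simp_all add: cuttable_def)
  have f_node: ?case if f: "f = node t \<alpha> \<kappa> I f'" and S: "fmlookup S \<alpha> = Some (t, principal t \<kappa> (fam I X))"
      and sub: "branches \<kappa> I |\<subseteq>| I" and prem: "\<And>i. i |\<in>| branches \<kappa> I \<Longrightarrow> cut_free P (fmupd \<alpha> (t, X i) S) (f' i)"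
      and ne: "\<alpha> \<noteq> \<gamma>" for t \<alpha> \<kappa> I X f'
    unfolding f
  proof (rule cut_law_node_left[OF ch S wf sub ne cut_free_Der[OF prem] D(2,3)])
    fix i assume i: "i |\<in>| branches \<kappa> I"
    have "size (f' i) < size f" unfolding f by (rule size_node[OF i])
    then have small: "size (f' i) + size g + size h < size f + size g + size h" by simp
    show "cut_law P s \<gamma> Z s' \<delta> Z' (fmupd \<alpha> (t, X i) S) T U (f' i) g h"
      by (rule less.hyps[OF small prem[OF i] less.prems(2,3) chain_fmupd[OF ch S ne]])
  qed
  have h_node: ?case if h: "h = node t \<alpha> \<kappa> I f'" and U: "fmlookup U \<alpha> = Some (t, principal t \<kappa> (fam I X))"
      and sub: "branches \<kappa> I |\<subseteq>| I" and prem: "\<And>i. i |\<in>| branches \<kappa> I \<Longrightarrow> cut_free P (fmupd \<alpha> (t, X i) U) (f' i)"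
      and ne: "\<alpha> \<noteq> \<delta>" for t \<alpha> \<kappa> I X f'
    unfolding h
  proof (rule cut_law_flip[OF ch],
      rule cut_law_node_left[OF chain_flip[OF ch] U wf(3,2,1) sub ne cut_free_Der[OF prem] D(2,1)])
    fix i assume i: "i |\<in>| branches \<kappa> I"
    have "size (f' i) < size h" unfolding h by (rule size_node[OF i])
    then have small: "size (f' i) + size g + size f < size f + size g + size h" by simp
    show "cut_law P (\<not> s') \<delta> Z' (\<not> s) \<gamma> Z (fmupd \<alpha> (t, X i) U) T S (f' i) g f"
      by (rule less.hyps[OF small prem[OF i] less.prems(2,1) chain_fmupd[OF chain_flip[OF ch] U ne]])
  qed
  have g_node: ?case if g: "g = node t \<alpha> \<kappa> I g'" and T: "fmlookup T \<alpha> = Some (t, principal t \<kappa> (fam I X))"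
      and sub: "branches \<kappa> I |\<subseteq>| I" and prem: "\<And>i. i |\<in>| branches \<kappa> I \<Longrightarrow> cut_free P (fmupd \<alpha> (t, X i) T) (g' i)"
      and ne: "\<alpha> \<noteq> \<gamma>" "\<alpha> \<noteq> \<delta>" for t \<alpha> \<kappa> I X g'
    unfolding g
  proof (rule cut_law_node_middle[OF ch T wf sub ne cut_free_Der[OF prem] D(1,3)])
    fix i assume i: "i |\<in>| branches \<kappa> I"
    have "size (g' i) < size g" unfolding g by (rule size_node[OF i])
    then have small: "size f + size (g' i) + size h < size f + size g + size h" by simp
    show "cut_law P s \<gamma> Z s' \<delta> Z' S (fmupd \<alpha> (t, X i) T) U f (g' i) h"
      by (rule less.hyps[OF small less.prems(1) prem[OF i] less.prems(3) chain_fmupd_middle[OF ch T ne]])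
  qed
  from less.prems(2) show ?case
  proof (cases rule: cut_free_nodeE)
    case g: (node \<beta> t \<kappa> J Y g')
    consider "\<beta> = \<gamma>" | "\<beta> = \<delta>" | "\<beta> \<noteq> \<gamma>" "\<beta> \<noteq> \<delta>" by blast
    then show ?thesis
    proof cases
      case \<beta>: 1
      from less.prems(1) show ?thesis
      proof (cases rule: cut_free_nodeE)
        case ax
        then obtain x where "Z = Atom x" using axs_atom[OF ax(2)] l(1) unfolding ax(3) by blast
        then show ?thesis using g(2) l(2) unfolding \<beta> by simp
      next
        case f: (node \<alpha> t' \<kappa>' I X f')
        show ?thesis
        proof (cases "\<alpha> = \<gamma>")
          case False
          then show ?thesis using f_node[OF f] by blast
        next
          case \<alpha>: True
          show ?thesis
            unfolding f(1) g(1) \<alpha> \<beta>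
          proof (rule cut_law_principal_cut_free[OF ch wf f(2)[unfolded \<alpha>] f(3) f(4)[unfolded \<alpha>]
                g(2)[unfolded \<beta>] g(3) g(4)[unfolded \<beta>] less.prems(3)])
            fix k S' T' s Z
            assume k: "k |\<in>| branches \<kappa>' I" "k |\<in>| branches \<kappa> J" and
              *: "cut_free P S' (f' k)" "cut_free P T' (g' k)" "chain s \<gamma> Z s' \<delta> Z' S' T' U"
            have "size (f' k) < size f" "size (g' k) < size g"
              unfolding f(1) g(1) by (rule size_node[OF k(1)], rule size_node[OF k(2)])
            then have small: "size (f' k) + size (g' k) + size h < size f + size g + size h" by simp
            show "cut_law P s \<gamma> Z s' \<delta> Z' S' T' U (f' k) (g' k) h"
              by (rule less.hyps[OF small *(1,2) less.prems(3) *(3)])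
          qed
        qed
      qed
    next
      case \<beta>: 2
      from less.prems(3) show ?thesis
      proof (cases rule: cut_free_nodeE)
        case ax
        then obtain x where "Z' = Atom x" using axs_atom[OF ax(2)] l(4) unfolding ax(3) by blast
        then show ?thesis using g(2) l(3) unfolding \<beta> by simp
      next
        case h: (node \<alpha> t' \<kappa>' I X h')
        show ?thesis
        proof (cases "\<alpha> = \<delta>")
          case False
          then show ?thesis using h_node[OF h] by blast
        next
          case \<alpha>: True
          show ?thesis
            unfolding h(1) g(1) \<alpha> \<beta>
          proof (rule cut_law_flip[OF ch], rule cut_law_principal_cut_free[OF chain_flip[OF ch] wf(3,2,1)
                h(2)[unfolded \<alpha>] h(3) h(4)[unfolded \<alpha>] g(2)[unfolded \<beta>] g(3) g(4)[unfolded \<beta>] less.prems(1)])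
            fix k S' T' t Z'
            assume k: "k |\<in>| branches \<kappa>' I" "k |\<in>| branches \<kappa> J" and
              *: "cut_free P S' (h' k)" "cut_free P T' (g' k)" "chain t \<delta> Z' (\<not> s) \<gamma> Z S' T' S"
            have "size (h' k) < size h" "size (g' k) < size g"
              unfolding h(1) g(1) by (rule size_node[OF k(1)], rule size_node[OF k(2)])
            then have small: "size (h' k) + size (g' k) + size f < size f + size g + size h" by simp
            show "cut_law P t \<delta> Z' (\<not> s) \<gamma> Z S' T' S (h' k) (g' k) f"
              by (rule less.hyps[OF small *(1,2) less.prems(1) *(3)])
          qed
        qed
      qed
    next
      case 3
      then show ?thesis using g_node[OF g] by blast
    qed
  next
    case g: ax
    obtain x where x: "Z = Atom x" using axs_atom[OF g(2)] l(2) unfolding g(3) by blast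
    obtain y where y: "Z' = Atom y" using axs_atom[OF g(2)] l(3) unfolding g(3) by blast
    from less.prems(1) show ?thesis
    proof (cases rule: cut_free_nodeE)
      case f: (node \<alpha> t \<kappa> I X f')
      have "\<alpha> \<noteq> \<gamma>" using f(2) l(1) x by auto
      then show ?thesis using f_node[OF f] by blast
    next
      case f: ax
      from less.prems(3) show ?thesis
      proof (cases rule: cut_free_nodeE)
        case h: (node \<alpha> t \<kappa> I X f')
        have "\<alpha> \<noteq> \<delta>" using h(2) l(4) y by auto
        then show ?thesis using h_node[OF h] by blast
      next
        case h: ax
        show ?thesis unfolding f(1) g(1) h(1) by (rule cut_law_axioms[OF ch f(2,3) g(2,3) h(2,3)])
      qed
    qed
  qed
qed

lemma cut_law:
  assumes "Der P S f" "Der P T g" "Der P U h" and ch: "chain s \<gamma> Z s' \<delta> Z' S T U"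
  shows "cut_law P s \<gamma> Z s' \<delta> Z' S T U f g h"
proof -
  obtain f' g' h' where "cut_free P S f'" "Sim P S f f'" "cut_free P T g'" "Sim P T g g'"
    "cut_free P U h'" "Sim P U h h'"
    using cut_elimination assms(1-3) by meson
  then show ?thesis using cut_law_cong[OF ch _ _ _ cut_law_cut_free[OF _ _ _ ch]] by blast
qed

subsection \<open>Identity derivations\<close>

text \<open>Arranges the arguments so that \<open>\<gamma>\<close> is the channel to be cut and
  \<open>\<beta>\<close> the one that remains, whichever side \<open>s\<close> the partner has
  \<open>\<gamma>\<close> on.\<close>

definition giota :: "bool \<Rightarrow> 'o form \<Rightarrow> chan \<Rightarrow> chan \<Rightarrow> ('o, 'm) der" where
  "giota s Z \<gamma> \<beta> = (if s then iota P Z \<gamma> \<beta> else iota P Z \<beta> \<gamma>)"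

text \<open>An identity begins with a (co)tupling, at the channel where the connective permits one.
  If the partner makes a choice at \<open>\<gamma>\<close>, this is \<open>\<gamma>\<close> itself
  and the rules match at once. If the partner is a (co)tupling at \<open>\<gamma>\<close>, it is
  \<open>\<beta>\<close>, and the outer rule of the identity first has to leave the cut.\<close>

lemma giota_Some:
  "giota s (principal s (Some k) (fam I X)) \<gamma> \<beta>
    = node (\<not> s) \<gamma> None I (\<lambda>i. node s \<beta> (Some i) I (\<lambda>_. giota s (X i) \<gamma> \<beta>))"
  by (cases s) (simp_all add: giota_def principal_def node_def fmmap_fam fmmap_keys_fam)

lemma giota_None:
  "giota s (principal s None (fam I X)) \<gamma> \<beta>
    = node s \<beta> None I (\<lambda>i. node (\<not> s) \<gamma> (Some i) I (\<lambda>_. giota s (X i) \<gamma> \<beta>))"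
  by (cases s) (simp_all add: giota_def principal_def node_def fmmap_fam fmmap_keys_fam)

lemma formulas_principal: "principal s \<kappa> (fam I X) \<in> formulas P \<longleftrightarrow> (\<forall>i. i |\<in>| I \<longrightarrow> X i \<in> formulas P)"
  by (auto simp: principal_def formulas_def fmran'_fam)

lemma wfs_idctx: "Z \<in> formulas P \<Longrightarrow> wfs P (idctx s Z \<gamma> \<beta>)"
  by (auto simp: wfs_def idctx_def split: if_splits)

lemma Der_giota:
  assumes "Z \<in> formulas P" "\<gamma> \<noteq> \<beta>"
  shows "Der P (idctx s Z \<gamma> \<beta>) (giota s Z \<gamma> \<beta>)"
  using assms(1)
proof (induction "size Z" arbitrary: Z rule: less_induct)
  case less
  show ?case
  proof (cases rule: form_cases[where Z=Z and s=s])
    case (atom x)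
    then have x: "x \<in> Ob P" using less.prems by (simp add: formulas_def)
    have *: "axiom P [x] [x] (Idn P x) [\<alpha>] [\<alpha>']" if "\<alpha> \<noteq> \<alpha>'" for \<alpha> \<alpha>' :: chan
      using Idn_Hom[OF x] that by (simp add: axiom_def)
    have "idctx s Z \<gamma> \<beta> = (if s then axs [x] [x] [\<gamma>] [\<beta>] else axs [x] [x] [\<beta>] [\<gamma>])"
      by (rule fmap_ext) (use assms(2) atom in \<open>auto simp: idctx_def axs_def signed_def label_def\<close>)
    then show ?thesis using Der_ax[OF *] assms(2) atom by (simp add: giota_def)
  next
    case node: (node \<kappa> I X)
    have IH: "Der P (idctx s (X i) \<gamma> \<beta>) (giota s (X i) \<gamma> \<beta>)" if "i |\<in>| I" for i
      by (rule less.hyps) (use size_form_fam[OF that] node less.prems that formulas_principal in auto)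
    have fX: "X i \<in> formulas P" if "i |\<in>| I" for i
      using less.prems that unfolding node formulas_principal by blast
    have wf: "wfs P (idctx s Z \<gamma> \<beta>)" by (rule wfs_idctx[OF less.prems])
    show ?thesis
    proof (cases \<kappa>)
      case None
      show ?thesis
        unfolding node None giota_None
      proof (rule Der_node)
        fix i assume "i |\<in>| branches None I"
        then have i: "i |\<in>| I" by simp
        show "Der P (fmupd \<beta> (s, X i) (idctx s (principal s None (fam I X)) \<gamma> \<beta>))
            (node (\<not> s) \<gamma> (Some i) I (\<lambda>_. giota s (X i) \<gamma> \<beta>))"
        proof (rule Der_node)
          show "Der P (fmupd \<gamma> (\<not> s, X j) (fmupd \<beta> (s, X i) (idctx s (principal s None (fam I X)) \<gamma> \<beta>))) (giota s (X i) \<gamma> \<beta>)"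
            if "j |\<in>| branches (Some i) I" for j using IH[OF i] that by (simp add: idctx_upd(1))
        qed (use i assms(2) wfs_fmupd[OF wf[unfolded node None] fX[OF i], of \<beta> s] in \<open>simp_all add: idctx_def\<close>)
      qed (use assms(2) wf[unfolded node None] in \<open>simp_all add: idctx_def\<close>)
    next
      case (Some k)
      show ?thesis
        unfolding node Some giota_Some
      proof (rule Der_node)
        fix i assume "i |\<in>| branches None I"
        then have i: "i |\<in>| I" by simp
        show "Der P (fmupd \<gamma> (\<not> s, X i) (idctx s (principal s (Some k) (fam I X)) \<gamma> \<beta>))
            (node s \<beta> (Some i) I (\<lambda>_. giota s (X i) \<gamma> \<beta>))"
        proof (rule Der_node)
          show "Der P (fmupd \<beta> (s, X j) (fmupd \<gamma> (\<not> s, X i) (idctx s (principal s (Some k) (fam I X)) \<gamma> \<beta>))) (giota s (X i) \<gamma> \<beta>)"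
            if "j |\<in>| branches (Some i) I" for j using IH[OF i] that by (simp add: idctx_upd(2)[OF assms(2)])
        qed (use i assms(2) wfs_fmupd[OF wf[unfolded node Some] fX[OF i], of \<gamma> "\<not> s"] in \<open>simp_all add: idctx_def\<close>)
      qed (use assms(2) wf[unfolded node Some] in \<open>simp_all add: idctx_def\<close>)
    qed
  qed
qed

text \<open>\<open>\<beta>\<close> is fresh, so on the channels of \<open>S\<close> the swap
  replaces \<open>\<gamma>\<close> by \<open>\<beta>\<close>, which is the effect of a cut with an
  identity on the sequent.\<close>

lemma cuttable_idctx:
  assumes "fmlookup S \<gamma> = Some (s, Z)" "\<beta> |\<notin>| fmdom S"
  shows "cuttable s \<gamma> Z S (idctx s Z \<gamma> \<beta>)" "\<gamma> \<noteq> \<beta>"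
    "join \<gamma> S (idctx s Z \<gamma> \<beta>) = relabel (transpose \<gamma> \<beta>) S"
proof -
  show ne: "\<gamma> \<noteq> \<beta>" using assms fmdomI by metis
  show "cuttable s \<gamma> Z S (idctx s Z \<gamma> \<beta>)"
    unfolding cuttable_def idctx_simps[OF ne] using assms fmdomI[OF assms(1)] by (auto simp: fset_eq_iff)
  have no: "fmlookup S \<beta> = None" using assms(2) by (rule fmdom_notD)
  have inv: "transpose \<gamma> \<beta> (transpose \<gamma> \<beta> c) = c" for c by simp
  have look: "fmlookup (relabel (transpose \<gamma> \<beta>) S) c = fmlookup S (transpose \<gamma> \<beta> c)" for c
    using fmlookup_relabel_app[OF inj_on_transpose, of \<gamma> \<beta> S "transpose \<gamma> \<beta> c"] unfolding inv .
  show "join \<gamma> S (idctx s Z \<gamma> \<beta>) = relabel (transpose \<gamma> \<beta>) S"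
    by (rule fmap_ext) (use ne no assms(1) in \<open>auto simp: look join_def idctx_def transpose_def\<close>)
qed

text \<open>\<open>r1\<close> and \<open>r2\<close> cover atoms. Against a rule of \<open>f\<close>
  at \<open>\<gamma>\<close> the identity unfolds by one layer: the rule reappears at
  \<open>\<beta>\<close>, above it are cuts with the identities of the components, and these are
  handled by the induction hypothesis for the premises of \<open>f\<close>.\<close>

lemma cut_giota:
  assumes "cut_free P S f" "fmlookup S \<gamma> = Some (s, Z)" "\<beta> |\<notin>| fmdom S"
  shows "Sim P (join \<gamma> S (idctx s Z \<gamma> \<beta>))
    (gcut s \<gamma> Z (fmdom S) (fmdom (idctx s Z \<gamma> \<beta>)) f (giota s Z \<gamma> \<beta>)) (rename (transpose \<gamma> \<beta>) f)"
  using assms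
proof (induction "size f" arbitrary: S f s Z rule: less_induct)
  case less
  note l = less.prems(2) and \<beta> = less.prems(3)
  note cut = cuttable_idctx(1)[OF l \<beta>] and ne = cuttable_idctx(2)[OF l \<beta>] and ctx = cuttable_idctx(3)[OF l \<beta>]
  let ?C = "idctx s Z \<gamma> \<beta>"
  have wf: "wfs P S" and D: "Der P S f" using less.prems(1) cut_free_wfs cut_free_Der by blast+
  have Z: "Z \<in> formulas P" using wf l unfolding wfs_def by blast
  have wfC: "wfs P ?C" by (rule wfs_idctx[OF Z])
  have DC: "Der P ?C (giota s Z \<gamma> \<beta>)" by (rule Der_giota[OF Z ne])
  from less.prems(1) show ?case
  proof (cases rule: cut_free_nodeE)
    case (ax As Bs a cs ds)
    obtain x where x: "Z = Atom x" using axs_atom[OF ax(2)] l unfolding ax(3) by blast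
    show ?thesis
    proof (rule Sim_rule)
      show "Der P (join \<gamma> S ?C) (gcut s \<gamma> Z (fmdom S) (fmdom ?C) f (giota s Z \<gamma> \<beta>))"
        by (rule Der_gcut[OF cut D DC])
      show "Der P (join \<gamma> S ?C) (rename (transpose \<gamma> \<beta>) f)"
        unfolding ctx by (rule Der_rename[OF D inj_on_transpose])
      show "rewr P (gcut s \<gamma> Z (fmdom S) (fmdom ?C) f (giota s Z \<gamma> \<beta>)) (rename (transpose \<gamma> \<beta>) f)"
        unfolding x by (cases s) (simp_all add: gcut_def giota_def rewr.r1 rewr.r2)
    qed
  next
    case (node \<alpha> t \<kappa> I X f')
    have size: "size (f' i) < size f" if "i |\<in>| branches \<kappa> I" for i
      unfolding node(1) by (rule size_node[OF that])
    show ?thesis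
    proof (cases "\<alpha> = \<gamma>")
      case False
      have "\<alpha> \<noteq> \<beta>" using node(2) \<beta> fmdomI by metis
      then have tr: "transpose \<gamma> \<beta> \<alpha> = \<alpha>" using False by (simp add: transpose_def)
      have jl: "fmlookup (join \<gamma> S ?C) \<alpha> = Some (t, principal t \<kappa> (fam I X))"
        using node(2) False unfolding fmlookup_join[OF cut] by blast
      have "Sim P (join \<gamma> S ?C) (gcut s \<gamma> Z (fmdom S) (fmdom ?C) f (giota s Z \<gamma> \<beta>))
          (node t \<alpha> \<kappa> I (\<lambda>i. gcut s \<gamma> Z (fmdom S) (fmdom ?C) (f' i) (giota s Z \<gamma> \<beta>)))"
        unfolding node(1) by (rule Sim_push[OF cut node(2) wf wfC node(3) False cut_free_Der[OF node(4)] DC])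
      also have "Sim P (join \<gamma> S ?C) \<dots> (node t \<alpha> \<kappa> I (\<lambda>i. rename (transpose \<gamma> \<beta>) (f' i)))"
      proof (rule Sim_node[OF jl wfs_join[OF cut wf wfC] node(3)])
        fix i assume i: "i |\<in>| branches \<kappa> I"
        have l': "fmlookup (fmupd \<alpha> (t, X i) S) \<gamma> = Some (s, Z)" using l False by simp
        have \<beta>': "\<beta> |\<notin>| fmdom (fmupd \<alpha> (t, X i) S)" unfolding fmdom_fmupd_idle[OF node(2)] by (rule \<beta>)
        show "Sim P (fmupd \<alpha> (t, X i) (join \<gamma> S ?C))
          (gcut s \<gamma> Z (fmdom S) (fmdom ?C) (f' i) (giota s Z \<gamma> \<beta>)) (rename (transpose \<gamma> \<beta>) (f' i))"
          using less.hyps[OF size[OF i] node(4)[OF i] l' \<beta>']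
          unfolding fmdom_fmupd_idle[OF node(2)] cuttable_fmupd(2)[OF cut node(2) False] .
      qed
      finally show ?thesis unfolding node(1) rename_node tr .
    next
      case True
      have t: "t = s" and Zp: "Z = principal s \<kappa> (fam I X)" using node(2) l True by simp_all
      have S\<gamma>: "fmlookup S \<gamma> = Some (s, principal s \<kappa> (fam I X))" using l Zp by simp
      have fp: "cut_free P (fmupd \<gamma> (s, X i) S) (f' i)" if "i |\<in>| branches \<kappa> I" for i
        using node(4)[OF that] unfolding True t .
      have IH: "Sim P (join \<gamma> (fmupd \<gamma> (s, X i) S) (idctx s (X i) \<gamma> \<beta>))
          (gcut s (\<gamma>) (X i) (fmdom S) (fmdom ?C) (f' i) (giota s (X i) \<gamma> \<beta>)) (rename (transpose \<gamma> \<beta>) (f' i))"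
        if i: "i |\<in>| branches \<kappa> I" for i
      proof -
        have l': "fmlookup (fmupd \<gamma> (s, X i) S) \<gamma> = Some (s, X i)" by simp
        have \<beta>': "\<beta> |\<notin>| fmdom (fmupd \<gamma> (s, X i) S)" unfolding fmdom_fmupd_idle[OF S\<gamma>] by (rule \<beta>)
        show ?thesis
          using less.hyps[OF size[OF i] fp[OF i] l' \<beta>'] unfolding fmdom_fmupd_idle[OF S\<gamma>] idctx_simps(3)[OF ne] .
      qed
      have fX: "X i \<in> formulas P" if "i |\<in>| I" for i using Z that unfolding Zp formulas_principal by blast
      have upd: "fmupd \<beta> (s, Y) (join \<gamma> S ?C) = join \<gamma> (fmupd \<gamma> (s, Y) S) (idctx s Y \<gamma> \<beta>)" for Y
        by (rule fmap_ext) (use ne in \<open>auto simp: join_def idctx_def\<close>)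
      have jl: "fmlookup (join \<gamma> S ?C) \<beta> = Some (s, principal s \<kappa> (fam I X))"
        using idctx_simps(2)[OF ne] ne Zp unfolding fmlookup_join[OF cut] by blast
      have last: "Sim P (join \<gamma> S ?C) (node s \<beta> \<kappa> I (\<lambda>i. gcut s \<gamma> (X i) (fmdom S) (fmdom ?C) (f' i) (giota s (X i) \<gamma> \<beta>)))
          (node s \<beta> \<kappa> I (\<lambda>i. rename (transpose \<gamma> \<beta>) (f' i)))"
        by (rule Sim_node[OF jl wfs_join[OF cut wf wfC] node(3)]) (unfold upd, rule IH)
      have "Sim P (join \<gamma> S ?C) (gcut s \<gamma> Z (fmdom S) (fmdom ?C) (node s \<gamma> \<kappa> I f') (giota s Z \<gamma> \<beta>))
          (node s \<beta> \<kappa> I (\<lambda>i. gcut s \<gamma> (X i) (fmdom S) (fmdom ?C) (f' i) (giota s (X i) \<gamma> \<beta>)))"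
      proof (cases \<kappa>)
        \<comment> \<open>Match first: the (co)tupling of the identity yields its branch
          \<open>k\<close>, a choice at \<open>\<beta>\<close>, which is then pushed out.\<close>
        case (Some k)
        have k: "k |\<in>| I" "k |\<in>| branches (Some k) I" "k |\<in>| branches None I" using node(3) Some by simp_all
        have cut0: "cuttable s \<gamma> (principal s (Some k) (fam I X)) S ?C" using cut unfolding Zp Some .
        note cut1 = cuttable_principal(1)[OF cut, of "X k"]
        have C\<beta>: "fmlookup (fmupd \<gamma> (\<not> s, X i) ?C) \<beta> = Some (s, principal s (Some i) (fam I X))" for i
          using ne Zp Some by (simp add: idctx_def)
        have wf1: "wfs P (fmupd \<gamma> (s, X k) S)" "wfs P (fmupd \<gamma> (\<not> s, X i) ?C)" if "i |\<in>| I" for i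
          by (rule wfs_fmupd[OF wf fX[OF k(1)]], rule wfs_fmupd[OF wfC fX[OF that]])
        have D1: "Der P (fmupd \<beta> (s, X j) (fmupd \<gamma> (\<not> s, X i) ?C)) (giota s (X i) \<gamma> \<beta>)"
          if "i |\<in>| I" "j |\<in>| branches (Some i) I" for i j
          using Der_giota[OF fX[OF that(1)] ne] that(2) by (simp add: idctx_upd(2)[OF ne])
        have D2: "Der P (fmupd \<gamma> (\<not> s, X i) ?C) (node s \<beta> (Some i) I (\<lambda>_. giota s (X i) \<gamma> \<beta>))"
          if "i |\<in>| I" for i
          by (rule Der_node[OF C\<beta> wf1(2)[OF that] _ D1[OF that]]) (use that in simp_all)
        have D3: "Der P (fmupd \<gamma> (s, X i) S) (f' i)" if "i |\<in>| branches (Some k) I" for i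
          using cut_free_Der[OF fp] that unfolding Some by blast
        have "Sim P (join \<gamma> S ?C)
            (gcut s \<gamma> (principal s (Some k) (fam I X)) (fmdom S) (fmdom ?C) (node s \<gamma> (Some k) I f')
              (node (\<not> s) \<gamma> None I (\<lambda>i. node s \<beta> (Some i) I (\<lambda>_. giota s (X i) \<gamma> \<beta>))))
            (gcut s \<gamma> (X k) (fmdom S) (fmdom ?C) (f' k) (node s \<beta> (Some k) I (\<lambda>_. giota s (X k) \<gamma> \<beta>)))"
          by (rule Sim_principal_cases[OF cut0 _ wf wfC k D3 D2]) simp_all
        also have "Sim P (join \<gamma> S ?C) \<dots>
            (node s \<beta> (Some k) I (\<lambda>_. gcut s \<gamma> (X k) (fmdom S) (fmdom ?C) (f' k) (giota s (X k) \<gamma> \<beta>)))"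
          using Sim_push_right[OF cut1 C\<beta> wf1[OF k(1)] _ not_sym[OF ne] D1[OF k(1)] D3[OF k(2)], unfolded
              cuttable_principal(2)[OF cut] fmdom_fmupd_idle[OF S\<gamma>] fmdom_fmupd_idle[OF idctx_simps(1)[OF ne]]]
            k(1) by simp
        finally show ?thesis unfolding Zp Some giota_Some by (simp add: node_def)
      next
        \<comment> \<open>Push first: the identity begins with a (co)tupling at
          \<open>\<beta>\<close>, and in each branch its choice at \<open>\<gamma>\<close> selects
          the premise \<open>f' i\<close>.\<close>
        case None
        have C\<beta>: "fmlookup ?C \<beta> = Some (s, principal s None (fam I X))"
          using ne Zp None by (simp add: idctx_def)
        have C\<gamma>: "fmlookup (fmupd \<beta> (s, X i) ?C) \<gamma> = Some (\<not> s, principal (\<not> s) (Some i) (fam I X))" for i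
          using ne Zp None by (simp add: idctx_def)
        have wf1: "wfs P (fmupd \<beta> (s, X i) ?C)" if "i |\<in>| I" for i
          by (rule wfs_fmupd[OF wfC fX[OF that]])
        have D1: "Der P (fmupd \<gamma> (\<not> s, X j) (fmupd \<beta> (s, X i) ?C)) (giota s (X i) \<gamma> \<beta>)"
          if "i |\<in>| I" "j |\<in>| branches (Some i) I" for i j
          using Der_giota[OF fX[OF that(1)] ne] that(2) by (simp add: idctx_upd(1))
        have D2: "Der P (fmupd \<beta> (s, X i) ?C) (node (\<not> s) \<gamma> (Some i) I (\<lambda>_. giota s (X i) \<gamma> \<beta>))"
          if "i |\<in>| branches None I" for i
          by (rule Der_node[OF C\<gamma> wf1 _ D1]) (use that in simp_all)
        have D3: "Der P (fmupd \<gamma> (s, X i) S) (f' i)" if "i |\<in>| branches None I" for i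
          using cut_free_Der[OF fp] that unfolding None by blast
        have Df: "Der P S (node s \<gamma> None I f')" using D unfolding node(1) True t None .
        have sub: "branches None I |\<subseteq>| I" by simp
        have "Sim P (join \<gamma> S ?C) (gcut s \<gamma> Z (fmdom S) (fmdom ?C) (node s \<gamma> None I f')
              (node s \<beta> None I (\<lambda>i. node (\<not> s) \<gamma> (Some i) I (\<lambda>_. giota s (X i) \<gamma> \<beta>))))
            (node s \<beta> None I (\<lambda>i. gcut s \<gamma> Z (fmdom S) (fmdom ?C) (node s \<gamma> None I f')
              (node (\<not> s) \<gamma> (Some i) I (\<lambda>_. giota s (X i) \<gamma> \<beta>))))"
          by (rule Sim_push_right[OF cut C\<beta> wf wfC sub not_sym[OF ne] D2 Df])
        also have "Sim P (join \<gamma> S ?C) \<dots>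
            (node s \<beta> None I (\<lambda>i. gcut s \<gamma> (X i) (fmdom S) (fmdom ?C) (f' i) (giota s (X i) \<gamma> \<beta>)))"
        proof (rule Sim_node[OF jl[unfolded None] wfs_join[OF cut wf wfC] sub])
          fix i assume i: "i |\<in>| branches None I"
          then have iI: "i |\<in>| I" by simp
          have cut2: "cuttable s \<gamma> Z S (fmupd \<beta> (s, X i) ?C)"
            using cuttable_flip[OF cuttable_fmupd(1)[OF cuttable_flip[OF cut] C\<beta> not_sym[OF ne]]] by simp
          have cut3: "cuttable s \<gamma> (principal s None (fam I X)) S (fmupd \<beta> (s, X i) ?C)"
            using cut2 unfolding Zp None .
          have j: "join \<gamma> S (fmupd \<beta> (s, X i) ?C) = fmupd \<beta> (s, X i) (join \<gamma> S ?C)"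
            unfolding join_flip[OF cut2] join_flip[OF cut]
            by (rule cuttable_fmupd(2)[OF cuttable_flip[OF cut] C\<beta> not_sym[OF ne]])
          have ii: "i |\<in>| branches (Some i) I" and dual: "(None = (None :: name option)) \<noteq> (Some i = None)"
            by simp_all
          have Zn: "principal s None (fam I X) = Z" using Zp None by simp
          have pr: "Sim P (join \<gamma> S (fmupd \<beta> (s, X i) ?C))
              (gcut s \<gamma> (principal s None (fam I X)) (fmdom S) (fmdom (fmupd \<beta> (s, X i) ?C))
                (node s \<gamma> None I f') (node (\<not> s) \<gamma> (Some i) I (\<lambda>_. giota s (X i) \<gamma> \<beta>)))
              (gcut s \<gamma> (X i) (fmdom S) (fmdom (fmupd \<beta> (s, X i) ?C)) (f' i) (giota s (X i) \<gamma> \<beta>))"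
            by (rule Sim_principal_cases[OF cut3 dual wf wf1[OF iI] iI i ii D3 D1[OF iI]])
          show "Sim P (fmupd \<beta> (s, X i) (join \<gamma> S ?C))
              (gcut s \<gamma> Z (fmdom S) (fmdom ?C) (node s \<gamma> None I f') (node (\<not> s) \<gamma> (Some i) I (\<lambda>_. giota s (X i) \<gamma> \<beta>)))
              (gcut s \<gamma> (X i) (fmdom S) (fmdom ?C) (f' i) (giota s (X i) \<gamma> \<beta>))"
            using pr unfolding j fmdom_fmupd_idle[OF C\<beta>] Zn .
        qed
        finally show ?thesis unfolding Zp None giota_None .
      qed
      then have "Sim P (join \<gamma> S ?C) (gcut s \<gamma> Z (fmdom S) (fmdom ?C) (node s \<gamma> \<kappa> I f') (giota s Z \<gamma> \<beta>))
          (node s \<beta> \<kappa> I (\<lambda>i. rename (transpose \<gamma> \<beta>) (f' i)))"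
        using last by (rule Sim_trans)
      then show ?thesis unfolding node(1) rename_node t True by simp
    qed
  qed
qed

end

subsection \<open>List-shaped sequents\<close>

definition seq :: "'o form list \<Rightarrow> 'o form list \<Rightarrow> 'o sctx" where
  "seq \<Gamma> \<Delta> = signed (dom_ctx \<Gamma>) (cod_ctx \<Delta>)"

lemma ctx_disj: "fmdom (dom_ctx \<Gamma>) |\<inter>| fmdom (cod_ctx \<Delta>) = {||}"
  by (auto simp: dom_ctx_def cod_ctx_def fset_eq_iff fset_of_list_elem)

lemma prj_seq: "prj False (seq \<Gamma> \<Delta>) = dom_ctx \<Gamma>" "prj True (seq \<Gamma> \<Delta>) = cod_ctx \<Delta>"
  unfolding seq_def by (rule prj_signed[OF ctx_disj])+

lemma derivations_iff: "t \<in> derivations A \<Gamma> \<Delta> \<longleftrightarrow> Der A (seq \<Gamma> \<Delta>) t"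
  by (simp add: derivations_def Der_def prj_seq)

lemma sim_rel_iff: "(t, u) \<in> sim_rel A \<Gamma> \<Delta> \<longleftrightarrow> Sim A (seq \<Gamma> \<Delta>) t u"
  by (simp add: sim_rel_def Sim_def prj_seq)

lemma fmlookup_seq [simp]:
  "fmlookup (seq \<Gamma> \<Delta>) (In i) = (if i < length \<Gamma> then Some (False, \<Gamma> ! i) else None)"
  "fmlookup (seq \<Gamma> \<Delta>) (Out i) = (if i < length \<Delta> then Some (True, \<Delta> ! i) else None)"
  "fmlookup (seq \<Gamma> \<Delta>) (Aux i) = None"
proof -
  have d: "distinct (map In [0..<length \<Gamma>])" "distinct (map Out [0..<length \<Delta>])"
    by (simp_all add: distinct_map inj_on_def)
  have D: "fmlookup (dom_ctx \<Gamma>) c = Some X \<longleftrightarrow> (\<exists>i<length \<Gamma>. c = In i \<and> X = \<Gamma> ! i)"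
    and C: "fmlookup (cod_ctx \<Delta>) c = Some X \<longleftrightarrow> (\<exists>i<length \<Delta>. c = Out i \<and> X = \<Delta> ! i)" for c X
    unfolding dom_ctx_def cod_ctx_def using d by (auto simp: fmlookup_label)
  have *: "fmlookup (seq \<Gamma> \<Delta>) c = Some (s, X) \<longleftrightarrow>
      (if s then \<exists>i<length \<Delta>. c = Out i \<and> X = \<Delta> ! i else \<exists>i<length \<Gamma>. c = In i \<and> X = \<Gamma> ! i)" for c s X
    unfolding seq_def fmlookup_signed[OF ctx_disj] using D C by simp
  have ex: "v = w" if "\<And>s X. v = Some (s, X) \<longleftrightarrow> w = Some (s, X)" for v w :: "(bool \<times> 'a form) option"
  proof (cases v)
    case (Some p)
    then show ?thesis using that[of "fst p" "snd p"] by simp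
  next
    case None
    then show ?thesis using that[of "fst (the w)" "snd (the w)"] by (cases w) simp_all
  qed
  show "fmlookup (seq \<Gamma> \<Delta>) (In i) = (if i < length \<Gamma> then Some (False, \<Gamma> ! i) else None)"
    by (rule ex) (auto simp: *)
  show "fmlookup (seq \<Gamma> \<Delta>) (Out i) = (if i < length \<Delta> then Some (True, \<Delta> ! i) else None)"
    by (rule ex) (auto simp: *)
  show "fmlookup (seq \<Gamma> \<Delta>) (Aux i) = None"
    by (rule ex) (auto simp: *)
qed

lemma fmdom_iff_lookup: "c |\<in>| fmdom S \<longleftrightarrow> fmlookup S c \<noteq> None"
  using fmdom_notI fmdom_notD by metis

lemma fmdom_seq [simp]:
  "In i |\<in>| fmdom (seq \<Gamma> \<Delta>) \<longleftrightarrow> i < length \<Gamma>"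
  "Out i |\<in>| fmdom (seq \<Gamma> \<Delta>) \<longleftrightarrow> i < length \<Delta>"
  "Aux i |\<notin>| fmdom (seq \<Gamma> \<Delta>)"
  by (simp_all add: fmdom_iff_lookup del: not_None_eq)

text \<open>Shifting every \<open>Aux k\<close> to \<open>Aux (Suc k)\<close> frees
  \<open>Aux 0\<close> for the cut channel, so the renaming is injective on all channels, those
  bound in the derivation included.\<close>

lemma inj_left_chan: "inj (left_chan n1 d1 d)"
proof (rule injI)
  fix a b assume "left_chan n1 d1 d a = left_chan n1 d1 d b"
  then show "a = b" by (cases a; cases b) (auto split: if_splits)
qed

lemma inj_right_chan: "inj (right_chan n1 n d1)"
proof (rule injI)
  fix a b assume "right_chan n1 n d1 a = right_chan n1 n d1 b"
  then show "a = b" by (cases a; cases b) (auto split: if_splits)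
qed

lemma inj_perm_chan: "\<sigma> permutes A \<Longrightarrow> \<tau> permutes B \<Longrightarrow> inj (perm_chan \<sigma> \<tau>)"
proof (rule injI)
  fix a b assume "\<sigma> permutes A" "\<tau> permutes B" and eq: "perm_chan \<sigma> \<tau> a = perm_chan \<sigma> \<tau> b"
  then have "inj (inv \<sigma>)" "inj (inv \<tau>)" using permutes_inj permutes_inv by blast+
  then show "a = b" using eq by (cases a; cases b) (auto simp: inj_eq)
qed

text \<open>In the codomain, \<open>d\<close> positions replace the single one at \<open>d1\<close>.
  So a position from \<open>d1 + d\<close> on comes from \<open>p + 1 - d\<close>, and the block in
  between has no preimage, being reserved for the codomain of the other derivation.\<close>

lemma fmlookup_relabel_left:
  "fmlookup (relabel (left_chan n1 d1 d) S) (In p) = (if p < n1 then None else fmlookup S (In (p - n1)))"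
  "fmlookup (relabel (left_chan n1 d1 d) S) (Out p) = (if p < d1 then fmlookup S (Out p)
    else if p < d1 + d then None else fmlookup S (Out (p + 1 - d)))"
  "fmlookup (relabel (left_chan n1 d1 d) S) (Aux 0) = fmlookup S (Out d1)"
  "fmlookup (relabel (left_chan n1 d1 d) S) (Aux (Suc k)) = fmlookup S (Aux k)"
proof -
  note app = fmlookup_relabel_app[OF inj_left_chan, of n1 d1 d S]
  have none: "fmlookup (relabel (left_chan n1 d1 d) S) c = None" if "\<And>a. left_chan n1 d1 d a \<noteq> c" for c
    using that by (auto simp: fmlookup_relabel)
  show "fmlookup (relabel (left_chan n1 d1 d) S) (In p) = (if p < n1 then None else fmlookup S (In (p - n1)))"
  proof (cases "p < n1")
    case True
    have "left_chan n1 d1 d a \<noteq> In p" for a using True by (cases a) auto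
    then show ?thesis using none True by simp
  next
    case False then show ?thesis using app[of "In (p - n1)"] by simp
  qed
  consider "p < d1" | "d1 \<le> p" "p < d1 + d" | "d1 + d \<le> p" by linarith
  then show "fmlookup (relabel (left_chan n1 d1 d) S) (Out p) = (if p < d1 then fmlookup S (Out p)
    else if p < d1 + d then None else fmlookup S (Out (p + 1 - d)))"
  proof cases
    case 1 then show ?thesis using app[of "Out p"] by simp
  next
    case 2
    have "left_chan n1 d1 d a \<noteq> Out p" for a using 2 by (cases a) auto
    then show ?thesis using none 2 by simp
  next
    case 3
    then have "d1 < p + 1 - d" by linarith
    then have "left_chan n1 d1 d (Out (p + 1 - d)) = Out p" using 3 by simp
    then show ?thesis using app[of "Out (p + 1 - d)"] 3 by simp
  qed
  show "fmlookup (relabel (left_chan n1 d1 d) S) (Aux 0) = fmlookup S (Out d1)" using app[of "Out d1"] by simp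
  show "fmlookup (relabel (left_chan n1 d1 d) S) (Aux (Suc k)) = fmlookup S (Aux k)" using app[of "Aux k"] by simp
qed

lemma fmlookup_relabel_right:
  "fmlookup (relabel (right_chan n1 n d1) S) (Out p) = (if p < d1 then None else fmlookup S (Out (p - d1)))"
  "fmlookup (relabel (right_chan n1 n d1) S) (In p) = (if p < n1 then fmlookup S (In p)
    else if p < n1 + n then None else fmlookup S (In (p + 1 - n)))"
  "fmlookup (relabel (right_chan n1 n d1) S) (Aux 0) = fmlookup S (In n1)"
  "fmlookup (relabel (right_chan n1 n d1) S) (Aux (Suc k)) = fmlookup S (Aux k)"
proof -
  note app = fmlookup_relabel_app[OF inj_right_chan, of n1 n d1 S]
  have none: "fmlookup (relabel (right_chan n1 n d1) S) c = None" if "\<And>a. right_chan n1 n d1 a \<noteq> c" for c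
    using that by (auto simp: fmlookup_relabel)
  show "fmlookup (relabel (right_chan n1 n d1) S) (Out p) = (if p < d1 then None else fmlookup S (Out (p - d1)))"
  proof (cases "p < d1")
    case True
    have "right_chan n1 n d1 a \<noteq> Out p" for a using True by (cases a) auto
    then show ?thesis using none True by simp
  next
    case False then show ?thesis using app[of "Out (p - d1)"] by simp
  qed
  consider "p < n1" | "n1 \<le> p" "p < n1 + n" | "n1 + n \<le> p" by linarith
  then show "fmlookup (relabel (right_chan n1 n d1) S) (In p) = (if p < n1 then fmlookup S (In p)
    else if p < n1 + n then None else fmlookup S (In (p + 1 - n)))"
  proof cases
    case 1 then show ?thesis using app[of "In p"] by simp
  next
    case 2
    have "right_chan n1 n d1 a \<noteq> In p" for a using 2 by (cases a) auto
    then show ?thesis using none 2 by simp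
  next
    case 3
    then have "n1 < p + 1 - n" by linarith
    then have "right_chan n1 n d1 (In (p + 1 - n)) = In p" using 3 by simp
    then show ?thesis using app[of "In (p + 1 - n)"] 3 by simp
  qed
  show "fmlookup (relabel (right_chan n1 n d1) S) (Aux 0) = fmlookup S (In n1)" using app[of "In n1"] by simp
  show "fmlookup (relabel (right_chan n1 n d1) S) (Aux (Suc k)) = fmlookup S (Aux k)" using app[of "Aux k"] by simp
qed

lemma nth_substitute:
  assumes "length xs + length ys \<le> p"
  shows "(xs @ ys @ zs) ! p = zs ! (p - length xs - length ys)"
    "(xs @ x # zs) ! (Suc p - length ys) = zs ! (p - length xs - length ys)"
  using assms by (auto simp: nth_append nth_Cons' Suc_diff_le add.commute)

text \<open>The position renamings send both occurrences of the cut formula to \<open>Aux 0\<close>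
  and everything else to different places, so a cut of list-shaped sequents is a cut of signed
  contexts whose join is the composite sequent.\<close>

lemma cut_seq:
  defines "l \<equiv> \<lambda>\<Gamma>1 \<Delta>1 \<Delta>. left_chan (length \<Gamma>1) (length \<Delta>1) (length \<Delta>)"
    and "r \<equiv> \<lambda>\<Gamma>1 \<Gamma> \<Delta>1. right_chan (length \<Gamma>1) (length \<Gamma>) (length \<Delta>1)"
  shows "cuttable True (Aux 0) x (relabel (l \<Gamma>1 \<Delta>1 \<Delta>) (seq \<Gamma> (\<Delta>1 @ x # \<Delta>2))) (relabel (r \<Gamma>1 \<Gamma> \<Delta>1) (seq (\<Gamma>1 @ x # \<Gamma>2) \<Delta>))"
    "join (Aux 0) (relabel (l \<Gamma>1 \<Delta>1 \<Delta>) (seq \<Gamma> (\<Delta>1 @ x # \<Delta>2))) (relabel (r \<Gamma>1 \<Gamma> \<Delta>1) (seq (\<Gamma>1 @ x # \<Gamma>2) \<Delta>))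
      = seq (\<Gamma>1 @ \<Gamma> @ \<Gamma>2) (\<Delta>1 @ \<Delta> @ \<Delta>2)"
proof -
  let ?S = "relabel (l \<Gamma>1 \<Delta>1 \<Delta>) (seq \<Gamma> (\<Delta>1 @ x # \<Delta>2))" and ?T = "relabel (r \<Gamma>1 \<Gamma> \<Delta>1) (seq (\<Gamma>1 @ x # \<Gamma>2) \<Delta>)"
  note look = fmlookup_relabel_left fmlookup_relabel_right
  note mem = fmdom_iff_lookup
  have disj: "c |\<in>| fmdom ?S \<and> c |\<in>| fmdom ?T \<longleftrightarrow> c = Aux 0" for c
    unfolding mem l_def r_def
  proof (cases c)
    case (Aux k) then show "fmlookup (relabel (left_chan (length \<Gamma>1) (length \<Delta>1) (length \<Delta>)) (seq \<Gamma> (\<Delta>1 @ x # \<Delta>2))) c \<noteq> None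
      \<and> fmlookup (relabel (right_chan (length \<Gamma>1) (length \<Gamma>) (length \<Delta>1)) (seq (\<Gamma>1 @ x # \<Gamma>2) \<Delta>)) c \<noteq> None \<longleftrightarrow> c = Aux 0"
      by (cases k) (simp_all add: look)
  qed (simp_all add: look del: not_None_eq, linarith+)
  show "cuttable True (Aux 0) x ?S ?T"
    unfolding cuttable_def
  proof (intro conjI)
    show "fmdom ?S |\<inter>| fmdom ?T = {|Aux 0|}" by (rule fset_eqI) (simp only: finter_iff disj, simp)
  qed (simp_all add: l_def r_def look)
  have join: "fmlookup (join (Aux 0) ?S ?T) c = (if c = Aux 0 then None
      else if fmlookup ?T c \<noteq> None then fmlookup ?T c else fmlookup ?S c)" for c
    by (simp add: join_def mem del: not_None_eq)
  show "join (Aux 0) ?S ?T = seq (\<Gamma>1 @ \<Gamma> @ \<Gamma>2) (\<Delta>1 @ \<Delta> @ \<Delta>2)"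
  proof (rule fmap_ext)
    fix c
    show "fmlookup (join (Aux 0) ?S ?T) c = fmlookup (seq (\<Gamma>1 @ \<Gamma> @ \<Gamma>2) (\<Delta>1 @ \<Delta> @ \<Delta>2)) c"
      unfolding join unfolding l_def r_def
    proof (cases c, goal_cases)
      case (1 p)
      \<comment> \<open>Before, inside and after the inserted block; the last range is where the
        removed formula shifts the indices by one.\<close>
      consider "p < length \<Gamma>1" | "length \<Gamma>1 \<le> p" "p < length \<Gamma>1 + length \<Gamma>" | "length \<Gamma>1 + length \<Gamma> \<le> p" by linarith
      then show ?case
      proof cases
        case 3
        then show ?thesis unfolding 1 look fmlookup_seq using nth_substitute(1)[OF 3, of \<Gamma>2] nth_substitute(2)[OF 3, of x \<Gamma>2]
          by (simp del: not_None_eq) linarith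
      qed (simp_all add: 1 look nth_append del: not_None_eq)
    next
      case (2 p)
      consider "p < length \<Delta>1" | "length \<Delta>1 \<le> p" "p < length \<Delta>1 + length \<Delta>" | "length \<Delta>1 + length \<Delta> \<le> p" by linarith
      then show ?case
      proof cases
        case 3
        then show ?thesis unfolding 2 look fmlookup_seq using nth_substitute(1)[OF 3, of \<Delta>2] nth_substitute(2)[OF 3, of x \<Delta>2]
          by (simp del: not_None_eq) linarith
      qed (simp_all add: 2 look nth_append del: not_None_eq)
    next
      case (3 k)
      then show ?case by (cases k) (simp_all add: look)
    qed
  qed
qed

text \<open>The inverses in \<open>perm_chan\<close> are explained here: a renaming says where an
  old position goes, \<open>permute_list\<close> where a new position comes from.\<close>

lemma perm_seq:
  assumes "\<sigma> permutes {..<length \<Gamma>}" "\<tau> permutes {..<length \<Delta>}"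
  shows "relabel (perm_chan \<sigma> \<tau>) (seq \<Gamma> \<Delta>) = seq (permute_list \<sigma> \<Gamma>) (permute_list \<tau> \<Delta>)"
proof (rule fmap_ext)
  fix c
  have inv: "inv \<sigma> (\<sigma> i) = i" "inv \<tau> (\<tau> i) = i" for i
    by (rule permutes_inverses(2)[OF assms(1)], rule permutes_inverses(2)[OF assms(2)])
  have lt: "\<sigma> i < length \<Gamma> \<longleftrightarrow> i < length \<Gamma>" "\<tau> i < length \<Delta> \<longleftrightarrow> i < length \<Delta>" for i
    using permutes_in_image[OF assms(1), of i] permutes_in_image[OF assms(2), of i] by simp_all
  note app = fmlookup_relabel_app[OF inj_perm_chan[OF assms], of "seq \<Gamma> \<Delta>"]
  show "fmlookup (relabel (perm_chan \<sigma> \<tau>) (seq \<Gamma> \<Delta>)) c = fmlookup (seq (permute_list \<sigma> \<Gamma>) (permute_list \<tau> \<Delta>)) c"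
  proof (cases c)
    case (In i)
    then show ?thesis using app[of "In (\<sigma> i)"] lt assms by (simp add: inv permute_list_nth)
  next
    case (Out i)
    then show ?thesis using app[of "Out (\<tau> i)"] lt assms by (simp add: inv permute_list_nth)
  next
    case (Aux i)
    then show ?thesis using app[of "Aux i"] by simp
  qed
qed

lemma cut_deriv_gcut:
  fixes \<Gamma> \<Gamma>1 \<Delta>1 \<Delta> :: "'o form list"
  defines "l \<equiv> left_chan (length \<Gamma>1) (length \<Delta>1) (length \<Delta>)"
    and "r \<equiv> right_chan (length \<Gamma>1) (length \<Gamma>) (length \<Delta>1)"
  shows "cut_deriv \<Gamma> \<Delta>1 x \<Delta>2 \<Gamma>1 \<Gamma>2 \<Delta> f g = gcut True (Aux 0) x
    (fmdom (relabel l (seq \<Gamma> (\<Delta>1 @ x # \<Delta>2)))) (fmdom (relabel r (seq (\<Gamma>1 @ x # \<Gamma>2) \<Delta>))) (rename l f) (rename r g)"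
proof -
  have "fmdom (dom_ctx \<Gamma>) |\<union>| fmdom (cod_ctx (\<Delta>1 @ x # \<Delta>2)) = fmdom (seq \<Gamma> (\<Delta>1 @ x # \<Delta>2))"
    using fmdom_prj[of "seq \<Gamma> (\<Delta>1 @ x # \<Delta>2)"] unfolding prj_seq .
  then show ?thesis
    unfolding cut_deriv_def Let_def l_def[symmetric] r_def[symmetric] gcut_def
    using fmdom_relabel[of l "seq \<Gamma> (\<Delta>1 @ x # \<Delta>2)"] inj_left_chan l_def by simp
qed

section \<open>Classes of derivations and the operations on them\<close>

definition cls :: "('o, 'm) polycat \<Rightarrow> 'o form list \<Rightarrow> 'o form list \<Rightarrow> ('o, 'm) der \<Rightarrow> ('o, 'm) der set" where
  "cls A \<Gamma> \<Delta> f = sim_rel A \<Gamma> \<Delta> `` {f}"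

lemma mem_cls: "t \<in> cls A \<Gamma> \<Delta> f \<longleftrightarrow> Sim A (seq \<Gamma> \<Delta>) f t"
  by (simp add: cls_def sim_rel_iff)

text \<open>A class depends on the lists only through their sequent. For
  \<open>cut_deriv_act\<close> this replaces a comparison of the composite lists by one of
  contexts.\<close>

lemma cls_eqI:
  assumes "Sim A (seq \<Gamma> \<Delta>) f g" "seq \<Gamma> \<Delta> = seq \<Gamma>' \<Delta>'"
  shows "cls A \<Gamma> \<Delta> f = cls A \<Gamma>' \<Delta>' g"
  using Sim_trans[OF assms(1)] Sim_trans[OF Sim_sym[OF assms(1)]] unfolding set_eq_iff mem_cls assms(2) by blast

lemma equiv_sim_rel: "equiv (derivations A \<Gamma> \<Delta>) (sim_rel A \<Gamma> \<Delta>)"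
proof (rule equivI)
  show "sim_rel A \<Gamma> \<Delta> \<subseteq> derivations A \<Gamma> \<Delta> \<times> derivations A \<Gamma> \<Delta>"
    by (auto simp: sim_rel_iff derivations_iff dest: Sim_Der)
  show "refl_on (derivations A \<Gamma> \<Delta>) (sim_rel A \<Gamma> \<Delta>)"
    using Sim_refl by (auto simp: refl_on_def sim_rel_iff derivations_iff)
  show "Relation.sym (sim_rel A \<Gamma> \<Delta>)" by (rule symI) (simp add: sim_rel_iff Sim_sym)
  show "Relation.trans (sim_rel A \<Gamma> \<Delta>)" by (rule transI) (unfold sim_rel_iff, rule Sim_trans)
qed

lemma SigmaPi_Hom: "F \<in> Hom (SigmaPi A) \<Gamma> \<Delta> \<longleftrightarrow> (\<exists>f. Der A (seq \<Gamma> \<Delta>) f \<and> F = cls A \<Gamma> \<Delta> f)"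
  by (auto simp: SigmaPi_def cls_def quotient_def derivations_iff)

lemma cut_deriv_Sim:
  assumes "Sim A (seq \<Gamma> (\<Delta>1 @ x # \<Delta>2)) f f'" "Sim A (seq (\<Gamma>1 @ x # \<Gamma>2) \<Delta>) g g'"
  shows "Sim A (seq (\<Gamma>1 @ \<Gamma> @ \<Gamma>2) (\<Delta>1 @ \<Delta> @ \<Delta>2)) (cut_deriv \<Gamma> \<Delta>1 x \<Delta>2 \<Gamma>1 \<Gamma>2 \<Delta> f g) (cut_deriv \<Gamma> \<Delta>1 x \<Delta>2 \<Gamma>1 \<Gamma>2 \<Delta> f' g')"
  using Sim_gcut[OF cut_seq(1) Sim_rename[OF assms(1) inj_left_chan] Sim_rename[OF assms(2) inj_right_chan]]
  unfolding cut_seq(2) cut_deriv_gcut .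

lemma cut_deriv_Der:
  assumes "Der A (seq \<Gamma> (\<Delta>1 @ x # \<Delta>2)) f" "Der A (seq (\<Gamma>1 @ x # \<Gamma>2) \<Delta>) g"
  shows "Der A (seq (\<Gamma>1 @ \<Gamma> @ \<Gamma>2) (\<Delta>1 @ \<Delta> @ \<Delta>2)) (cut_deriv \<Gamma> \<Delta>1 x \<Delta>2 \<Gamma>1 \<Gamma>2 \<Delta> f g)"
  using Sim_Der[OF cut_deriv_Sim[OF Sim_refl[OF assms(1)] Sim_refl[OF assms(2)]]] by blast

text \<open>The unions over representatives in \<open>SigmaPi\<close> collapse once all
  representatives give the same class.\<close>

lemma UN_UN_const:
  "a \<in> F \<Longrightarrow> b \<in> G \<Longrightarrow> (\<And>x y. x \<in> F \<Longrightarrow> y \<in> G \<Longrightarrow> h x y = c) \<Longrightarrow> (\<Union>x\<in>F. \<Union>y\<in>G. h x y) = c"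
  by auto

lemma cut_cls:
  assumes "Der A (seq \<Gamma> (\<Delta>1 @ x # \<Delta>2)) f" "Der A (seq (\<Gamma>1 @ x # \<Gamma>2) \<Delta>) g"
  shows "polycat.cut (SigmaPi A) \<Gamma> \<Delta>1 x \<Delta>2 \<Gamma>1 \<Gamma>2 \<Delta> (cls A \<Gamma> (\<Delta>1 @ x # \<Delta>2) f) (cls A (\<Gamma>1 @ x # \<Gamma>2) \<Delta> g)
    = cls A (\<Gamma>1 @ \<Gamma> @ \<Gamma>2) (\<Delta>1 @ \<Delta> @ \<Delta>2) (cut_deriv \<Gamma> \<Delta>1 x \<Delta>2 \<Gamma>1 \<Gamma>2 \<Delta> f g)"
proof -
  have "polycat.cut (SigmaPi A) \<Gamma> \<Delta>1 x \<Delta>2 \<Gamma>1 \<Gamma>2 \<Delta> F G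
      = (\<Union>f\<in>F. \<Union>g\<in>G. cls A (\<Gamma>1 @ \<Gamma> @ \<Gamma>2) (\<Delta>1 @ \<Delta> @ \<Delta>2) (cut_deriv \<Gamma> \<Delta>1 x \<Delta>2 \<Gamma>1 \<Gamma>2 \<Delta> f g))" for F G
    by (simp add: SigmaPi_def cls_def)
  then show ?thesis
  proof (simp only:, intro UN_UN_const)
    show "f \<in> cls A \<Gamma> (\<Delta>1 @ x # \<Delta>2) f" "g \<in> cls A (\<Gamma>1 @ x # \<Gamma>2) \<Delta> g"
      using assms by (simp_all add: mem_cls Sim_refl)
    show "cls A (\<Gamma>1 @ \<Gamma> @ \<Gamma>2) (\<Delta>1 @ \<Delta> @ \<Delta>2) (cut_deriv \<Gamma> \<Delta>1 x \<Delta>2 \<Gamma>1 \<Gamma>2 \<Delta> f' g')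
        = cls A (\<Gamma>1 @ \<Gamma> @ \<Gamma>2) (\<Delta>1 @ \<Delta> @ \<Delta>2) (cut_deriv \<Gamma> \<Delta>1 x \<Delta>2 \<Gamma>1 \<Gamma>2 \<Delta> f g)"
      if "f' \<in> cls A \<Gamma> (\<Delta>1 @ x # \<Delta>2) f" "g' \<in> cls A (\<Gamma>1 @ x # \<Gamma>2) \<Delta> g" for f' g'
      by (rule cls_eqI[OF Sim_sym[OF cut_deriv_Sim[OF that[unfolded mem_cls]]] HOL.refl])
  qed
qed

lemma act_cls:
  assumes "Der A (seq \<Gamma> \<Delta>) f" "\<sigma> permutes {..<length \<Gamma>}" "\<tau> permutes {..<length \<Delta>}"
  shows "act (SigmaPi A) \<Gamma> \<Delta> \<sigma> \<tau> (cls A \<Gamma> \<Delta> f)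
    = cls A (permute_list \<sigma> \<Gamma>) (permute_list \<tau> \<Delta>) (rename (perm_chan \<sigma> \<tau>) f)"
proof -
  have eq: "cls A (permute_list \<sigma> \<Gamma>) (permute_list \<tau> \<Delta>) (rename (perm_chan \<sigma> \<tau>) f')
      = cls A (permute_list \<sigma> \<Gamma>) (permute_list \<tau> \<Delta>) (rename (perm_chan \<sigma> \<tau>) f)"
    if "f' \<in> cls A \<Gamma> \<Delta> f" for f'
  proof (rule cls_eqI[OF Sim_sym HOL.refl])
    show "Sim A (seq (permute_list \<sigma> \<Gamma>) (permute_list \<tau> \<Delta>)) (rename (perm_chan \<sigma> \<tau>) f) (rename (perm_chan \<sigma> \<tau>) f')"
      using Sim_rename[OF that[unfolded mem_cls] inj_perm_chan[OF assms(2,3)]] unfolding perm_seq[OF assms(2,3)] .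
  qed
  have act: "act (SigmaPi A) \<Gamma> \<Delta> \<sigma> \<tau> F
      = (\<Union>f\<in>F. cls A (permute_list \<sigma> \<Gamma>) (permute_list \<tau> \<Delta>) (rename (perm_chan \<sigma> \<tau>) f))" for F
    by (simp add: SigmaPi_def cls_def)
  have mem: "f \<in> cls A \<Gamma> \<Delta> f" using assms(1) by (simp add: mem_cls Sim_refl)
  show ?thesis unfolding act by (intro UN_constant_eq[OF mem] ballI eq)
qed

lemma act_Der:
  assumes "Der A (seq \<Gamma> \<Delta>) f" "\<sigma> permutes {..<length \<Gamma>}" "\<tau> permutes {..<length \<Delta>}"
  shows "Der A (seq (permute_list \<sigma> \<Gamma>) (permute_list \<tau> \<Delta>)) (rename (perm_chan \<sigma> \<tau>) f)"
  using Der_rename[OF assms(1) inj_perm_chan[OF assms(2,3)]] unfolding perm_seq[OF assms(2,3)] .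

section \<open>Permutations induced on a composite list\<close>

lemma slot_Inr: "slot i n p = Inr q \<longleftrightarrow> p = i + q \<and> q < n"
  by (auto simp: slot_def)

lemma slot_Inl: "slot i n p = Inl q \<longleftrightarrow> q < i \<and> p = q \<or> i < q \<and> p = q - 1 + n"
  by (auto simp: slot_def)

text \<open>The law \<open>cut_act\<close> describes \<open>\<pi>\<close> by the origin of each
  position, while \<open>perm_chan\<close> needs its inverse. For a position of the inserted block
  the inverse is read off from the tag \<open>Inr\<close>.\<close>

lemma perm_slot_Inr:
  assumes \<pi>: "\<pi> permutes {..<N}" and slot: "\<forall>p<N. slot i n (\<pi> p) = map_sum \<sigma>' \<sigma> (slot i' n p)"
    and \<sigma>: "\<sigma> permutes {..<n}" and "i' + n \<le> N" "q < n"
  shows "inv \<pi> (i + q) = i' + inv \<sigma> q"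
proof -
  have "inv \<sigma> q < n" using permutes_in_image[OF permutes_inv[OF \<sigma>]] \<open>q < n\<close> by simp
  then have "slot i' n (i' + inv \<sigma> q) = Inr (inv \<sigma> q)" by (simp add: slot_Inr)
  moreover have "\<sigma> (inv \<sigma> q) = q" using permutes_inverses[OF \<sigma>] by simp
  ultimately have "slot i n (\<pi> (i' + inv \<sigma> q)) = Inr q" using slot \<open>inv \<sigma> q < n\<close> \<open>i' + n \<le> N\<close> by simp
  then have "\<pi> (i' + inv \<sigma> q) = i + q" by (simp add: slot_Inr)
  then show ?thesis using permutes_inverses(2)[OF \<pi>] by metis
qed

text \<open>The counterpart outside the block. \<open>M\<close> is the length of the list that still
  contains the cut object, hence \<open>N + 1 = M + n\<close>; the cut object itself, at
  \<open>i\<close>, is excluded, and \<open>q - 1 + n\<close> is the shift past a block of length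
  \<open>n\<close> that replaced one entry.\<close>

lemma perm_slot_Inl:
  assumes \<pi>: "\<pi> permutes {..<N}" and slot: "\<forall>p<N. slot i n (\<pi> p) = map_sum \<sigma>' \<sigma> (slot i' n p)"
    and \<sigma>': "\<sigma>' permutes {..<M}" and M: "N + 1 = M + n" "i' < M" and i: "\<sigma>' i' = i" and q: "q < M" "q \<noteq> i"
  shows "inv \<pi> (if q < i then q else q - 1 + n) = (if inv \<sigma>' q < i' then inv \<sigma>' q else inv \<sigma>' q - 1 + n)"
    "inv \<sigma>' q \<noteq> i'"
proof -
  let ?k = "inv \<sigma>' q" and ?p = "if inv \<sigma>' q < i' then inv \<sigma>' q else inv \<sigma>' q - 1 + n"
  have k: "?k < M" using permutes_in_image[OF permutes_inv[OF \<sigma>'], of q] q(1) by simp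
  have \<sigma>k: "\<sigma>' ?k = q" using permutes_inverses[OF \<sigma>'] by simp
  show ne: "?k \<noteq> i'"
  proof
    assume "?k = i'"
    then have "q = i" using \<sigma>k i by metis
    then show False using q(2) by contradiction
  qed
  have "slot i' n ?p = Inl ?k" using ne by (auto simp: slot_Inl)
  moreover have p: "?p < N"
  proof (cases "?k < i'")
    case True
    then have "?k < N" using M by linarith
    then show ?thesis using True by (simp only: if_True)
  next
    case False
    then have "0 < ?k" using ne by linarith
    then have "?k - 1 + n < N" using k M by linarith
    then show ?thesis using False by (simp only: if_False)
  qed
  ultimately have "slot i n (\<pi> ?p) = map_sum \<sigma>' \<sigma> (Inl ?k)" using slot by metis
  then have "slot i n (\<pi> ?p) = Inl q" unfolding map_sum.simps \<sigma>k .
  then consider "q < i" "\<pi> ?p = q" | "i < q" "\<pi> ?p = q - 1 + n" unfolding slot_Inl by blast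
  then have \<pi>p: "\<pi> ?p = (if q < i then q else q - 1 + n)"
  proof cases
    case 1 then show ?thesis by (simp only: if_True)
  next
    case 2
    then have "\<not> q < i" by simp
    then show ?thesis using 2(2) by (simp only: if_False)
  qed
  have "inv \<pi> (\<pi> ?p) = ?p" by (rule permutes_inverses(2)[OF \<pi>])
  then show "inv \<pi> (if q < i then q else q - 1 + n) = ?p" unfolding \<pi>p .
qed

lemma rename_iota: "rename \<rho> (iota A Z \<alpha> \<beta>) = iota A Z (\<rho> \<alpha>) (\<rho> \<beta>)"
proof (induction Z)
  case (Atom x)
  show ?case by simp
next
  case (SumF F)
  obtain I X where F: "F = fam I X" using fam_fmdom by metis
  have "rename \<rho> (iota A (X i) \<alpha> \<beta>) = iota A (X i) (\<rho> \<alpha>) (\<rho> \<beta>)" if "i |\<in>| I" for i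
    by (rule SumF) (use that in \<open>simp add: F fmran'_fam\<close>)
  then show ?case unfolding F by (simp add: fmmap_fam fmmap_keys_fam fam_eq_iff)
next
  case (ProdF F)
  obtain I X where F: "F = fam I X" using fam_fmdom by metis
  have "rename \<rho> (iota A (X i) \<alpha> \<beta>) = iota A (X i) (\<rho> \<alpha>) (\<rho> \<beta>)" if "i |\<in>| I" for i
    by (rule ProdF) (use that in \<open>simp add: F fmran'_fam\<close>)
  then show ?case unfolding F by (simp add: fmmap_fam fmmap_keys_fam fam_eq_iff)
qed

lemma cuttable_iff:
  "cuttable s \<gamma> Z S T \<longleftrightarrow> fmlookup S \<gamma> = Some (s, Z) \<and> fmlookup T \<gamma> = Some (\<not> s, Z)
     \<and> (\<forall>c. c |\<in>| fmdom S \<and> c |\<in>| fmdom T \<longleftrightarrow> c = \<gamma>)"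
  by (simp add: cuttable_def fset_eq_iff)

lemma fmdom_seq_single: "fmdom (seq [x] [y]) = {|In 0, Out 0|}"
proof (rule fset_eqI)
  fix c show "c |\<in>| fmdom (seq [x] [y]) \<longleftrightarrow> c |\<in>| {|In 0, Out 0|}" by (cases c) simp_all
qed

text \<open>Recovers a chain from two nested cuts, the form in which \<open>cut_deriv\<close>
  produces them. The outer cut channel lies in \<open>T\<close> and differs from
  \<open>\<gamma>\<close>, so it cannot be shared by \<open>S\<close> and \<open>U\<close>.\<close>

lemma chainI:
  assumes "cuttable s \<gamma> Z S T" "cuttable s' \<delta> Z' (join \<gamma> S T) U" "fmlookup T \<delta> = Some (s', Z')" "\<gamma> |\<notin>| fmdom U"
  shows "chain s \<gamma> Z s' \<delta> Z' S T U"
proof -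
  have ST: "c |\<in>| fmdom S \<and> c |\<in>| fmdom T \<longleftrightarrow> c = \<gamma>" for c
    using assms(1) unfolding cuttable_iff by (elim conjE allE)
  have J: "c |\<in>| fmdom (join \<gamma> S T) \<and> c |\<in>| fmdom U \<longleftrightarrow> c = \<delta>" for c
    using assms(2) unfolding cuttable_iff by (elim conjE allE)
  have dom: "c |\<in>| fmdom (join \<gamma> S T) \<longleftrightarrow> (c |\<in>| fmdom S \<or> c |\<in>| fmdom T) \<and> c \<noteq> \<gamma>" for c
    unfolding fmdom_join by simp
  have \<delta>T: "\<delta> |\<in>| fmdom T" by (rule fmdomI[OF assms(3)])
  have ne: "\<gamma> \<noteq> \<delta>" using J[of \<delta>] dom[of \<delta>] by metis
  have TU: "c |\<in>| fmdom T \<and> c |\<in>| fmdom U \<longleftrightarrow> c = \<delta>" for c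
    using J[of c] dom[of c] assms(4) \<delta>T by metis
  have SU: "\<not> (c |\<in>| fmdom S \<and> c |\<in>| fmdom U)" for c
    using J[of c] dom[of c] assms(4) \<delta>T ST[of c] by metis
  have "fmlookup U \<delta> = Some (\<not> s', Z')" using assms(2) unfolding cuttable_def by (elim conjE)
  then have "cuttable s' \<delta> Z' T U" using assms(3) TU unfolding cuttable_iff by (intro conjI allI)
  moreover have "fmdom S |\<inter>| fmdom U = {||}" using SU by (intro fset_eqI) (simp only: finter_iff fempty_iff)
  ultimately show ?thesis using assms(1) ne unfolding chain_def by (intro conjI)
qed

section \<open>From the laws on channels to the laws on lists\<close>

context polycategory
begin

text \<open>The law of a chain uses the same channel names on both sides, whereas list composition
  names them differently. \<open>\<tau>\<close> carries the names given by \<open>a\<close>,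
  \<open>b\<close>, \<open>c\<close> to those given by \<open>a'\<close>, \<open>b'\<close>,
  \<open>c'\<close> and fixes the channels of the conclusion, so by \<open>Sim_rename_cong\<close>
  it does not change the class.\<close>

lemma three_cuts:
  assumes D: "Der P S f" "Der P T g" "Der P U h"
    and inj: "inj a" "inj b" "inj c" "inj a'" "inj b'" "inj c'" "inj \<tau>"
    and ch: "chain s \<gamma> Z s' \<delta> Z' (relabel a S) (relabel b T) (relabel c U)"
    and eq: "\<And>e. e |\<in>| fmdom S \<Longrightarrow> \<tau> (a e) = a' e" "\<And>e. e |\<in>| fmdom T \<Longrightarrow> \<tau> (b e) = b' e"
      "\<And>e. e |\<in>| fmdom U \<Longrightarrow> \<tau> (c e) = c' e"
    and id: "\<And>e. e |\<in>| fmdom (join \<delta> (join \<gamma> (relabel a S) (relabel b T)) (relabel c U)) \<Longrightarrow> \<tau> e = e"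
  shows "Sim P (join \<delta> (join \<gamma> (relabel a S) (relabel b T)) (relabel c U))
    (gcut s' \<delta> Z' (fmdom (join \<gamma> (relabel a S) (relabel b T))) (fmdom (relabel c U))
      (gcut s \<gamma> Z (fmdom (relabel a S)) (fmdom (relabel b T)) (rename a f) (rename b g)) (rename c h))
    (gcut s (\<tau> \<gamma>) Z (fmdom (relabel a' S)) (fmdom (join (\<tau> \<delta>) (relabel b' T) (relabel c' U))) (rename a' f)
      (gcut s' (\<tau> \<delta>) Z' (fmdom (relabel b' T)) (fmdom (relabel c' U)) (rename b' g) (rename c' h)))"
proof -
  let ?J = "join \<delta> (join \<gamma> (relabel a S) (relabel b T)) (relabel c U)"
  let ?R = "gcut s \<gamma> Z (fmdom (relabel a S)) (fmdom (join \<delta> (relabel b T) (relabel c U))) (rename a f)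
      (gcut s' \<delta> Z' (fmdom (relabel b T)) (fmdom (relabel c U)) (rename b g) (rename c h))"
  note c = chain_outer[OF ch]
  note Dr = Der_rename[OF D(1) inj(1)] Der_rename[OF D(2) inj(2)] Der_rename[OF D(3) inj(3)]
  have 1: "Sim P ?J (gcut s' \<delta> Z' (fmdom (join \<gamma> (relabel a S) (relabel b T))) (fmdom (relabel c U))
      (gcut s \<gamma> Z (fmdom (relabel a S)) (fmdom (relabel b T)) (rename a f) (rename b g)) (rename c h)) ?R"
    using cut_law[OF Dr ch] unfolding cut_law_def .
  have relabelJ: "relabel \<tau> ?J = ?J"
  proof -
    have "relabel \<tau> ?J = relabel id ?J" by (rule relabel_cong[OF inj(7) inj_on_id]) (simp only: id id_apply)
    then show ?thesis unfolding relabel_id .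
  qed
  have "Sim P (relabel id ?J) (rename id ?R) (rename \<tau> ?R)"
    by (rule Sim_rename_cong[OF _ inj_on_id inj(7)]) (use Sim_Der[OF 1] id in simp_all)
  then have 2: "Sim P ?J ?R (rename \<tau> ?R)" unfolding relabel_id rename_id .
  have relabel\<tau>: "relabel \<tau> (relabel a S) = relabel a' S" "relabel \<tau> (relabel b T) = relabel b' T" "relabel \<tau> (relabel c U) = relabel c' U"
    unfolding relabel_comp[OF inj(7) inj(1), symmetric] relabel_comp[OF inj(7) inj(2), symmetric] relabel_comp[OF inj(7) inj(3), symmetric]
    by (rule relabel_cong; use inj eq in \<open>simp add: inj_compose\<close>)+
  have ren: "Sim P (relabel a' S) (rename \<tau> (rename a f)) (rename a' f)"
    "Sim P (relabel b' T) (rename \<tau> (rename b g)) (rename b' g)"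
    "Sim P (relabel c' U) (rename \<tau> (rename c h)) (rename c' h)"
    unfolding relabel\<tau>[symmetric] rename_comp
      relabel_comp[OF inj(7) inj(1), symmetric] relabel_comp[OF inj(7) inj(2), symmetric] relabel_comp[OF inj(7) inj(3), symmetric]
    by (rule Sim_rename_cong; use D inj eq in \<open>simp add: inj_compose\<close>)+
  have c': "cuttable s' (\<tau> \<delta>) Z' (relabel b' T) (relabel c' U)"
    "cuttable s (\<tau> \<gamma>) Z (relabel a' S) (join (\<tau> \<delta>) (relabel b' T) (relabel c' U))"
    using cuttable_relabel[OF inj(7) c(2)] cuttable_relabel[OF inj(7) c(4)] unfolding relabel_join[OF inj(7)] relabel\<tau> .
  have 0: "relabel \<tau> (join \<gamma> (relabel a S) (join \<delta> (relabel b T) (relabel c U)))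
      = join (\<tau> \<gamma>) (relabel a' S) (join (\<tau> \<delta>) (relabel b' T) (relabel c' U))"
    by (simp only: relabel_join[OF inj(7)] relabel\<tau>)
  have J: "?J = join (\<tau> \<gamma>) (relabel a' S) (join (\<tau> \<delta>) (relabel b' T) (relabel c' U))"
    unfolding 0[symmetric] c(5)[symmetric] relabelJ ..
  have im: "\<tau> |`| fmdom (relabel a S) = fmdom (relabel a' S)" "\<tau> |`| fmdom (relabel b T) = fmdom (relabel b' T)"
    "\<tau> |`| fmdom (relabel c U) = fmdom (relabel c' U)"
    "\<tau> |`| fmdom (join \<delta> (relabel b T) (relabel c U)) = fmdom (join (\<tau> \<delta>) (relabel b' T) (relabel c' U))"
    by (simp_all only: fmdom_relabel[OF inj(7), symmetric] relabel_join[OF inj(7)] relabel\<tau>)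
  have "Sim P (join (\<tau> \<gamma>) (relabel a' S) (join (\<tau> \<delta>) (relabel b' T) (relabel c' U)))
      (gcut s (\<tau> \<gamma>) Z (fmdom (relabel a' S)) (fmdom (join (\<tau> \<delta>) (relabel b' T) (relabel c' U))) (rename \<tau> (rename a f))
        (gcut s' (\<tau> \<delta>) Z' (fmdom (relabel b' T)) (fmdom (relabel c' U)) (rename \<tau> (rename b g)) (rename \<tau> (rename c h))))
      (gcut s (\<tau> \<gamma>) Z (fmdom (relabel a' S)) (fmdom (join (\<tau> \<delta>) (relabel b' T) (relabel c' U))) (rename a' f)
        (gcut s' (\<tau> \<delta>) Z' (fmdom (relabel b' T)) (fmdom (relabel c' U)) (rename b' g) (rename c' h)))"
    by (intro Sim_gcut c' ren)
  then have 3: "Sim P ?J (rename \<tau> ?R)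
      (gcut s (\<tau> \<gamma>) Z (fmdom (relabel a' S)) (fmdom (join (\<tau> \<delta>) (relabel b' T) (relabel c' U))) (rename a' f)
        (gcut s' (\<tau> \<delta>) Z' (fmdom (relabel b' T)) (fmdom (relabel c' U)) (rename b' g) (rename c' h)))"
    unfolding J rename_gcut[OF inj(7)] im .
  show ?thesis by (rule Sim_trans[OF Sim_trans[OF 1 2] 3])
qed

lemma cut_giota_Der:
  assumes f: "Der P S f" and l: "fmlookup S \<gamma> = Some (s, Z)" "\<beta> |\<notin>| fmdom S"
  shows "Sim P (relabel (transpose \<gamma> \<beta>) S)
    (gcut s \<gamma> Z (fmdom S) {|\<gamma>, \<beta>|} f (giota s Z \<gamma> \<beta>)) (rename (transpose \<gamma> \<beta>) f)"
proof -
  obtain u where u: "cut_free P S u" "Sim P S f u" using cut_elimination[OF f] by blast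
  note c = cuttable_idctx[OF l]
  have Z: "Z \<in> formulas P" using Der_wfs[OF f] l(1) unfolding wfs_def by blast
  have 1: "Sim P (join \<gamma> S (idctx s Z \<gamma> \<beta>)) (gcut s \<gamma> Z (fmdom S) (fmdom (idctx s Z \<gamma> \<beta>)) f (giota s Z \<gamma> \<beta>))
     (gcut s \<gamma> Z (fmdom S) (fmdom (idctx s Z \<gamma> \<beta>)) u (giota s Z \<gamma> \<beta>))"
    by (rule Sim_gcut[OF c(1) u(2) Sim_refl[OF Der_giota[OF Z c(2)]]])
  have 2: "Sim P (relabel (transpose \<gamma> \<beta>) S) (rename (transpose \<gamma> \<beta>) u) (rename (transpose \<gamma> \<beta>) f)"
    by (rule Sim_rename[OF Sim_sym[OF u(2)] inj_on_transpose])
  show ?thesis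
    using Sim_trans[OF Sim_trans[OF 1 cut_giota[OF u(1) l]] 2[folded c(3)]]
    unfolding c(3) idctx_simps(3)[OF c(2)] .
qed

lemma Der_iota:
  assumes "X \<in> formulas P"
  shows "Der P (seq [X] [X]) (iota P X (In 0) (Out 0))"
proof -
  have "idctx True X (In 0) (Out 0) = seq [X] [X]"
  proof (rule fmap_ext)
    fix c show "fmlookup (idctx True X (In 0) (Out 0)) c = fmlookup (seq [X] [X]) c"
      by (cases c) (simp_all add: idctx_def)
  qed
  then show ?thesis using Der_giota[OF assms, of "In 0" "Out 0" True] by (simp add: giota_def)
qed

lemma Sim_rename_idle:
  assumes "Der P S t" "inj \<rho>" "\<And>e. e |\<in>| fmdom S \<Longrightarrow> \<rho> e = e"
  shows "Sim P S (rename \<rho> t) t" "relabel \<rho> S = S"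
proof -
  show relabel: "relabel \<rho> S = S" using relabel_cong[OF assms(2) inj_on_id, of S] assms(3) by (simp add: relabel_id)
  have "Sim P (relabel \<rho> S) (rename \<rho> t) (rename id t)"
    by (rule Sim_rename_cong[OF assms(1,2) inj_on_id]) (simp add: assms(3))
  then show "Sim P S (rename \<rho> t) t" unfolding relabel rename_id .
qed

lemma cut_iota_right:
  assumes f: "Der P (seq \<Gamma> (\<Delta>1 @ x # \<Delta>2)) f"
  shows "Sim P (seq \<Gamma> (\<Delta>1 @ x # \<Delta>2)) (cut_deriv \<Gamma> \<Delta>1 x \<Delta>2 [] [] [x] f (iota P x (In 0) (Out 0))) f"
proof -
  let ?S = "seq \<Gamma> (\<Delta>1 @ x # \<Delta>2)" and ?l = "left_chan 0 (length \<Delta>1) 1" and ?\<beta> = "Out (length \<Delta>1)"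
  let ?t = "transpose (Aux 0) ?\<beta>"
  have look: "fmlookup (relabel ?l ?S) (Aux 0) = Some (True, x)" "?\<beta> |\<notin>| fmdom (relabel ?l ?S)"
    unfolding fmdom_iff_lookup by (simp_all add: fmlookup_relabel_left)
  \<comment> \<open>\<open>left_chan\<close> moves the cut position to \<open>Aux 0\<close> and the
    swap moves it back. The other positions stay in place because the identity contributes exactly
    one formula to the codomain in exchange for the cut one.\<close>
  have id: "(?t \<circ> ?l) e = e" if "e |\<in>| fmdom ?S" for e
    using that by (cases e) (auto simp: transpose_def)
  have inj: "inj (?t \<circ> ?l)" by (intro inj_compose inj_left_chan) simp
  have idle1: "Sim P ?S (rename (?t \<circ> ?l) f) f"
    using f inj id by (rule Sim_rename_idle(1))
  have idle2: "relabel (?t \<circ> ?l) ?S = ?S"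
    using f inj id by (rule Sim_rename_idle(2))
  have eq: "cut_deriv \<Gamma> \<Delta>1 x \<Delta>2 [] [] [x] f (iota P x (In 0) (Out 0))
      = gcut True (Aux 0) x (fmdom (relabel ?l ?S)) {|Aux 0, ?\<beta>|} (rename ?l f) (giota True x (Aux 0) ?\<beta>)"
    by (simp add: cut_deriv_gcut gcut_def giota_def rename_iota)
  have "Sim P (relabel ?t (relabel ?l ?S)) (cut_deriv \<Gamma> \<Delta>1 x \<Delta>2 [] [] [x] f (iota P x (In 0) (Out 0))) (rename ?t (rename ?l f))"
    unfolding eq by (rule cut_giota_Der[OF Der_rename[OF f inj_left_chan] look])
  then have "Sim P ?S (cut_deriv \<Gamma> \<Delta>1 x \<Delta>2 [] [] [x] f (iota P x (In 0) (Out 0))) (rename (?t \<circ> ?l) f)"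
    unfolding rename_comp relabel_comp[OF inj_on_transpose inj_left_chan, symmetric] idle2 .
  then show ?thesis using idle1 by (rule Sim_trans)
qed

text \<open>The identity is the left premise here, so the cut is read from \<open>g\<close>, where
  the cut channel is on side \<open>False\<close>.\<close>

lemma cut_iota_left:
  assumes g: "Der P (seq (\<Gamma>1 @ x # \<Gamma>2) \<Delta>) g"
  shows "Sim P (seq (\<Gamma>1 @ x # \<Gamma>2) \<Delta>) (cut_deriv [x] [] x [] \<Gamma>1 \<Gamma>2 \<Delta> (iota P x (In 0) (Out 0)) g) g"
proof -
  let ?S = "seq (\<Gamma>1 @ x # \<Gamma>2) \<Delta>" and ?r = "right_chan (length \<Gamma>1) 1 0" and ?\<beta> = "In (length \<Gamma>1)"
  let ?t = "transpose (Aux 0) ?\<beta>"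
  have look: "fmlookup (relabel ?r ?S) (Aux 0) = Some (False, x)" "?\<beta> |\<notin>| fmdom (relabel ?r ?S)"
    unfolding fmdom_iff_lookup by (simp_all add: fmlookup_relabel_right)
  have id: "(?t \<circ> ?r) e = e" if "e |\<in>| fmdom ?S" for e
    using that by (cases e) (auto simp: transpose_def)
  have inj: "inj (?t \<circ> ?r)" by (intro inj_compose inj_right_chan) simp
  have idle1: "Sim P ?S (rename (?t \<circ> ?r) g) g"
    using g inj id by (rule Sim_rename_idle(1))
  have idle2: "relabel (?t \<circ> ?r) ?S = ?S"
    using g inj id by (rule Sim_rename_idle(2))
  have dom: "fmdom (relabel (left_chan (length \<Gamma>1) 0 (length \<Delta>)) (seq [x] [x])) = {|Aux 0, ?\<beta>|}"
    unfolding fmdom_relabel[OF inj_left_chan] fmdom_seq_single by auto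
  have eq: "cut_deriv [x] [] x [] \<Gamma>1 \<Gamma>2 \<Delta> (iota P x (In 0) (Out 0)) g
      = gcut False (Aux 0) x (fmdom (relabel ?r ?S)) {|Aux 0, ?\<beta>|} (rename ?r g) (giota False x (Aux 0) ?\<beta>)"
    using dom by (simp add: cut_deriv_gcut gcut_def giota_def rename_iota)
  have "Sim P (relabel ?t (relabel ?r ?S)) (cut_deriv [x] [] x [] \<Gamma>1 \<Gamma>2 \<Delta> (iota P x (In 0) (Out 0)) g) (rename ?t (rename ?r g))"
    unfolding eq by (rule cut_giota_Der[OF Der_rename[OF g inj_right_chan] look])
  then have "Sim P ?S (cut_deriv [x] [] x [] \<Gamma>1 \<Gamma>2 \<Delta> (iota P x (In 0) (Out 0)) g) (rename (?t \<circ> ?r) g)"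
    unfolding rename_comp relabel_comp[OF inj_on_transpose inj_right_chan, symmetric] idle2 .
  then show ?thesis using idle1 by (rule Sim_trans)
qed

text \<open>Each list cut binds \<open>Aux 0\<close>, and an outer renaming shifts the inner one to
  \<open>Aux 1\<close>. The outer cut of one side is the inner cut of the other, so the sides differ
  by the swap \<open>\<tau>\<close> of these two names. What a law still has to provide is the
  comparison of positions in \<open>eq\<close>.\<close>

lemma nested_cuts:
  fixes \<tau> :: "chan \<Rightarrow> chan"
  defines "\<tau> \<equiv> transpose (Aux 0) (Aux 1)"
  assumes D: "Der P S f" "Der P T g" "Der P U h"
    and inj: "inj l1" "inj r1" "inj l2" "inj r2" "inj l1'" "inj r1'" "inj l2'" "inj r2'"
    and Aux: "l1 (Aux 0) = Aux 1" "r1 (Aux 0) = Aux 1" "r1' (Aux 0) = Aux 1" "Aux 0 |\<notin>| fmdom U"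
    and V: "V = join (Aux 0) (relabel l2 S) (relabel r2 T)" and V': "V' = join (Aux 0) (relabel l2' T) (relabel r2' U)"
    and inner: "cuttable s (Aux 0) Z (relabel l2 S) (relabel r2 T)"
    and outer: "cuttable s' (Aux 0) Z' (relabel l1 V) (relabel r1 U)"
    and T: "fmlookup T \<delta> = Some (s', Z')" "l1 (r2 \<delta>) = Aux 0"
    and J: "join (Aux 0) (relabel l1 V) (relabel r1 U) = seq \<Gamma> \<Delta>"
    and eq: "\<And>e. e |\<in>| fmdom S \<Longrightarrow> \<tau> (l1 (l2 e)) = l1' e" "\<And>e. e |\<in>| fmdom T \<Longrightarrow> \<tau> (l1 (r2 e)) = r1' (l2' e)"
      "\<And>e. e |\<in>| fmdom U \<Longrightarrow> \<tau> (r1 e) = r1' (r2' e)"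
  shows "Sim P (seq \<Gamma> \<Delta>)
    (gcut s' (Aux 0) Z' (fmdom (relabel l1 V)) (fmdom (relabel r1 U))
      (rename l1 (gcut s (Aux 0) Z (fmdom (relabel l2 S)) (fmdom (relabel r2 T)) (rename l2 f) (rename r2 g))) (rename r1 h))
    (gcut s (Aux 0) Z (fmdom (relabel l1' S)) (fmdom (relabel r1' V')) (rename l1' f)
      (rename r1' (gcut s' (Aux 0) Z' (fmdom (relabel l2' T)) (fmdom (relabel r2' U)) (rename l2' g) (rename r2' h))))"
proof -
  have relabelV: "relabel l1 V = join (Aux 1) (relabel (l1 \<circ> l2) S) (relabel (l1 \<circ> r2) T)"
    by (simp add: V relabel_join Aux relabel_comp inj)
  have relabelV': "relabel r1' V' = join (Aux 1) (relabel (r1' \<circ> l2') T) (relabel (r1' \<circ> r2') U)"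
    by (simp add: V' relabel_join Aux relabel_comp inj)
  have \<tau>: "\<tau> (Aux 0) = Aux 1" "\<tau> (Aux 1) = Aux 0" by (simp_all add: \<tau>_def)
  have in': "cuttable s (Aux 1) Z (relabel (l1 \<circ> l2) S) (relabel (l1 \<circ> r2) T)"
    using cuttable_relabel[OF inj(1) inner] by (simp add: Aux relabel_comp inj)
  have ch: "chain s (Aux 1) Z s' (Aux 0) Z' (relabel (l1 \<circ> l2) S) (relabel (l1 \<circ> r2) T) (relabel r1 U)"
  proof (rule chainI[OF in' outer[unfolded relabelV]])
    have "fmlookup (relabel (l1 \<circ> r2) T) ((l1 \<circ> r2) \<delta>) = Some (s', Z')"
      using T inj by (subst fmlookup_relabel_app) (simp_all add: inj_compose)
    then show "fmlookup (relabel (l1 \<circ> r2) T) (Aux 0) = Some (s', Z')" using T by simp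
    have "Aux 1 |\<notin>| r1 |`| fmdom U"
    proof
      assume "Aux 1 |\<in>| r1 |`| fmdom U"
      then obtain e where "e |\<in>| fmdom U" "r1 e = r1 (Aux 0)" using Aux(2) by auto
      then show False using Aux(4) injD[OF inj(2)] by metis
    qed
    then show "Aux 1 |\<notin>| fmdom (relabel r1 U)" unfolding fmdom_relabel[OF inj(2)] .
  qed
  have id: "\<tau> e = e" if "e |\<in>| fmdom (seq \<Gamma> \<Delta>)" for e
    using that by (cases e) (simp_all add: \<tau>_def transpose_def)
  have *: "Sim P (join (Aux 0) (join (Aux 1) (relabel (l1 \<circ> l2) S) (relabel (l1 \<circ> r2) T)) (relabel r1 U))
    (gcut s' (Aux 0) Z' (fmdom (join (Aux 1) (relabel (l1 \<circ> l2) S) (relabel (l1 \<circ> r2) T))) (fmdom (relabel r1 U))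
      (gcut s (Aux 1) Z (fmdom (relabel (l1 \<circ> l2) S)) (fmdom (relabel (l1 \<circ> r2) T)) (rename (l1 \<circ> l2) f) (rename (l1 \<circ> r2) g)) (rename r1 h))
    (gcut s (\<tau> (Aux 1)) Z (fmdom (relabel l1' S)) (fmdom (join (\<tau> (Aux 0)) (relabel (r1' \<circ> l2') T) (relabel (r1' \<circ> r2') U))) (rename l1' f)
      (gcut s' (\<tau> (Aux 0)) Z' (fmdom (relabel (r1' \<circ> l2') T)) (fmdom (relabel (r1' \<circ> r2') U)) (rename (r1' \<circ> l2') g) (rename (r1' \<circ> r2') h)))"
  proof (rule three_cuts[OF D _ _ _ _ _ _ _ ch])
    show "inj (l1 \<circ> l2)" "inj (l1 \<circ> r2)" "inj r1" "inj l1'" "inj (r1' \<circ> l2')" "inj (r1' \<circ> r2')"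
      using inj by (simp_all add: inj_compose)
    show "inj \<tau>" unfolding \<tau>_def by simp
    show "\<tau> ((l1 \<circ> l2) e) = l1' e" if "e |\<in>| fmdom S" for e using eq(1)[OF that] by simp
    show "\<tau> ((l1 \<circ> r2) e) = (r1' \<circ> l2') e" if "e |\<in>| fmdom T" for e using eq(2)[OF that] by simp
    show "\<tau> (r1 e) = (r1' \<circ> r2') e" if "e |\<in>| fmdom U" for e using eq(3)[OF that] by simp
    show "\<tau> e = e" if "e |\<in>| fmdom (join (Aux 0) (join (Aux 1) (relabel (l1 \<circ> l2) S) (relabel (l1 \<circ> r2) T)) (relabel r1 U))" for e
      using id[of e] that unfolding relabelV[symmetric] J .
  qed
  have L: "rename l1 (gcut s (Aux 0) Z (fmdom (relabel l2 S)) (fmdom (relabel r2 T)) (rename l2 f) (rename r2 g))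
      = gcut s (Aux 1) Z (fmdom (relabel (l1 \<circ> l2) S)) (fmdom (relabel (l1 \<circ> r2) T)) (rename (l1 \<circ> l2) f) (rename (l1 \<circ> r2) g)"
    by (simp add: rename_gcut inj Aux rename_comp relabel_comp fmdom_relabel[OF inj(1)])
  have R: "rename r1' (gcut s' (Aux 0) Z' (fmdom (relabel l2' T)) (fmdom (relabel r2' U)) (rename l2' g) (rename r2' h))
      = gcut s' (Aux 1) Z' (fmdom (relabel (r1' \<circ> l2') T)) (fmdom (relabel (r1' \<circ> r2') U)) (rename (r1' \<circ> l2') g) (rename (r1' \<circ> r2') h)"
    by (simp add: rename_gcut inj Aux rename_comp relabel_comp fmdom_relabel[OF inj(6)])
  show ?thesis using * unfolding L R relabelV' \<tau> unfolding relabelV[symmetric] J .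
qed

text \<open>Up to the names of the two cut channels, both bracketings send each position of a
  premise to the same place. The channel \<open>\<delta>\<close> is the position of \<open>y\<close>
  in the codomain of \<open>g\<close>.\<close>

lemma cut_deriv_assoc:
  assumes f: "Der P (seq \<Gamma> (\<Delta>1 @ x # \<Delta>2)) f" and g: "Der P (seq (\<Gamma>1 @ x # \<Gamma>2) (\<Theta>1 @ y # \<Theta>2)) g"
    and h: "Der P (seq (\<Lambda>1 @ y # \<Lambda>2) \<Xi>) h"
  shows "Sim P (seq (\<Lambda>1 @ \<Gamma>1 @ \<Gamma> @ \<Gamma>2 @ \<Lambda>2) (\<Delta>1 @ \<Theta>1 @ \<Xi> @ \<Theta>2 @ \<Delta>2))
    (cut_deriv (\<Gamma>1 @ \<Gamma> @ \<Gamma>2) (\<Delta>1 @ \<Theta>1) y (\<Theta>2 @ \<Delta>2) \<Lambda>1 \<Lambda>2 \<Xi>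
      (cut_deriv \<Gamma> \<Delta>1 x \<Delta>2 \<Gamma>1 \<Gamma>2 (\<Theta>1 @ y # \<Theta>2) f g) h)
    (cut_deriv \<Gamma> \<Delta>1 x \<Delta>2 (\<Lambda>1 @ \<Gamma>1) (\<Gamma>2 @ \<Lambda>2) (\<Theta>1 @ \<Xi> @ \<Theta>2) f
      (cut_deriv (\<Gamma>1 @ x # \<Gamma>2) \<Theta>1 y \<Theta>2 \<Lambda>1 \<Lambda>2 \<Xi> g h))"
proof -
  note in_seq = cut_seq(1)[of x \<Gamma>1 \<Delta>1 "\<Theta>1 @ y # \<Theta>2" \<Gamma> \<Delta>2 \<Gamma>2]
    cut_seq(2)[of \<Gamma>1 \<Delta>1 "\<Theta>1 @ y # \<Theta>2" \<Gamma> x \<Delta>2 \<Gamma>2]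
  note in_seq' = cut_seq(2)[of \<Lambda>1 \<Theta>1 \<Xi> "\<Gamma>1 @ x # \<Gamma>2" y \<Theta>2 \<Lambda>2]
  note out_seq = cut_seq(1)[of y \<Lambda>1 "\<Delta>1 @ \<Theta>1" \<Xi> "\<Gamma>1 @ \<Gamma> @ \<Gamma>2" "\<Theta>2 @ \<Delta>2" \<Lambda>2]
    cut_seq(2)[of \<Lambda>1 "\<Delta>1 @ \<Theta>1" \<Xi> "\<Gamma>1 @ \<Gamma> @ \<Gamma>2" y "\<Theta>2 @ \<Delta>2" \<Lambda>2]
  have "Sim P (seq (\<Lambda>1 @ (\<Gamma>1 @ \<Gamma> @ \<Gamma>2) @ \<Lambda>2) ((\<Delta>1 @ \<Theta>1) @ \<Xi> @ \<Theta>2 @ \<Delta>2))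
    (cut_deriv (\<Gamma>1 @ \<Gamma> @ \<Gamma>2) (\<Delta>1 @ \<Theta>1) y (\<Theta>2 @ \<Delta>2) \<Lambda>1 \<Lambda>2 \<Xi>
      (cut_deriv \<Gamma> \<Delta>1 x \<Delta>2 \<Gamma>1 \<Gamma>2 (\<Theta>1 @ y # \<Theta>2) f g) h)
    (cut_deriv \<Gamma> \<Delta>1 x \<Delta>2 (\<Lambda>1 @ \<Gamma>1) (\<Gamma>2 @ \<Lambda>2) (\<Theta>1 @ \<Xi> @ \<Theta>2) f
      (cut_deriv (\<Gamma>1 @ x # \<Gamma>2) \<Theta>1 y \<Theta>2 \<Lambda>1 \<Lambda>2 \<Xi> g h))"
    unfolding cut_deriv_gcut
  proof (rule nested_cuts[OF f g h, where \<delta> = "Out (length \<Theta>1)"])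
    show "seq (\<Gamma>1 @ \<Gamma> @ \<Gamma>2) ((\<Delta>1 @ \<Theta>1) @ y # \<Theta>2 @ \<Delta>2) = join (Aux 0)
       (relabel (left_chan (length \<Gamma>1) (length \<Delta>1) (length (\<Theta>1 @ y # \<Theta>2))) (seq \<Gamma> (\<Delta>1 @ x # \<Delta>2)))
       (relabel (right_chan (length \<Gamma>1) (length \<Gamma>) (length \<Delta>1)) (seq (\<Gamma>1 @ x # \<Gamma>2) (\<Theta>1 @ y # \<Theta>2)))"
      unfolding in_seq(2) by simp
    show "seq ((\<Lambda>1 @ \<Gamma>1) @ x # \<Gamma>2 @ \<Lambda>2) (\<Theta>1 @ \<Xi> @ \<Theta>2) = join (Aux 0)
       (relabel (left_chan (length \<Lambda>1) (length \<Theta>1) (length \<Xi>)) (seq (\<Gamma>1 @ x # \<Gamma>2) (\<Theta>1 @ y # \<Theta>2)))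
       (relabel (right_chan (length \<Lambda>1) (length (\<Gamma>1 @ x # \<Gamma>2)) (length \<Theta>1)) (seq (\<Lambda>1 @ y # \<Lambda>2) \<Xi>))"
      unfolding in_seq' by simp
    fix e
    show "transpose (Aux 0) (Aux 1) (left_chan (length \<Lambda>1) (length (\<Delta>1 @ \<Theta>1)) (length \<Xi>)
        (left_chan (length \<Gamma>1) (length \<Delta>1) (length (\<Theta>1 @ y # \<Theta>2)) e))
      = left_chan (length (\<Lambda>1 @ \<Gamma>1)) (length \<Delta>1) (length (\<Theta>1 @ \<Xi> @ \<Theta>2)) e"
      if "e |\<in>| fmdom (seq \<Gamma> (\<Delta>1 @ x # \<Delta>2))"
      using that by (cases e) (auto simp: transpose_def)
    show "transpose (Aux 0) (Aux 1) (left_chan (length \<Lambda>1) (length (\<Delta>1 @ \<Theta>1)) (length \<Xi>)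
        (right_chan (length \<Gamma>1) (length \<Gamma>) (length \<Delta>1) e))
      = right_chan (length (\<Lambda>1 @ \<Gamma>1)) (length \<Gamma>) (length \<Delta>1) (left_chan (length \<Lambda>1) (length \<Theta>1) (length \<Xi>) e)"
      if "e |\<in>| fmdom (seq (\<Gamma>1 @ x # \<Gamma>2) (\<Theta>1 @ y # \<Theta>2))"
      using that by (cases e) (auto simp: transpose_def)
    show "transpose (Aux 0) (Aux 1) (right_chan (length \<Lambda>1) (length (\<Gamma>1 @ \<Gamma> @ \<Gamma>2)) (length (\<Delta>1 @ \<Theta>1)) e)
      = right_chan (length (\<Lambda>1 @ \<Gamma>1)) (length \<Gamma>) (length \<Delta>1)
         (right_chan (length \<Lambda>1) (length (\<Gamma>1 @ x # \<Gamma>2)) (length \<Theta>1) e)"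
      if "e |\<in>| fmdom (seq (\<Lambda>1 @ y # \<Lambda>2) \<Xi>)"
      using that by (cases e) (auto simp: transpose_def)
  qed (use in_seq(1) out_seq in \<open>simp_all add: inj_left_chan inj_right_chan\<close>)
  then show ?thesis by simp
qed

text \<open>An instance of \<open>nested_cuts\<close> with \<open>f\<close> in the middle, between
  \<open>g\<close> and \<open>h\<close>. The cut on \<open>x\<close> runs against the order of this
  chain, whence \<open>fl\<close> and the sign \<open>False\<close>.\<close>

lemma cut_deriv_interchange_codomain:
  assumes f: "Der P (seq \<Gamma> (\<Delta>1 @ x # \<Delta>2 @ y # \<Delta>3)) f" and g: "Der P (seq (\<Gamma>1 @ [x]) \<Theta>) g"
    and h: "Der P (seq (y # \<Lambda>2) \<Xi>) h"
  shows "Sim P (seq (\<Gamma>1 @ \<Gamma> @ \<Lambda>2) (\<Delta>1 @ \<Theta> @ \<Delta>2 @ \<Xi> @ \<Delta>3))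
    (cut_deriv (\<Gamma>1 @ \<Gamma>) (\<Delta>1 @ \<Theta> @ \<Delta>2) y \<Delta>3 [] \<Lambda>2 \<Xi> (cut_deriv \<Gamma> \<Delta>1 x (\<Delta>2 @ y # \<Delta>3) \<Gamma>1 [] \<Theta> f g) h)
    (cut_deriv (\<Gamma> @ \<Lambda>2) \<Delta>1 x (\<Delta>2 @ \<Xi> @ \<Delta>3) \<Gamma>1 [] \<Theta> (cut_deriv \<Gamma> (\<Delta>1 @ x # \<Delta>2) y \<Delta>3 [] \<Lambda>2 \<Xi> f h) g)"
proof -
  have fl: "gcut True (Aux 0) x K K' a b = gcut False (Aux 0) x K' K b a" for K K' and a b :: "('o, 'm) der"
    by (simp add: gcut_def)
  note in1 = cut_seq(1)[of x \<Gamma>1 \<Delta>1 \<Theta> \<Gamma> "\<Delta>2 @ y # \<Delta>3" "[]"]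
  have in_seq: "cuttable False (Aux 0) x (relabel (right_chan (length \<Gamma>1) (length \<Gamma>) (length \<Delta>1)) (seq (\<Gamma>1 @ [x]) \<Theta>))
      (relabel (left_chan (length \<Gamma>1) (length \<Delta>1) (length \<Theta>)) (seq \<Gamma> (\<Delta>1 @ x # \<Delta>2 @ y # \<Delta>3)))"
    using cuttable_flip[OF in1] by simp
  note in2 = cut_seq(2)[of \<Gamma>1 \<Delta>1 \<Theta> \<Gamma> x "\<Delta>2 @ y # \<Delta>3" "[]"]
  note in_seq' = cut_seq(2)[of "[]" "\<Delta>1 @ x # \<Delta>2" \<Xi> \<Gamma> y \<Delta>3 \<Lambda>2]
  note out_seq = cut_seq(1)[of y "[]" "\<Delta>1 @ \<Theta> @ \<Delta>2" \<Xi> "\<Gamma>1 @ \<Gamma>" \<Delta>3 \<Lambda>2]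
    cut_seq(2)[of "[]" "\<Delta>1 @ \<Theta> @ \<Delta>2" \<Xi> "\<Gamma>1 @ \<Gamma>" y \<Delta>3 \<Lambda>2]
  have f': "Der P (seq \<Gamma> ((\<Delta>1 @ x # \<Delta>2) @ y # \<Delta>3)) f" using f by simp
  have h': "Der P (seq ([] @ y # \<Lambda>2) \<Xi>) h" using h by simp
  have "Sim P (seq ([] @ (\<Gamma>1 @ \<Gamma>) @ \<Lambda>2) ((\<Delta>1 @ \<Theta> @ \<Delta>2) @ \<Xi> @ \<Delta>3))
    (cut_deriv (\<Gamma>1 @ \<Gamma>) (\<Delta>1 @ \<Theta> @ \<Delta>2) y \<Delta>3 [] \<Lambda>2 \<Xi> (cut_deriv \<Gamma> \<Delta>1 x (\<Delta>2 @ y # \<Delta>3) \<Gamma>1 [] \<Theta> f g) h)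
    (cut_deriv (\<Gamma> @ \<Lambda>2) \<Delta>1 x (\<Delta>2 @ \<Xi> @ \<Delta>3) \<Gamma>1 [] \<Theta> (cut_deriv \<Gamma> (\<Delta>1 @ x # \<Delta>2) y \<Delta>3 [] \<Lambda>2 \<Xi> f h) g)"
    unfolding cut_deriv_gcut fl append_assoc append_Cons
  proof (rule nested_cuts[OF g f h', where \<delta> = "Out (length \<Delta>1 + 1 + length \<Delta>2)"])
    show "seq (\<Gamma>1 @ \<Gamma>) (\<Delta>1 @ \<Theta> @ \<Delta>2 @ y # \<Delta>3) = join (Aux 0)
       (relabel (right_chan (length \<Gamma>1) (length \<Gamma>) (length \<Delta>1)) (seq (\<Gamma>1 @ [x]) \<Theta>))
       (relabel (left_chan (length \<Gamma>1) (length \<Delta>1) (length \<Theta>)) (seq \<Gamma> (\<Delta>1 @ x # \<Delta>2 @ y # \<Delta>3)))"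
      using in2 unfolding join_flip[OF in1] by simp
    show "seq (\<Gamma> @ \<Lambda>2) (\<Delta>1 @ x # \<Delta>2 @ \<Xi> @ \<Delta>3) = join (Aux 0)
       (relabel (left_chan (length ([] :: 'o form list)) (length (\<Delta>1 @ x # \<Delta>2)) (length \<Xi>)) (seq \<Gamma> (\<Delta>1 @ x # \<Delta>2 @ y # \<Delta>3)))
       (relabel (right_chan (length ([] :: 'o form list)) (length \<Gamma>) (length (\<Delta>1 @ x # \<Delta>2))) (seq ([] @ y # \<Lambda>2) \<Xi>))"
      using in_seq' by simp
    fix e
    show "transpose (Aux 0) (Aux 1) (left_chan (length ([] :: 'o form list)) (length (\<Delta>1 @ \<Theta> @ \<Delta>2)) (length \<Xi>)
        (right_chan (length \<Gamma>1) (length \<Gamma>) (length \<Delta>1) e))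
      = right_chan (length \<Gamma>1) (length (\<Gamma> @ \<Lambda>2)) (length \<Delta>1) e"
      if "e |\<in>| fmdom (seq (\<Gamma>1 @ [x]) \<Theta>)"
      using that by (cases e) (auto simp: transpose_def)
    show "transpose (Aux 0) (Aux 1) (left_chan (length ([] :: 'o form list)) (length (\<Delta>1 @ \<Theta> @ \<Delta>2)) (length \<Xi>)
        (left_chan (length \<Gamma>1) (length \<Delta>1) (length \<Theta>) e))
      = left_chan (length \<Gamma>1) (length \<Delta>1) (length \<Theta>)
         (left_chan (length ([] :: 'o form list)) (length (\<Delta>1 @ x # \<Delta>2)) (length \<Xi>) e)"
      if "e |\<in>| fmdom (seq \<Gamma> (\<Delta>1 @ x # \<Delta>2 @ y # \<Delta>3))"
    proof (cases e)
      case (Out j)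
      \<comment> \<open>\<open>f\<close> has two cut positions, and the shift of \<open>j\<close>
        depends on which of them precede it. Writing \<open>j\<close> as a successor, once or twice,
        resolves the truncated subtractions.\<close>
      consider "j < length \<Delta>1" | "j = length \<Delta>1" | "length \<Delta>1 < j" "j < length \<Delta>1 + 1 + length \<Delta>2"
        | "j = length \<Delta>1 + 1 + length \<Delta>2" | "length \<Delta>1 + 1 + length \<Delta>2 < j" by linarith
      then show ?thesis
      proof cases
        case 3
        then obtain k where k: "j = Suc k" by (cases j) simp_all
        show ?thesis using 3 by (auto simp: Out k transpose_def)
      next
        case 5
        then obtain k' where "j = Suc k'" by (cases j) simp_all
        then obtain k where k: "j = Suc (Suc k)" using 5 by (cases k') simp_all
        show ?thesis using 5 by (auto simp: Out k transpose_def)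
      qed (simp_all add: Out transpose_def)
    qed (use that in \<open>simp_all add: transpose_def\<close>)
    show "transpose (Aux 0) (Aux 1) (right_chan (length ([] :: 'o form list)) (length (\<Gamma>1 @ \<Gamma>)) (length (\<Delta>1 @ \<Theta> @ \<Delta>2)) e)
      = left_chan (length \<Gamma>1) (length \<Delta>1) (length \<Theta>)
         (right_chan (length ([] :: 'o form list)) (length \<Gamma>) (length (\<Delta>1 @ x # \<Delta>2)) e)"
      if "e |\<in>| fmdom (seq ([] @ y # \<Lambda>2) \<Xi>)"
      using that by (cases e) (auto simp: transpose_def)
  qed (use in_seq out_seq in \<open>simp_all add: inj_left_chan inj_right_chan nth_append\<close>)
  then show ?thesis by simp
qed

text \<open>Now \<open>h\<close> is in the middle, between \<open>f\<close> and \<open>g\<close>.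
  The cut on \<open>y\<close> runs against the order of this chain; it is the outer cut on the left
  side and the inner one on the right side.\<close>

lemma cut_deriv_interchange_domain:
  assumes f: "Der P (seq \<Gamma> (\<Delta>1 @ [x])) f" and g: "Der P (seq \<Lambda> (y # \<Theta>2)) g"
    and h: "Der P (seq (\<Gamma>1 @ x # \<Gamma>2 @ y # \<Gamma>3) \<Xi>) h"
  shows "Sim P (seq (\<Gamma>1 @ \<Gamma> @ \<Gamma>2 @ \<Lambda> @ \<Gamma>3) (\<Delta>1 @ \<Xi> @ \<Theta>2))
    (cut_deriv \<Lambda> [] y \<Theta>2 (\<Gamma>1 @ \<Gamma> @ \<Gamma>2) \<Gamma>3 (\<Delta>1 @ \<Xi>) g (cut_deriv \<Gamma> \<Delta>1 x [] \<Gamma>1 (\<Gamma>2 @ y # \<Gamma>3) \<Xi> f h))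
    (cut_deriv \<Gamma> \<Delta>1 x [] \<Gamma>1 (\<Gamma>2 @ \<Lambda> @ \<Gamma>3) (\<Xi> @ \<Theta>2) f (cut_deriv \<Lambda> [] y \<Theta>2 (\<Gamma>1 @ x # \<Gamma>2) \<Gamma>3 \<Xi> g h))"
proof -
  have fl: "gcut True (Aux 0) y K K' a b = gcut False (Aux 0) y K' K b a" for K K' and a b :: "('o, 'm) der"
    by (simp add: gcut_def)
  note in_seq = cut_seq(1)[of x \<Gamma>1 \<Delta>1 \<Xi> \<Gamma> "[]" "\<Gamma>2 @ y # \<Gamma>3"]
    cut_seq(2)[of \<Gamma>1 \<Delta>1 \<Xi> \<Gamma> x "[]" "\<Gamma>2 @ y # \<Gamma>3"]
  note in1' = cut_seq(1)[of y "\<Gamma>1 @ x # \<Gamma>2" "[]" \<Xi> \<Lambda> \<Theta>2 \<Gamma>3]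
    and in2' = cut_seq(2)[of "\<Gamma>1 @ x # \<Gamma>2" "[]" \<Xi> \<Lambda> y \<Theta>2 \<Gamma>3]
  note out1 = cut_seq(1)[of y "\<Gamma>1 @ \<Gamma> @ \<Gamma>2" "[]" "\<Delta>1 @ \<Xi>" \<Lambda> \<Theta>2 \<Gamma>3]
    and out2 = cut_seq(2)[of "\<Gamma>1 @ \<Gamma> @ \<Gamma>2" "[]" "\<Delta>1 @ \<Xi>" \<Lambda> y \<Theta>2 \<Gamma>3]
  note out_seq = cuttable_flip[OF out1] out2[unfolded join_flip[OF out1]]
  have g': "Der P (seq \<Lambda> ([] @ y # \<Theta>2)) g" using g by simp
  have "Sim P (seq ((\<Gamma>1 @ \<Gamma> @ \<Gamma>2) @ \<Lambda> @ \<Gamma>3) ([] @ (\<Delta>1 @ \<Xi>) @ \<Theta>2))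
    (cut_deriv \<Lambda> [] y \<Theta>2 (\<Gamma>1 @ \<Gamma> @ \<Gamma>2) \<Gamma>3 (\<Delta>1 @ \<Xi>) g (cut_deriv \<Gamma> \<Delta>1 x [] \<Gamma>1 (\<Gamma>2 @ y # \<Gamma>3) \<Xi> f h))
    (cut_deriv \<Gamma> \<Delta>1 x [] \<Gamma>1 (\<Gamma>2 @ \<Lambda> @ \<Gamma>3) (\<Xi> @ \<Theta>2) f (cut_deriv \<Lambda> [] y \<Theta>2 (\<Gamma>1 @ x # \<Gamma>2) \<Gamma>3 \<Xi> g h))"
    unfolding cut_deriv_gcut fl append_assoc append_Cons
  proof (rule nested_cuts[OF f h g', where \<delta> = "In (length \<Gamma>1 + 1 + length \<Gamma>2)"])
    show "seq (\<Gamma>1 @ \<Gamma> @ \<Gamma>2 @ y # \<Gamma>3) (\<Delta>1 @ \<Xi>) = join (Aux 0)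
       (relabel (left_chan (length \<Gamma>1) (length \<Delta>1) (length \<Xi>)) (seq \<Gamma> (\<Delta>1 @ [x])))
       (relabel (right_chan (length \<Gamma>1) (length \<Gamma>) (length \<Delta>1)) (seq (\<Gamma>1 @ x # \<Gamma>2 @ y # \<Gamma>3) \<Xi>))"
      using in_seq(2) by simp
    show "seq (\<Gamma>1 @ x # \<Gamma>2 @ \<Lambda> @ \<Gamma>3) (\<Xi> @ \<Theta>2) = join (Aux 0)
       (relabel (right_chan (length (\<Gamma>1 @ x # \<Gamma>2)) (length \<Lambda>) (length ([] :: 'o form list))) (seq (\<Gamma>1 @ x # \<Gamma>2 @ y # \<Gamma>3) \<Xi>))
       (relabel (left_chan (length (\<Gamma>1 @ x # \<Gamma>2)) (length ([] :: 'o form list)) (length \<Xi>)) (seq \<Lambda> ([] @ y # \<Theta>2)))"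
      using in2' unfolding join_flip[OF in1'] by simp
    fix e
    show "transpose (Aux 0) (Aux 1) (right_chan (length (\<Gamma>1 @ \<Gamma> @ \<Gamma>2)) (length \<Lambda>) (length ([] :: 'o form list))
        (left_chan (length \<Gamma>1) (length \<Delta>1) (length \<Xi>) e))
      = left_chan (length \<Gamma>1) (length \<Delta>1) (length (\<Xi> @ \<Theta>2)) e"
      if "e |\<in>| fmdom (seq \<Gamma> (\<Delta>1 @ [x]))"
      using that by (cases e) (auto simp: transpose_def)
    show "transpose (Aux 0) (Aux 1) (right_chan (length (\<Gamma>1 @ \<Gamma> @ \<Gamma>2)) (length \<Lambda>) (length ([] :: 'o form list))
        (right_chan (length \<Gamma>1) (length \<Gamma>) (length \<Delta>1) e))
      = right_chan (length \<Gamma>1) (length \<Gamma>) (length \<Delta>1)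
         (right_chan (length (\<Gamma>1 @ x # \<Gamma>2)) (length \<Lambda>) (length ([] :: 'o form list)) e)"
      if "e |\<in>| fmdom (seq (\<Gamma>1 @ x # \<Gamma>2 @ y # \<Gamma>3) \<Xi>)"
    proof (cases e)
      case (In j)
      consider "j < length \<Gamma>1" | "j = length \<Gamma>1" | "length \<Gamma>1 < j" "j < length \<Gamma>1 + 1 + length \<Gamma>2"
        | "j = length \<Gamma>1 + 1 + length \<Gamma>2" | "length \<Gamma>1 + 1 + length \<Gamma>2 < j" by linarith
      then show ?thesis
      proof cases
        case 3
        then obtain k where k: "j = Suc k" by (cases j) simp_all
        show ?thesis using 3 by (auto simp: In k transpose_def)
      next
        case 5
        then obtain k' where "j = Suc k'" by (cases j) simp_all
        then obtain k where k: "j = Suc (Suc k)" using 5 by (cases k') simp_all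
        show ?thesis using 5 by (auto simp: In k transpose_def)
      qed (simp_all add: In transpose_def)
    qed (use that in \<open>simp_all add: transpose_def\<close>)
    show "transpose (Aux 0) (Aux 1) (left_chan (length (\<Gamma>1 @ \<Gamma> @ \<Gamma>2)) (length ([] :: 'o form list)) (length (\<Delta>1 @ \<Xi>)) e)
      = right_chan (length \<Gamma>1) (length \<Gamma>) (length \<Delta>1)
         (left_chan (length (\<Gamma>1 @ x # \<Gamma>2)) (length ([] :: 'o form list)) (length \<Xi>) e)"
      if "e |\<in>| fmdom (seq \<Lambda> ([] @ y # \<Theta>2))"
      using that by (cases e) (auto simp: transpose_def)
  qed (use in_seq out_seq in \<open>simp_all add: inj_left_chan inj_right_chan nth_append\<close>)
  then show ?thesis by simp
qed

text \<open>Permuting the premises before the cut or the conclusion after it puts each formula in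
  the same position: this is \<open>l\<close> for the channels of \<open>f\<close> and
  \<open>r\<close> for those of \<open>g\<close>. Elsewhere the renamings may differ, so the terms
  are compared by \<open>Sim_rename_cong\<close>.\<close>

lemma cut_deriv_act:
  assumes f: "Der P (seq \<Gamma> (\<Delta>1 @ x # \<Delta>2)) f" and g: "Der P (seq (\<Gamma>1 @ x # \<Gamma>2) \<Delta>) g"
    and \<sigma>: "\<sigma> permutes {..<length \<Gamma>}" and \<tau>: "\<tau> permutes {..<length (\<Delta>1 @ x # \<Delta>2)}"
    and \<sigma>': "\<sigma>' permutes {..<length (\<Gamma>1 @ x # \<Gamma>2)}" and \<tau>': "\<tau>' permutes {..<length \<Delta>}"
    and \<Delta>': "permute_list \<tau> (\<Delta>1 @ x # \<Delta>2) = \<Delta>1' @ x # \<Delta>2'" "\<tau> (length \<Delta>1') = length \<Delta>1"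
    and \<Gamma>': "permute_list \<sigma>' (\<Gamma>1 @ x # \<Gamma>2) = \<Gamma>1' @ x # \<Gamma>2'" "\<sigma>' (length \<Gamma>1') = length \<Gamma>1"
    and \<pi>: "\<pi> permutes {..<length (\<Gamma>1 @ \<Gamma> @ \<Gamma>2)}"
      "\<forall>p < length (\<Gamma>1 @ \<Gamma> @ \<Gamma>2). slot (length \<Gamma>1) (length \<Gamma>) (\<pi> p) = map_sum \<sigma>' \<sigma> (slot (length \<Gamma>1') (length \<Gamma>) p)"
    and \<rho>: "\<rho> permutes {..<length (\<Delta>1 @ \<Delta> @ \<Delta>2)}"
      "\<forall>p < length (\<Delta>1 @ \<Delta> @ \<Delta>2). slot (length \<Delta>1) (length \<Delta>) (\<rho> p) = map_sum \<tau> \<tau>' (slot (length \<Delta>1') (length \<Delta>) p)"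
  shows "cls P (\<Gamma>1' @ permute_list \<sigma> \<Gamma> @ \<Gamma>2') (\<Delta>1' @ permute_list \<tau>' \<Delta> @ \<Delta>2')
      (cut_deriv (permute_list \<sigma> \<Gamma>) \<Delta>1' x \<Delta>2' \<Gamma>1' \<Gamma>2' (permute_list \<tau>' \<Delta>)
        (rename (perm_chan \<sigma> \<tau>) f) (rename (perm_chan \<sigma>' \<tau>') g))
    = cls P (permute_list \<pi> (\<Gamma>1 @ \<Gamma> @ \<Gamma>2)) (permute_list \<rho> (\<Delta>1 @ \<Delta> @ \<Delta>2))
      (rename (perm_chan \<pi> \<rho>) (cut_deriv \<Gamma> \<Delta>1 x \<Delta>2 \<Gamma>1 \<Gamma>2 \<Delta> f g))"
proof -
  let ?S = "seq \<Gamma> (\<Delta>1 @ x # \<Delta>2)" and ?T = "seq (\<Gamma>1 @ x # \<Gamma>2) \<Delta>"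
  let ?l = "left_chan (length \<Gamma>1) (length \<Delta>1) (length \<Delta>)" and ?r = "right_chan (length \<Gamma>1) (length \<Gamma>) (length \<Delta>1)"
  let ?l' = "left_chan (length \<Gamma>1') (length \<Delta>1') (length \<Delta>)" and ?r' = "right_chan (length \<Gamma>1') (length \<Gamma>) (length \<Delta>1')"
  let ?p = "perm_chan \<sigma> \<tau>" and ?q = "perm_chan \<sigma>' \<tau>'" and ?m = "perm_chan \<pi> \<rho>"
  note inj = inj_perm_chan[OF \<sigma> \<tau>] inj_perm_chan[OF \<sigma>' \<tau>'] inj_perm_chan[OF \<pi>(1) \<rho>(1)] inj_left_chan inj_right_chan
  have len\<Gamma>: "length \<Gamma>1' + length \<Gamma>2' = length \<Gamma>1 + length \<Gamma>2" using arg_cong[OF \<Gamma>'(1), of length] by simp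
  have len\<Delta>: "length \<Delta>1' + length \<Delta>2' = length \<Delta>1 + length \<Delta>2" using arg_cong[OF \<Delta>'(1), of length] by simp
  have \<Gamma>_in: "inv \<pi> (length \<Gamma>1 + i) = length \<Gamma>1' + inv \<sigma> i" if "i < length \<Gamma>" for i
    by (rule perm_slot_Inr[OF \<pi> \<sigma> _ that]) (use len\<Gamma> in simp)
  have \<Delta>_in: "inv \<rho> (length \<Delta>1 + i) = length \<Delta>1' + inv \<tau>' i" if "i < length \<Delta>" for i
    by (rule perm_slot_Inr[OF \<rho> \<tau>' _ that]) (use len\<Delta> in simp)
  have \<Gamma>_out: "inv \<pi> (if i < length \<Gamma>1 then i else i - 1 + length \<Gamma>)
      = (if inv \<sigma>' i < length \<Gamma>1' then inv \<sigma>' i else inv \<sigma>' i - 1 + length \<Gamma>)" "inv \<sigma>' i \<noteq> length \<Gamma>1'"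
    if "i < length (\<Gamma>1 @ x # \<Gamma>2)" "i \<noteq> length \<Gamma>1" for i
    by (rule perm_slot_Inl[OF \<pi> \<sigma>' _ _ \<Gamma>'(2) that]; use len\<Gamma> in simp)+
  have \<Delta>_out: "inv \<rho> (if i < length \<Delta>1 then i else i - 1 + length \<Delta>)
      = (if inv \<tau> i < length \<Delta>1' then inv \<tau> i else inv \<tau> i - 1 + length \<Delta>)" "inv \<tau> i \<noteq> length \<Delta>1'"
    if "i < length (\<Delta>1 @ x # \<Delta>2)" "i \<noteq> length \<Delta>1" for i
    by (rule perm_slot_Inl[OF \<rho> \<tau> _ _ \<Delta>'(2) that]; use len\<Delta> in simp)+
  have \<Gamma>_x: "inv \<sigma>' (length \<Gamma>1) = length \<Gamma>1'" using permutes_inverses(2)[OF \<sigma>', of "length \<Gamma>1'"] \<Gamma>'(2) by simp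
  have \<Delta>_x: "inv \<tau> (length \<Delta>1) = length \<Delta>1'" using permutes_inverses(2)[OF \<tau>, of "length \<Delta>1'"] \<Delta>'(2) by simp
  have l: "?m (?l e) = ?l' (?p e)" if e: "e |\<in>| fmdom ?S" for e
  proof (cases e)
    case (In i)
    then show ?thesis using \<Gamma>_in[of i] e by simp
  next
    case (Out i)
    show ?thesis
    proof (cases "i = length \<Delta>1")
      case True
      then show ?thesis using Out \<Delta>_x by simp
    next
      case False
      have "i < length (\<Delta>1 @ x # \<Delta>2)" using e Out by simp
      note o = \<Delta>_out[OF this False]
      show ?thesis using o False unfolding Out by (cases "i < length \<Delta>1"; cases "inv \<tau> i < length \<Delta>1'") simp_all
    qed
  qed (use e in simp)
  have r: "?m (?r e) = ?r' (?q e)" if e: "e |\<in>| fmdom ?T" for e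
  proof (cases e)
    case (Out i)
    then show ?thesis using \<Delta>_in[of i] e by simp
  next
    case (In i)
    show ?thesis
    proof (cases "i = length \<Gamma>1")
      case True
      then show ?thesis using In \<Gamma>_x by simp
    next
      case False
      have "i < length (\<Gamma>1 @ x # \<Gamma>2)" using e In by simp
      note o = \<Gamma>_out[OF this False]
      show ?thesis using o False unfolding In by (cases "i < length \<Gamma>1"; cases "inv \<sigma>' i < length \<Gamma>1'") simp_all
    qed
  qed (use e in simp)
  have S: "relabel ?l' (seq (permute_list \<sigma> \<Gamma>) (\<Delta>1' @ x # \<Delta>2')) = relabel ?m (relabel ?l ?S)"
    unfolding \<Delta>'(1)[symmetric] perm_seq[OF \<sigma> \<tau>, symmetric] relabel_comp[OF inj(4) inj(1), symmetric]
      relabel_comp[OF inj(3) inj(4), symmetric]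
    by (rule relabel_cong[OF inj_compose[OF inj(4) inj(1)] inj_compose[OF inj(3) inj(4)]]) (use l in simp)
  have T: "relabel ?r' (seq (\<Gamma>1' @ x # \<Gamma>2') (permute_list \<tau>' \<Delta>)) = relabel ?m (relabel ?r ?T)"
    unfolding \<Gamma>'(1)[symmetric] perm_seq[OF \<sigma>' \<tau>', symmetric] relabel_comp[OF inj(5) inj(2), symmetric]
      relabel_comp[OF inj(3) inj(5), symmetric]
    by (rule relabel_cong[OF inj_compose[OF inj(5) inj(2)] inj_compose[OF inj(3) inj(5)]]) (use r in simp)
  have f': "Sim P (relabel ?m (relabel ?l ?S)) (rename ?l' (rename ?p f)) (rename ?m (rename ?l f))"
    unfolding rename_comp relabel_comp[OF inj(3) inj(4), symmetric]
    by (rule Sim_sym, rule Sim_rename_cong[OF f inj_compose[OF inj(3) inj(4)] inj_compose[OF inj(4) inj(1)]]) (use l in simp)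
  have g': "Sim P (relabel ?m (relabel ?r ?T)) (rename ?r' (rename ?q g)) (rename ?m (rename ?r g))"
    unfolding rename_comp relabel_comp[OF inj(3) inj(5), symmetric]
    by (rule Sim_sym, rule Sim_rename_cong[OF g inj_compose[OF inj(3) inj(5)] inj_compose[OF inj(5) inj(2)]]) (use r in simp)
  have m: "?m (Aux 0) = Aux 0" by simp
  have c: "cuttable True (Aux 0) x (relabel ?m (relabel ?l ?S)) (relabel ?m (relabel ?r ?T))"
    using cuttable_relabel[OF inj(3) cut_seq(1)] unfolding m .
  have j: "join (Aux 0) (relabel ?m (relabel ?l ?S)) (relabel ?m (relabel ?r ?T)) = seq (permute_list \<pi> (\<Gamma>1 @ \<Gamma> @ \<Gamma>2)) (permute_list \<rho> (\<Delta>1 @ \<Delta> @ \<Delta>2))"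
    unfolding perm_seq[OF \<pi>(1) \<rho>(1), symmetric] cut_seq(2)[of \<Gamma>1 \<Delta>1 \<Delta> \<Gamma> x \<Delta>2 \<Gamma>2, symmetric] relabel_join[OF inj(3)] m ..
  have len: "length (permute_list \<sigma> \<Gamma>) = length \<Gamma>" "length (permute_list \<tau>' \<Delta>) = length \<Delta>" by simp_all
  have j': "seq (\<Gamma>1' @ permute_list \<sigma> \<Gamma> @ \<Gamma>2') (\<Delta>1' @ permute_list \<tau>' \<Delta> @ \<Delta>2')
      = join (Aux 0) (relabel ?m (relabel ?l ?S)) (relabel ?m (relabel ?r ?T))"
    unfolding cut_seq(2)[of \<Gamma>1' \<Delta>1' "permute_list \<tau>' \<Delta>" "permute_list \<sigma> \<Gamma>" x \<Delta>2' \<Gamma>2', symmetric] len S T ..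
  show ?thesis
  proof (rule cls_eqI)
    show "seq (\<Gamma>1' @ permute_list \<sigma> \<Gamma> @ \<Gamma>2') (\<Delta>1' @ permute_list \<tau>' \<Delta> @ \<Delta>2')
      = seq (permute_list \<pi> (\<Gamma>1 @ \<Gamma> @ \<Gamma>2)) (permute_list \<rho> (\<Delta>1 @ \<Delta> @ \<Delta>2))"
      unfolding j' j ..
    show "Sim P (seq (\<Gamma>1' @ permute_list \<sigma> \<Gamma> @ \<Gamma>2') (\<Delta>1' @ permute_list \<tau>' \<Delta> @ \<Delta>2'))
      (cut_deriv (permute_list \<sigma> \<Gamma>) \<Delta>1' x \<Delta>2' \<Gamma>1' \<Gamma>2' (permute_list \<tau>' \<Delta>) (rename ?p f) (rename ?q g))
      (rename ?m (cut_deriv \<Gamma> \<Delta>1 x \<Delta>2 \<Gamma>1 \<Gamma>2 \<Delta> f g))"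
      unfolding j' cut_deriv_gcut rename_gcut[OF inj(3)] m len S T fmdom_relabel[OF inj(3), symmetric]
      by (rule Sim_gcut[OF c f' g'])
  qed
qed

section \<open>The polycategory axioms for formulas and classes of derivations\<close>

lemma seq_formulas:
  assumes "wfs P (seq \<Gamma> \<Delta>)"
  shows "set \<Gamma> \<union> set \<Delta> \<subseteq> formulas P"
proof -
  have "\<Gamma> ! i \<in> formulas P" if "i < length \<Gamma>" for i
    using assms[unfolded wfs_def, rule_format, of "In i" False "\<Gamma> ! i"] that by simp
  moreover have "\<Delta> ! i \<in> formulas P" if "i < length \<Delta>" for i
    using assms[unfolded wfs_def, rule_format, of "Out i" True "\<Delta> ! i"] that by simp
  ultimately show ?thesis by (auto simp: in_set_conv_nth)
qed

lemma SigmaPi_Idn: "Idn (SigmaPi P) X = cls P [X] [X] (iota P X (In 0) (Out 0))"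
  by (simp add: SigmaPi_def cls_def)

lemma SigmaPi_Ob: "Ob (SigmaPi P) = formulas P"
  by (simp add: SigmaPi_def)

lemma polycategory_SigmaPi: "polycategory (SigmaPi P)"
proof (rule polycategory.intro)
  fix f \<Gamma> \<Delta>
  assume "f \<in> Hom (SigmaPi P) \<Gamma> \<Delta>"
  then show "set \<Gamma> \<union> set \<Delta> \<subseteq> Ob (SigmaPi P)"
    unfolding SigmaPi_Hom SigmaPi_Ob using seq_formulas Der_wfs by blast
next
  fix x assume "x \<in> Ob (SigmaPi P)"
  then show "Idn (SigmaPi P) x \<in> Hom (SigmaPi P) [x] [x]"
    unfolding SigmaPi_Hom SigmaPi_Ob SigmaPi_Idn using Der_iota by blast
next
  fix F \<Gamma> \<Delta>1 x \<Delta>2 G \<Gamma>1 \<Gamma>2 \<Delta>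
  assume "F \<in> Hom (SigmaPi P) \<Gamma> (\<Delta>1 @ x # \<Delta>2)" "G \<in> Hom (SigmaPi P) (\<Gamma>1 @ x # \<Gamma>2) \<Delta>"
  then obtain f g where f: "Der P (seq \<Gamma> (\<Delta>1 @ x # \<Delta>2)) f" "F = cls P \<Gamma> (\<Delta>1 @ x # \<Delta>2) f"
    and g: "Der P (seq (\<Gamma>1 @ x # \<Gamma>2) \<Delta>) g" "G = cls P (\<Gamma>1 @ x # \<Gamma>2) \<Delta> g"
    unfolding SigmaPi_Hom by blast
  show "polycat.cut (SigmaPi P) \<Gamma> \<Delta>1 x \<Delta>2 \<Gamma>1 \<Gamma>2 \<Delta> F G \<in> Hom (SigmaPi P) (\<Gamma>1 @ \<Gamma> @ \<Gamma>2) (\<Delta>1 @ \<Delta> @ \<Delta>2)"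
    unfolding SigmaPi_Hom f(2) g(2) cut_cls[OF f(1) g(1)] using cut_deriv_Der[OF f(1) g(1)] by blast
next
  fix F \<Gamma> \<Delta> \<sigma> \<tau>
  assume F: "F \<in> Hom (SigmaPi P) \<Gamma> \<Delta>" and \<sigma>: "\<sigma> permutes {..<length \<Gamma>}" and \<tau>: "\<tau> permutes {..<length \<Delta>}"
  obtain f where f: "Der P (seq \<Gamma> \<Delta>) f" "F = cls P \<Gamma> \<Delta> f" using F unfolding SigmaPi_Hom by blast
  show "act (SigmaPi P) \<Gamma> \<Delta> \<sigma> \<tau> F \<in> Hom (SigmaPi P) (permute_list \<sigma> \<Gamma>) (permute_list \<tau> \<Delta>)"
    unfolding SigmaPi_Hom f(2) act_cls[OF f(1) \<sigma> \<tau>] using act_Der[OF f(1) \<sigma> \<tau>] by blast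
next
  fix F \<Gamma> \<Delta>1 x \<Delta>2
  assume "F \<in> Hom (SigmaPi P) \<Gamma> (\<Delta>1 @ x # \<Delta>2)"
  then obtain f where f: "Der P (seq \<Gamma> (\<Delta>1 @ x # \<Delta>2)) f" "F = cls P \<Gamma> (\<Delta>1 @ x # \<Delta>2) f"
    unfolding SigmaPi_Hom by blast
  have "x \<in> formulas P" using seq_formulas[OF Der_wfs[OF f(1)]] by simp
  then have i: "Der P (seq ([] @ x # []) [x]) (iota P x (In 0) (Out 0))" using Der_iota by simp
  show "polycat.cut (SigmaPi P) \<Gamma> \<Delta>1 x \<Delta>2 [] [] [x] F (Idn (SigmaPi P) x) = F"
    unfolding f(2) SigmaPi_Idn using cut_cls[OF f(1) i] cls_eqI[OF cut_iota_right[OF f(1)] HOL.refl] by simp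
next
  fix G \<Gamma>1 x \<Gamma>2 \<Delta>
  assume "G \<in> Hom (SigmaPi P) (\<Gamma>1 @ x # \<Gamma>2) \<Delta>"
  then obtain g where g: "Der P (seq (\<Gamma>1 @ x # \<Gamma>2) \<Delta>) g" "G = cls P (\<Gamma>1 @ x # \<Gamma>2) \<Delta> g"
    unfolding SigmaPi_Hom by blast
  have "x \<in> formulas P" using seq_formulas[OF Der_wfs[OF g(1)]] by simp
  then have i: "Der P (seq [x] ([] @ x # [])) (iota P x (In 0) (Out 0))" using Der_iota by simp
  show "polycat.cut (SigmaPi P) [x] [] x [] \<Gamma>1 \<Gamma>2 \<Delta> (Idn (SigmaPi P) x) G = G"
    unfolding g(2) SigmaPi_Idn using cut_cls[OF i g(1)] cls_eqI[OF cut_iota_left[OF g(1)] HOL.refl] by simp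
next
  fix F \<Gamma> \<Delta>1 x \<Delta>2 G \<Gamma>1 \<Gamma>2 \<Theta>1 y \<Theta>2 H \<Lambda>1 \<Lambda>2 \<Xi>
  assume "F \<in> Hom (SigmaPi P) \<Gamma> (\<Delta>1 @ x # \<Delta>2)" "G \<in> Hom (SigmaPi P) (\<Gamma>1 @ x # \<Gamma>2) (\<Theta>1 @ y # \<Theta>2)"
    "H \<in> Hom (SigmaPi P) (\<Lambda>1 @ y # \<Lambda>2) \<Xi>"
  then obtain f g h where F: "F = cls P \<Gamma> (\<Delta>1 @ x # \<Delta>2) f" and f: "Der P (seq \<Gamma> (\<Delta>1 @ x # \<Delta>2)) f"
    and G: "G = cls P (\<Gamma>1 @ x # \<Gamma>2) (\<Theta>1 @ y # \<Theta>2) g" and g: "Der P (seq (\<Gamma>1 @ x # \<Gamma>2) (\<Theta>1 @ y # \<Theta>2)) g"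
    and H: "H = cls P (\<Lambda>1 @ y # \<Lambda>2) \<Xi> h" and h: "Der P (seq (\<Lambda>1 @ y # \<Lambda>2) \<Xi>) h"
    unfolding SigmaPi_Hom by blast
  have fg: "Der P (seq (\<Gamma>1 @ \<Gamma> @ \<Gamma>2) ((\<Delta>1 @ \<Theta>1) @ y # \<Theta>2 @ \<Delta>2)) (cut_deriv \<Gamma> \<Delta>1 x \<Delta>2 \<Gamma>1 \<Gamma>2 (\<Theta>1 @ y # \<Theta>2) f g)"
    using cut_deriv_Der[OF f g] by simp
  have gh: "Der P (seq ((\<Lambda>1 @ \<Gamma>1) @ x # \<Gamma>2 @ \<Lambda>2) (\<Theta>1 @ \<Xi> @ \<Theta>2)) (cut_deriv (\<Gamma>1 @ x # \<Gamma>2) \<Theta>1 y \<Theta>2 \<Lambda>1 \<Lambda>2 \<Xi> g h)"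
    using cut_deriv_Der[OF g h] by simp
  show "polycat.cut (SigmaPi P) (\<Gamma>1 @ \<Gamma> @ \<Gamma>2) (\<Delta>1 @ \<Theta>1) y (\<Theta>2 @ \<Delta>2) \<Lambda>1 \<Lambda>2 \<Xi>
      (polycat.cut (SigmaPi P) \<Gamma> \<Delta>1 x \<Delta>2 \<Gamma>1 \<Gamma>2 (\<Theta>1 @ y # \<Theta>2) F G) H
    = polycat.cut (SigmaPi P) \<Gamma> \<Delta>1 x \<Delta>2 (\<Lambda>1 @ \<Gamma>1) (\<Gamma>2 @ \<Lambda>2) (\<Theta>1 @ \<Xi> @ \<Theta>2) F
      (polycat.cut (SigmaPi P) (\<Gamma>1 @ x # \<Gamma>2) \<Theta>1 y \<Theta>2 \<Lambda>1 \<Lambda>2 \<Xi> G H)"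
    unfolding F G H cut_cls[OF f g] cut_cls[OF g h]
    using cut_cls[OF fg h] cut_cls[OF f gh] cls_eqI[OF cut_deriv_assoc[OF f g h] HOL.refl] by simp
next
  fix F \<Gamma> \<Delta>1 x \<Delta>2 y \<Delta>3 G \<Gamma>1 \<Theta> H \<Lambda>2 \<Xi>
  assume "F \<in> Hom (SigmaPi P) \<Gamma> (\<Delta>1 @ x # \<Delta>2 @ y # \<Delta>3)" "G \<in> Hom (SigmaPi P) (\<Gamma>1 @ [x]) \<Theta>"
    "H \<in> Hom (SigmaPi P) (y # \<Lambda>2) \<Xi>"
  then obtain f g h where F: "F = cls P \<Gamma> (\<Delta>1 @ x # \<Delta>2 @ y # \<Delta>3) f" and f: "Der P (seq \<Gamma> (\<Delta>1 @ x # \<Delta>2 @ y # \<Delta>3)) f"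
    and G: "G = cls P (\<Gamma>1 @ [x]) \<Theta> g" and g: "Der P (seq (\<Gamma>1 @ [x]) \<Theta>) g"
    and H: "H = cls P (y # \<Lambda>2) \<Xi> h" and h: "Der P (seq (y # \<Lambda>2) \<Xi>) h"
    unfolding SigmaPi_Hom by blast
  have f': "Der P (seq \<Gamma> ((\<Delta>1 @ x # \<Delta>2) @ y # \<Delta>3)) f" using f by simp
  have h': "Der P (seq ([] @ y # \<Lambda>2) \<Xi>) h" using h by simp
  have fg: "Der P (seq (\<Gamma>1 @ \<Gamma>) ((\<Delta>1 @ \<Theta> @ \<Delta>2) @ y # \<Delta>3)) (cut_deriv \<Gamma> \<Delta>1 x (\<Delta>2 @ y # \<Delta>3) \<Gamma>1 [] \<Theta> f g)"
    using cut_deriv_Der[OF f g] by simp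
  have fh: "Der P (seq (\<Gamma> @ \<Lambda>2) (\<Delta>1 @ x # \<Delta>2 @ \<Xi> @ \<Delta>3)) (cut_deriv \<Gamma> (\<Delta>1 @ x # \<Delta>2) y \<Delta>3 [] \<Lambda>2 \<Xi> f h)"
    using cut_deriv_Der[OF f' h'] by simp
  show "polycat.cut (SigmaPi P) (\<Gamma>1 @ \<Gamma>) (\<Delta>1 @ \<Theta> @ \<Delta>2) y \<Delta>3 [] \<Lambda>2 \<Xi>
      (polycat.cut (SigmaPi P) \<Gamma> \<Delta>1 x (\<Delta>2 @ y # \<Delta>3) \<Gamma>1 [] \<Theta> F G) H
    = polycat.cut (SigmaPi P) (\<Gamma> @ \<Lambda>2) \<Delta>1 x (\<Delta>2 @ \<Xi> @ \<Delta>3) \<Gamma>1 [] \<Theta>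
      (polycat.cut (SigmaPi P) \<Gamma> (\<Delta>1 @ x # \<Delta>2) y \<Delta>3 [] \<Lambda>2 \<Xi> F H) G"
    using cut_cls[OF f g] cut_cls[OF f' h'] cut_cls[OF fg h'] cut_cls[OF fh g]
      cls_eqI[OF cut_deriv_interchange_codomain[OF f g h] HOL.refl] by (simp add: F G H)
next
  fix F \<Gamma> \<Delta>1 x G \<Lambda> y \<Theta>2 H \<Gamma>1 \<Gamma>2 \<Gamma>3 \<Xi>
  assume "F \<in> Hom (SigmaPi P) \<Gamma> (\<Delta>1 @ [x])" "G \<in> Hom (SigmaPi P) \<Lambda> (y # \<Theta>2)"
    "H \<in> Hom (SigmaPi P) (\<Gamma>1 @ x # \<Gamma>2 @ y # \<Gamma>3) \<Xi>"
  then obtain f g h where F: "F = cls P \<Gamma> (\<Delta>1 @ [x]) f" and f: "Der P (seq \<Gamma> (\<Delta>1 @ [x])) f"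
    and G: "G = cls P \<Lambda> (y # \<Theta>2) g" and g: "Der P (seq \<Lambda> (y # \<Theta>2)) g"
    and H: "H = cls P (\<Gamma>1 @ x # \<Gamma>2 @ y # \<Gamma>3) \<Xi> h" and h: "Der P (seq (\<Gamma>1 @ x # \<Gamma>2 @ y # \<Gamma>3) \<Xi>) h"
    unfolding SigmaPi_Hom by blast
  have g': "Der P (seq \<Lambda> ([] @ y # \<Theta>2)) g" using g by simp
  have h': "Der P (seq ((\<Gamma>1 @ x # \<Gamma>2) @ y # \<Gamma>3) \<Xi>) h" using h by simp
  have fh: "Der P (seq ((\<Gamma>1 @ \<Gamma> @ \<Gamma>2) @ y # \<Gamma>3) (\<Delta>1 @ \<Xi>)) (cut_deriv \<Gamma> \<Delta>1 x [] \<Gamma>1 (\<Gamma>2 @ y # \<Gamma>3) \<Xi> f h)"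
    using cut_deriv_Der[OF f h] by simp
  have gh: "Der P (seq (\<Gamma>1 @ x # \<Gamma>2 @ \<Lambda> @ \<Gamma>3) (\<Xi> @ \<Theta>2)) (cut_deriv \<Lambda> [] y \<Theta>2 (\<Gamma>1 @ x # \<Gamma>2) \<Gamma>3 \<Xi> g h)"
    using cut_deriv_Der[OF g' h'] by simp
  show "polycat.cut (SigmaPi P) \<Lambda> [] y \<Theta>2 (\<Gamma>1 @ \<Gamma> @ \<Gamma>2) \<Gamma>3 (\<Delta>1 @ \<Xi>) G
      (polycat.cut (SigmaPi P) \<Gamma> \<Delta>1 x [] \<Gamma>1 (\<Gamma>2 @ y # \<Gamma>3) \<Xi> F H)
    = polycat.cut (SigmaPi P) \<Gamma> \<Delta>1 x [] \<Gamma>1 (\<Gamma>2 @ \<Lambda> @ \<Gamma>3) (\<Xi> @ \<Theta>2) F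
      (polycat.cut (SigmaPi P) \<Lambda> [] y \<Theta>2 (\<Gamma>1 @ x # \<Gamma>2) \<Gamma>3 \<Xi> G H)"
    using cut_cls[OF f h] cut_cls[OF g' h'] cut_cls[OF g' fh] cut_cls[OF f gh]
      cls_eqI[OF cut_deriv_interchange_domain[OF f g h] HOL.refl] by (simp add: F G H)
next
  fix F \<Gamma> \<Delta>
  assume "F \<in> Hom (SigmaPi P) \<Gamma> \<Delta>"
  then obtain f where f: "Der P (seq \<Gamma> \<Delta>) f" "F = cls P \<Gamma> \<Delta> f" unfolding SigmaPi_Hom by blast
  have "perm_chan id id = id"
  proof
    fix c show "perm_chan id id c = id c" by (cases c) simp_all
  qed
  then show "act (SigmaPi P) \<Gamma> \<Delta> id id F = F"
    unfolding f(2) act_cls[OF f(1) permutes_id permutes_id] by (simp add: rename_id)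
next
  fix F \<Gamma> \<Delta> \<sigma> \<sigma>' \<tau> \<tau>'
  assume F: "F \<in> Hom (SigmaPi P) \<Gamma> \<Delta>"
    and \<sigma>: "\<sigma> permutes {..<length \<Gamma>}" and \<sigma>': "\<sigma>' permutes {..<length \<Gamma>}"
    and \<tau>: "\<tau> permutes {..<length \<Delta>}" and \<tau>': "\<tau>' permutes {..<length \<Delta>}"
  obtain f where f: "Der P (seq \<Gamma> \<Delta>) f" "F = cls P \<Gamma> \<Delta> f" using F unfolding SigmaPi_Hom by blast
  \<comment> \<open>Renaming by \<open>perm_chan \<sigma> \<tau>\<close> and then by
    \<open>perm_chan \<sigma>' \<tau>'\<close> applies the inverses in the order in which they occur
    in the inverse of \<open>\<sigma> \<circ> \<sigma>'\<close>.\<close>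
  have inv: "inv (\<sigma> \<circ> \<sigma>') = inv \<sigma>' \<circ> inv \<sigma>" "inv (\<tau> \<circ> \<tau>') = inv \<tau>' \<circ> inv \<tau>"
    using o_inv_distrib permutes_bij \<sigma> \<sigma>' \<tau> \<tau>' by metis+
  have comp: "perm_chan \<sigma>' \<tau>' \<circ> perm_chan \<sigma> \<tau> = perm_chan (\<sigma> \<circ> \<sigma>') (\<tau> \<circ> \<tau>')"
  proof
    fix c show "(perm_chan \<sigma>' \<tau>' \<circ> perm_chan \<sigma> \<tau>) c = perm_chan (\<sigma> \<circ> \<sigma>') (\<tau> \<circ> \<tau>') c"
      by (cases c) (simp_all add: inv)
  qed
  have len: "\<sigma>' permutes {..<length (permute_list \<sigma> \<Gamma>)}" "\<tau>' permutes {..<length (permute_list \<tau> \<Delta>)}"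
    using \<sigma>' \<tau>' by simp_all
  have list: "permute_list \<sigma>' (permute_list \<sigma> \<Gamma>) = permute_list (\<sigma> \<circ> \<sigma>') \<Gamma>"
    "permute_list \<tau>' (permute_list \<tau> \<Delta>) = permute_list (\<tau> \<circ> \<tau>') \<Delta>"
    using permute_list_compose \<sigma>' \<tau>' by metis+
  show "act (SigmaPi P) (permute_list \<sigma> \<Gamma>) (permute_list \<tau> \<Delta>) \<sigma>' \<tau>' (act (SigmaPi P) \<Gamma> \<Delta> \<sigma> \<tau> F)
    = act (SigmaPi P) \<Gamma> \<Delta> (\<sigma> \<circ> \<sigma>') (\<tau> \<circ> \<tau>') F"
    unfolding f(2) act_cls[OF f(1) \<sigma> \<tau>] act_cls[OF act_Der[OF f(1) \<sigma> \<tau>] len]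
      act_cls[OF f(1) permutes_compose[OF \<sigma>' \<sigma>] permutes_compose[OF \<tau>' \<tau>]] rename_comp comp list ..
next
  fix F \<Gamma> \<Delta>1 x \<Delta>2 G \<Gamma>1 \<Gamma>2 \<Delta> \<sigma> \<tau> \<sigma>' \<tau>' \<Delta>1' \<Delta>2' \<Gamma>1' \<Gamma>2' \<pi> \<rho>
  assume F: "F \<in> Hom (SigmaPi P) \<Gamma> (\<Delta>1 @ x # \<Delta>2)" and G: "G \<in> Hom (SigmaPi P) (\<Gamma>1 @ x # \<Gamma>2) \<Delta>"
    and \<sigma>: "\<sigma> permutes {..<length \<Gamma>}" and \<tau>: "\<tau> permutes {..<length (\<Delta>1 @ x # \<Delta>2)}"
    and \<sigma>': "\<sigma>' permutes {..<length (\<Gamma>1 @ x # \<Gamma>2)}" and \<tau>': "\<tau>' permutes {..<length \<Delta>}"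
    and \<Delta>': "permute_list \<tau> (\<Delta>1 @ x # \<Delta>2) = \<Delta>1' @ x # \<Delta>2'" "\<tau> (length \<Delta>1') = length \<Delta>1"
    and \<Gamma>': "permute_list \<sigma>' (\<Gamma>1 @ x # \<Gamma>2) = \<Gamma>1' @ x # \<Gamma>2'" "\<sigma>' (length \<Gamma>1') = length \<Gamma>1"
    and \<pi>: "\<pi> permutes {..<length (\<Gamma>1 @ \<Gamma> @ \<Gamma>2)}"
      "\<forall>p < length (\<Gamma>1 @ \<Gamma> @ \<Gamma>2). slot (length \<Gamma>1) (length \<Gamma>) (\<pi> p) = map_sum \<sigma>' \<sigma> (slot (length \<Gamma>1') (length \<Gamma>) p)"
    and \<rho>: "\<rho> permutes {..<length (\<Delta>1 @ \<Delta> @ \<Delta>2)}"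
      "\<forall>p < length (\<Delta>1 @ \<Delta> @ \<Delta>2). slot (length \<Delta>1) (length \<Delta>) (\<rho> p) = map_sum \<tau> \<tau>' (slot (length \<Delta>1') (length \<Delta>) p)"
  obtain f where f: "Der P (seq \<Gamma> (\<Delta>1 @ x # \<Delta>2)) f" "F = cls P \<Gamma> (\<Delta>1 @ x # \<Delta>2) f"
    using F unfolding SigmaPi_Hom by blast
  obtain g where g: "Der P (seq (\<Gamma>1 @ x # \<Gamma>2) \<Delta>) g" "G = cls P (\<Gamma>1 @ x # \<Gamma>2) \<Delta> g"
    using G unfolding SigmaPi_Hom by blast
  note fa = act_Der[OF f(1) \<sigma> \<tau>, unfolded \<Delta>'(1)] and ga = act_Der[OF g(1) \<sigma>' \<tau>', unfolded \<Gamma>'(1)]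
  show "polycat.cut (SigmaPi P) (permute_list \<sigma> \<Gamma>) \<Delta>1' x \<Delta>2' \<Gamma>1' \<Gamma>2' (permute_list \<tau>' \<Delta>)
      (act (SigmaPi P) \<Gamma> (\<Delta>1 @ x # \<Delta>2) \<sigma> \<tau> F) (act (SigmaPi P) (\<Gamma>1 @ x # \<Gamma>2) \<Delta> \<sigma>' \<tau>' G)
    = act (SigmaPi P) (\<Gamma>1 @ \<Gamma> @ \<Gamma>2) (\<Delta>1 @ \<Delta> @ \<Delta>2) \<pi> \<rho> (polycat.cut (SigmaPi P) \<Gamma> \<Delta>1 x \<Delta>2 \<Gamma>1 \<Gamma>2 \<Delta> F G)"
    unfolding f(2) g(2) act_cls[OF f(1) \<sigma> \<tau>] act_cls[OF g(1) \<sigma>' \<tau>'] \<Delta>'(1) \<Gamma>'(1) cut_cls[OF fa ga] cut_cls[OF f(1) g(1)]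
      act_cls[OF cut_deriv_Der[OF f(1) g(1)] \<pi>(1) \<rho>(1)]
    by (rule cut_deriv_act[OF f(1) g(1) \<sigma> \<tau> \<sigma>' \<tau>' \<Delta>' \<Gamma>' \<pi> \<rho>])
qed

end

theorem theorem4p1p1:
  fixes A :: "('o, 'm) polycat"
  assumes "polycategory A"
  shows "polycategory (SigmaPi A)
    \<and> Ob (SigmaPi A) = formulas A
    \<and> (\<forall>\<Gamma> \<Delta>. equiv (derivations A \<Gamma> \<Delta>) (sim_rel A \<Gamma> \<Delta>)
         \<and> Hom (SigmaPi A) \<Gamma> \<Delta> = derivations A \<Gamma> \<Delta> // sim_rel A \<Gamma> \<Delta>)
    \<and> (\<forall>X \<in> formulas A. iota A X (In 0) (Out 0) \<in> derivations A [X] [X]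
         \<and> Idn (SigmaPi A) X = sim_rel A [X] [X] `` {iota A X (In 0) (Out 0)})
    \<and> (\<forall>\<Gamma> \<Delta>1 x \<Delta>2 \<Gamma>1 \<Gamma>2 \<Delta>.
         \<forall>f \<in> derivations A \<Gamma> (\<Delta>1 @ x # \<Delta>2). \<forall>g \<in> derivations A (\<Gamma>1 @ x # \<Gamma>2) \<Delta>.
           cut_deriv \<Gamma> \<Delta>1 x \<Delta>2 \<Gamma>1 \<Gamma>2 \<Delta> f g \<in> derivations A (\<Gamma>1 @ \<Gamma> @ \<Gamma>2) (\<Delta>1 @ \<Delta> @ \<Delta>2)
           \<and> polycat.cut (SigmaPi A) \<Gamma> \<Delta>1 x \<Delta>2 \<Gamma>1 \<Gamma>2 \<Delta>
                (sim_rel A \<Gamma> (\<Delta>1 @ x # \<Delta>2) `` {f}) (sim_rel A (\<Gamma>1 @ x # \<Gamma>2) \<Delta> `` {g})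
              = sim_rel A (\<Gamma>1 @ \<Gamma> @ \<Gamma>2) (\<Delta>1 @ \<Delta> @ \<Delta>2)
                  `` {cut_deriv \<Gamma> \<Delta>1 x \<Delta>2 \<Gamma>1 \<Gamma>2 \<Delta> f g})
    \<and> (\<forall>\<Gamma> \<Delta> \<sigma> \<tau>. \<forall>f \<in> derivations A \<Gamma> \<Delta>.
         \<sigma> permutes {..<length \<Gamma>} \<longrightarrow> \<tau> permutes {..<length \<Delta>} \<longrightarrow>
           act (SigmaPi A) \<Gamma> \<Delta> \<sigma> \<tau> (sim_rel A \<Gamma> \<Delta> `` {f})
             = sim_rel A (permute_list \<sigma> \<Gamma>) (permute_list \<tau> \<Delta>)
                 `` {rename (perm_chan \<sigma> \<tau>) f})"
proof (intro conjI allI ballI impI)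
  interpret polycategory A by fact
  show "polycategory (SigmaPi A)" by (rule polycategory_SigmaPi)
  show "Ob (SigmaPi A) = formulas A" by (rule SigmaPi_Ob)
  show "equiv (derivations A \<Gamma> \<Delta>) (sim_rel A \<Gamma> \<Delta>)" for \<Gamma> \<Delta> by (rule equiv_sim_rel)
  show "Hom (SigmaPi A) \<Gamma> \<Delta> = derivations A \<Gamma> \<Delta> // sim_rel A \<Gamma> \<Delta>" for \<Gamma> \<Delta>
    by (simp add: SigmaPi_def)
  show "iota A X (In 0) (Out 0) \<in> derivations A [X] [X]" if "X \<in> formulas A" for X
    unfolding derivations_iff by (rule Der_iota[OF that])
  show "Idn (SigmaPi A) X = sim_rel A [X] [X] `` {iota A X (In 0) (Out 0)}" for X
    by (simp add: SigmaPi_def)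
  fix \<Gamma> \<Delta>1 x \<Delta>2 \<Gamma>1 \<Gamma>2 \<Delta> f g
  assume f: "f \<in> derivations A \<Gamma> (\<Delta>1 @ x # \<Delta>2)" and g: "g \<in> derivations A (\<Gamma>1 @ x # \<Gamma>2) \<Delta>"
  note D = f[unfolded derivations_iff] g[unfolded derivations_iff]
  show "cut_deriv \<Gamma> \<Delta>1 x \<Delta>2 \<Gamma>1 \<Gamma>2 \<Delta> f g \<in> derivations A (\<Gamma>1 @ \<Gamma> @ \<Gamma>2) (\<Delta>1 @ \<Delta> @ \<Delta>2)"
    unfolding derivations_iff by (rule cut_deriv_Der[OF D])
  show "polycat.cut (SigmaPi A) \<Gamma> \<Delta>1 x \<Delta>2 \<Gamma>1 \<Gamma>2 \<Delta>
      (sim_rel A \<Gamma> (\<Delta>1 @ x # \<Delta>2) `` {f}) (sim_rel A (\<Gamma>1 @ x # \<Gamma>2) \<Delta> `` {g})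
    = sim_rel A (\<Gamma>1 @ \<Gamma> @ \<Gamma>2) (\<Delta>1 @ \<Delta> @ \<Delta>2) `` {cut_deriv \<Gamma> \<Delta>1 x \<Delta>2 \<Gamma>1 \<Gamma>2 \<Delta> f g}"
    using cut_cls[OF D] unfolding cls_def .
next
  fix \<Gamma> \<Delta> \<sigma> \<tau> f
  assume "f \<in> derivations A \<Gamma> \<Delta>" "\<sigma> permutes {..<length \<Gamma>}" "\<tau> permutes {..<length \<Delta>}"
  then show "act (SigmaPi A) \<Gamma> \<Delta> \<sigma> \<tau> (sim_rel A \<Gamma> \<Delta> `` {f})
      = sim_rel A (permute_list \<sigma> \<Gamma>) (permute_list \<tau> \<Delta>) `` {rename (perm_chan \<sigma> \<tau>) f}"
    unfolding derivations_iff cls_def[symmetric] by (rule act_cls)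
qed

end
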